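(* Let $f:(\mathbb{C}^n,0)\to(\mathbb{C},0)$ be an isolated singularity such that $$f=g_1\frac{\partial f}{\partial z_1}+\cdots+g_n\frac{\partial f}{\partial z_n}$$ for some $g_1,\ldots,g_n\in\mathbb{C}\{z_1,\ldots,z_n\}$. Let $[\alpha_1,\ldots,\alpha_n]\subset\mathbb{C}$ be the multiset of all eigenvalues of the matrix $\left.\frac{\partial(g_1,\ldots,g_n)}{\partial(z_1,\ldots,z_n)}\right|_{z=0}$. Put $l_j:=\operatorname{Re}\alpha_j$ for $j=1,\ldots,n$. Define the multisets $L:=[l_1,\ldots,l_n]$ and $L^-:=\left[1-a:a\in L\wedge a>\tfrac12\right]$, the set $L^0:=(L\setminus L^-)\cup\{\tfrac12\}$, where $L\setminus L^-$ is the difference of multisets, and $l_{\min}:=\min L^0$. Then $$\mathcal{L}_0(f)=\frac{1}{l_{\min}}-1.$$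
   Context: A germ of a holomorphic function $f:(\mathbb{C}^n,0)\to(\mathbb{C},0)$ is an (isolated) singularity if it has an isolated critical point at $0$. $\mathbb{C}\{z_1,\ldots,z_n\}$ is the ring of convergent power series. For a holomorphic map-germ $F:(\mathbb{C}^n,0)\to(\mathbb{C}^m,0)$ the Łojasiewicz exponent is $$l_0(F):=\inf\{q\in\mathbb{Q}_{>0}: C_1\|z\|^q\leqslant\|F(z)\|\text{ for some }C_1>0\text{ and all }z\text{ with }\|z\|\text{ sufficiently small}\}.$$ For a singularity $f$, $\mathcal{L}_0(f):=l_0\left(\frac{\partial f}{\partial z_1},\ldots,\frac{\partial f}{\partial z_n}\right)$. Multisets are written with square brackets and counted with multiplicity (eigenvalues with algebraic multiplicity); in $L\setminus L^-$ the multiplicity of an element is the multiplicity in $L$ minus that in $L^-$ (or $0$ if this is negative). *)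

theory Defs
  imports "HOL-Analysis.Analysis" "HOL-Computational_Algebra.Computational_Algebra"
begin

text \<open>
  A germ at the origin is represented by a total function of which only the values near \<open>0\<close>
  matter: every notion below is invariant under changing the functions away from \<open>0\<close>.
\<close>

definition holomorphic_germ :: "(complex ^ 'n \<Rightarrow> complex) \<Rightarrow> bool" where
  "holomorphic_germ f \<longleftrightarrow>
     (\<forall>\<^sub>F z in nhds 0. \<exists>f'. (f has_derivative f') (at z) \<and> Vector_Spaces.linear (*s) (*) f')"

text \<open>
  The germs of the sums of elements of \<open>\<complex>{z\<^sub>1, \<dots>, z\<^sub>n}\<close>; \<open>c k\<close> is the coefficient of the
  monomial with exponent vector \<open>k\<close>.
\<close>

definition convergent_power_series :: "(complex ^ 'n \<Rightarrow> complex) set" where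
  "convergent_power_series =
     {g. \<exists>c :: ('n \<Rightarrow> nat) \<Rightarrow> complex.
           \<forall>\<^sub>F z in nhds 0. ((\<lambda>k. c k * (\<Prod>i\<in>UNIV. (z $ i) ^ k i)) has_sum g z) UNIV}"

definition partial_deriv :: "'n \<Rightarrow> (complex ^ 'n \<Rightarrow> complex) \<Rightarrow> complex ^ 'n \<Rightarrow> complex" where
  "partial_deriv j f z = deriv (\<lambda>t. f (z + axis j t)) 0"

definition gradient :: "(complex ^ 'n \<Rightarrow> complex) \<Rightarrow> complex ^ 'n \<Rightarrow> complex ^ 'n" where
  "gradient f z = (\<chi> j. partial_deriv j f z)"

definition complex_jacobian :: "('n \<Rightarrow> complex ^ 'n \<Rightarrow> complex) \<Rightarrow> complex ^ 'n \<Rightarrow> complex ^ 'n ^ 'n" where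
  "complex_jacobian g z = (\<chi> i j. partial_deriv j (g i) z)"

definition isolated_singularity :: "(complex ^ 'n \<Rightarrow> complex) \<Rightarrow> bool" where
  "isolated_singularity f \<longleftrightarrow>
     holomorphic_germ f \<and> f 0 = 0 \<and> gradient f 0 = 0 \<and> (\<forall>\<^sub>F z in at 0. gradient f z \<noteq> 0)"

text \<open>Extended-real valued, so that the infimum of the empty set is \<open>\<infinity>\<close>.\<close>

definition map_lojasiewicz_exponent :: "(complex ^ 'n \<Rightarrow> complex ^ 'm) \<Rightarrow> ereal" where
  "map_lojasiewicz_exponent F =
     Inf {ereal (of_rat q) | q :: rat. q > 0 \<and>
            (\<exists>C>0. \<forall>\<^sub>F z in nhds 0. C * norm z powr of_rat q \<le> norm (F z))}"

definition lojasiewicz_exponent :: "(complex ^ 'n \<Rightarrow> complex) \<Rightarrow> ereal" where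
  "lojasiewicz_exponent f = map_lojasiewicz_exponent (gradient f)"

definition charpoly :: "complex ^ 'n ^ 'n \<Rightarrow> complex poly" where
  "charpoly A = det (mat [:0, 1:] - (\<chi> i j. [:A $ i $ j:]))"

text \<open>Algebraic multiplicities: the multiplicity of \<open>\<alpha>\<close> is its order as a root of \<open>charpoly A\<close>.\<close>

definition eigenvalues :: "complex ^ 'n ^ 'n \<Rightarrow> complex multiset" where
  "eigenvalues A = proots (charpoly A)"

definition L_minus :: "real multiset \<Rightarrow> real multiset" where
  "L_minus L = image_mset (\<lambda>a. 1 - a) (filter_mset (\<lambda>a. a > 1 / 2) L)"

definition L_zero :: "real multiset \<Rightarrow> real set" where
  "L_zero L = set_mset (L - L_minus L) \<union> {1 / 2}"

end

theory Submission
  imports Defs "HOL-Complex_Analysis.Complex_Analysis"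
begin

text \<open>
  Write \<open>p\<close> for the gradient of \<open>f\<close>, \<open>A\<close> for the Jacobian matrix of \<open>g\<close> at \<open>0\<close> and \<open>B\<close> for the Hessian of \<open>f\<close> at
  \<open>0\<close>. Differentiating \<open>f = g \<cdot> p\<close> gives \<open>Dp g = p - Dg\<^sup>T p\<close>. Hence \<open>g 0 = 0\<close>, \<open>A\<^sup>T B + B A = B\<close>, and moving \<open>z\<close>
  along \<open>\<plusminus> g\<close> or \<open>\<plusminus> \<i> g\<close> multiplies \<open>z\<close> and \<open>p z\<close> at rates read off from the eigenvalues of \<open>A\<close> and \<open>1 - A\<close>.
  Adding to \<open>g\<close> an antisymmetric multiple of \<open>p\<close> one may assume \<open>B A = B / 2\<close>, so that every eigenvalue of \<open>A\<close>
  is \<open>1 / 2\<close> or occurs on the kernel of \<open>B\<close>; comparing the rates (\<open>p\<close> is quadratic along the kernel) puts the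
  eigenvalues on the kernel into the interval \<open>(0, 1 / 2]\<close>. The remaining eigenvalues of the original \<open>A\<close> are
  symmetric under \<open>a \<mapsto> 1 - a\<close>, so \<open>l_min\<close> is the least \<open>l\<close> among \<open>1 / 2\<close> and the eigenvalues on the kernel.
  The same comparison of rates bounds the exponent from above by \<open>(1 - l) / l = 1 / l - 1\<close>.

  For the lower bound with \<open>l < 1 / 2\<close>, linearise \<open>g\<close> in one coordinate \<open>x\<close> with \<open>g x = l x\<close> that does not vanish on
  the kernel of \<open>B\<close>. Where all components of \<open>p\<close> but the one dual to \<open>x\<close> vanish, the Legendre dual
  \<open>k = z \<cdot> p - f\<close> equals \<open>(1 - l) x u\<close>, \<open>u\<close> being the remaining component. Since \<open>dk = z \<cdot> dp\<close>, averaging \<open>|k|\<^sup>2\<close> over the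
  fibres of \<open>p\<close> shows that \<open>k\<close> decays no faster than \<open>u\<close> to the power \<open>1 / (1 - l)\<close> on some such points, which thus
  satisfy \<open>|p z| \<le> C |z|\<close> to the power \<open>(1 - l) / l\<close>.
\<close>

no_notation fps_nth (infixl "$" 75)

section \<open>Holomorphic functions of several variables\<close>

text \<open>Two obstacles shape the proof. Near \<open>0\<close> the gradient is a branched map, so
  no branch of its inverse can be followed along a path. The averages over fibres are therefore
  integrals over the source with weight \<open>|hess_det|^2\<close>, the real Jacobian of the
  gradient, on a thin tube around a fibre; high powers of the averaged quantity turn the average
  into a maximum, and degenerate points are reached by a perturbation and a compactness limit.
  Moreover no integral curves are used: growth along a curve is expressed by Euler steps, or by
  moving a little off a minimum over a compact set. On the lower side the exponent arises as
  follows. On the polar curve \<open>dk = x du\<close> and \<open>k = (1 - l) x u\<close> give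
  \<open>dk / k = du / ((1 - l) u)\<close>; so \<open>k\<close> behaves like \<open>u\<close> to the
  power \<open>1 / (1 - l)\<close>, and division by \<open>u\<close> leaves
  \<open>l / (1 - l)\<close> for \<open>x\<close>. A polar curve inside \<open>x = 0\<close> would
  make \<open>k\<close> vanish and has to be excluded separately; this is where the kernel of the
  Hessian enters.\<close>

definition cdot :: "complex ^ 'n \<Rightarrow> complex ^ 'n \<Rightarrow> complex" where
  "cdot x y = (\<Sum>i\<in>UNIV. x $ i * y $ i)"

lemma cdot_axis [simp]: "cdot x (axis j t) = x $ j * t"
  by (simp add: cdot_def axis_def if_distrib [of "\<lambda>u. _ * u"] cong: if_cong)

lemma cdot_commute: "cdot x y = cdot y x"
  by (simp add: cdot_def mult.commute)

lemma norm_cdot_le: "norm (cdot x y) \<le> norm x * norm y"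
proof -
  have "norm (cdot x y) \<le> (\<Sum>i\<in>UNIV. \<bar>norm (x $ i)\<bar> * \<bar>norm (y $ i)\<bar>)"
    unfolding cdot_def by (rule order_trans [OF norm_sum]) (simp add: norm_mult)
  also have "\<dots> \<le> norm x * norm y"
    unfolding norm_vec_def by (rule L2_set_mult_ineq)
  finally show ?thesis .
qed

lemma bounded_bilinear_cdot: "bounded_bilinear cdot"
proof
  show "\<exists>K. \<forall>a b :: complex ^ 'n. norm (cdot a b) \<le> norm a * norm b * K"
    by (rule exI [of _ 1]) (simp add: norm_cdot_le)
qed (simp_all add: cdot_def algebra_simps sum.distrib scaleR_sum_right)

interpretation cdot: bounded_bilinear cdot
  by (rule bounded_bilinear_cdot)

lemma cdot_scale_left [simp]: "cdot (c *s x) y = c * cdot x y"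
  and cdot_scale_right [simp]: "cdot x (c *s y) = c * cdot x y"
  by (simp_all add: cdot_def sum_distrib_left algebra_simps)

lemma norm_smult_vec [simp]: "norm (c *s (v :: complex ^ 'n)) = norm c * norm v"
  unfolding norm_vec_def by (simp add: norm_mult L2_set_right_distrib)

lemma norm_axis_complex [simp]: "norm (axis j (t :: complex) :: complex ^ 'n) = norm t"
proof -
  have "norm (axis j t :: complex ^ 'n) = L2_set (\<lambda>i. if i = j then norm t else 0) UNIV"
    unfolding norm_vec_def axis_def by (intro L2_set_cong) auto
  also have "\<dots> = norm t"
    by (simp add: L2_set_def if_distrib [of "\<lambda>x. x ^ 2"] cong: if_cong)
  finally show ?thesis .
qed

lemma axis_0 [simp]: "axis j (0 :: complex) = (0 :: complex ^ 'n)"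
  by (simp add: axis_def vec_eq_iff)

lemma bounded_linear_axis: "bounded_linear (\<lambda>t :: complex. axis j t :: complex ^ 'n)"
proof (rule bounded_linear_intro [where K = 1])
  show "norm (axis j t :: complex ^ 'n) \<le> norm t * 1" for t :: complex
    by (simp only: norm_axis_complex mult_1_right order_refl)
qed (auto simp: axis_def vec_eq_iff)

lemmas has_derivative_axis [derivative_intros] = bounded_linear.has_derivative [OF bounded_linear_axis]
lemmas continuous_on_axis [continuous_intros] = bounded_linear.continuous_on [OF bounded_linear_axis]

text \<open>The pairing \<open>cdot\<close> is bilinear, without conjugation, so the maps
  \<open>cdot D\<close> are exactly the complex linear functionals; a real Frechet derivative of
  this form is a complex derivative, and real differential calculus applies unchanged.\<close>

definition hol :: "(complex ^ 'n) set \<Rightarrow> (complex ^ 'n \<Rightarrow> complex) \<Rightarrow> bool" where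
  "hol S f \<longleftrightarrow> (\<forall>z\<in>S. \<exists>D. (f has_derivative cdot D) (at z))"

definition holv :: "(complex ^ 'n) set \<Rightarrow> (complex ^ 'n \<Rightarrow> complex ^ 'm) \<Rightarrow> bool" where
  "holv S F \<longleftrightarrow> (\<forall>i. hol S (\<lambda>z. F z $ i))"

definition jac :: "(complex ^ 'n \<Rightarrow> complex ^ 'm) \<Rightarrow> complex ^ 'n \<Rightarrow> complex ^ 'n ^ 'm" where
  "jac F z = (\<chi> i. gradient (\<lambda>z. F z $ i) z)"

lemma partial_derivative_along:
  assumes "(f has_derivative cdot D) (at z)"
  shows "((\<lambda>t. f (z + axis j t)) has_field_derivative D $ j) (at 0)"
proof -
  have "((\<lambda>t. z + axis j t) has_derivative (\<lambda>t. axis j t)) (at 0)"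
    using has_derivative_add [OF has_derivative_const has_derivative_axis [OF has_derivative_ident]] by simp
  from has_derivative_compose [OF this, of f "cdot D"] assms
  have "((\<lambda>t. f (z + axis j t)) has_derivative (\<lambda>t. cdot D (axis j t))) (at 0)"
    by (simp del: cdot_axis)
  then show ?thesis
    by (simp add: has_field_derivative_def)
qed

lemma gradient_eqI:
  assumes "(f has_derivative cdot D) (at z)"
  shows "gradient f z = D"
  unfolding gradient_def partial_deriv_def vec_eq_iff
  using DERIV_imp_deriv [OF partial_derivative_along [OF assms]] by simp

lemma hol_has_derivative:
  assumes "hol S f" "z \<in> S"
  shows "(f has_derivative cdot (gradient f z)) (at z)"
proof -
  obtain D where "(f has_derivative cdot D) (at z)"
    using assms by (auto simp: hol_def)
  with gradient_eqI [OF this] show ?thesis by simp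
qed

lemma hol_along:
  assumes "hol S f" "z \<in> S"
  shows "((\<lambda>t. f (z + axis j t)) has_field_derivative gradient f z $ j) (at 0)"
  by (rule partial_derivative_along [OF hol_has_derivative [OF assms]])

lemma hol_subset: "hol S f \<Longrightarrow> T \<subseteq> S \<Longrightarrow> hol T f"
  by (auto simp: hol_def)

lemma holv_subset: "holv S f \<Longrightarrow> T \<subseteq> S \<Longrightarrow> holv T f"
  by (auto simp: holv_def intro: hol_subset)

lemma hol_continuous_on: "hol S f \<Longrightarrow> continuous_on S f"
  by (intro continuous_at_imp_continuous_on ballI)
    (rule has_derivative_continuous [OF hol_has_derivative])

lemma hol_const [simp]: "hol S (\<lambda>z. c)"
  unfolding hol_def
proof (intro ballI exI [of _ 0])
  show "((\<lambda>z. c) has_derivative cdot 0) (at z)" for z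
    by (rule has_derivative_eq_rhs [OF has_derivative_const]) (simp add: cdot.zero_left fun_eq_iff)
qed

lemma hol_cdot_right [simp]: "hol S (\<lambda>z. cdot c z)"
  unfolding hol_def
  by (auto intro!: exI [of _ c] bounded_linear_imp_has_derivative cdot.bounded_linear_right)

lemma hol_component [simp]:
  fixes S :: "(complex ^ 'n) set"
  shows "hol S (\<lambda>z. z $ i)"
proof -
  have "(\<lambda>z :: complex ^ 'n. z $ i) = cdot (axis i 1)"
    by (auto simp: cdot_commute [of "axis i 1"])
  then show ?thesis using hol_cdot_right [of S "axis i 1"] by simp
qed

lemma gradient_add:
  assumes "(f has_derivative cdot D) (at z)" "(g has_derivative cdot E) (at z)"
  shows "((\<lambda>z. f z + g z) has_derivative cdot (D + E)) (at z)"
  by (rule has_derivative_eq_rhs [OF has_derivative_add [OF assms]]) (simp add: cdot.add_left fun_eq_iff)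

lemma gradient_mult:
  assumes "(f has_derivative cdot D) (at z)" "(g has_derivative cdot E) (at z)"
  shows "((\<lambda>z. f z * g z) has_derivative cdot (f z *s E + g z *s D)) (at z)"
  by (rule has_derivative_eq_rhs [OF has_derivative_mult [OF assms]])
    (simp add: cdot.add_left fun_eq_iff mult.commute)

lemma hol_add: "hol S f \<Longrightarrow> hol S g \<Longrightarrow> hol S (\<lambda>z. f z + g z)"
  unfolding hol_def [of S "\<lambda>z. f z + g z"]
  using gradient_add [OF hol_has_derivative hol_has_derivative] by blast

lemma hol_mult: "hol S f \<Longrightarrow> hol S g \<Longrightarrow> hol S (\<lambda>z. f z * g z)"
  unfolding hol_def [of S "\<lambda>z. f z * g z"]
  using gradient_mult [OF hol_has_derivative hol_has_derivative] by blast

lemma hol_minus: "hol S f \<Longrightarrow> hol S (\<lambda>z. - f z)"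
  using hol_mult [of S "\<lambda>_. -1" f] by simp

lemma hol_diff: "hol S f \<Longrightarrow> hol S g \<Longrightarrow> hol S (\<lambda>z. f z - g z)"
  using hol_add [of S f "\<lambda>z. - g z"] hol_minus [of S g] by simp

lemma hol_sum: "(\<And>i. i \<in> I \<Longrightarrow> hol S (f i)) \<Longrightarrow> hol S (\<lambda>z. \<Sum>i\<in>I. f i z)"
  by (induction I rule: infinite_finite_induct) (auto intro!: hol_add)

lemma hol_prod: "(\<And>i. i \<in> I \<Longrightarrow> hol S (f i)) \<Longrightarrow> hol S (\<lambda>z. \<Prod>i\<in>I. f i z)"
  by (induction I rule: infinite_finite_induct) (auto intro!: hol_mult)

lemma hol_det: "(\<And>i j. hol S (\<lambda>z. M z $ i $ j)) \<Longrightarrow> hol S (\<lambda>z. det (M z))"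
  unfolding det_def by (intro hol_sum hol_mult hol_prod hol_const) auto

lemma has_derivative_vecI:
  fixes F :: "'a::real_normed_vector \<Rightarrow> complex ^ 'm"
  assumes "\<And>i. ((\<lambda>z. F z $ i) has_derivative (\<lambda>v. F' v $ i)) (at z within S)"
  shows "(F has_derivative F') (at z within S)"
proof -
  have "((\<lambda>z. \<Sum>i\<in>UNIV. axis i (F z $ i)) has_derivative (\<lambda>v. \<Sum>i\<in>UNIV. axis i (F' v $ i))) (at z within S)"
    by (intro has_derivative_sum has_derivative_axis assms)
  moreover have "(\<Sum>i\<in>UNIV. axis i (x $ i)) = x" for x :: "complex ^ 'm"
    by (simp add: vec_eq_iff axis_def if_distrib cong: if_cong)
  ultimately show ?thesis by simp
qed

lemma matrix_vector_cdot: "(M *v v) $ i = cdot (M $ i) v"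
  by (simp add: matrix_vector_mult_def cdot_def)

lemma holv_has_derivative:
  assumes "holv S F" "z \<in> S"
  shows "(F has_derivative (\<lambda>v. jac F z *v v)) (at z)"
proof (rule has_derivative_vecI)
  fix i
  have "((\<lambda>z. F z $ i) has_derivative cdot (gradient (\<lambda>z. F z $ i) z)) (at z)"
    using assms by (auto simp: holv_def intro: hol_has_derivative)
  then show "((\<lambda>z. F z $ i) has_derivative (\<lambda>v. (jac F z *v v) $ i)) (at z)"
    by (simp add: matrix_vector_cdot jac_def)
qed

lemma holvI:
  assumes "\<And>z. z \<in> S \<Longrightarrow> \<exists>M. (F has_derivative (\<lambda>v. M *v v)) (at z)"
  shows "holv S F"
  unfolding holv_def hol_def
proof (intro allI ballI)
  fix i z assume "z \<in> S"
  then obtain M where "(F has_derivative (\<lambda>v. M *v v)) (at z)" using assms by blast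
  from bounded_linear.has_derivative [OF bounded_linear_vec_nth [of i] this]
  have "((\<lambda>z. F z $ i) has_derivative cdot (M $ i)) (at z)"
    by (simp add: matrix_vector_cdot)
  then show "\<exists>D. ((\<lambda>z. F z $ i) has_derivative cdot D) (at z)" by blast
qed

lemma jac_eqI:
  assumes "(F has_derivative (\<lambda>v. M *v v)) (at z)"
  shows "jac F z = M"
proof -
  have "gradient (\<lambda>z. F z $ i) z = M $ i" for i
    using bounded_linear.has_derivative [OF bounded_linear_vec_nth [of i] assms]
    by (intro gradient_eqI) (simp add: matrix_vector_cdot)
  then show ?thesis by (simp add: jac_def vec_eq_iff)
qed

lemma holv_continuous_on: "holv S F \<Longrightarrow> continuous_on S F"
  by (intro continuous_at_imp_continuous_on ballI)
    (rule has_derivative_continuous [OF holv_has_derivative])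

lemma holv_compose:
  assumes "holv S F" "holv T G" "F ` S \<subseteq> T"
  shows "holv S (\<lambda>z. G (F z))"
proof (rule holvI)
  fix z assume z: "z \<in> S"
  have "((\<lambda>z. G (F z)) has_derivative (\<lambda>v. jac G (F z) *v (jac F z *v v))) (at z)"
    using assms z by (intro has_derivative_compose [OF holv_has_derivative [OF assms(1) z]]
        holv_has_derivative [of T]) auto
  then show "\<exists>M. ((\<lambda>z. G (F z)) has_derivative (\<lambda>v. M *v v)) (at z)"
    by (auto simp: matrix_vector_mul_assoc)
qed

lemma cdot_transpose: "cdot D (M *v v) = cdot (transpose M *v D) v"
proof -
  have "cdot D (M *v v) = (\<Sum>i\<in>UNIV. \<Sum>j\<in>UNIV. D $ i * (M $ i $ j * v $ j))"
    by (simp add: cdot_def matrix_vector_mult_def sum_distrib_left)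
  also have "\<dots> = (\<Sum>j\<in>UNIV. \<Sum>i\<in>UNIV. D $ i * (M $ i $ j * v $ j))"
    by (rule sum.swap)
  also have "\<dots> = cdot (transpose M *v D) v"
    by (simp add: cdot_def matrix_vector_mult_def transpose_def sum_distrib_right sum_distrib_left mult_ac)
  finally show ?thesis .
qed

lemma gradient_compose:
  assumes "(F has_derivative (\<lambda>v. M *v v)) (at z)" "(f has_derivative cdot D) (at (F z))"
  shows "((\<lambda>z. f (F z)) has_derivative cdot (transpose M *v D)) (at z)"
  using has_derivative_compose [OF assms] by (simp add: cdot_transpose)

lemma hol_compose:
  assumes "holv S F" "hol T f" "F ` S \<subseteq> T"
  shows "hol S (\<lambda>z. f (F z))"
  unfolding hol_def
proof
  fix z assume z: "z \<in> S"
  then have "F z \<in> T" using assms by auto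
  from gradient_compose [OF holv_has_derivative [OF assms(1) z] hol_has_derivative [OF assms(2) this]]
  show "\<exists>D. ((\<lambda>z. f (F z)) has_derivative cdot D) (at z)" by blast
qed

lemma holv_linear [simp]: "holv S (\<lambda>z. M *v z)"
  unfolding holv_def matrix_vector_cdot by simp

lemma jac_linear [simp]: "jac (\<lambda>z. M *v z) z = M"
  by (rule jac_eqI) (auto intro!: bounded_linear_imp_has_derivative)

section \<open>Osgood's lemma and second derivatives through Cauchy integrals\<close>

definition cauchy_integral :: "'n \<Rightarrow> real \<Rightarrow> (complex ^ 'n \<Rightarrow> complex) \<Rightarrow> complex ^ 'n \<Rightarrow> complex" where
  "cauchy_integral j r f w =
     integral {0..1} (\<lambda>x. f (w + axis j (r * exp (2 * of_real pi * \<i> * of_real x))) * exp (- (2 * of_real pi * \<i> * of_real x))) / r"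

text \<open>Cauchy's formula for the first derivative with the parametrisation of the circle
  substituted: the factor \<open>2 * pi * \<i>\<close> cancels and one power of \<open>r\<close> is
  left. The value depends on \<open>w\<close> through the integrand only, so continuity and
  derivatives in \<open>w\<close> can be read off.\<close>

lemma cauchy_integral_eq:
  assumes r: "0 < r" and S: "open S"
    and along: "\<And>z. z \<in> S \<Longrightarrow> (\<lambda>t. f (z + axis j t)) field_differentiable at 0"
    and sub: "\<And>t. norm t \<le> r \<Longrightarrow> w + axis j t \<in> S"
  shows "((\<lambda>t. f (w + axis j t)) has_field_derivative cauchy_integral j r f w) (at 0)"
proof -
  define g where "g t = f (w + axis j t)" for t
  have diff: "g field_differentiable at t" if "norm t \<le> r" for t
  proof -
    have "(\<lambda>s. f ((w + axis j t) + axis j s)) field_differentiable at 0"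
      using along sub that by blast
    then obtain D where "((\<lambda>s. f ((w + axis j t) + axis j s)) has_field_derivative D) (at (0::complex))"
      by (auto simp: field_differentiable_def)
    moreover have "(\<lambda>s. f ((w + axis j t) + axis j s)) = (\<lambda>s. g (s + t))"
      by (auto simp: g_def axis_def vec_eq_iff fun_eq_iff intro!: arg_cong [of _ _ f])
    ultimately have "(g has_field_derivative D) (at t)"
      using DERIV_shift [of g D 0 t] by simp
    then show ?thesis by (auto simp: field_differentiable_def)
  qed
  have hg: "g holomorphic_on ball 0 r"
    unfolding holomorphic_on_def
    by (intro ballI, rule field_differentiable_at_within, rule diff) simp
  have cg: "continuous_on (cball 0 r) g"
    by (intro continuous_at_imp_continuous_on ballI field_differentiable_imp_continuous_at diff) simp
  have main: "(g has_field_derivative (1 / (2 * of_real pi * \<i>) *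
      contour_integral (circlepath 0 r) (\<lambda>u. g u / (u - 0)^2))) (at 0)"
    by (rule Cauchy_derivative_integral_circlepath (2) [OF cg hg]) (simp add: r)
  have "contour_integral (circlepath 0 r) (\<lambda>u. g u / (u - 0)^2)
     = integral {0..1} (\<lambda>x. (2 * of_real pi * \<i> / r) *
         (g (r * exp (2 * of_real pi * \<i> * of_real x)) * exp (- (2 * of_real pi * \<i> * of_real x))))"
    unfolding contour_integral_integral vector_derivative_circlepath
  proof (rule integral_cong, goal_cases)
    case (1 x)
    define E where "E = exp (2 * of_real pi * \<i> * of_real x)"
    have "E \<noteq> 0" by (simp add: E_def)
    have "G / (R * E - 0)\<^sup>2 * (P * R * E) = (P / R) * (G * inverse E)" if "R \<noteq> 0" for G P R :: complex
      using that \<open>E \<noteq> 0\<close> by (simp add: power2_eq_square field_simps)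
    from this [of "of_real r" "g (r * E)" "2 * of_real pi * \<i>"] r show ?case
      unfolding circlepath exp_minus E_def by simp
  qed
  also have "\<dots> = (2 * of_real pi * \<i>) * cauchy_integral j r f w"
    unfolding cauchy_integral_def g_def integral_mult_right by (simp only: times_divide_eq_left times_divide_eq_right)
  finally have eq: "1 / (2 * of_real pi * \<i>) * contour_integral (circlepath 0 r) (\<lambda>u. g u / (u - 0)^2)
      = cauchy_integral j r f w" by simp
  have "g = (\<lambda>t. f (w + axis j t))" by (simp add: fun_eq_iff g_def)
  then show ?thesis
    using main unfolding eq by simp
qed

lemma cauchy_integral_continuous:
  assumes S: "open S" and cont: "continuous_on S f"
    and sub: "\<And>w t. w \<in> U \<Longrightarrow> norm t \<le> r \<Longrightarrow> w + axis j t \<in> S" and r: "0 < r"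
  shows "continuous_on U (cauchy_integral j r f)"
proof -
  have "continuous_on U (\<lambda>w. integral (cbox 0 1)
     (\<lambda>x::real. f (w + axis j (r * exp (2 * of_real pi * \<i> * of_real x))) * exp (- (2 * of_real pi * \<i> * of_real x))))"
  proof (rule integral_continuous_on_param)
    have "w + axis j (r * exp (2 * of_real pi * \<i> * of_real x)) \<in> S" if "w \<in> U" for w and x :: real
      using r by (intro sub that) (simp add: norm_mult)
    then show "continuous_on (U \<times> cbox 0 1) (\<lambda>(w, x::real). f (w + axis j (r * exp (2 * of_real pi * \<i> * of_real x)))
        * exp (- (2 * of_real pi * \<i> * of_real x)))"
      unfolding split_beta
      by (intro continuous_intros continuous_on_compose2 [OF cont]) auto
  qed
  then show ?thesis
    using r unfolding cauchy_integral_def by (auto intro!: continuous_intros)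
qed

text \<open>The increment \<open>v\<close> is built up one coordinate at a time; each new coordinate
  costs a one-variable mean value estimate, whose error is small because the partial derivatives are
  continuous at \<open>z\<close>.\<close>

lemma partials_imp_has_derivative:
  fixes f :: "complex ^ 'n \<Rightarrow> complex"
  assumes e: "0 < e"
    and der: "\<And>w j. w \<in> ball z e \<Longrightarrow> ((\<lambda>t. f (w + axis j t)) has_field_derivative P w $ j) (at 0)"
    and cont: "isCont P z"
  shows "(f has_derivative cdot (P z)) (at z)"
proof -
  define vI where "vI I v = (\<chi> i. if i \<in> I then v $ i else 0)" for I :: "'n set" and v :: "complex ^ 'n"
  have vI_norm: "norm (vI I v) \<le> norm v" for I v
    unfolding norm_vec_def vI_def by (intro L2_set_mono) auto
  have main: "\<exists>d>0. \<forall>v. norm v < d \<longrightarrow> norm (f (z + vI I v) - f z - cdot (P z) (vI I v)) \<le> eps * norm v"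
    if "0 < eps" for I eps
    using finite [of I] that
  proof (induction I arbitrary: eps rule: finite_induct)
    case empty
    have "vI {} v = 0" for v by (simp add: vI_def vec_eq_iff)
    then show ?case using empty by (auto simp: cdot.zero_right intro!: exI [of _ 1])
  next
    case (insert j I)
    obtain d1 where d1: "0 < d1"
      "\<And>v. norm v < d1 \<Longrightarrow> norm (f (z + vI I v) - f z - cdot (P z) (vI I v)) \<le> eps / 2 * norm v"
      using insert.IH [of "eps / 2"] insert.prems by auto
    obtain d2 where d2: "0 < d2" "\<And>w. dist w z < d2 \<Longrightarrow> dist (P w) (P z) < eps / 2"
      using cont [unfolded continuous_at_eps_delta, rule_format, of "eps / 2"] insert.prems by auto
    \<comment> \<open>Half of \<open>d2\<close> and of \<open>e\<close>, because the points used
      below are at distance up to twice \<open>norm v\<close> from \<open>z\<close>.\<close>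
    define d where "d = min d1 (min (d2/2) (e/2))"
    have "norm (f (z + vI (insert j I) v) - f z - cdot (P z) (vI (insert j I) v)) \<le> eps * norm v"
      if v: "norm v < d" for v
    proof -
      define w where "w = z + vI I v"
      have vj: "norm (v $ j) \<le> norm v" by (rule Finite_Cartesian_Product.norm_nth_le)
      have wt: "dist (w + axis j t) z < min d2 e" if "t \<in> cball 0 (norm (v $ j))" for t
      proof -
        have "dist (w + axis j t) z = norm (vI I v + axis j t)"
          by (simp add: w_def dist_norm)
        also have "\<dots> \<le> norm (vI I v) + norm t"
          using norm_triangle_ineq [of "vI I v" "axis j t"] by simp
        also have "\<dots> \<le> norm v + norm v" using that vI_norm [of I v] vj by auto
        finally show ?thesis using v by (auto simp: d_def)
      qed
      \<comment> \<open>Subtracting the linear part at \<open>z\<close> leaves a function with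
        derivative at most \<open>eps / 2\<close> on the disc in question.\<close>
      define g where "g t = f (w + axis j t) - P z $ j * t" for t
      have derg: "(g has_field_derivative (P (w + axis j t) $ j - P z $ j)) (at t)"
        if "t \<in> cball 0 (norm (v $ j))" for t
      proof -
        have "((\<lambda>s. f ((w + axis j t) + axis j s)) has_field_derivative P (w + axis j t) $ j) (at 0)"
          using wt [OF that] by (intro der) (auto simp: dist_commute)
        moreover have "(\<lambda>s. f ((w + axis j t) + axis j s)) = (\<lambda>s. f (w + axis j (s + t)))"
          by (auto simp: axis_def vec_eq_iff fun_eq_iff intro!: arg_cong [of _ _ f])
        ultimately have "((\<lambda>t. f (w + axis j t)) has_field_derivative P (w + axis j t) $ j) (at t)"
          using DERIV_shift [of "\<lambda>t. f (w + axis j t)" "P (w + axis j t) $ j" 0 t] by simp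
        then show ?thesis unfolding g_def by (auto intro!: derivative_eq_intros)
      qed
      have "norm (g (v $ j) - g 0) \<le> eps / 2 * norm (v $ j - 0)"
      proof (rule field_differentiable_bound [where S = "cball 0 (norm (v $ j))"])
        fix t :: complex assume t: "t \<in> cball 0 (norm (v $ j))"
        show "(g has_field_derivative (P (w + axis j t) $ j - P z $ j)) (at t within cball 0 (norm (v $ j)))"
          using derg [OF t] by (rule DERIV_subset) simp
        have "norm (P (w + axis j t) $ j - P z $ j) \<le> norm (P (w + axis j t) - P z)"
          using Finite_Cartesian_Product.norm_nth_le [of "P (w + axis j t) - P z" j] by simp
        then show "norm (P (w + axis j t) $ j - P z $ j) \<le> eps / 2"
          using d2(2) [of "w + axis j t"] wt [OF t] by (simp add: dist_norm)
      qed auto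
      moreover have vI_insert: "vI (insert j I) v = vI I v + axis j (v $ j)"
        using insert.hyps by (auto simp: vI_def vec_eq_iff axis_def)
      moreover have "g (v $ j) - g 0 = f (z + (vI I v + axis j (v $ j))) - f w - P z $ j * v $ j"
        by (simp add: g_def w_def add.assoc)
      ultimately have "norm (f (z + vI (insert j I) v) - f w - P z $ j * v $ j) \<le> eps / 2 * norm v"
        using order_trans [OF _ mult_left_mono [OF vj, of "eps/2"]] insert.prems by simp
      moreover have "norm (f w - f z - cdot (P z) (vI I v)) \<le> eps / 2 * norm v"
        using d1(2) [of v] v by (simp add: w_def d_def)
      moreover have "cdot (P z) (vI (insert j I) v) = cdot (P z) (vI I v) + P z $ j * v $ j"
        unfolding vI_insert by (simp add: cdot.add_right)
      ultimately show ?thesis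
        using norm_triangle_ineq [of "f (z + vI (insert j I) v) - f w - P z $ j * v $ j"
            "f w - f z - cdot (P z) (vI I v)"]
        by (simp add: algebra_simps)
    qed
    then show ?case using d1 d2 e by (intro exI [of _ d]) (auto simp: d_def)
  qed
  have [simp]: "vI UNIV v = v" for v by (simp add: vI_def)
  show ?thesis
    unfolding has_derivative_at_alt
  proof (intro conjI allI impI)
    show "bounded_linear (cdot (P z))" by (rule cdot.bounded_linear_right)
    fix eps :: real assume "0 < eps"
    from main [OF this, of UNIV] obtain d where d: "d > 0"
      "\<And>v. norm v < d \<Longrightarrow> norm (f (z + v) - f z - cdot (P z) v) \<le> eps * norm v" by auto
    then show "\<exists>d>0. \<forall>y. norm (y - z) < d \<longrightarrow> norm (f y - f z - cdot (P z) (y - z)) \<le> eps * norm (y - z)"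
    proof (intro exI [of _ d] conjI allI impI)
      fix y assume "norm (y - z) < d"
      from d(2) [OF this] show "norm (f y - f z - cdot (P z) (y - z)) \<le> eps * norm (y - z)"
        by simp
    qed (rule d)
  qed
qed

text \<open>On a small ball the partial derivatives coincide with Cauchy integrals of
  \<open>f\<close>, which are continuous because \<open>f\<close> is; continuous partial derivatives
  give the total derivative.\<close>

lemma osgood:
  fixes f :: "complex ^ 'n \<Rightarrow> complex"
  assumes S: "open S" and cont: "continuous_on S f"
    and along: "\<And>z j. z \<in> S \<Longrightarrow> (\<lambda>t. f (z + axis j t)) field_differentiable at 0"
  shows "hol S f" "continuous_on S (gradient f)"
proof -
  have *: "(f has_derivative cdot (gradient f z)) (at z) \<and> isCont (gradient f) z" if "z \<in> S" for z
  proof -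
    obtain e where e: "0 < e" "cball z e \<subseteq> S"
      using S \<open>z \<in> S\<close> open_contains_cball by blast
    define r where "r = e / 2"
    have sub: "w + axis j t \<in> S" if "w \<in> ball z r" "norm t \<le> r" for w j and t :: complex
    proof -
      have "dist z (w + axis j t) \<le> dist z w + dist w (w + axis j t)" by (rule dist_triangle)
      also have "\<dots> \<le> e" using that by (auto simp: r_def dist_norm)
      finally show ?thesis using e by auto
    qed
    have r: "0 < r" using e by (simp add: r_def)
    define P where "P w = (\<chi> j. cauchy_integral j r f w)" for w
    have der: "((\<lambda>t. f (w + axis j t)) has_field_derivative P w $ j) (at 0)" if "w \<in> ball z r" for w j
      unfolding P_def using cauchy_integral_eq [OF r S along] sub that by simp
    then have P_eq: "gradient f w = P w" if "w \<in> ball z r" for w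
      using that by (auto simp: gradient_def partial_deriv_def vec_eq_iff intro: DERIV_imp_deriv)
    have "continuous_on (ball z r) P"
      unfolding P_def
      by (intro continuous_on_vec_lambda cauchy_integral_continuous [OF S cont]) (use sub r in auto)
    then have P_cont: "isCont P z"
      using r by (auto simp: continuous_on_eq_continuous_at)
    have "isCont (gradient f) z"
      using P_cont continuous_transform_within [of z UNIV P r "gradient f"] P_eq r
      by (auto simp: dist_commute)
    then show ?thesis
      using partials_imp_has_derivative [OF r der P_cont] P_eq [of z] r by auto
  qed
  then show "hol S f" "continuous_on S (gradient f)"
    by (auto simp: hol_def intro!: continuous_at_imp_continuous_on)
qed

lemma hol_field_differentiable:
  "hol S f \<Longrightarrow> z \<in> S \<Longrightarrow> (\<lambda>t. f (z + axis j t)) field_differentiable at 0"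
  using hol_along field_differentiable_def by blast

lemma continuous_on_gradient: "open S \<Longrightarrow> hol S f \<Longrightarrow> continuous_on S (gradient f)"
  by (rule osgood) (auto intro: hol_continuous_on hol_field_differentiable)

text \<open>Differentiation under the integral sign. It serves twice: it makes partial derivatives
  holomorphic again, and as the circle runs in direction \<open>j\<close> while the derivative is
  taken in direction \<open>k\<close>, it exchanges the two directions.\<close>

lemma cauchy_integral_derivative:
  assumes S: "open S" and f: "hol S f" and U: "convex U" "w \<in> U" "open U" and r: "0 < r"
    and sub: "\<And>w t. w \<in> U \<Longrightarrow> norm t \<le> r \<Longrightarrow> w + axis j t \<in> S"
  shows "((\<lambda>s. cauchy_integral j r f (w + axis k s)) has_field_derivative
           cauchy_integral j r (\<lambda>z. gradient f z $ k) w) (at 0)"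
proof -
  define V where "V = {s. w + axis k s \<in> U}"
  have V: "open V" "convex V" "0 \<in> V"
  proof -
    have "V = (\<lambda>s. w + axis k s) -` U" by (auto simp: V_def)
    then show "open V" using U by (auto intro!: open_vimage continuous_intros)
    show "0 \<in> V" using U by (simp add: V_def)
    have "V = axis k -` ((+) (- w) ` U)"
      unfolding V_def by (force simp: image_iff intro: bexI [of _ "w + axis k _"])
    moreover have "convex (axis k -` ((+) (- w) ` U))"
      by (rule convex_linear_vimage [OF bounded_linear.linear [OF bounded_linear_axis] convex_translation [OF U(1)]])
    ultimately show "convex V" by simp
  qed
  let ?c = "\<lambda>x::real. axis j (r * exp (2 * of_real pi * \<i> * of_real x)) :: complex ^ _"
  have in_S: "w + axis k s + ?c x \<in> S" if "s \<in> V" for s x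
    by (intro sub) (use that r in \<open>simp_all add: V_def norm_mult\<close>)
  have cg: "continuous_on S (\<lambda>z. gradient f z $ k)"
    using continuous_on_gradient [OF S f] by (intro continuous_intros)
  have "((\<lambda>s. integral (cbox 0 1) (\<lambda>x. f (w + axis k s + ?c x) * exp (- (2 * of_real pi * \<i> * of_real x))))
      has_field_derivative
      integral (cbox 0 1) (\<lambda>x. gradient f (w + axis k 0 + ?c x) $ k * exp (- (2 * of_real pi * \<i> * of_real x)))) (at 0 within V)"
  proof (rule leibniz_rule_field_derivative)
    fix s and x :: real assume "s \<in> V"
    have "((\<lambda>t. f ((w + axis k s + ?c x) + axis k t)) has_field_derivative gradient f (w + axis k s + ?c x) $ k) (at 0)"
      using in_S [OF \<open>s \<in> V\<close>] f by (intro hol_along)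
    moreover have "(\<lambda>t. f ((w + axis k s + ?c x) + axis k t)) = (\<lambda>t. f (w + axis k (t + s) + ?c x))"
      by (auto simp: axis_def vec_eq_iff fun_eq_iff intro!: arg_cong [of _ _ f])
    ultimately have "((\<lambda>t. f (w + axis k t + ?c x)) has_field_derivative gradient f (w + axis k s + ?c x) $ k) (at s)"
      using DERIV_shift [of "\<lambda>t. f (w + axis k t + ?c x)" _ 0 s] by simp
    then show "((\<lambda>s. f (w + axis k s + ?c x) * exp (- (2 * of_real pi * \<i> * of_real x))) has_field_derivative
        gradient f (w + axis k s + ?c x) $ k * exp (- (2 * of_real pi * \<i> * of_real x))) (at s within V)"
      by (rule DERIV_cmult_right [OF DERIV_subset [OF _ subset_UNIV]])
  next
    fix s assume "s \<in> V"
    then show "(\<lambda>x::real. f (w + axis k s + ?c x) * exp (- (2 * of_real pi * \<i> * of_real x))) integrable_on cbox 0 1"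
      by (intro integrable_continuous continuous_intros continuous_on_compose2 [OF hol_continuous_on [OF f]])
        (use in_S in auto)
  next
    show "continuous_on (V \<times> cbox 0 1) (\<lambda>(s, x::real). gradient f (w + axis k s + ?c x) $ k * exp (- (2 * of_real pi * \<i> * of_real x)))"
      unfolding split_beta
      by (intro continuous_intros continuous_on_compose2 [OF continuous_on_gradient [OF S f]]) (use in_S in auto)
  qed (use V in auto)
  then have "((\<lambda>s. integral (cbox 0 1) (\<lambda>x. f (w + axis k s + ?c x) * exp (- (2 * of_real pi * \<i> * of_real x))))
      has_field_derivative
      integral (cbox 0 1) (\<lambda>x. gradient f (w + ?c x) $ k * exp (- (2 * of_real pi * \<i> * of_real x)))) (at 0)"
    by (simp only: at_within_open [OF V(3,1)] axis_0 add_0_right)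
  then show ?thesis
    unfolding cauchy_integral_def by (simp only: cbox_interval DERIV_cdivide)
qed

lemma hol_gradient_aux:
  assumes S: "open S" and f: "hol S f" and z: "z \<in> S"
  shows "\<exists>e>0. \<exists>r>0. ball z e \<subseteq> S \<and> (\<forall>w\<in>ball z e. \<forall>j t. norm t \<le> r \<longrightarrow> w + axis j t \<in> S)"
proof -
  obtain e where e: "0 < e" "cball z e \<subseteq> S"
    using S z open_contains_cball by blast
  have "w + axis j t \<in> S" if "w \<in> ball z (e/2)" "norm t \<le> e/2" for w j and t :: complex
  proof -
    have "dist z (w + axis j t) \<le> dist z w + dist w (w + axis j t)" by (rule dist_triangle)
    also have "\<dots> \<le> e" using that by (auto simp: dist_norm)
    finally show ?thesis using e by auto
  qed
  moreover have "ball z (e/2) \<subseteq> S" using e by auto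
  ultimately show ?thesis using e by (intro exI [of _ "e/2"] conjI) auto
qed

lemma hol_gradient:
  assumes S: "open S" and f: "hol S f"
  shows "hol S (\<lambda>z. gradient f z $ j)"
proof (rule osgood [OF S])
  show "continuous_on S (\<lambda>z. gradient f z $ j)"
    using continuous_on_gradient [OF S f] by (intro continuous_intros)
  fix z k assume z: "z \<in> S"
  obtain e r where er: "0 < e" "0 < r" "\<And>w j t. w \<in> ball z e \<Longrightarrow> norm t \<le> r \<Longrightarrow> w + axis j t \<in> S"
    using hol_gradient_aux [OF S f z] by blast
  have eq: "gradient f w $ j = cauchy_integral j r f w" if "w \<in> ball z e" for w
  proof -
    have "((\<lambda>t. f (w + axis j t)) has_field_derivative cauchy_integral j r f w) (at 0)"
      by (rule cauchy_integral_eq [OF er(2) S]) (use f er that hol_field_differentiable in auto)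
    then show ?thesis by (auto simp: gradient_def partial_deriv_def intro: DERIV_imp_deriv)
  qed
  have "((\<lambda>s. cauchy_integral j r f (z + axis k s)) has_field_derivative
      cauchy_integral j r (\<lambda>z. gradient f z $ k) z) (at 0)"
    using er by (intro cauchy_integral_derivative [OF S f, of "ball z e"]) auto
  then have "((\<lambda>s. gradient f (z + axis k s) $ j) has_field_derivative
      cauchy_integral j r (\<lambda>z. gradient f z $ k) z) (at 0)"
    using er(1) by (elim has_field_derivative_transform_within [where d = e]) (auto simp: dist_norm eq)
  then show "(\<lambda>t. gradient f (z + axis k t) $ j) field_differentiable at 0"
    by (auto simp: field_differentiable_def)
qed

lemma holv_gradient: "open S \<Longrightarrow> hol S f \<Longrightarrow> holv S (gradient f)"
  by (simp add: holv_def hol_gradient)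

text \<open>Both mixed derivatives equal the Cauchy integral in direction \<open>j\<close> of the
  partial derivative in direction \<open>k\<close>.\<close>

lemma gradient_gradient_commute:
  assumes S: "open S" and f: "hol S f" and z: "z \<in> S"
  shows "gradient (\<lambda>z. gradient f z $ j) z $ k = gradient (\<lambda>z. gradient f z $ k) z $ j"
proof -
  obtain e r where er: "0 < e" "0 < r" "\<And>w j t. w \<in> ball z e \<Longrightarrow> norm t \<le> r \<Longrightarrow> w + axis j t \<in> S"
    using hol_gradient_aux [OF S f z] by blast
  have eq: "gradient h w $ j = cauchy_integral j r h w" if "w \<in> ball z e" "hol S h" for h w
  proof -
    have "((\<lambda>t. h (w + axis j t)) has_field_derivative cauchy_integral j r h w) (at 0)"
      by (rule cauchy_integral_eq [OF er(2) S]) (use that er hol_field_differentiable in auto)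
    then show ?thesis by (auto simp: gradient_def partial_deriv_def intro: DERIV_imp_deriv)
  qed
  have "((\<lambda>s. cauchy_integral j r f (z + axis k s)) has_field_derivative
      cauchy_integral j r (\<lambda>z. gradient f z $ k) z) (at 0)"
    using er by (intro cauchy_integral_derivative [OF S f, of "ball z e"]) auto
  then have "((\<lambda>s. gradient f (z + axis k s) $ j) has_field_derivative
      cauchy_integral j r (\<lambda>z. gradient f z $ k) z) (at 0)"
    using er(1) by (elim has_field_derivative_transform_within [where d = e]) (auto simp: dist_norm eq f)
  then have "gradient (\<lambda>z. gradient f z $ j) z $ k = cauchy_integral j r (\<lambda>z. gradient f z $ k) z"
    using DERIV_unique hol_along [OF hol_gradient [OF S f] z] by blast
  also have "\<dots> = gradient (\<lambda>z. gradient f z $ k) z $ j"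
    using er hol_gradient [OF S f] by (intro eq [symmetric]) auto
  finally show ?thesis .
qed

lemma hessian_symmetric:
  "open S \<Longrightarrow> hol S f \<Longrightarrow> z \<in> S \<Longrightarrow> transpose (jac (gradient f) z) = jac (gradient f) z"
  using gradient_gradient_commute [of S f z] by (simp add: jac_def transpose_def vec_eq_iff)

lemma continuous_on_jac: "open S \<Longrightarrow> holv S F \<Longrightarrow> continuous_on S (jac F)"
  unfolding jac_def holv_def by (intro continuous_on_vec_lambda continuous_on_gradient) auto

lemma hol_jac: "open S \<Longrightarrow> holv S F \<Longrightarrow> hol S (\<lambda>z. jac F z $ i $ j)"
  unfolding jac_def holv_def by (simp add: hol_gradient)

section \<open>Lifted vector fields and the Piola identity\<close>

definition hess_det :: "(complex ^ 'n \<Rightarrow> complex) \<Rightarrow> complex ^ 'n \<Rightarrow> complex" where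
  "hess_det h z = det (jac (gradient h) z)"

definition legendre :: "(complex ^ 'n \<Rightarrow> complex) \<Rightarrow> complex ^ 'n \<Rightarrow> complex" where
  "legendre h z = cdot z (gradient h z) - h z"

text \<open>The adjugate of the Hessian applied to \<open>v\<close>, by Cramer's rule with rows
  instead of columns, which is the same by symmetry. Divided by \<open>hess_det\<close> it would be
  the lift of the constant field \<open>v\<close> through the gradient; in this form it is
  holomorphic across the degenerate points.\<close>

definition adj_field :: "(complex ^ 'n \<Rightarrow> complex) \<Rightarrow> complex ^ 'n \<Rightarrow> complex ^ 'n \<Rightarrow> complex ^ 'n" where
  "adj_field h v z = (\<chi> k. det (\<chi> i. if i = k then v else jac (gradient h) z $ i))"

lemma adj_field_mult:
  assumes S: "open S" "hol S h" "z \<in> S" and J: "hess_det h z \<noteq> 0"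
  shows "jac (gradient h) z *v adj_field h v z = hess_det h z *s v"
proof -
  define M where "M = jac (gradient h) z"
  have sym: "M $ j $ i = M $ i $ j" for i j
    using hessian_symmetric [OF S] by (simp add: M_def transpose_def vec_eq_iff)
  have J': "det M \<noteq> 0" using J by (simp add: hess_det_def M_def)
  define x where "x = (\<chi> k. det (\<chi> i j. if j = k then v $ i else M $ i $ j) / det M)"
  have "M *v x = v"
    using cramer [OF J', of x v] by (simp add: x_def)
  have "adj_field h v z = det M *s x"
  proof -
    have "det (\<chi> i. if i = k then v else M $ i) = det (\<chi> i j. if j = k then v $ i else M $ i $ j)" for k
    proof -
      have "transpose (\<chi> i. if i = k then v else M $ i) = (\<chi> i j. if j = k then v $ i else M $ i $ j)"
        by (simp add: transpose_def vec_eq_iff sym)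
      with det_transpose [of "\<chi> i. if i = k then v else M $ i"] show ?thesis by (simp only:)
    qed
    then show ?thesis
      using J' unfolding adj_field_def x_def M_def [symmetric] by (simp add: vec_eq_iff)
  qed
  then have "M *v adj_field h v z = det M *s (M *v x)"
    by (simp add: matrix_vector_mult_def vec_eq_iff sum_distrib_left mult_ac)
  with \<open>M *v x = v\<close> show ?thesis by (simp add: M_def hess_det_def)
qed

lemma det_rows_derivative:
  fixes M :: "complex \<Rightarrow> complex ^ 'n ^ 'n"
  assumes "\<And>i j. ((\<lambda>t. M t $ i $ j) has_field_derivative M' $ i $ j) (at x)"
  shows "((\<lambda>t. det (M t)) has_field_derivative
     (\<Sum>i\<in>UNIV. det (\<chi> a. if a = i then M' $ i else M x $ a))) (at x)"
proof -
  let ?P = "{p. p permutes (UNIV :: 'n set)}"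
  have "((\<lambda>t. \<Sum>p\<in>?P. of_int (sign p) * (\<Prod>i\<in>UNIV. M t $ i $ p i)) has_field_derivative
      (\<Sum>p\<in>?P. of_int (sign p) * (\<Sum>i\<in>UNIV. M' $ i $ p i * (\<Prod>j\<in>UNIV - {i}. M x $ j $ p j)))) (at x)"
    by (intro DERIV_sum DERIV_cmult has_field_derivative_prod assms)
  moreover have "(\<Sum>p\<in>?P. of_int (sign p) * (\<Sum>i\<in>UNIV. M' $ i $ p i * (\<Prod>j\<in>UNIV - {i}. M x $ j $ p j)))
    = (\<Sum>i\<in>UNIV. det (\<chi> a. if a = i then M' $ i else M x $ a))"
  proof -
    have "(\<Prod>a\<in>UNIV. (if a = i then M' $ i else M x $ a) $ p a) = M' $ i $ p i * (\<Prod>j\<in>UNIV - {i}. M x $ j $ p j)"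
      for i and p :: "'n \<Rightarrow> 'n"
      by (subst prod.remove [of UNIV i]) (auto intro!: prod.cong)
    then have "(\<Sum>i\<in>UNIV. det (\<chi> a. if a = i then M' $ i else M x $ a))
      = (\<Sum>i\<in>UNIV. \<Sum>p\<in>?P. of_int (sign p) * (M' $ i $ p i * (\<Prod>j\<in>UNIV - {i}. M x $ j $ p j)))"
      by (simp add: det_def)
    also have "\<dots> = (\<Sum>p\<in>?P. \<Sum>i\<in>UNIV. of_int (sign p) * (M' $ i $ p i * (\<Prod>j\<in>UNIV - {i}. M x $ j $ p j)))"
      by (rule sum.swap)
    finally show ?thesis by (simp only: sum_distrib_left)
  qed
  ultimately show ?thesis unfolding det_def by simp
qed

lemma gradient_cong_open:
  assumes "open S" "z \<in> S" "hol S f" "\<And>w. w \<in> S \<Longrightarrow> f w = g w"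
  shows "gradient f z = gradient g z"
proof -
  have "(g has_derivative cdot (gradient f z)) (at z)"
    by (rule has_derivative_transform_within_open [OF hol_has_derivative [OF assms(3,2)] assms(1,2)])
      (use assms in auto)
  then show ?thesis using gradient_eqI by metis
qed

lemma det_swap_two_rows:
  fixes x y :: "complex ^ 'n"
  assumes "i \<noteq> k"
  shows "det (\<chi> a. if a = i then x else if a = k then y else H a)
       = - det (\<chi> a. if a = k then x else if a = i then y else H a)"
proof -
  let ?A = "\<chi> a. if a = k then x else if a = i then y else H a"
  have "det (\<chi> a. ?A $ (Transposition.transpose i k a)) = of_int (sign (Transposition.transpose i k)) * det ?A"
    by (rule det_permute_rows) (rule permutes_swap_id, auto)
  moreover have "(\<chi> a. ?A $ (Transposition.transpose i k a)) = (\<chi> a. if a = i then x else if a = k then y else H a)"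
    using assms by (auto simp: vec_eq_iff Transposition.transpose_def)
  ultimately show ?thesis using assms by (simp add: sign_swap_id)
qed

lemma holv_adj_field: "open S \<Longrightarrow> hol S h \<Longrightarrow> holv S (adj_field h v)"
  unfolding holv_def adj_field_def
proof (intro allI)
  fix k assume S: "open S" "hol S h"
  have "hol S (\<lambda>z. (\<chi> i. if i = k then v else jac (gradient h) z $ i) $ i $ j)" for i j
    using hol_jac [OF S(1) holv_gradient [OF S]] by (cases "i = k") auto
  from hol_det [OF this]
  show "hol S (\<lambda>z. (\<chi> k. det (\<chi> i. if i = k then v else jac (gradient h) z $ i)) $ k)"
    by simp
qed

lemma hol_hess_det: "open S \<Longrightarrow> hol S h \<Longrightarrow> hol S (hess_det h)"
  unfolding hess_det_def by (intro hol_det hol_jac holv_gradient)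

text \<open>The Piola identity. In the term \<open>D k i\<close> of the divergence, row
  \<open>k\<close> is \<open>v\<close> and row \<open>i\<close> has been differentiated in direction
  \<open>k\<close>. Third derivatives of \<open>h\<close> commute, so exchanging \<open>k\<close>
  and \<open>i\<close> only exchanges two rows; the double sum is antisymmetric and
  vanishes.\<close>

lemma adj_field_divergence_free:
  assumes S: "open S" "hol S h" "z \<in> S"
  shows "(\<Sum>k\<in>UNIV. jac (adj_field h v) z $ k $ k) = 0"
proof -
  let ?H = "jac (gradient h)"
  define T where "T k i = (\<chi> j. gradient (\<lambda>z. ?H z $ i $ j) z $ k)" for k i
  \<comment> \<open>The zero in the case \<open>i = k\<close> is the derivative of the constant row
    \<open>v\<close>.\<close>
  define D where "D k i = det (\<chi> a. if a = i then (if i = k then 0 else T k i) else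
      if a = k then v else ?H z $ a)" for k i
  have holH: "hol S (\<lambda>z. ?H z $ i $ j)" for i j
    using hol_jac [OF S(1) holv_gradient [OF S(1,2)]] .
  have T_sym: "T k i = T i k" for k i
  proof -
    have "gradient (\<lambda>z. ?H z $ i $ j) z $ k = gradient (\<lambda>z. ?H z $ k $ j) z $ i" for j
    proof -
      \<comment> \<open>Symmetry of the third derivatives of \<open>h\<close> is symmetry of the
        second derivatives of its partial derivative \<open>q\<close>.\<close>
      define q where "q = (\<lambda>z. gradient h z $ j)"
      have q: "hol S q" unfolding q_def by (rule hol_gradient [OF S(1,2)])
      have e: "?H w $ a $ j = gradient q w $ a" if "w \<in> S" for w a
        using gradient_gradient_commute [OF S(1,2) that] by (simp add: jac_def q_def)
      have "gradient (\<lambda>z. ?H z $ a $ j) z = gradient (\<lambda>z. gradient q z $ a) z" for a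
        using e by (intro gradient_cong_open [OF S(1,3) holH])
      then show ?thesis
        using gradient_gradient_commute [OF S(1) q S(3)] by simp
    qed
    then show ?thesis by (simp add: T_def)
  qed
  have "jac (adj_field h v) z $ k $ k = (\<Sum>i\<in>UNIV. D k i)" for k
  proof -
    define R where "R t = (\<chi> i. if i = k then v else ?H (z + axis k t) $ i)" for t
    define R' where "R' = (\<chi> i. if i = k then 0 else T k i)"
    have "((\<lambda>t. R t $ i $ j) has_field_derivative R' $ i $ j) (at 0)" for i j
    proof (cases "i = k")
      case False
      then show ?thesis
        using hol_along [OF holH [of i j] S(3), of k] by (simp add: R_def R'_def T_def)
    qed (simp add: R_def R'_def)
    from det_rows_derivative [OF this]
    have "((\<lambda>t. adj_field h v (z + axis k t) $ k) has_field_derivative (\<Sum>i\<in>UNIV. D k i)) (at 0)"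
      by (simp add: adj_field_def R_def R'_def D_def cong: if_cong)
    moreover have "((\<lambda>t. adj_field h v (z + axis k t) $ k) has_field_derivative
        gradient (\<lambda>z. adj_field h v z $ k) z $ k) (at 0)"
      using holv_adj_field [OF S(1,2)] by (intro hol_along [of S] S) (auto simp: holv_def)
    ultimately show ?thesis
      using DERIV_unique by (force simp: jac_def)
  qed
  then have sum: "(\<Sum>k\<in>UNIV. jac (adj_field h v) z $ k $ k) = (\<Sum>k\<in>UNIV. \<Sum>i\<in>UNIV. D k i)"
    by simp
  have anti: "D k i = - D i k" for k i
  proof (cases "i = k")
    case True
    have "det (\<chi> a. if a = k then 0 else ?H z $ a) = 0"
      by (rule det_row_0)
    moreover have "(\<lambda>a. if a = k then 0 else if a = k then v else ?H z $ a) = (\<lambda>a. if a = k then 0 else ?H z $ a)"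
      by auto
    ultimately have "D k k = 0" by (simp add: D_def)
    with True show ?thesis by simp
  next
    case False
    then have "D k i = det (\<chi> a. if a = i then T k i else if a = k then v else ?H z $ a)"
      by (simp add: D_def)
    also have "\<dots> = - det (\<chi> a. if a = k then T k i else if a = i then v else ?H z $ a)"
      using False by (rule det_swap_two_rows)
    also have "det (\<chi> a. if a = k then T k i else if a = i then v else ?H z $ a) = D i k"
      using False unfolding D_def T_sym [of i k] by simp
    finally show ?thesis .
  qed
  have "(\<Sum>k\<in>UNIV. \<Sum>i\<in>UNIV. D k i) = (\<Sum>k\<in>UNIV. \<Sum>i\<in>UNIV. - D i k)"
    by (intro sum.cong refl) (rule anti)
  also have "\<dots> = - (\<Sum>i\<in>UNIV. \<Sum>k\<in>UNIV. D i k)"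
    by (subst sum.swap) (simp add: sum_negf)
  finally show ?thesis
    unfolding sum by simp
qed

section \<open>Real divergence and integration by parts\<close>

lemma sum_Basis_complex_vec:
  "(\<Sum>b\<in>(Basis :: (complex ^ 'n) set). g b) = (\<Sum>i\<in>UNIV. g (axis i 1) + g (axis i \<i>))"
proof -
  have B: "(Basis :: (complex ^ 'n) set) = (\<lambda>(i, u). axis i u) ` (UNIV \<times> {1, \<i>})"
    by (auto simp: Basis_vec_def Basis_complex_def image_iff)
  have inj: "inj_on (\<lambda>(i, u). axis i u :: complex ^ 'n) (UNIV \<times> {1, \<i>})"
    by (auto simp: inj_on_def axis_eq_axis)
  show ?thesis
    unfolding B sum.reindex [OF inj] by (simp add: sum.cartesian_product' o_def)
qed

text \<open>The derivative of a field \<open>cnj c *s X\<close> with \<open>c\<close> and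
  \<open>X\<close> holomorphic has a conjugate linear part, whose contributions in the real
  directions \<open>axis i 1\<close> and \<open>axis i \<i>\<close> cancel, and a complex linear
  part, whose real trace is twice the real part of its complex trace. An antiholomorphic factor thus
  keeps the divergence zero.\<close>

lemma real_divergence_lifted:
  fixes d x :: "complex ^ 'n" and A :: "complex ^ 'n ^ 'n"
  assumes "(\<Sum>k\<in>UNIV. A $ k $ k) = 0"
  shows "(\<Sum>b\<in>Basis. (cnj (cdot d b) *s x + cnj c *s (A *v b)) \<bullet> b) = 0"
proof -
  have A: "(A *v axis i u) $ i = A $ i $ i * u" for i u
    by (simp add: matrix_vector_cdot)
  have e: "(cnj (cdot d (axis i 1)) *s x + cnj c *s (A *v axis i 1)) \<bullet> axis i 1
     + (cnj (cdot d (axis i \<i>)) *s x + cnj c *s (A *v axis i \<i>)) \<bullet> axis i \<i> = 2 * Re (cnj c * (A $ i $ i))" for i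
    by (simp add: inner_axis A inner_complex_def algebra_simps)
  have "(\<Sum>b\<in>Basis. (cnj (cdot d b) *s x + cnj c *s (A *v b)) \<bullet> b) = (\<Sum>i\<in>UNIV. 2 * Re (cnj c * (A $ i $ i)))"
    unfolding sum_Basis_complex_vec e ..
  also have "\<dots> = 2 * Re (cnj c * (\<Sum>k\<in>UNIV. A $ k $ k))"
    by (simp only: sum_distrib_left Re_sum)
  finally show ?thesis using assms by simp
qed

text \<open>Translating \<open>\<psi>\<close> does not change its integral, so the derivative of the
  integral under translation vanishes. The margin \<open>norm b\<close> in the box accommodates all
  translates by \<open>s *\<^sub>R b\<close> with \<open>s\<close> between \<open>-1\<close> and
  \<open>1\<close>.\<close>

lemma integral_derivative_compact_support:
  fixes \<psi> :: "'a::euclidean_space \<Rightarrow> real"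
  assumes der: "\<And>z. (\<psi> has_derivative \<psi>' z) (at z)"
    and cont: "continuous_on UNIV (\<lambda>z. \<psi>' z b)"
    and supp: "\<And>z. norm z \<ge> R \<Longrightarrow> \<psi> z = 0"
    and B: "cball 0 (R + norm b) \<subseteq> cbox a c"
  shows "integral (cbox a c) (\<lambda>z. \<psi>' z b) = 0"
proof -
  have c\<psi>: "continuous_on UNIV \<psi>"
    by (intro continuous_at_imp_continuous_on ballI) (rule has_derivative_continuous [OF der])
  have shift: "((\<lambda>s. \<psi> (z + s *\<^sub>R b)) has_vector_derivative \<psi>' (z + s *\<^sub>R b) b) (at s within U)" for z s U
  proof -
    have "((\<lambda>s. z + s *\<^sub>R b) has_derivative (\<lambda>h. h *\<^sub>R b)) (at s within U)"
      by (auto intro!: derivative_eq_intros)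
    from has_derivative_compose [OF this der]
    show ?thesis
      by (simp add: has_vector_derivative_def linear_scale [OF has_derivative_linear [OF der]])
  qed
  have "((\<lambda>s. integral (cbox a c) (\<lambda>z. \<psi> (z + s *\<^sub>R b))) has_vector_derivative
      integral (cbox a c) (\<lambda>z. \<psi>' (z + 0 *\<^sub>R b) b)) (at 0 within {-1..1})"
  proof (rule leibniz_rule_vector_derivative)
    show "(\<lambda>z. \<psi> (z + s *\<^sub>R b)) integrable_on cbox a c" for s
      by (intro integrable_continuous continuous_on_compose2 [OF c\<psi>] continuous_intros) auto
    show "continuous_on ({-1..1} \<times> cbox a c) (\<lambda>(s, z). \<psi>' (z + s *\<^sub>R b) b)"
      unfolding split_beta by (intro continuous_on_compose2 [OF cont] continuous_intros) auto
  qed (auto intro: shift)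
  moreover have const: "integral (cbox a c) (\<lambda>z. \<psi> (z + s *\<^sub>R b)) = integral UNIV \<psi>" if "s \<in> {-1..1}" for s
  proof -
    have sub: "z \<in> cbox (a + s *\<^sub>R b) (c + s *\<^sub>R b)" if "\<psi> z \<noteq> 0" for z
    proof -
      have "norm (z - s *\<^sub>R b) \<le> norm z + \<bar>s\<bar> * norm b"
        using norm_triangle_ineq4 [of z "s *\<^sub>R b"] by simp
      also have "\<bar>s\<bar> * norm b \<le> 1 * norm b"
        using \<open>s \<in> {-1..1}\<close> by (intro mult_right_mono) auto
      finally have "norm (z - s *\<^sub>R b) \<le> R + norm b"
        using supp [of z] that by linarith
      then have "z - s *\<^sub>R b \<in> cbox a c" using B by auto
      then show ?thesis by (simp add: mem_box algebra_simps)
    qed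
    have "integral (cbox a c) (\<lambda>z. \<psi> (z + s *\<^sub>R b)) = integral (cbox (a + s *\<^sub>R b) (c + s *\<^sub>R b)) \<psi>"
      using integral_shift_cbox [of "a + s *\<^sub>R b" "s *\<^sub>R b" "c + s *\<^sub>R b" \<psi>] by simp
    also have "\<dots> = integral UNIV (\<lambda>z. if z \<in> cbox (a + s *\<^sub>R b) (c + s *\<^sub>R b) then \<psi> z else 0)"
      by (rule integral_restrict_UNIV [symmetric])
    also have "(\<lambda>z. if z \<in> cbox (a + s *\<^sub>R b) (c + s *\<^sub>R b) then \<psi> z else 0) = \<psi>"
      using sub by fastforce
    finally show ?thesis .
  qed
  have "((\<lambda>s. integral (cbox a c) (\<lambda>z. \<psi> (z + s *\<^sub>R b))) has_vector_derivative 0) (at 0 within {-1..1})"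
    by (rule has_vector_derivative_transform [of 0 "{-1..1}" _ "\<lambda>_. integral UNIV \<psi>"]) (simp_all add: const)
  ultimately have "integral (cbox a c) (\<lambda>z. \<psi>' (z + 0 *\<^sub>R b) b) = 0"
    by (rule vector_derivative_unique_within [rotated]) (auto simp: trivial_limit_within)
  then show ?thesis by simp
qed

lemma extend_zero_has_derivative:
  fixes u :: "'a::real_normed_vector \<Rightarrow> real"
  assumes der: "\<And>z. norm z < R \<Longrightarrow> (u has_derivative u' z) (at z)"
    and supp: "\<And>z. R1 \<le> norm z \<Longrightarrow> norm z < R \<Longrightarrow> u z = 0" and R1: "R1 < R"
  shows "((\<lambda>z. if norm z < R then u z else 0) has_derivative
      (if norm z < R then u' z else (\<lambda>_. 0))) (at z)"
proof (cases "norm z < R")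
  case True
  have "((\<lambda>z. if norm z < R then u z else 0) has_derivative u' z) (at z)"
    by (rule has_derivative_transform_within_open [OF der [OF True], of "ball 0 R"]) (use True in auto)
  with True show ?thesis by simp
next
  case False
  have "((\<lambda>z. if norm z < R then u z else 0) has_derivative (\<lambda>_. 0)) (at z)"
    by (rule has_derivative_transform_within_open [OF has_derivative_const, of "- cball 0 R1"])
      (use False R1 supp in auto)
  with False show ?thesis by simp
qed

lemma extend_zero_derivative_zero:
  fixes u :: "'a::real_normed_vector \<Rightarrow> real"
  assumes der: "\<And>z. norm z < R \<Longrightarrow> (u has_derivative u' z) (at z)"
    and supp: "\<And>z. R1 \<le> norm z \<Longrightarrow> norm z < R \<Longrightarrow> u z = 0" and z: "R1 < norm z" "norm z < R"
  shows "u' z = (\<lambda>_. 0)"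
proof -
  have "(u has_derivative (\<lambda>_. 0)) (at z)"
    by (rule has_derivative_transform_within_open [OF has_derivative_const, of "ball 0 R - cball 0 R1"])
      (use z supp in auto)
  then show ?thesis
    using der [OF z(2)] has_derivative_unique by blast
qed

lemma extend_zero_continuous_on:
  fixes g :: "'b::metric_space \<Rightarrow> 'a::real_normed_vector \<Rightarrow> real"
  assumes g: "continuous_on (T \<times> ball 0 R) (\<lambda>(t, z). g t z)"
    and supp: "\<And>t z. t \<in> T \<Longrightarrow> R1 < norm z \<Longrightarrow> norm z < R \<Longrightarrow> g t z = 0" and R1: "R1 < R"
  shows "continuous_on (T \<times> UNIV) (\<lambda>(t, z). if norm z < R then g t z else 0)"
proof -
  let ?f = "\<lambda>(t, z). if norm z < R then g t z else 0"
  let ?U = "T \<times> UNIV :: ('b \<times> 'a) set"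
  have eq: "?U = T \<times> ball 0 R \<union> T \<times> - cball 0 R1" using R1 by auto
  have o: "openin (top_of_set ?U) (T \<times> V)" if "open V" for V :: "'a set"
    by (rule openin_Times) (simp_all add: that)
  show ?thesis
    unfolding eq
  proof (rule continuous_on_Un_local_open)
    show "openin (top_of_set (T \<times> ball 0 R \<union> T \<times> - cball 0 R1)) (T \<times> (ball 0 R :: 'a set))"
      using o [of "ball 0 R"] unfolding eq by simp
    show "openin (top_of_set (T \<times> ball 0 R \<union> T \<times> - cball 0 R1)) (T \<times> (- cball 0 R1 :: 'a set))"
      using o [OF open_Compl [OF closed_cball]] unfolding eq .
    show "continuous_on (T \<times> ball 0 R) ?f"
      by (rule continuous_on_eq [OF g]) auto
    show "continuous_on (T \<times> - cball 0 R1) ?f"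
      by (rule continuous_on_eq [of _ "\<lambda>_. 0"]) (use supp in auto)
  qed
qed

lemma has_derivative_cscale:
  assumes "(f has_derivative f') (at z within S)" "(F has_derivative F') (at z within S)"
  shows "((\<lambda>z. f z *s (F z :: complex ^ 'n)) has_derivative (\<lambda>w. f z *s F' w + f' w *s F z)) (at z within S)"
proof -
  have "bounded_bilinear (\<lambda>(c :: complex) (v :: complex ^ 'n). c *s v)"
  proof
    show "\<exists>K. \<forall>a (b :: complex ^ 'n). norm (a *s b) \<le> norm a * norm b * K"
      by (rule exI [of _ 1]) simp
  qed (auto simp: vec_eq_iff algebra_simps)
  from bounded_bilinear.FDERIV [OF this assms] show ?thesis .
qed

text \<open>Integration by parts for \<open>\<rho>\<close> along the divergence-free field
  \<open>W\<close>. Where \<open>hess_det\<close> is nonzero, \<open>W\<close> is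
  \<open>|hess_det|^2\<close> times the lift of \<open>v\<close>, so this is translation invariance
  of integrals over the target of the gradient, summed over fibres, without inverting the
  gradient.\<close>

lemma weighted_piola:
  fixes h :: "complex ^ 'n \<Rightarrow> complex" and \<rho> :: "complex ^ 'n \<Rightarrow> real"
  assumes S: "open S" "hol S h" "cball 0 R \<subseteq> S" and R1: "R1 < R"
    and der: "\<And>z. norm z < R \<Longrightarrow> (\<rho> has_derivative \<rho>' z) (at z)"
    and cont: "\<And>b. continuous_on (ball 0 R) (\<lambda>z. \<rho>' z b)"
    and supp: "\<And>z. R1 \<le> norm z \<Longrightarrow> norm z < R \<Longrightarrow> \<rho> z = 0"
    and B: "cball 0 (R + 1) \<subseteq> cbox a c"
  shows "integral (cbox a c) (\<lambda>z. if norm z < R then \<rho>' z (cnj (hess_det h z) *s adj_field h v z) else 0) = 0"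
proof -
  define W where "W z = cnj (hess_det h z) *s adj_field h v z" for z
  define W' where "W' z w = cnj (cdot (gradient (hess_det h) z) w) *s adj_field h v z
     + cnj (hess_det h z) *s (jac (adj_field h v) z *v w)" for z w
  have zS: "z \<in> S" if "norm z < R" for z using S(3) that by auto
  have W: "(W has_derivative W' z) (at z)" if z: "norm z < R" for z
  proof -
    have "((\<lambda>z. cnj (hess_det h z)) has_derivative (\<lambda>w. cnj (cdot (gradient (hess_det h) z) w))) (at z)"
      by (intro bounded_linear.has_derivative [OF bounded_linear_cnj] hol_has_derivative [OF hol_hess_det [OF S(1,2)] zS [OF z]])
    from has_derivative_cscale [OF this holv_has_derivative [OF holv_adj_field [OF S(1,2)] zS [OF z]]]
    show ?thesis unfolding W_def W'_def by (simp add: add.commute)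
  qed
  have cW: "continuous_on (ball 0 R) W"
    using W by (auto intro!: continuous_at_imp_continuous_on has_derivative_continuous)
  have bS: "ball 0 R \<subseteq> S" using S(3) by auto
  have cont_cs: "continuous_on X f \<Longrightarrow> continuous_on X F \<Longrightarrow> continuous_on X (\<lambda>z. f z *s (F z :: complex ^ 'n))"
    for X :: "(complex ^ 'n) set" and f F
    unfolding vector_scalar_mult_def by (intro continuous_intros)
  have cW': "continuous_on (ball 0 R) (\<lambda>z. W' z w)" for w
  proof -
    have 1: "continuous_on (ball 0 R) (gradient (hess_det h))"
      using continuous_on_gradient [OF S(1) hol_hess_det [OF S(1,2)]] bS by (rule continuous_on_subset)
    have 2: "continuous_on (ball 0 R) (jac (adj_field h v))"
      using continuous_on_jac [OF S(1) holv_adj_field [OF S(1,2)]] bS by (rule continuous_on_subset)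
    have 3: "continuous_on (ball 0 R) (adj_field h v)"
      using holv_continuous_on [OF holv_adj_field [OF S(1,2)]] bS by (rule continuous_on_subset)
    have 4: "continuous_on (ball 0 R) (hess_det h)"
      using hol_continuous_on [OF hol_hess_det [OF S(1,2)]] bS by (rule continuous_on_subset)
    show ?thesis
      unfolding W'_def matrix_vector_mult_def
      by (intro continuous_on_add cont_cs continuous_on_cnj cdot.continuous_on continuous_on_const
          continuous_intros 1 2 3 4)
  qed
  have each: "integral (cbox a c) (\<lambda>z. if norm z < R then \<rho> z * (W' z b \<bullet> b) + \<rho>' z b * (W z \<bullet> b) else 0) = 0"
     (is "integral _ ?F = 0") 
     and each_int: "(\<lambda>z. if norm z < R then \<rho> z * (W' z b \<bullet> b) + \<rho>' z b * (W z \<bullet> b) else 0) integrable_on cbox a c"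
    if b: "b \<in> Basis" for b
  proof -
    define u where "u z = \<rho> z * (W z \<bullet> b)" for z
    define u' where "u' z w = \<rho> z * (W' z w \<bullet> b) + \<rho>' z w * (W z \<bullet> b)" for z w
    have u: "(u has_derivative u' z) (at z)" if "norm z < R" for z
      unfolding u_def u'_def
      by (intro has_derivative_mult der that bounded_linear.has_derivative [OF bounded_linear_inner_left] W)
    have us: "u z = 0" if "R1 \<le> norm z" "norm z < R" for z using supp that by (simp add: u_def)
    have c\<rho>: "continuous_on (ball 0 R) \<rho>"
      using der by (auto intro!: continuous_at_imp_continuous_on has_derivative_continuous)
    have cu: "continuous_on (ball 0 R) (\<lambda>z. u' z b)"
      unfolding u'_def by (intro continuous_intros c\<rho> cont cW cW')
    have "continuous_on ({0::real} \<times> UNIV) (\<lambda>(t, z). if norm z < R then u' z b else 0)"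
      by (rule extend_zero_continuous_on [OF _ _ R1])
         (use extend_zero_derivative_zero [OF u us] cu in
           \<open>auto simp: split_beta intro!: continuous_on_compose2 [OF cu] continuous_intros\<close>)
    then have "continuous_on UNIV (\<lambda>z. (\<lambda>(t, z). if norm z < R then u' z b else 0) (0::real, z))"
      by (rule continuous_on_compose2) (auto intro!: continuous_intros)
    then have cu2: "continuous_on UNIV (\<lambda>z. if norm z < R then u' z b else 0)" by simp
    have e: "(if norm z < R then u' z else (\<lambda>_. 0)) b = (if norm z < R then u' z b else 0)" for z
      by simp
    have "integral (cbox a c) (\<lambda>z. (if norm z < R then u' z else (\<lambda>_. 0)) b) = 0"
      by (rule integral_derivative_compact_support [OF extend_zero_has_derivative [OF u us R1]])
         (use cu2 b B in \<open>auto simp: e\<close>)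
    then show "integral (cbox a c) ?F = 0" unfolding e unfolding u'_def .
    show "?F integrable_on cbox a c"
      using integrable_continuous [OF continuous_on_subset [OF cu2 subset_UNIV]] unfolding u'_def .
  qed
  \<comment> \<open>Summed over a real orthonormal basis, the product rule leaves the derivative of
    \<open>\<rho>\<close> along \<open>W\<close>, since the divergence term drops out.\<close>
  have point: "(\<Sum>b\<in>Basis. \<rho> z * (W' z b \<bullet> b) + \<rho>' z b * (W z \<bullet> b)) = \<rho>' z (W z)" if z: "norm z < R" for z
  proof -
    have "(\<Sum>b\<in>Basis. W' z b \<bullet> b) = 0"
      unfolding W'_def
      by (rule real_divergence_lifted [OF adj_field_divergence_free [OF S(1,2) zS [OF z]]])
    moreover have "\<rho>' z (W z) = (\<Sum>b\<in>Basis. \<rho>' z b * (W z \<bullet> b))"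
    proof -
      have lin: "linear (\<rho>' z)" using der [OF z] by (rule has_derivative_linear)
      have "\<rho>' z (W z) = \<rho>' z (\<Sum>b\<in>Basis. (W z \<bullet> b) *\<^sub>R b)" by (simp add: euclidean_representation)
      also have "\<dots> = (\<Sum>b\<in>Basis. (W z \<bullet> b) *\<^sub>R \<rho>' z b)"
        using lin by (simp add: linear_sum linear_scale)
      finally show ?thesis by (simp add: mult.commute)
    qed
    ultimately show ?thesis
      by (simp add: sum.distrib flip: sum_distrib_left)
  qed
  have "integral (cbox a c) (\<lambda>z. if norm z < R then \<rho>' z (W z) else 0)
     = integral (cbox a c) (\<lambda>z. \<Sum>b\<in>Basis. if norm z < R then \<rho> z * (W' z b \<bullet> b) + \<rho>' z b * (W z \<bullet> b) else 0)"
    using point by (intro integral_cong) auto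
  also have "\<dots> = (\<Sum>b\<in>Basis. integral (cbox a c) (\<lambda>z. if norm z < R then \<rho> z * (W' z b \<bullet> b) + \<rho>' z b * (W z \<bullet> b) else 0))"
    by (rule integral_sum) (use each_int in auto)
  also have "\<dots> = 0" using each by simp
  finally show ?thesis unfolding W_def .
qed

section \<open>Growth of the Legendre dual along fibres of the gradient\<close>

text \<open>The positive part is squared so that the cut-off built from it is continuously
  differentiable.\<close>

lemma DERIV_max_power2: "((\<lambda>x::real. (max 0 x)\<^sup>2) has_real_derivative 2 * max 0 x) (at x)"
proof (cases "x = 0")
  case True
  have "(\<lambda>h::real. (max 0 h)\<^sup>2 / h) \<midarrow>0\<rightarrow> 0"
  proof (rule Lim_null_comparison)
    show "\<forall>\<^sub>F h in at 0. norm ((max 0 h)\<^sup>2 / h) \<le> norm (h::real)"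
      by (rule always_eventually) (auto simp: max_def power2_eq_square)
  qed (auto intro!: tendsto_eq_intros)
  with True show ?thesis by (simp add: DERIV_def)
next
  case False
  show ?thesis
  proof (cases "x > 0")
    case True
    have "((\<lambda>x::real. x\<^sup>2) has_real_derivative 2 * x) (at x)"
      by (auto intro!: derivative_eq_intros)
    then have "((\<lambda>x::real. (max 0 x)\<^sup>2) has_real_derivative 2 * x) (at x)"
      by (rule has_field_derivative_transform_within_open [of _ _ _ "{0<..}"]) (use True in auto)
    with True show ?thesis by simp
  next
    case x: False
    have "((\<lambda>x::real. (max 0 x)\<^sup>2) has_real_derivative 0) (at x)"
      by (rule has_field_derivative_transform_within_open [OF DERIV_const [of 0], of "{..<0}"])
        (use False x in auto)
    with x show ?thesis by simp
  qed
qed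

lemma legendre_has_derivative:
  assumes S: "open S" "hol S h" "z \<in> S"
  shows "(legendre h has_derivative (\<lambda>w. cdot z (jac (gradient h) z *v w))) (at z)"
proof -
  have "((\<lambda>z. cdot z (gradient h z)) has_derivative
      (\<lambda>w. cdot z (jac (gradient h) z *v w) + cdot w (gradient h z))) (at z)"
    by (rule cdot.FDERIV [OF has_derivative_ident holv_has_derivative [OF holv_gradient [OF S(1,2)] S(3)]])
  from has_derivative_diff [OF this hol_has_derivative [OF S(2,3)]]
  show ?thesis
    unfolding legendre_def by (simp add: cdot_commute [of _ "gradient h z"])
qed

text \<open>Constants do not affect exponential growth rates; this is how a maximum is extracted
  from moments of increasing order.\<close>

lemma power_growth_le:
  assumes a: "0 < a" and m: "0 < m" and le: "\<And>K. a ^ Suc K * m \<le> M * c ^ Suc K" and c: "0 \<le> c"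
  shows "a \<le> (c::real)"
proof (rule ccontr)
  assume "\<not> a \<le> c"
  then have q: "0 \<le> c / a" "c / a < 1" using a c by auto
  have "(\<lambda>K. M * (c / a) ^ Suc K) \<longlonglongrightarrow> M * 0"
    using q by (intro tendsto_mult tendsto_const LIMSEQ_Suc LIMSEQ_power_zero) auto
  moreover have "m \<le> M * (c / a) ^ Suc K" for K
    using le [of K] a by (simp add: power_divide field_simps)
  ultimately have "m \<le> M * 0" by (intro LIMSEQ_le_const) auto
  with m show False by simp
qed

text \<open>If \<open>z\<close> follows \<open>gradient h z = \<eta> t\<close>, then
  \<open>k\<close> has derivative \<open>cdot z v\<close>, and \<open>rate\<close> bounds the
  logarithmic derivative of \<open>norm (k z)^2 + s^2\<close> by \<open>b' t\<close>. Such a path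
  need not continue through branch points. Instead the maximum of this quantity over a thin tube
  around the fibre is followed: it is the growth rate in \<open>K\<close> of the integrals
  \<open>N K t\<close>, for which the differential inequality holds. The positive \<open>s\<close>
  keeps the quantity away from zero where \<open>k\<close> vanishes.\<close>

lemma growth_nondegenerate:
  fixes h :: "complex ^ 'n \<Rightarrow> complex" and v \<eta>0 :: "complex ^ 'n"
  defines "\<eta> \<equiv> \<lambda>t. \<eta>0 + t *\<^sub>R v"
    and "k \<equiv> legendre h"
  assumes S: "open S" "hol S h" "cball 0 R \<subseteq> S"
    and t: "t0 \<le> t1" and s: "0 < s" and \<delta>: "0 < \<delta>" and R1: "R1 < R"
    and supp: "\<And>z t. R1 \<le> norm z \<Longrightarrow> norm z < R \<Longrightarrow> t \<in> {t0..t1} \<Longrightarrow> \<delta> \<le> norm (gradient h z - \<eta> t)"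
    and b: "\<And>t. t \<in> {t0..t1} \<Longrightarrow> (b has_real_derivative b' t) (at t)"
    and rate: "\<And>z t. norm z < R \<Longrightarrow> t \<in> {t0..t1} \<Longrightarrow> norm (gradient h z - \<eta> t) < \<delta> \<Longrightarrow>
       2 * Re (cnj (k z) * cdot z v) \<le> b' t * ((norm (k z))\<^sup>2 + s\<^sup>2)"
    and z1: "norm z1 < R" "gradient h z1 = \<eta> t1" "hess_det h z1 \<noteq> 0"
  shows "\<exists>z. norm z < R \<and> norm (gradient h z - \<eta> t0) \<le> \<delta> \<and>
     ((norm (k z1))\<^sup>2 + s\<^sup>2) * exp (b t0 - b t1) \<le> (norm (k z))\<^sup>2 + s\<^sup>2"
proof (rule ccontr)
  assume contra: "\<not> ?thesis"
  define p where "p = gradient h"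
  define J where "J = hess_det h"
  define \<Phi> where "\<Phi> z = (norm (k z))\<^sup>2 + s\<^sup>2" for z
  \<comment> \<open>Positive exactly in the open tube of radius \<open>\<delta>\<close> around the
    fibre over \<open>\<eta> t\<close>; the square of its positive part is the cut-off.\<close>
  define A where "A t z = \<delta>\<^sup>2 - (norm (p z - \<eta> t))\<^sup>2" for t z
  define F where "F K t z = (if norm z < R then (max 0 (A t z))\<^sup>2 * \<Phi> z ^ K * (norm (J z))\<^sup>2 else 0)" for K t z
  define Fd where "Fd K t z = (if norm z < R then 4 * max 0 (A t z) * ((p z - \<eta> t) \<bullet> v) * \<Phi> z ^ K * (norm (J z))\<^sup>2 else 0)" for K t z
  \<comment> \<open>The result of moving the derivative in \<open>t\<close> from the cut-off to
    \<open>\<Phi> ^ Suc K\<close>; hence the exponent \<open>K\<close> and the factor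
    \<open>Suc K\<close>, whereas \<open>Fd\<close> keeps the exponent of \<open>F\<close>.\<close>
  define Gd where "Gd K t z = (if norm z < R then (max 0 (A t z))\<^sup>2 * (real (Suc K) * \<Phi> z ^ K * (2 * Re (cnj (k z) * cdot z v))) * (norm (J z))\<^sup>2 else 0)" for K t z
  have \<Phi>_pos: "0 < \<Phi> z" for z using s by (simp add: \<Phi>_def add_nonneg_pos)
  have zS: "z \<in> S" if "norm z < R" for z using S(3) that by auto
  have bS: "ball 0 R \<subseteq> S" using S(3) by auto
  obtain B where B: "cball (0 :: complex ^ 'n) (R + 1) \<subseteq> cbox (- B) B"
    using bounded_subset_cbox_symmetric [OF bounded_cball] by blast
  have cp: "continuous_on (ball 0 R) p"
    unfolding p_def using continuous_on_gradient [OF S(1,2)] bS by (rule continuous_on_subset)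
  have ck: "continuous_on (ball 0 R) k"
  proof -
    have "continuous_on S k"
      unfolding k_def legendre_def
      by (intro continuous_intros cdot.continuous_on continuous_on_gradient [OF S(1,2)] hol_continuous_on [OF S(2)])
    then show ?thesis using bS by (rule continuous_on_subset)
  qed
  have cJ: "continuous_on (ball 0 R) J"
    unfolding J_def using hol_continuous_on [OF hol_hess_det [OF S(1,2)]] bS by (rule continuous_on_subset)
  have c\<Phi>: "continuous_on (ball 0 R) \<Phi>"
    unfolding \<Phi>_def by (intro continuous_intros ck)
  have cjac: "continuous_on (ball 0 R) (jac p)"
    unfolding p_def using continuous_on_jac [OF S(1) holv_gradient [OF S(1,2)]] bS by (rule continuous_on_subset)
  have snd_ball: "snd ` (T \<times> ball 0 R) \<subseteq> ball 0 R" for T :: "real set" by auto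
  have lift: "continuous_on (T \<times> ball 0 R) (\<lambda>x. f (snd x))" if "continuous_on (ball 0 R) f"
    for T :: "real set" and f :: "complex ^ 'n \<Rightarrow> 'b::topological_space"
    by (rule continuous_on_compose2 [OF that _ snd_ball]) (intro continuous_intros)
  have cA: "continuous_on (T \<times> ball 0 R) (\<lambda>x. A (fst x) (snd x))" for T
    unfolding A_def \<eta>_def by (intro continuous_intros lift cp)
  have A0: "max 0 (A t z) = 0" if "R1 \<le> norm z" "norm z < R" "t \<in> {t0..t1}" for t z
  proof -
    have "\<delta>\<^sup>2 \<le> (norm (p z - \<eta> t))\<^sup>2"
      using supp [OF that] \<delta> unfolding p_def by (intro power_mono) auto
    then show ?thesis by (simp add: A_def)
  qed
  have cont_ext: "continuous_on ({t0..t1} \<times> UNIV) (\<lambda>(t, z). F K t z)"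
    "continuous_on ({t0..t1} \<times> UNIV) (\<lambda>(t, z). Fd K t z)"
    "continuous_on ({t0..t1} \<times> UNIV) (\<lambda>(t, z). Gd K t z)" for K
  proof -
    have c\<eta>: "continuous_on (T \<times> ball 0 R) (\<lambda>x. \<eta> (fst x))" for T :: "real set"
      unfolding \<eta>_def by (intro continuous_intros)
    show "continuous_on ({t0..t1} \<times> UNIV) (\<lambda>(t, z). F K t z)"
      unfolding F_def
    proof (rule extend_zero_continuous_on [OF _ _ R1])
      show "continuous_on ({t0..t1} \<times> ball 0 R) (\<lambda>(t, z). (max 0 (A t z))\<^sup>2 * \<Phi> z ^ K * (norm (J z))\<^sup>2)"
        unfolding split_beta by (intro continuous_intros lift cJ c\<Phi> cA continuous_on_max)
    qed (simp add: A0)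
    show "continuous_on ({t0..t1} \<times> UNIV) (\<lambda>(t, z). Fd K t z)"
      unfolding Fd_def
    proof (rule extend_zero_continuous_on [OF _ _ R1])
      show "continuous_on ({t0..t1} \<times> ball 0 R) (\<lambda>(t, z). 4 * max 0 (A t z) * ((p z - \<eta> t) \<bullet> v) * \<Phi> z ^ K * (norm (J z))\<^sup>2)"
        unfolding split_beta by (intro continuous_intros lift cp cJ c\<Phi> cA c\<eta> continuous_on_max)
    qed (simp add: A0)
    have ckv: "continuous_on (ball 0 R) (\<lambda>z. 2 * Re (cnj (k z) * cdot z v))"
      by (intro continuous_intros cdot.continuous_on ck)
    show "continuous_on ({t0..t1} \<times> UNIV) (\<lambda>(t, z). Gd K t z)"
      unfolding Gd_def
    proof (rule extend_zero_continuous_on [OF _ _ R1])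
      show "continuous_on ({t0..t1} \<times> ball 0 R) (\<lambda>(t, z). (max 0 (A t z))\<^sup>2 *
          (real (Suc K) * \<Phi> z ^ K * (2 * Re (cnj (k z) * cdot z v))) * (norm (J z))\<^sup>2)"
        unfolding split_beta by (intro continuous_on_mult continuous_on_power continuous_on_const continuous_on_norm
            lift cJ c\<Phi> cA ckv continuous_on_max)
    qed (simp add: A0)
  qed
  have int: "F K t integrable_on cbox (- B) B" "Fd K t integrable_on cbox (- B) B" "Gd K t integrable_on cbox (- B) B"
    if "t \<in> {t0..t1}" for K t
  proof -
    have *: "(\<lambda>z. case (t, z) of (t, z) \<Rightarrow> g t z) integrable_on cbox (- B) B"
      if "continuous_on ({t0..t1} \<times> UNIV) (\<lambda>(t, z). g t z)" for g :: "real \<Rightarrow> complex ^ 'n \<Rightarrow> real"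
      by (rule integrable_continuous [OF continuous_on_compose2 [OF that]])
        (use \<open>t \<in> {t0..t1}\<close> in \<open>auto intro!: continuous_intros\<close>)
    show "F K t integrable_on cbox (- B) B" "Fd K t integrable_on cbox (- B) B" "Gd K t integrable_on cbox (- B) B"
      using * [OF cont_ext(1)] * [OF cont_ext(2)] * [OF cont_ext(3)] by simp_all
  qed
  have dA_t: "((\<lambda>t. A t z) has_real_derivative 2 * ((p z - \<eta> t) \<bullet> v)) (at t)" for t z
  proof -
    have "((\<lambda>t. \<delta>\<^sup>2 - (p z - \<eta> t) \<bullet> (p z - \<eta> t)) has_derivative (\<lambda>h. 2 * ((p z - \<eta> t) \<bullet> v) * h)) (at t)"
      unfolding \<eta>_def by (auto intro!: derivative_eq_intros simp: fun_eq_iff algebra_simps inner_commute)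
    then show ?thesis
      unfolding A_def power2_norm_eq_inner has_field_derivative_def by simp
  qed
  have dF: "((\<lambda>t. F K t z) has_vector_derivative Fd K t z) (at t within U)" for K t z U
  proof (cases "norm z < R")
    case True
    have "((\<lambda>t. (max 0 (A t z))\<^sup>2) has_real_derivative (2 * max 0 (A t z)) * (2 * ((p z - \<eta> t) \<bullet> v))) (at t)"
      by (rule DERIV_chain2 [OF DERIV_max_power2 dA_t])
    from DERIV_cmult_right [OF this, of "\<Phi> z ^ K * (norm (J z))\<^sup>2"]
    have "((\<lambda>t. F K t z) has_real_derivative Fd K t z) (at t)"
      using True unfolding F_def Fd_def by (simp add: mult_ac)
    then show ?thesis
      unfolding has_real_derivative_iff_has_vector_derivative by (rule has_vector_derivative_at_within)
  qed (simp add: F_def Fd_def)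
  define N where "N K t = integral (cbox (- B) B) (F K t)" for K t
  have dN: "(N K has_vector_derivative integral (cbox (- B) B) (Fd K t)) (at t within {t0..t1})"
    if "t \<in> {t0..t1}" for K t
    unfolding N_def
  proof (rule leibniz_rule_vector_derivative)
    show "continuous_on ({t0..t1} \<times> cbox (- B) B) (\<lambda>(t, z). Fd K t z)"
      by (rule continuous_on_subset [OF cont_ext(2)]) auto
  qed (use that int dF in auto)
  \<comment> \<open>A shift of \<open>\<eta> t\<close> is a translation in the target, so
    \<open>weighted_piola\<close> trades the derivative of the cut-off for the derivative of
    \<open>\<Phi> ^ Suc K\<close> along the lift of \<open>v\<close>.\<close>
  have integral_eq: "integral (cbox (- B) B) (Fd (Suc K) t) = integral (cbox (- B) B) (Gd K t)"
    if t: "t \<in> {t0..t1}" for K t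
  proof -
    define \<rho> where "\<rho> z = (max 0 (A t z))\<^sup>2 * \<Phi> z ^ Suc K" for z
    define d\<Phi> where "d\<Phi> z w = 2 * (k z \<bullet> cdot z (jac p z *v w))" for z w
    define dAz where "dAz z w = - 2 * ((p z - \<eta> t) \<bullet> (jac p z *v w))" for z w
    define \<rho>' where "\<rho>' z w = (max 0 (A t z))\<^sup>2 * (real (Suc K) * \<Phi> z ^ K * d\<Phi> z w)
       + (2 * max 0 (A t z) * dAz z w) * \<Phi> z ^ Suc K" for z w
    have d\<Phi>: "(\<Phi> has_derivative d\<Phi> z) (at z)" if "norm z < R" for z
    proof -
      have "((\<lambda>z. k z \<bullet> k z + s\<^sup>2) has_derivative (\<lambda>w. k z \<bullet> cdot z (jac p z *v w) + cdot z (jac p z *v w) \<bullet> k z + 0)) (at z)"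
        unfolding k_def p_def
        by (intro has_derivative_add has_derivative_inner has_derivative_const legendre_has_derivative [OF S(1,2) zS [OF that]])
      then show ?thesis
        unfolding \<Phi>_def d\<Phi>_def power2_norm_eq_inner by (simp add: inner_commute)
    qed
    have dA: "((\<lambda>z. A t z) has_derivative dAz z) (at z)" if "norm z < R" for z
    proof -
      have 1: "((\<lambda>z. p z - \<eta> t) has_derivative (\<lambda>w. jac p z *v w - 0)) (at z)"
        unfolding p_def
        by (intro has_derivative_diff has_derivative_const holv_has_derivative [OF holv_gradient [OF S(1,2)] zS [OF that]])
      have "((\<lambda>z. \<delta>\<^sup>2 - (p z - \<eta> t) \<bullet> (p z - \<eta> t)) has_derivative
          (\<lambda>w. 0 - ((p z - \<eta> t) \<bullet> (jac p z *v w - 0) + (jac p z *v w - 0) \<bullet> (p z - \<eta> t)))) (at z)"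
        by (intro has_derivative_diff has_derivative_const has_derivative_inner 1)
      then show ?thesis
        unfolding A_def dAz_def power2_norm_eq_inner by (simp add: inner_commute)
    qed
    have d\<rho>: "(\<rho> has_derivative \<rho>' z) (at z)" if "norm z < R" for z
    proof -
      have 1: "((\<lambda>z. (max 0 (A t z))\<^sup>2) has_derivative (\<lambda>w. 2 * max 0 (A t z) * dAz z w)) (at z)"
        using has_derivative_compose [OF dA [OF that] DERIV_max_power2 [THEN has_field_derivative_imp_has_derivative]]
        by (simp add: mult_ac)
      have 2: "((\<lambda>z. \<Phi> z ^ Suc K) has_derivative (\<lambda>w. real (Suc K) * \<Phi> z ^ K * d\<Phi> z w)) (at z)"
        using has_derivative_power [OF d\<Phi> [OF that], of "Suc K"] by (simp add: mult_ac)
      show ?thesis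
        unfolding \<rho>_def \<rho>'_def by (rule has_derivative_mult [OF 1 2])
    qed
    have cAt: "continuous_on (ball 0 R) (A t)"
      unfolding A_def by (intro continuous_intros cp)
    have zero: "integral (cbox (- B) B) (\<lambda>z. if norm z < R then \<rho>' z (cnj (hess_det h z) *s adj_field h v z) else 0) = 0"
    proof (rule weighted_piola [OF S R1 d\<rho> _ _ B])
      show "continuous_on (ball 0 R) (\<lambda>z. \<rho>' z w)" for w
        unfolding \<rho>'_def d\<Phi>_def dAz_def matrix_vector_mult_def
        by (intro continuous_intros cdot.continuous_on continuous_on_max cp ck cJ c\<Phi> cAt cjac)
      show "\<rho> z = 0" if "R1 \<le> norm z" "norm z < R" for z
        using A0 [OF that t] by (simp add: \<rho>_def)
    qed
    have pw: "\<rho>' z (cnj (J z) *s adj_field h v z) = Gd K t z - Fd (Suc K) t z" if z: "norm z < R" for z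
    proof -
      \<comment> \<open>The weight \<open>|J|^2\<close> makes the identity hold at degenerate points
        as well, where both sides vanish.\<close>
      have W: "jac p z *v (cnj (J z) *s adj_field h v z) = (norm (J z))\<^sup>2 *\<^sub>R v"
      proof (cases "J z = 0")
        case False
        have "jac p z *v (cnj (J z) *s adj_field h v z) = cnj (J z) *s (jac p z *v adj_field h v z)"
          by (simp add: matrix_vector_mult_def vec_eq_iff sum_distrib_left mult_ac)
        also have "\<dots> = cnj (J z) *s (J z *s v)"
          using adj_field_mult [OF S(1,2) zS [OF z]] False by (simp add: p_def J_def)
        also have "\<dots> = (norm (J z))\<^sup>2 *\<^sub>R v"
          using complex_norm_square [of "J z"]
          by (simp only: vec_eq_iff vector_smult_component vector_scaleR_component)
            (simp add: scaleR_conv_of_real mult_ac)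
        finally show ?thesis .
      next
        case True
        have "(0::complex) *s adj_field h v z = 0" by (simp add: vec_eq_iff)
        with True show ?thesis by simp
      qed
      have "cdot z ((norm (J z))\<^sup>2 *\<^sub>R v) = (norm (J z))\<^sup>2 *\<^sub>R cdot z v"
        by (simp add: cdot.scaleR_right)
      moreover have "k z \<bullet> cdot z v = Re (cnj (k z) * cdot z v)" by (simp add: inner_complex_def)
      ultimately show ?thesis
        unfolding \<rho>'_def d\<Phi>_def dAz_def W Gd_def Fd_def using z
        by (simp add: algebra_simps)
    qed
    have "integral (cbox (- B) B) (\<lambda>z. Gd K t z - Fd (Suc K) t z) =
      integral (cbox (- B) B) (\<lambda>z. if norm z < R then \<rho>' z (cnj (hess_det h z) *s adj_field h v z) else 0)"
      using pw by (intro integral_cong) (auto simp: Gd_def Fd_def J_def)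
    with zero integral_diff [OF int(3) [OF t] int(2) [OF t], of K "Suc K"] show ?thesis by simp
  qed
  have Gd_le: "Gd K t z \<le> real (Suc K) * b' t * F (Suc K) t z" if t: "t \<in> {t0..t1}" for K t z
  proof (cases "norm z < R \<and> 0 < A t z")
    case True
    then have "(norm (p z - \<eta> t))\<^sup>2 < \<delta>\<^sup>2" by (simp add: A_def)
    then have "norm (p z - \<eta> t) < \<delta>" using \<delta> by (simp add: power_less_imp_less_base)
    then have "2 * Re (cnj (k z) * cdot z v) \<le> b' t * \<Phi> z"
      using rate [of z t] True t by (simp add: p_def \<Phi>_def)
    then have "((max 0 (A t z))\<^sup>2 * (norm (J z))\<^sup>2 * real (Suc K) * \<Phi> z ^ K) * (2 * Re (cnj (k z) * cdot z v))
       \<le> ((max 0 (A t z))\<^sup>2 * (norm (J z))\<^sup>2 * real (Suc K) * \<Phi> z ^ K) * (b' t * \<Phi> z)"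
      using \<Phi>_pos [of z] by (intro mult_left_mono) auto
    then show ?thesis
      using True unfolding Gd_def F_def by (simp add: mult_ac)
  next
    case False
    then show ?thesis by (auto simp: Gd_def F_def max_def)
  qed
  \<comment> \<open>Gronwall's inequality for the moments, with \<open>Suc K\<close> times the rate
    of \<open>\<Phi>\<close>.\<close>
  have mono: "N (Suc K) t1 * exp (- real (Suc K) * b t1) \<le> N (Suc K) t0 * exp (- real (Suc K) * b t0)" for K
  proof (cases "t0 = t1")
    case False
    then have lt: "t0 < t1" using t by simp
    define g where "g t = N (Suc K) t * exp (- real (Suc K) * b t)" for t
    show ?thesis
      unfolding g_def [symmetric]
    proof (rule DERIV_nonpos_imp_decreasing_open [OF t])
      fix x assume x: "t0 < x" "x < t1"
      then have xi: "x \<in> {t0..t1}" by auto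
      have dn: "(N (Suc K) has_real_derivative integral (cbox (- B) B) (Gd K x)) (at x)"
        using dN [OF xi, of "Suc K"] integral_eq [OF xi, of K] x
        by (simp add: has_real_derivative_iff_has_vector_derivative at_within_Icc_at)
      have de: "((\<lambda>t. exp (- real (Suc K) * b t)) has_real_derivative
          exp (- real (Suc K) * b x) * (- real (Suc K) * b' x)) (at x)"
        by (rule DERIV_chain2 [OF DERIV_exp DERIV_cmult [OF b [OF xi]]])
      have "integral (cbox (- B) B) (Gd K x) \<le> integral (cbox (- B) B) (\<lambda>z. real (Suc K) * b' x * F (Suc K) x z)"
        using int [OF xi] Gd_le [OF xi] by (intro integral_le integrable_on_mult_right) auto
      then have le: "integral (cbox (- B) B) (Gd K x) \<le> real (Suc K) * b' x * N (Suc K) x"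
        by (simp add: N_def)
      have "(g has_real_derivative
          integral (cbox (- B) B) (Gd K x) * exp (- real (Suc K) * b x)
          + (exp (- real (Suc K) * b x) * (- real (Suc K) * b' x)) * N (Suc K) x) (at x)"
        unfolding g_def by (rule DERIV_mult [OF dn de])
      moreover have "integral (cbox (- B) B) (Gd K x) * exp (- real (Suc K) * b x)
          + (exp (- real (Suc K) * b x) * (- real (Suc K) * b' x)) * N (Suc K) x
         = exp (- real (Suc K) * b x) * (integral (cbox (- B) B) (Gd K x) - real (Suc K) * b' x * N (Suc K) x)"
        by (simp add: algebra_simps)
      moreover have "\<dots> \<le> 0" using le by (intro mult_nonneg_nonpos) auto
      ultimately show "\<exists>y. (g has_real_derivative y) (at x) \<and> y \<le> 0" by auto
    next
      have "continuous_on {t0..t1} (N (Suc K))"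
        using dN by (intro continuous_on_vector_derivative) auto
      moreover have "continuous_on {t0..t1} b"
        using b by (intro continuous_at_imp_continuous_on ballI DERIV_isCont) auto
      ultimately show "continuous_on {t0..t1} g" unfolding g_def by (intro continuous_intros)
    qed
  qed simp
  define Q where "Q = \<Phi> z1 * exp (b t0 - b t1)"
  have Q: "0 < Q" using \<Phi>_pos by (simp add: Q_def)
  have lt: "\<Phi> z < Q" if "norm z < R" "norm (p z - \<eta> t0) \<le> \<delta>" for z
    using contra that unfolding Q_def \<Phi>_def p_def by force
  define C where "C = {z \<in> cball 0 R1. norm (p z - \<eta> t0) \<le> \<delta>}"
  \<comment> \<open>The negated claim is a strict inequality on a compact set, which leaves room for
    a fixed \<open>Q'\<close> below \<open>Q\<close>; this gap is what the limit of large
    \<open>K\<close> detects.\<close>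
  have "\<exists>Q'. 0 \<le> Q' \<and> Q' < Q \<and> (\<forall>z\<in>C. \<Phi> z \<le> Q')"
  proof (cases "C = {}")
    case False
    have sub: "cball 0 R1 \<subseteq> (ball 0 R :: (complex ^ 'n) set)" using R1 by auto
    have "C = cball 0 R1 \<inter> (\<lambda>z. norm (p z - \<eta> t0)) -` {..\<delta>}" by (auto simp: C_def)
    moreover have "closed (cball 0 R1 \<inter> (\<lambda>z. norm (p z - \<eta> t0)) -` {..\<delta>})"
      by (rule continuous_closed_preimage [OF _ closed_cball closed_atMost])
        (intro continuous_intros continuous_on_subset [OF cp sub])
    ultimately have "closed C" by simp
    moreover have "bounded C" unfolding C_def by (rule bounded_subset [OF bounded_cball [of 0 R1]]) auto
    ultimately have "compact C" by (simp add: compact_eq_bounded_closed)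
    moreover have "continuous_on C \<Phi>" using sub by (intro continuous_on_subset [OF c\<Phi>]) (auto simp: C_def)
    ultimately obtain x where x: "x \<in> C" "\<And>z. z \<in> C \<Longrightarrow> \<Phi> z \<le> \<Phi> x"
      using continuous_attains_sup [OF _ False] by metis
    then have "\<Phi> x < Q" using lt [of x] sub by (auto simp: C_def)
    then show ?thesis using x \<Phi>_pos [of x] by (intro exI [of _ "\<Phi> x"]) auto
  qed (use Q in \<open>auto intro: exI [of _ 0]\<close>)
  then obtain Q' where Q': "0 \<le> Q'" "Q' < Q" "\<And>z. z \<in> C \<Longrightarrow> \<Phi> z \<le> Q'" by blast
  have t0: "t0 \<in> {t0..t1}" and t1: "t1 \<in> {t0..t1}" using t by auto
  have up: "N K t0 \<le> N 0 t0 * Q' ^ K" for K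
  proof -
    have "F K t0 z \<le> Q' ^ K * F 0 t0 z" for z
    proof (cases "norm z < R \<and> 0 < A t0 z")
      case True
      then have "(norm (p z - \<eta> t0))\<^sup>2 \<le> \<delta>\<^sup>2" by (simp add: A_def)
      then have "norm (p z - \<eta> t0) \<le> \<delta>" using \<delta> by (simp add: power2_le_iff_abs_le)
      moreover have "norm z < R1" using A0 [of z t0] True t0 by force
      ultimately have "\<Phi> z \<le> Q'" using Q'(3) [of z] by (simp add: C_def)
      then have "\<Phi> z ^ K \<le> Q' ^ K" using \<Phi>_pos [of z] by (intro power_mono) auto
      then have "((max 0 (A t0 z))\<^sup>2 * (norm (J z))\<^sup>2) * \<Phi> z ^ K \<le> ((max 0 (A t0 z))\<^sup>2 * (norm (J z))\<^sup>2) * Q' ^ K"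
        by (intro mult_left_mono) auto
      then show ?thesis using True by (simp add: F_def mult_ac)
    qed (auto simp: F_def max_def)
    then have "N K t0 \<le> integral (cbox (- B) B) (\<lambda>z. Q' ^ K * F 0 t0 z)"
      unfolding N_def using int(1) [OF t0] by (intro integral_le integrable_on_mult_right) auto
    then show ?thesis by (simp add: N_def mult.commute)
  qed
  have "Q' * exp (b t1 - b t0) < \<Phi> z1"
  proof -
    have "Q' * exp (b t1 - b t0) < Q * exp (b t1 - b t0)" using Q'(2) by simp
    also have "\<dots> = \<Phi> z1" by (simp add: Q_def flip: exp_add mult.assoc)
    finally show ?thesis .
  qed
  then obtain Q1 where Q1: "Q' * exp (b t1 - b t0) < Q1" "Q1 < \<Phi> z1" using dense by blast
  have Q1_pos: "0 < Q1" using Q1(1) Q'(1) by (meson exp_ge_zero le_less_trans mult_nonneg_nonneg)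
  \<comment> \<open>On a neighbourhood of \<open>z1\<close> all three factors of the integrand are
    bounded below, that with \<open>hess_det\<close> by the hypothesis on \<open>z1\<close>; so at
    \<open>t1\<close> the moments grow at least like the powers of \<open>Q1\<close>.\<close>
  define U where "U = {z \<in> ball 0 R. norm (p z - \<eta> t1) < \<delta> / 2 \<and> Q1 < \<Phi> z \<and> norm (J z1) / 2 < norm (J z)}"
  have "open U"
  proof -
    have o: "open (ball 0 R \<inter> f -` V)" if "continuous_on (ball 0 R) f" "open V"
      for f :: "complex ^ 'n \<Rightarrow> real" and V
      using continuous_open_preimage [OF that(1) open_ball that(2)] .
    have "U = (ball 0 R \<inter> (\<lambda>z. norm (p z - \<eta> t1)) -` {..<\<delta>/2}) \<inter> (ball 0 R \<inter> \<Phi> -` {Q1<..})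
        \<inter> (ball 0 R \<inter> (\<lambda>z. norm (J z)) -` {norm (J z1) / 2<..})"
      by (auto simp: U_def)
    then show ?thesis
      using o [OF continuous_on_norm [OF continuous_on_diff [OF cp continuous_on_const]], of "{..<\<delta>/2}"]
        o [OF c\<Phi>, of "{Q1<..}"] o [OF continuous_on_norm [OF cJ], of "{norm (J z1) / 2<..}"]
      by (simp add: open_Int)
  qed
  moreover have "z1 \<in> U" using z1 Q1 \<delta> by (simp add: U_def p_def J_def)
  ultimately obtain l u where lu: "z1 \<in> box l u" "cbox l u \<subseteq> U"
    using open_contains_cbox by (metis box_subset_cbox subsetD)
  have cpos: "0 < measure lborel (cbox l u)" using lu(1) content_pos_lt_eq [of l u] box_ne_empty(2) [of l u] by auto
  have subB: "cbox l u \<subseteq> cbox (- B) B"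
  proof
    fix z assume "z \<in> cbox l u"
    then have "norm z < R" using lu(2) by (auto simp: U_def)
    then show "z \<in> cbox (- B) B" using B by auto
  qed
  define c where "c = (\<delta>\<^sup>2 - (\<delta> / 2)\<^sup>2)\<^sup>2 * (norm (J z1) / 2)\<^sup>2"
  have c: "0 < c" using \<delta> z1(3) by (auto simp: c_def J_def power2_eq_square)
  have low: "Q1 ^ K * (c * measure lborel (cbox l u)) \<le> N K t1" for K
  proof -
    have F_nn: "0 \<le> F K t1 z" for z using \<Phi>_pos [of z] by (simp add: F_def)
    have "Q1 ^ K * c \<le> F K t1 z" if "z \<in> cbox l u" for z
    proof -
      have zU: "z \<in> U" using lu(2) that by auto
      have "(norm (p z - \<eta> t1))\<^sup>2 \<le> (\<delta> / 2)\<^sup>2" using zU by (intro power_mono) (auto simp: U_def)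
      moreover have "(\<delta> / 2)\<^sup>2 \<le> \<delta>\<^sup>2" using \<delta> by (intro power_mono) auto
      ultimately have "(\<delta>\<^sup>2 - (\<delta> / 2)\<^sup>2)\<^sup>2 \<le> (max 0 (A t1 z))\<^sup>2"
        by (intro power_mono) (auto simp: A_def)
      moreover have "(norm (J z1) / 2)\<^sup>2 \<le> (norm (J z))\<^sup>2" using zU by (intro power_mono) (auto simp: U_def)
      moreover have "Q1 ^ K \<le> \<Phi> z ^ K" using zU Q1_pos by (intro power_mono) (auto simp: U_def)
      ultimately have "((\<delta>\<^sup>2 - (\<delta> / 2)\<^sup>2)\<^sup>2 * Q1 ^ K) * (norm (J z1) / 2)\<^sup>2
         \<le> ((max 0 (A t1 z))\<^sup>2 * \<Phi> z ^ K) * (norm (J z))\<^sup>2"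
        using Q1_pos \<Phi>_pos [of z] by (intro mult_mono) auto
      then show ?thesis using zU by (simp add: F_def U_def c_def mult_ac)
    qed
    then have "integral (cbox l u) (\<lambda>z. Q1 ^ K * c) \<le> integral (cbox l u) (F K t1)"
      using int(1) [OF t1] subB by (intro integral_le) (auto intro: integrable_on_subcbox)
    also have "\<dots> \<le> N K t1"
      unfolding N_def using int(1) [OF t1] subB F_nn
      by (intro integral_subset_le) (auto intro: integrable_on_subcbox)
    finally show ?thesis by (simp add: mult_ac)
  qed
  \<comment> \<open>The lower bound at \<open>t1\<close>, the monotonicity and the upper bound at
    \<open>t0\<close> are compared for large \<open>K\<close>.\<close>
  have "Q1 \<le> Q' * exp (b t1 - b t0)"
  proof (rule power_growth_le [OF Q1_pos])
    show "0 < c * measure lborel (cbox l u)" using c cpos by simp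
    show "0 \<le> Q' * exp (b t1 - b t0)" using Q'(1) by simp
    fix K
    have "N (Suc K) t1 \<le> N (Suc K) t0 * exp (real (Suc K) * (b t1 - b t0))"
    proof -
      have "N (Suc K) t1 = (N (Suc K) t1 * exp (- real (Suc K) * b t1)) * exp (real (Suc K) * b t1)"
        by (simp add: mult.assoc algebra_simps flip: exp_add)
      also have "\<dots> \<le> (N (Suc K) t0 * exp (- real (Suc K) * b t0)) * exp (real (Suc K) * b t1)"
        using mono [of K] by (intro mult_right_mono) auto
      also have "\<dots> = N (Suc K) t0 * exp (real (Suc K) * (b t1 - b t0))"
        by (simp add: mult.assoc algebra_simps flip: exp_add)
      finally show ?thesis .
    qed
    also have "\<dots> \<le> (N 0 t0 * Q' ^ Suc K) * exp (real (Suc K) * (b t1 - b t0))"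
      using up [of "Suc K"] by (intro mult_right_mono) auto
    also have "\<dots> = N 0 t0 * (Q' * exp (b t1 - b t0)) ^ Suc K"
      by (simp only: exp_of_nat_mult power_mult_distrib mult.assoc)
    finally show "Q1 ^ Suc K * (c * measure lborel (cbox l u)) \<le> N 0 t0 * (Q' * exp (b t1 - b t0)) ^ Suc K"
      using low [of "Suc K"] by simp
  qed
  with Q1(1) show False by simp
qed

text \<open>A strict inequality on the zero set of \<open>f\<close> persists where \<open>f\<close>
  is small: on the compact set where \<open>g\<close> is nonnegative, \<open>f\<close> has a
  positive minimum.\<close>

lemma compact_gap:
  fixes f g :: "'a::metric_space \<Rightarrow> real"
  assumes C: "compact C" and f: "continuous_on C f" "\<And>x. x \<in> C \<Longrightarrow> 0 \<le> f x"
    and g: "continuous_on C g" and fg: "\<And>x. x \<in> C \<Longrightarrow> f x = 0 \<Longrightarrow> g x < 0"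
  shows "\<exists>\<delta>>0. \<forall>x\<in>C. f x \<le> \<delta> \<longrightarrow> g x < 0"
proof (cases "C \<inter> g -` {0..} = {}")
  case True
  then show ?thesis by (intro exI [of _ 1]) (auto simp: disjoint_iff not_le)
next
  case False
  have "closedin (top_of_set C) (C \<inter> g -` {0..})"
    by (rule continuous_closedin_preimage [OF g closed_atLeast])
  then have K: "compact (C \<inter> g -` {0..})"
    using C closedin_compact by blast
  obtain x where x: "x \<in> C \<inter> g -` {0..}" "\<And>y. y \<in> C \<inter> g -` {0..} \<Longrightarrow> f x \<le> f y"
    using continuous_attains_inf [OF K False continuous_on_subset [OF f(1)]] by blast
  have pos: "0 < f x" using x(1) f(2) [of x] fg [of x] by (auto simp: less_le)
  show ?thesis
  proof (intro exI [of _ "f x / 2"] conjI ballI impI)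
    fix y assume y: "y \<in> C" "f y \<le> f x / 2"
    show "g y < 0"
    proof (rule ccontr)
      assume "\<not> g y < 0"
      then have "f x \<le> f y" using y x(2) [of y] by auto
      with y(2) pos show False by simp
    qed
  qed (use pos in simp)
qed

section \<open>Determinants, kernels and nearby nonsingular matrices\<close>

lemma poly_charpoly: "poly (charpoly A) x = det (mat x - A)"
proof -
  have "poly ((mat [:0, 1:] - (\<chi> i j. [:A $ i $ j:])) $ i $ j) x = (mat x - A) $ i $ j" for i j
    by (simp add: mat_def)
  then show ?thesis
    unfolding charpoly_def det_def by (simp add: poly_sum poly_prod)
qed

lemma det_nonzero_iff_kernel:
  fixes A :: "complex ^ 'n ^ 'n"
  shows "det A \<noteq> 0 \<longleftrightarrow> (\<forall>x. A *v x = 0 \<longrightarrow> x = 0)"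
  using invertible_det_nz [of A] matrix_left_invertible_ker [of A] invertible_left_inverse [of A]
  by (metis invertible_def)

lemma mat_mult_vec [simp]: "mat c *v (v :: complex ^ 'n) = c *s v"
  by (simp add: mat_def matrix_vector_mult_def vec_eq_iff if_distrib [of "\<lambda>u. u * _"] cong: if_cong)

lemma matrix_vector_norm_bound:
  fixes A :: "complex ^ 'n ^ 'm"
  shows "\<exists>C\<ge>0. \<forall>v. norm (A *v v) \<le> C * norm v"
proof -
  have "bounded_linear (\<lambda>v. A *v v)" by simp
  then obtain C where "\<forall>v. norm (A *v v) \<le> norm v * C" using bounded_linear.bounded by blast
  then have "\<forall>v. norm (A *v v) \<le> max 0 C * norm v"
    by (metis max.cobounded2 mult.commute mult_right_mono norm_ge_zero order_trans)
  then show ?thesis by (intro exI [of _ "max 0 C"]) auto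
qed

text \<open>At a real number beyond a bound for the operator norm of \<open>A\<close> the matrix
  \<open>mat x - A\<close> has trivial kernel.\<close>

lemma charpoly_nonzero: "charpoly A \<noteq> 0"
proof
  assume z: "charpoly A = 0"
  obtain C where C: "0 \<le> C" "\<And>v. norm (A *v v) \<le> C * norm v" using matrix_vector_norm_bound by blast
  have "det (mat (of_real (C + 1)) - A) = 0" using z poly_charpoly [of A "of_real (C + 1)"] by simp
  then obtain x where x: "(mat (of_real (C + 1)) - A) *v x = 0" "x \<noteq> 0"
    using det_nonzero_iff_kernel by blast
  then have "of_real (C + 1) *s x = A *v x" by (simp add: matrix_vector_mult_diff_rdistrib)
  then have "norm (of_real (C + 1) *s x) \<le> C * norm x" using C(2) [of x] by simp
  then have "(C + 1) * norm x \<le> C * norm x" using C(1) unfolding norm_smult_vec norm_of_real by simp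
  with x(2) show False by (simp add: algebra_simps)
qed

text \<open>Only the finitely many negatives of eigenvalues have to be avoided.\<close>

lemma det_perturb:
  fixes A :: "complex ^ 'n ^ 'n"
  assumes "0 < e"
  shows "\<exists>\<epsilon>::real. 0 < \<epsilon> \<and> \<epsilon> < e \<and> det (A + mat (of_real \<epsilon>)) \<noteq> 0"
proof -
  have fin: "finite {x. poly (charpoly (- A)) x = 0}"
    by (rule poly_roots_finite [OF charpoly_nonzero])
  have "infinite (complex_of_real ` {0<..<e})"
    using assms by (subst finite_image_iff) (auto simp: inj_on_def infinite_Ioo)
  then have "\<not> complex_of_real ` {0<..<e} \<subseteq> {x. poly (charpoly (- A)) x = 0}"
    using fin finite_subset by blast
  then obtain y where "y \<in> complex_of_real ` {0<..<e}" "poly (charpoly (- A)) y \<noteq> 0" by blast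
  then obtain x where "0 < x" "x < e" "poly (charpoly (- A)) (of_real x) \<noteq> 0" by auto
  then show ?thesis by (intro exI [of _ x]) (simp add: poly_charpoly add.commute)
qed

text \<open>The nondegenerate case is applied to \<open>H \<epsilon>\<close>, whose Hessian is
  shifted by \<open>\<epsilon>\<close> and is invertible at \<open>z1\<close> for arbitrarily small
  \<open>\<epsilon>\<close>; a limit point of the solutions is the desired \<open>z\<close>. Besides
  the estimate this is a continuation principle: solutions of \<open>gradient h z = \<eta> t\<close>
  persist along the segment as long as none can reach the sphere of radius \<open>R\<close>.\<close>

lemma legendre_growth:
  fixes h :: "complex ^ 'n \<Rightarrow> complex" and v \<eta>0 :: "complex ^ 'n"
  defines "\<eta> \<equiv> \<lambda>t. \<eta>0 + t *\<^sub>R v"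
    and "k \<equiv> legendre h"
  assumes S: "open S" "hol S h" "cball 0 R \<subseteq> S" and R: "0 < R"
    and t: "t0 \<le> t1" and s: "0 < s"
    and avoid: "\<And>z t. norm z = R \<Longrightarrow> t \<in> {t0..t1} \<Longrightarrow> gradient h z \<noteq> \<eta> t"
    and b: "\<And>t. t \<in> {t0..t1} \<Longrightarrow> (b has_real_derivative b' t) (at t)"
    and b': "continuous_on {t0..t1} b'"
    and rate: "\<And>z t. norm z < R \<Longrightarrow> t \<in> {t0..t1} \<Longrightarrow> gradient h z = \<eta> t \<Longrightarrow>
       2 * Re (cnj (k z) * cdot z v) \<le> b' t * ((norm (k z))\<^sup>2 + s\<^sup>2)"
    and z1: "norm z1 < R" "gradient h z1 = \<eta> t1"
  shows "\<exists>z. norm z < R \<and> gradient h z = \<eta> t0 \<and>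
     ((norm (k z1))\<^sup>2 + s\<^sup>2) * exp (b t0 - b t1) \<le> (norm (k z))\<^sup>2 + s\<^sup>2"
proof -
  define p where "p = gradient h"
  \<comment> \<open>The perturbing quadratic is centred at \<open>z1\<close>, so neither the
    gradient nor the Legendre value at \<open>z1\<close> changes; \<open>q\<close> is its Legendre
    dual.\<close>
  define q where "q z = cdot z (z - z1) - cdot (z - z1) (z - z1) / 2" for z
  define ke where "ke \<epsilon> z = k z + of_real \<epsilon> * q z" for \<epsilon> z
  define H where "H \<epsilon> z = h z + of_real \<epsilon> * (cdot (z - z1) (z - z1) / 2)" for \<epsilon> :: real and z
  have cp: "continuous_on S p" unfolding p_def by (rule continuous_on_gradient [OF S(1,2)])
  have ck: "continuous_on S k"
    unfolding k_def legendre_def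
    by (intro continuous_intros cdot.continuous_on continuous_on_gradient [OF S(1,2)] hol_continuous_on [OF S(2)])
  have dH: "(H \<epsilon> has_derivative cdot (p z + of_real \<epsilon> *s (z - z1))) (at z)" if "z \<in> S" for \<epsilon> z
  proof -
    have 1: "((\<lambda>z. z - z1) has_derivative (\<lambda>w. w - 0)) (at z)"
      by (intro has_derivative_diff has_derivative_ident has_derivative_const)
    have "((\<lambda>z. of_real \<epsilon> * (cdot (z - z1) (z - z1) / 2)) has_derivative
        (\<lambda>w. of_real \<epsilon> * ((cdot (z - z1) (w - 0) + cdot (w - 0) (z - z1)) / 2))) (at z)"
      using has_derivative_mult_right [OF has_derivative_mult_left [OF cdot.FDERIV [OF 1 1], of "1 / 2"], of "of_real \<epsilon>"]
      by simp
    from has_derivative_add [OF hol_has_derivative [OF S(2) that] this]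
    show ?thesis
      unfolding H_def p_def
      by (rule has_derivative_eq_rhs)
        (simp only: fun_eq_iff cdot.add_left cdot_scale_left diff_zero cdot_commute [of _ "z - z1"], simp)
  qed
  then have holH: "hol S (H \<epsilon>)" for \<epsilon> unfolding hol_def by blast
  have gH: "gradient (H \<epsilon>) z = p z + of_real \<epsilon> *s (z - z1)" if "z \<in> S" for \<epsilon> z
    using dH [OF that] by (rule gradient_eqI)
  have kH: "legendre (H \<epsilon>) z = ke \<epsilon> z" if "z \<in> S" for \<epsilon> z
    unfolding legendre_def gH [OF that] ke_def k_def q_def H_def p_def
    unfolding cdot.add_right cdot_scale_right by (simp add: right_diff_distrib)
  have JH: "hess_det (H \<epsilon>) z1 = det (jac p z1 + mat (of_real \<epsilon>))" for \<epsilon>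
  proof -
    have z1S: "z1 \<in> S" using S(3) z1(1) by auto
    have "((\<lambda>z. p z + of_real \<epsilon> *s (z - z1)) has_derivative (\<lambda>w. (jac p z1 + mat (of_real \<epsilon>)) *v w)) (at z1)"
    proof -
      have 1: "((\<lambda>z. z - z1) has_derivative (\<lambda>w. w - 0)) (at z1)"
        by (intro has_derivative_diff has_derivative_ident has_derivative_const)
      have 2: "((\<lambda>z. of_real \<epsilon> *s (z - z1)) has_derivative (\<lambda>w. of_real \<epsilon> *s w)) (at z1)"
        by (rule has_derivative_eq_rhs [OF has_derivative_cscale [OF has_derivative_const 1]])
           (simp add: fun_eq_iff vec_eq_iff)
      have 3: "(p has_derivative (\<lambda>w. jac p z1 *v w)) (at z1)"
        unfolding p_def by (rule holv_has_derivative [OF holv_gradient [OF S(1,2)] z1S])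
      show ?thesis
        by (rule has_derivative_eq_rhs [OF has_derivative_add [OF 3 2]])
          (simp add: fun_eq_iff matrix_vector_mult_add_rdistrib)
    qed
    then have "(gradient (H \<epsilon>) has_derivative (\<lambda>w. (jac p z1 + mat (of_real \<epsilon>)) *v w)) (at z1)"
      by (rule has_derivative_transform_within_open [OF _ S(1) z1S]) (simp add: gH)
    from jac_eqI [OF this] show ?thesis by (simp add: hess_det_def)
  qed
  define C where "C = cball (0 :: complex ^ 'n) R \<times> {t0..t1} \<times> {0..1::real}"
  define P where "P x = p (fst x) + snd (snd x) *\<^sub>R (fst x - z1) - \<eta> (fst (snd x))"
    for x :: "(complex ^ 'n) \<times> real \<times> real"
  \<comment> \<open>On \<open>C\<close> this vanishes exactly at the unperturbed solutions, so
    \<open>compact_gap\<close> carries strict inequalities over to small \<open>\<epsilon>\<close>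
    and thin tubes at once.\<close>
  define f where "f x = norm (P x) + snd (snd x)" for x
  have C: "compact C" unfolding C_def by (intro compact_Times compact_cball compact_Icc)
  have fstS: "fst ` C \<subseteq> S" using S(3) by (auto simp: C_def)
  have liftp: "continuous_on C (\<lambda>x. p (fst x))"
    by (rule continuous_on_compose2 [OF cp _ fstS]) (intro continuous_intros)
  have liftk: "continuous_on C (\<lambda>x. k (fst x))"
    by (rule continuous_on_compose2 [OF ck _ fstS]) (intro continuous_intros)
  have cP: "continuous_on C P" unfolding P_def \<eta>_def by (intro continuous_intros liftp)
  have cf: "continuous_on C f" unfolding f_def by (intro continuous_intros cP)
  have cke: "continuous_on C (\<lambda>x. ke (snd (snd x)) (fst x))"
    unfolding ke_def q_def by (intro continuous_intros liftk cdot.continuous_on) auto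
  have f0: "0 \<le> f x" if "x \<in> C" for x using that by (auto simp: f_def C_def)
  have f00: "snd (snd x) = 0 \<and> p (fst x) = \<eta> (fst (snd x))" if "x \<in> C" "f x = 0" for x
  proof -
    have "norm (P x) = 0 \<and> snd (snd x) = 0" using that by (auto simp: f_def C_def add_nonneg_eq_0_iff)
    then show ?thesis by (auto simp: P_def)
  qed
  have approx: "\<exists>\<epsilon> z. 0 \<le> \<epsilon> \<and> \<epsilon> \<le> \<kappa> \<and> norm z \<le> R \<and> norm (p z + \<epsilon> *\<^sub>R (z - z1) - \<eta> t0) \<le> \<kappa> \<and>
      ((norm (k z1))\<^sup>2 + s\<^sup>2) * exp (b t0 - b t1 + \<kappa> * (t0 - t1)) \<le> (norm (ke \<epsilon> z))\<^sup>2 + s\<^sup>2"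
    if \<kappa>: "0 < \<kappa>" for \<kappa> :: real
  proof -
    have "\<exists>\<delta>>0. \<forall>x\<in>C. f x \<le> \<delta> \<longrightarrow> norm (fst x) - R < 0"
    proof (rule compact_gap [OF C cf])
      fix x assume x: "x \<in> C" "f x = 0"
      then have "norm (fst x) \<le> R" "fst (snd x) \<in> {t0..t1}" by (auto simp: C_def)
      then show "norm (fst x) - R < 0" using avoid [of "fst x" "fst (snd x)"] f00 [OF x] by (force simp: p_def)
    qed (auto intro: f0 intro!: continuous_intros)
    then obtain d1 where d1: "0 < d1" "\<And>x. x \<in> C \<Longrightarrow> f x \<le> d1 \<Longrightarrow> norm (fst x) < R" by auto
    \<comment> \<open>The slack \<open>\<kappa>\<close> turns the assumed rate into a strict
      inequality, which survives the perturbation; it is sent to \<open>0\<close> at the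
      end.\<close>
    define g where "g x = 2 * Re (cnj (ke (snd (snd x)) (fst x)) * cdot (fst x) v)
       - (b' (fst (snd x)) + \<kappa>) * ((norm (ke (snd (snd x)) (fst x)))\<^sup>2 + s\<^sup>2)"
      for x :: "(complex ^ 'n) \<times> real \<times> real"
    have "\<exists>\<delta>>0. \<forall>x\<in>C. f x \<le> \<delta> \<longrightarrow> g x < 0"
    proof (rule compact_gap [OF C cf])
      have "continuous_on C (\<lambda>x. b' (fst (snd x)))"
        by (rule continuous_on_compose2 [OF b']) (auto simp: C_def intro!: continuous_intros)
      then show "continuous_on C g"
        unfolding g_def by (intro continuous_intros cke cdot.continuous_on)
      fix x assume x: "x \<in> C" "f x = 0"
      then have xx: "norm (fst x) < R" "fst (snd x) \<in> {t0..t1}" using d1 by (auto simp: C_def)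
      have "ke (snd (snd x)) (fst x) = k (fst x)" using f00 [OF x] by (simp add: ke_def)
      note keq = this
      have "0 < (norm (k (fst x)))\<^sup>2 + s\<^sup>2" using s by (simp add: add_nonneg_pos)
      with \<kappa> have 2: "0 < \<kappa> * ((norm (k (fst x)))\<^sup>2 + s\<^sup>2)" by (rule mult_pos_pos)
      have "2 * Re (cnj (k (fst x)) * cdot (fst x) v) \<le> b' (fst (snd x)) * ((norm (k (fst x)))\<^sup>2 + s\<^sup>2)"
        by (rule rate [OF xx]) (use f00 [OF x] in \<open>simp add: p_def\<close>)
      with 2 show "g x < 0" unfolding g_def keq distrib_right by linarith
    qed (rule f0)
    then obtain d2 where d2: "0 < d2" "\<And>x. x \<in> C \<Longrightarrow> f x \<le> d2 \<Longrightarrow> g x < 0" by auto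
    define \<delta> where "\<delta> = min (min (d1 / 2) (d2 / 2)) (min \<kappa> 1)"
    have \<delta>: "0 < \<delta>" "\<delta> \<le> d1 / 2" "\<delta> \<le> d2 / 2" "\<delta> \<le> \<kappa>" "\<delta> \<le> 1"
      using d1 d2 \<kappa> by (auto simp: \<delta>_def)
    obtain \<epsilon> where \<epsilon>: "0 < \<epsilon>" "\<epsilon> < \<delta>" "det (jac p z1 + mat (of_real \<epsilon>)) \<noteq> 0"
      using det_perturb [OF \<delta>(1)] by blast
    have sc: "of_real \<epsilon> *s w = \<epsilon> *\<^sub>R w" for w :: "complex ^ 'n"
      by (simp only: vec_eq_iff vector_smult_component vector_scaleR_component) (simp add: scaleR_conv_of_real)
    have inC: "(z, t, \<epsilon>) \<in> C" if "norm z \<le> R" "t \<in> {t0..t1}" for z t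
      using that \<epsilon> \<delta> by (auto simp: C_def)
    have PH: "P (z, t, \<epsilon>) = gradient (H \<epsilon>) z - \<eta> t" if "norm z \<le> R" for z t
    proof -
      have "z \<in> S" using that S(3) by auto
      then show ?thesis by (simp add: P_def sc gH scaleR_right_diff_distrib)
    qed
    have near: "f (z, t, \<epsilon>) \<le> d1 \<and> f (z, t, \<epsilon>) \<le> d2"
      if "norm z \<le> R" "norm (gradient (H \<epsilon>) z - \<eta> t) \<le> \<delta>" for z t
      using that \<delta> \<epsilon> by (auto simp: f_def PH)
    \<comment> \<open>The closed tube over the segment is compact and contained in the open ball, so
      a shell inside the sphere is free of it.\<close>
    have "\<exists>R1<R. \<forall>z t. R1 \<le> norm z \<and> norm z < R \<and> t \<in> {t0..t1} \<longrightarrow> \<delta> \<le> norm (gradient (H \<epsilon>) z - \<eta> t)"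
    proof -
      define D where "D = {x \<in> C. snd (snd x) = \<epsilon> \<and> norm (P x) \<le> \<delta>}"
      have "D = C \<inter> (\<lambda>x. snd (snd x)) -` {\<epsilon>} \<inter> (C \<inter> (\<lambda>x. norm (P x)) -` {..\<delta>})" by (auto simp: D_def)
      moreover have "closedin (top_of_set C) (C \<inter> (\<lambda>x. snd (snd x)) -` {\<epsilon>})"
        by (rule continuous_closedin_preimage) (auto intro!: continuous_intros)
      moreover have "closedin (top_of_set C) (C \<inter> (\<lambda>x. norm (P x)) -` {..\<delta>})"
        by (rule continuous_closedin_preimage [OF continuous_on_norm [OF cP] closed_atMost])
      ultimately have "closedin (top_of_set C) D" by (simp add: closedin_Int)
      then have "compact D" by (rule closedin_compact [OF C])
      show ?thesis
      proof (cases "D = {}")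
        case True
        have "\<delta> \<le> norm (gradient (H \<epsilon>) z - \<eta> t)" if "norm z < R" "t \<in> {t0..t1}" for z t
        proof (rule ccontr)
          assume "\<not> ?thesis"
          then have "(z, t, \<epsilon>) \<in> D" using that inC [of z t] by (simp add: D_def PH)
          with True show False by simp
        qed
        then show ?thesis using R by (intro exI [of _ 0]) auto
      next
        case False
        have "continuous_on D (\<lambda>x. norm (fst x))" by (intro continuous_intros)
        then obtain x where x: "x \<in> D" "\<And>y. y \<in> D \<Longrightarrow> norm (fst y) \<le> norm (fst x)"
          using continuous_attains_sup [OF \<open>compact D\<close> False] by blast
        have xR: "norm (fst x) < R"
        proof -
          have "x \<in> C" "snd (snd x) = \<epsilon>" "norm (P x) \<le> \<delta>" using x(1) by (auto simp: D_def)
          then have "f x \<le> d1" using \<delta> \<epsilon> by (simp add: f_def)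
          then show ?thesis using d1(2) \<open>x \<in> C\<close> by blast
        qed
        have "\<delta> \<le> norm (gradient (H \<epsilon>) z - \<eta> t)"
          if "(norm (fst x) + R) / 2 \<le> norm z" "norm z < R" "t \<in> {t0..t1}" for z t
        proof (rule ccontr)
          assume "\<not> ?thesis"
          then have "(z, t, \<epsilon>) \<in> D" using that inC [of z t] by (simp add: D_def PH)
          from x(2) [OF this] that xR show False by simp
        qed
        then show ?thesis using xR by (intro exI [of _ "(norm (fst x) + R) / 2"]) auto
      qed
    qed
    then obtain R1 where R1: "R1 < R"
      "\<And>z t. R1 \<le> norm z \<Longrightarrow> norm z < R \<Longrightarrow> t \<in> {t0..t1} \<Longrightarrow> \<delta> \<le> norm (gradient (H \<epsilon>) z - \<eta> t)" by blast
    have z1S: "z1 \<in> S" using S(3) z1(1) by auto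
    have "\<exists>z. norm z < R \<and> norm (gradient (H \<epsilon>) z - (\<eta>0 + t0 *\<^sub>R v)) \<le> \<delta> \<and>
      ((norm (legendre (H \<epsilon>) z1))\<^sup>2 + s\<^sup>2) * exp ((b t0 + \<kappa> * t0) - (b t1 + \<kappa> * t1)) \<le> (norm (legendre (H \<epsilon>) z))\<^sup>2 + s\<^sup>2"
    proof (rule growth_nondegenerate [where b = "\<lambda>t. b t + \<kappa> * t" and b' = "\<lambda>t. b' t + \<kappa>" and ?R1.0 = R1
        and v = v and h = "H \<epsilon>" and ?\<eta>0.0 = \<eta>0 and ?z1.0 = z1, OF S(1) holH S(3) t s \<delta>(1) R1(1)])
      show "\<delta> \<le> norm (gradient (H \<epsilon>) z - (\<eta>0 + t *\<^sub>R v))"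
        if "R1 \<le> norm z" "norm z < R" "t \<in> {t0..t1}" for z t
        using R1(2) [OF that] by (simp add: \<eta>_def)
      show "((\<lambda>t. b t + \<kappa> * t) has_real_derivative b' t + \<kappa>) (at t)" if "t \<in> {t0..t1}" for t
        using b [OF that] by (auto intro!: derivative_eq_intros)
      show "2 * Re (cnj (legendre (H \<epsilon>) z) * cdot z v) \<le> (b' t + \<kappa>) * ((norm (legendre (H \<epsilon>) z))\<^sup>2 + s\<^sup>2)"
        if "norm z < R" "t \<in> {t0..t1}" "norm (gradient (H \<epsilon>) z - (\<eta>0 + t *\<^sub>R v)) < \<delta>" for z t
      proof -
        have "f (z, t, \<epsilon>) \<le> d2" using near [of z t] that by (simp add: \<eta>_def)
        then have "g (z, t, \<epsilon>) < 0" using d2(2) [OF inC [of z t]] that by simp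
        moreover have "z \<in> S" using S(3) that by auto
        ultimately show ?thesis by (simp add: g_def kH)
      qed
      show "norm z1 < R" by (rule z1(1))
      show "gradient (H \<epsilon>) z1 = \<eta>0 + t1 *\<^sub>R v"
        using z1(2) gH [OF z1S, of \<epsilon>] by (simp add: p_def \<eta>_def vec_eq_iff)
      show "hess_det (H \<epsilon>) z1 \<noteq> 0" using \<epsilon>(3) JH by simp
    qed
    then obtain z where z: "norm z < R" "norm (gradient (H \<epsilon>) z - \<eta> t0) \<le> \<delta>"
      "((norm (ke \<epsilon> z1))\<^sup>2 + s\<^sup>2) * exp ((b t0 + \<kappa> * t0) - (b t1 + \<kappa> * t1)) \<le> (norm (legendre (H \<epsilon>) z))\<^sup>2 + s\<^sup>2"
      using kH [OF z1S] by (auto simp: \<eta>_def)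
    have zS: "z \<in> S" using z(1) S(3) by auto
    have "ke \<epsilon> z1 = k z1" by (simp add: ke_def q_def cdot.zero_right)
    then show ?thesis
      using z \<epsilon> \<delta> gH [OF zS, of \<epsilon>] kH [OF zS, of \<epsilon>]
      by (intro exI [of _ \<epsilon>] exI [of _ z]) (auto simp: sc algebra_simps)
  qed
  have "\<forall>n. \<exists>y. 0 \<le> fst y \<and> fst y \<le> inverse (real (Suc n)) \<and> norm (snd y) \<le> R \<and>
      norm (p (snd y) + fst y *\<^sub>R (snd y - z1) - \<eta> t0) \<le> inverse (real (Suc n)) \<and>
      ((norm (k z1))\<^sup>2 + s\<^sup>2) * exp (b t0 - b t1 + inverse (real (Suc n)) * (t0 - t1)) \<le> (norm (ke (fst y) (snd y)))\<^sup>2 + s\<^sup>2"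
    using approx [of "inverse (real (Suc n))" for n] by (simp only: split_paired_Ex fst_conv snd_conv) simp
  then obtain y where y: "\<And>n. 0 \<le> fst (y n) \<and> fst (y n) \<le> inverse (real (Suc n)) \<and> norm (snd (y n)) \<le> R \<and>
      norm (p (snd (y n)) + fst (y n) *\<^sub>R (snd (y n) - z1) - \<eta> t0) \<le> inverse (real (Suc n)) \<and>
      ((norm (k z1))\<^sup>2 + s\<^sup>2) * exp (b t0 - b t1 + inverse (real (Suc n)) * (t0 - t1)) \<le> (norm (ke (fst (y n)) (snd (y n))))\<^sup>2 + s\<^sup>2"
    by metis
  have y1: "\<And>n. 0 \<le> fst (y n)" and y2: "\<And>n. fst (y n) \<le> inverse (real (Suc n))"
    and y3: "\<And>n. norm (snd (y n)) \<le> R"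
    and y4: "\<And>n. norm (p (snd (y n)) + fst (y n) *\<^sub>R (snd (y n) - z1) - \<eta> t0) \<le> inverse (real (Suc n))"
    and y5: "\<And>n. ((norm (k z1))\<^sup>2 + s\<^sup>2) * exp (b t0 - b t1 + inverse (real (Suc n)) * (t0 - t1)) \<le> (norm (ke (fst (y n)) (snd (y n))))\<^sup>2 + s\<^sup>2"
    using y by blast+
  \<comment> \<open>A limit point of the approximate solutions solves the unperturbed equation and
    hence cannot lie on the sphere, by \<open>avoid\<close>.\<close>
  have "compact (cball (0 :: complex ^ 'n) R)" by simp
  moreover have "\<And>n. snd (y n) \<in> cball 0 R" using y3 by simp
  ultimately obtain z r where zr: "z \<in> cball 0 R" "strict_mono r" "((\<lambda>n. snd (y n)) \<circ> r) \<longlonglongrightarrow> z"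
    using compact_imp_seq_compact seq_compactE by metis
  have lim_inv: "(\<lambda>n. inverse (real (Suc (r n)))) \<longlonglongrightarrow> 0"
    using LIMSEQ_subseq_LIMSEQ [OF LIMSEQ_inverse_real_of_nat zr(2)] by (simp add: o_def)
  have ye: "(\<lambda>n. fst (y (r n))) \<longlonglongrightarrow> 0"
    by (rule tendsto_sandwich [OF always_eventually always_eventually tendsto_const lim_inv]) (simp_all only: y1 y2 HOL.simp_thms)
  have yz: "(\<lambda>n. snd (y (r n))) \<longlonglongrightarrow> z" using zr(3) by (simp add: o_def)
  have zS: "z \<in> S" using zr(1) S(3) by auto
  have "isCont p z"
    using cp zS continuous_on_eq_continuous_at [OF S(1), of p] by blast
  then have pz: "(\<lambda>n. p (snd (y (r n)))) \<longlonglongrightarrow> p z" by (rule isCont_tendsto_compose [OF _ yz])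
  have "isCont k z"
    using ck zS continuous_on_eq_continuous_at [OF S(1), of k] by blast
  then have kz: "(\<lambda>n. k (snd (y (r n)))) \<longlonglongrightarrow> k z" by (rule isCont_tendsto_compose [OF _ yz])
  have lim1: "(\<lambda>n. norm (p (snd (y (r n))) + fst (y (r n)) *\<^sub>R (snd (y (r n)) - z1) - \<eta> t0))
     \<longlonglongrightarrow> norm (p z + 0 *\<^sub>R (z - z1) - \<eta> t0)"
    by (intro tendsto_intros pz ye yz)
  have "norm (p z + 0 *\<^sub>R (z - z1) - \<eta> t0) \<le> 0"
    by (rule LIMSEQ_le [OF lim1 lim_inv], intro exI [of _ 0] allI impI, rule y4)
  then have pz0: "p z = \<eta> t0" by simp
  have yd: "(\<lambda>n. snd (y (r n)) - z1) \<longlonglongrightarrow> z - z1" by (rule tendsto_diff [OF yz tendsto_const])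
  have "(\<lambda>n. q (snd (y (r n)))) \<longlonglongrightarrow> q z"
    unfolding q_def
    by (rule tendsto_diff [OF cdot.tendsto [OF yz yd] tendsto_divide [OF cdot.tendsto [OF yd yd] tendsto_const]]) simp
  from tendsto_add [OF kz tendsto_mult [OF tendsto_of_real [OF ye] this]]
  have "(\<lambda>n. ke (fst (y (r n))) (snd (y (r n)))) \<longlonglongrightarrow> k z + of_real 0 * q z"
    unfolding ke_def .
  from tendsto_add [OF tendsto_power [OF tendsto_norm [OF this]] tendsto_const]
  have lim2: "(\<lambda>n. (norm (ke (fst (y (r n))) (snd (y (r n)))))\<^sup>2 + s\<^sup>2) \<longlonglongrightarrow> (norm (k z + of_real 0 * q z))\<^sup>2 + s\<^sup>2" .
  have lim3: "(\<lambda>n. ((norm (k z1))\<^sup>2 + s\<^sup>2) * exp (b t0 - b t1 + inverse (real (Suc (r n))) * (t0 - t1)))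
     \<longlonglongrightarrow> ((norm (k z1))\<^sup>2 + s\<^sup>2) * exp (b t0 - b t1 + 0 * (t0 - t1))"
    by (intro tendsto_intros lim_inv)
  have fin: "((norm (k z1))\<^sup>2 + s\<^sup>2) * exp (b t0 - b t1 + 0 * (t0 - t1)) \<le> (norm (k z + of_real 0 * q z))\<^sup>2 + s\<^sup>2"
    by (rule LIMSEQ_le [OF lim3 lim2], intro exI [of _ 0] allI impI, rule y5)
  have gz: "gradient h z = \<eta> t0" using pz0 unfolding p_def .
  have "t0 \<in> {t0..t1}" using t by simp
  with avoid gz have "norm z \<noteq> R" by blast
  with zr(1) have zR: "norm z < R" by simp
  have "((norm (k z1))\<^sup>2 + s\<^sup>2) * exp (b t0 - b t1) \<le> (norm (k z))\<^sup>2 + s\<^sup>2"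
    using fin by (simp only: mult_zero_left add_0_right of_real_0)
  with zR gz show ?thesis by blast
qed

section \<open>Points of slow decay of the gradient\<close>

definition drop_component :: "'n \<Rightarrow> complex ^ 'n \<Rightarrow> complex ^ 'n" where
  "drop_component i v = (\<chi> j. if j = i then 0 else v $ j)"

lemma drop_component_nth [simp]: "drop_component i v $ j = (if j = i then 0 else v $ j)"
  by (simp add: drop_component_def)

lemma axis_drop_component: "axis i (v $ i) + drop_component i v = v"
  by (simp add: vec_eq_iff axis_def)

lemma norm_le_componentwise:
  fixes v w :: "complex ^ 'n"
  assumes "\<And>i. norm (v $ i) \<le> norm (w $ i)"
  shows "norm v \<le> norm w"
  unfolding norm_vec_def by (intro L2_set_mono assms) auto

lemma norm_drop_component_le: "norm (drop_component i v) \<le> norm v"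
  by (rule norm_le_componentwise) simp

lemma norm_le_component_drop: "norm v \<le> norm (v $ i) + norm (drop_component i v)"
  using norm_triangle_ineq [of "axis i (v $ i)" "drop_component i v"] by (simp add: axis_drop_component)

lemma compact_norm_bounded_below:
  fixes p :: "'a::metric_space \<Rightarrow> 'b::real_normed_vector"
  assumes "compact K" "continuous_on K p" "\<And>z. z \<in> K \<Longrightarrow> p z \<noteq> 0"
  shows "\<exists>c>0. \<forall>z\<in>K. c \<le> norm (p z)"
proof (cases "K = {}")
  case False
  obtain x where x: "x \<in> K" "\<And>y. y \<in> K \<Longrightarrow> norm (p x) \<le> norm (p y)"
    using continuous_attains_inf [OF assms(1) False continuous_on_norm [OF assms(2)]] by blast
  then show ?thesis using assms(3) by (intro exI [of _ "norm (p x)"]) auto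
qed (auto intro: exI [of _ 1])

section \<open>The polar curve of a coordinate that is scaled by \<open>G\<close>\<close>

context
  fixes h :: "complex ^ 'n \<Rightarrow> complex" and G :: "complex ^ 'n \<Rightarrow> complex ^ 'n"
    and i0 :: 'n and l :: real and S :: "(complex ^ 'n) set"
  assumes S: "open S" "hol S h" "0 \<in> S" and G: "continuous_on S G"
    and euler: "\<And>z. z \<in> S \<Longrightarrow> h z = cdot (G z) (gradient h z)"
    and Gi0: "\<And>z. z \<in> S \<Longrightarrow> G z $ i0 = of_real l * z $ i0"
    and l: "0 < l" "l < 1"
    and iso: "\<And>z. z \<in> S \<Longrightarrow> gradient h z = 0 \<longleftrightarrow> z = 0"
    and flat: "\<And>e. 0 < e \<Longrightarrow> \<exists>d>0. \<forall>x. norm x < d \<longrightarrow> norm (gradient h (axis i0 x)) \<le> e * norm x"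
begin

lemma legendre_euler:
  assumes "z \<in> S"
  shows "legendre h z = of_real (1 - l) * z $ i0 * gradient h z $ i0
     + cdot (z - G z) (drop_component i0 (gradient h z))"
proof -
  have "legendre h z = cdot (z - G z) (gradient h z)"
    using euler [OF assms] by (simp add: legendre_def cdot.diff_left)
  also have "gradient h z = axis i0 (gradient h z $ i0) + drop_component i0 (gradient h z)"
    by (simp add: axis_drop_component)
  finally have "legendre h z = cdot (z - G z) (axis i0 (gradient h z $ i0) + drop_component i0 (gradient h z))"
    by (simp add: axis_drop_component)
  then show ?thesis
    unfolding cdot.add_right cdot_axis using Gi0 [OF assms] by (simp add: algebra_simps)
qed

text \<open>Join \<open>gradient h z\<close> to its component in direction \<open>i0\<close> by a
  segment in direction \<open>v\<close>. At that end every solution is polar, hence has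
  \<open>z $ i0 = 0\<close> and Legendre value \<open>0\<close> by \<open>legendre_euler\<close>;
  along the segment the value changes at rate at most \<open>\<rho> * norm v\<close>.\<close>

lemma legendre_le_drop_component:
  assumes \<rho>: "0 < \<rho>" "cball 0 \<rho> \<subseteq> S"
    and polar: "\<And>z. norm z < \<rho> \<Longrightarrow> drop_component i0 (gradient h z) = 0 \<Longrightarrow> z $ i0 = 0"
    and c: "\<And>z. norm z = \<rho> \<Longrightarrow> c \<le> norm (gradient h z)"
    and z: "norm z < \<rho>" "norm (gradient h z) < c"
  shows "norm (legendre h z) \<le> 2 * \<rho> * norm (drop_component i0 (gradient h z))"
proof (cases "drop_component i0 (gradient h z) = 0")
  case True
  have "z \<in> S" using z \<rho> by auto
  with True show ?thesis
    using polar [OF z(1) True] legendre_euler [of z] by (simp add: cdot.zero_right)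
next
  case False
  define v where "v = drop_component i0 (gradient h z)"
  \<comment> \<open>With this \<open>s\<close> the rate is bounded by
    \<open>2 |k| s \<le> |k|^2 + s^2\<close>, so \<open>b t = t\<close> serves and the growth factor
    is \<open>exp 1\<close>, at most \<open>3\<close>.\<close>
  define s where "s = \<rho> * norm v"
  define \<eta>0 where "\<eta>0 = axis i0 (gradient h z $ i0)"
  have s: "0 < s" using False \<rho> by (simp add: s_def v_def)
  have "\<exists>z0. norm z0 < \<rho> \<and> gradient h z0 = \<eta>0 + 0 *\<^sub>R v \<and>
     ((norm (legendre h z))\<^sup>2 + s\<^sup>2) * exp (0 - 1) \<le> (norm (legendre h z0))\<^sup>2 + s\<^sup>2"
  proof (rule legendre_growth [where b = "\<lambda>t. t" and b' = "\<lambda>_. 1" and ?t1.0 = 1, OF S(1,2) \<rho>(2,1) _ s])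
    fix w :: "complex ^ 'n" and t :: real assume w: "norm w = \<rho>" and t: "t \<in> {0..1::real}"
    have "norm (\<eta>0 + t *\<^sub>R v) \<le> norm (gradient h z)"
    proof (rule norm_le_componentwise)
      fix i
      have "t * norm (gradient h z $ i) \<le> 1 * norm (gradient h z $ i)"
        using t by (intro mult_right_mono) auto
      then show "norm ((\<eta>0 + t *\<^sub>R v) $ i) \<le> norm (gradient h z $ i)"
        using t by (auto simp: \<eta>0_def v_def axis_def)
    qed
    then show "gradient h w \<noteq> \<eta>0 + t *\<^sub>R v" using c [OF w] z(2) by auto
  next
    fix w :: "complex ^ 'n" and t :: real assume w: "norm w < \<rho>"
    have "2 * Re (cnj (legendre h w) * cdot w v) \<le> 2 * norm (cnj (legendre h w) * cdot w v)"
      by (rule mult_left_mono [OF complex_Re_le_cmod]) simp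
    also have "\<dots> \<le> 2 * (norm (legendre h w) * (norm w * norm v))"
      using norm_cdot_le [of w v] by (simp add: norm_mult mult_left_mono)
    also have "\<dots> \<le> 2 * (norm (legendre h w) * s)"
      using w unfolding s_def by (intro mult_left_mono mult_right_mono) auto
    also have "\<dots> \<le> 1 * ((norm (legendre h w))\<^sup>2 + s\<^sup>2)"
      using sum_squares_bound [of "norm (legendre h w)" s] by simp
    finally show "2 * Re (cnj (legendre h w) * cdot w v) \<le> 1 * ((norm (legendre h w))\<^sup>2 + s\<^sup>2)" .
  next
    show "gradient h z = \<eta>0 + 1 *\<^sub>R v" by (simp add: \<eta>0_def v_def axis_drop_component)
  qed (use z in auto)
  then obtain z0 where z0: "norm z0 < \<rho>" "gradient h z0 = \<eta>0 + 0 *\<^sub>R v"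
    "((norm (legendre h z))\<^sup>2 + s\<^sup>2) * exp (0 - 1) \<le> (norm (legendre h z0))\<^sup>2 + s\<^sup>2" by blast
  have d0: "drop_component i0 (gradient h z0) = 0"
    unfolding z0(2) by (simp add: vec_eq_iff \<eta>0_def axis_def)
  have "z0 \<in> S" using z0(1) \<rho> by auto
  then have "legendre h z0 = 0"
    using legendre_euler [of z0] polar [OF z0(1) d0] d0 by (simp add: cdot.zero_right)
  then have "((norm (legendre h z))\<^sup>2 + s\<^sup>2) * exp (0 - 1) \<le> s\<^sup>2" using z0(3) by simp
  then have "((norm (legendre h z))\<^sup>2 + s\<^sup>2) * exp (0 - 1) * exp 1 \<le> s\<^sup>2 * exp 1"
    by (rule mult_right_mono) simp
  moreover have "exp (0 - 1) * exp 1 = (1::real)" by (simp add: exp_add [symmetric])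
  ultimately have "(norm (legendre h z))\<^sup>2 + s\<^sup>2 \<le> s\<^sup>2 * exp 1"
    by (simp only: mult.assoc mult_1_right)
  moreover have "s\<^sup>2 * exp 1 \<le> s\<^sup>2 * 3" by (intro mult_left_mono exp_le) auto
  ultimately have "(norm (legendre h z))\<^sup>2 \<le> 4 * s\<^sup>2" using zero_le_power2 [of s] by linarith
  then have "(norm (legendre h z))\<^sup>2 \<le> (2 * s)\<^sup>2" unfolding power_mult_distrib by simp
  then have "norm (legendre h z) \<le> 2 * s" by (rule power2_le_imp_le) (use s in simp)
  then show ?thesis by (simp add: s_def v_def)
qed

text \<open>Suppose that all polar points have \<open>z $ i0 = 0\<close>. Then
  \<open>legendre_le_drop_component\<close> bounds the product of \<open>z $ i0\<close> and the
  component \<open>i0\<close> of the gradient by the other components (\<open>key\<close>), so these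
  cannot be much smaller than \<open>z $ i0\<close> at a fixed distance from the origin. On the axis
  they are, by \<open>flat\<close>. Continuation within the hyperplane \<open>z $ i0 = x\<close>,
  from the axis point, therefore stays in a ball and ends where the other components vanish: at a
  polar point with \<open>x \<noteq> 0\<close>.\<close>

lemma polar_point_exists:
  assumes \<rho>: "0 < \<rho>" "cball 0 \<rho> \<subseteq> S"
  shows "\<exists>z. norm z < \<rho> \<and> drop_component i0 (gradient h z) = 0 \<and> z $ i0 \<noteq> 0"
proof (rule ccontr)
  assume "\<not> ?thesis"
  then have polar: "\<And>z. norm z < \<rho> \<Longrightarrow> drop_component i0 (gradient h z) = 0 \<Longrightarrow> z $ i0 = 0" by blast
  define p where "p = gradient h"
  have cp: "continuous_on S p" unfolding p_def by (rule continuous_on_gradient [OF S(1,2)])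
  have nz: "p z \<noteq> 0" if "norm z \<le> \<rho>" "z \<noteq> 0" for z
    using iso [of z] that \<rho>(2) by (auto simp: p_def)
  have "\<exists>c>0. \<forall>z\<in>sphere 0 \<rho>. c \<le> norm (p z)"
  proof (rule compact_norm_bounded_below)
    show "continuous_on (sphere 0 \<rho>) p" by (rule continuous_on_subset [OF cp]) (use \<rho>(2) in auto)
    show "p z \<noteq> 0" if "z \<in> sphere 0 \<rho>" for z using nz [of z] that \<rho>(1) by auto
  qed simp
  then obtain c where c: "0 < c" "\<And>z. norm z = \<rho> \<Longrightarrow> c \<le> norm (p z)" by auto
  have "bounded ((\<lambda>z. z - G z) ` cball 0 \<rho>)"
    by (intro compact_imp_bounded compact_continuous_image continuous_intros continuous_on_subset [OF G \<rho>(2)]) simp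
  then obtain M where "\<forall>y\<in>(\<lambda>z. z - G z) ` cball 0 \<rho>. norm y \<le> M" unfolding bounded_iff by blast
  then have M: "norm (z - G z) \<le> M" if "norm z \<le> \<rho>" for z using that by simp
  have M0: "0 \<le> M" using order_trans [OF norm_ge_zero M [of 0]] \<rho>(1) by simp
  define C1 where "C1 = (2 * \<rho> + M) / (1 - l)"
  have C1: "0 < C1" using \<rho> M0 l by (simp add: C1_def add_pos_nonneg)
  have key: "norm (z $ i0) * norm (p z $ i0) \<le> C1 * norm (drop_component i0 (p z))"
    if z: "norm z < \<rho>" "norm (p z) < c" for z
  proof -
    have zS: "z \<in> S" using z \<rho> by auto
    have "norm (legendre h z) \<le> 2 * \<rho> * norm (drop_component i0 (p z))"
      unfolding p_def
    proof (rule legendre_le_drop_component [OF \<rho>])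
      show "z $ i0 = 0" if "norm z < \<rho>" "drop_component i0 (gradient h z) = 0" for z using polar [OF that] .
      show "c \<le> norm (gradient h z)" if "norm z = \<rho>" for z using c(2) [OF that] by (simp add: p_def)
      show "norm z < \<rho>" "norm (gradient h z) < c" using z by (simp_all add: p_def)
    qed
    moreover have "norm (cdot (z - G z) (drop_component i0 (p z))) \<le> M * norm (drop_component i0 (p z))"
      using norm_cdot_le [of "z - G z" "drop_component i0 (p z)"] M [of z] z(1)
      by (meson less_imp_le mult_right_mono norm_ge_zero order_trans)
    moreover have "of_real (1 - l) * (z $ i0 * p z $ i0) = legendre h z - cdot (z - G z) (drop_component i0 (p z))"
      using legendre_euler [OF zS] by (simp add: p_def)
    ultimately have "norm (of_real (1 - l) * (z $ i0 * p z $ i0)) \<le> (2 * \<rho> + M) * norm (drop_component i0 (p z))"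
      using norm_triangle_ineq4 [of "legendre h z" "cdot (z - G z) (drop_component i0 (p z))"]
      by (simp add: distrib_right)
    moreover have "norm (of_real (1 - l) * (z $ i0 * p z $ i0)) = (1 - l) * (norm (z $ i0) * norm (p z $ i0))"
      unfolding norm_mult norm_of_real using l by simp
    ultimately show ?thesis using l by (simp add: C1_def field_simps)
  qed
  have "isCont p 0" using cp S by (simp add: continuous_on_eq_continuous_at)
  moreover have "p 0 = 0" using iso [of 0] S by (simp add: p_def)
  ultimately obtain d where d: "0 < d" "\<And>z. norm z < d \<Longrightarrow> norm (p z) < c"
    using c(1) unfolding continuous_at_eps_delta by (metis dist_0_norm dist_commute diff_zero dist_norm)
  define r where "r = min (\<rho> / 4) (d / 4)"
  have r: "0 < r" "2 * r < \<rho>" "2 * r < d" using \<rho> d by (auto simp: r_def)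
  have "\<exists>m>0. \<forall>z\<in>cball 0 (2 * r) - ball 0 r. m \<le> norm (p z)"
  proof (rule compact_norm_bounded_below)
    show "compact (cball 0 (2 * r) - ball 0 r :: (complex ^ 'n) set)" by (intro compact_diff) auto
    have "cball 0 (2 * r) \<subseteq> S" using r \<rho>(2) by (force simp: subset_iff)
    then show "continuous_on (cball 0 (2 * r) - ball 0 r) p" by (intro continuous_on_subset [OF cp]) auto
    show "p z \<noteq> 0" if "z \<in> cball 0 (2 * r) - ball 0 r" for z
    proof -
      have "norm z \<le> 2 * r" "r \<le> norm z" using that by auto
      then have "norm z \<le> \<rho>" "z \<noteq> 0" using r by auto
      then show ?thesis by (rule nz)
    qed
  qed
  then obtain m where m: "0 < m" "\<And>z. norm z \<le> 2 * r \<Longrightarrow> r \<le> norm z \<Longrightarrow> m \<le> norm (p z)" by auto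
  \<comment> \<open>At distance between \<open>r\<close> and \<open>2 * r\<close> the gradient has
    norm at least \<open>m\<close>. Either the dropped vector accounts for half of it, or the
    component \<open>i0\<close> does, and then \<open>key\<close> applies.\<close>
  define \<kappa> where "\<kappa> = min (m / 2) (m / (2 * C1))"
  have \<kappa>: "0 < \<kappa>" using m C1 by (simp add: \<kappa>_def)
  have bound: "\<kappa> * norm x \<le> norm (drop_component i0 (p z))"
    if z: "norm z \<le> 2 * r" "r \<le> norm z" "z $ i0 = x" "norm x \<le> 1" for z x
  proof -
    have "m \<le> norm (p z $ i0) + norm (drop_component i0 (p z))"
      using m(2) [OF z(1,2)] norm_le_component_drop [of "p z" i0] by linarith
    then consider "m / 2 \<le> norm (drop_component i0 (p z))" | "m / 2 \<le> norm (p z $ i0)" by linarith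
    then show ?thesis
    proof cases
      case 1
      have "\<kappa> * norm x \<le> (m / 2) * 1" using z(4) m by (intro mult_mono) (auto simp: \<kappa>_def)
      with 1 show ?thesis by simp
    next
      case 2
      have "norm x * (m / 2) \<le> norm x * norm (p z $ i0)" using 2 by (intro mult_left_mono) auto
      also have "\<dots> \<le> C1 * norm (drop_component i0 (p z))"
        using key [of z] z r d(2) [of z] by auto
      finally have "m / (2 * C1) * norm x \<le> norm (drop_component i0 (p z))"
        using C1 by (simp add: field_simps)
      moreover have "\<kappa> * norm x \<le> m / (2 * C1) * norm x" by (intro mult_right_mono) (auto simp: \<kappa>_def)
      ultimately show ?thesis by linarith
    qed
  qed
  obtain e where e: "0 < e" "\<And>x. norm x < e \<Longrightarrow> norm (p (axis i0 x)) \<le> \<kappa> / 2 * norm x"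
    using flat [of "\<kappa> / 2"] \<kappa> by (auto simp: p_def)
  define x :: complex where "x = of_real (min (e / 2) (min (r / 2) 1))"
  have x: "x \<noteq> 0" "norm x < e" "norm x < r" "norm x \<le> 1" using e r by (auto simp: x_def)
  define v where "v = drop_component i0 (p (axis i0 x))"
  have v_lt: "norm v < \<kappa> * norm x"
  proof -
    have "norm v \<le> \<kappa> / 2 * norm x"
      using norm_drop_component_le [of i0 "p (axis i0 x)"] e(2) [OF x(2)] by (simp add: v_def)
    also have "\<dots> < \<kappa> * norm x" using \<kappa> x(1) by simp
    finally show ?thesis .
  qed
  \<comment> \<open>The slice \<open>z $ i0 = x\<close>, parametrised by the whole space so that the
    dimension does not change; the spare coordinate is filled by \<open>(w $ i0)^2 / 2\<close> in
    \<open>hx\<close>, whose critical point is \<open>0\<close>.\<close>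
  define L where "L w = axis i0 x + drop_component i0 w" for w :: "complex ^ 'n"
  have L_norm: "norm (L w) \<le> norm x + norm w" for w
    unfolding L_def using norm_triangle_ineq [of "axis i0 x" "drop_component i0 w"] norm_drop_component_le [of i0 w]
    by simp
  define M0 :: "complex ^ 'n ^ 'n" where "M0 = (\<chi> i. if i = i0 then 0 else axis i 1)"
  have M0: "M0 *v w = drop_component i0 w" for w
    by (simp add: vec_eq_iff matrix_vector_cdot M0_def cdot.zero_left cdot_commute [of "axis _ _"])
  have dL: "(L has_derivative (\<lambda>w. M0 *v w)) (at w)" for w
    unfolding L_def M0 [symmetric]
    by (rule has_derivative_eq_rhs [OF has_derivative_add [OF has_derivative_const
          bounded_linear_imp_has_derivative [OF matrix_vector_mul_bounded_linear]]]) simp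
  define T where "T = L -` S"
  have T: "open T"
    unfolding T_def using dL by (intro open_vimage S(1) continuous_at_imp_continuous_on ballI has_derivative_continuous) 
  define hx where "hx w = (w $ i0)\<^sup>2 / 2 + h (L w)" for w
  have dhx: "(hx has_derivative cdot (axis i0 (w $ i0) + drop_component i0 (p (L w)))) (at w)" if "w \<in> T" for w
  proof -
    have "((\<lambda>w. w $ i0) has_derivative (\<lambda>y. y $ i0)) (at w)"
      by (rule bounded_linear_imp_has_derivative [OF bounded_linear_vec_nth])
    from has_derivative_mult [OF this this]
    have 1: "((\<lambda>w. (w $ i0)\<^sup>2 / 2) has_derivative (\<lambda>y. w $ i0 * y $ i0)) (at w)"
      unfolding power2_eq_square
      by (rule has_derivative_eq_rhs [OF has_derivative_divide' [where g = "\<lambda>_. 2"]]) (auto simp: fun_eq_iff)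
    have "L w \<in> S" using that by (simp add: T_def)
    from gradient_compose [OF dL hol_has_derivative [OF S(2) this]]
    have 2: "((\<lambda>w. h (L w)) has_derivative cdot (transpose M0 *v p (L w))) (at w)" by (simp add: p_def)
    have 3: "transpose M0 *v p (L w) = drop_component i0 (p (L w))"
    proof -
      have "transpose M0 = M0" by (auto simp: vec_eq_iff transpose_def M0_def axis_def)
      then have "transpose M0 *v p (L w) = M0 *v p (L w)" by (rule arg_cong)
      then show ?thesis by (rule trans [OF _ M0])
    qed
    show ?thesis
      unfolding hx_def
      by (rule has_derivative_eq_rhs [OF has_derivative_add [OF 1 2]], unfold 3)
        (simp add: fun_eq_iff cdot.add_left cdot_commute [of "axis _ _"] mult.commute)
  qed
  then have holhx: "hol T hx" unfolding hol_def by blast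
  have ghx: "gradient hx w = axis i0 (w $ i0) + drop_component i0 (p (L w))" if "w \<in> T" for w
    using dhx [OF that] by (rule gradient_eqI)
  have sub: "cball 0 r \<subseteq> T"
  proof
    fix w :: "complex ^ 'n" assume "w \<in> cball 0 r"
    then have "norm (L w) \<le> 2 * r" using L_norm [of w] x(3) by simp
    then show "w \<in> T" using r \<rho>(2) by (auto simp: T_def)
  qed
  \<comment> \<open>Continuation from gradient \<open>v\<close> at \<open>w = 0\<close> to gradient
    \<open>0\<close>; with \<open>s = 1\<close> the rate is a plain Cauchy-Schwarz bound.\<close>
  have "\<exists>w. norm w < r \<and> gradient hx w = 0 + 0 *\<^sub>R v \<and>
     ((norm (legendre hx 0))\<^sup>2 + 1\<^sup>2) * exp (r * norm v * 0 - r * norm v * 1) \<le> (norm (legendre hx w))\<^sup>2 + 1\<^sup>2"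
  proof (rule legendre_growth [where b = "\<lambda>t. r * norm v * t" and b' = "\<lambda>_. r * norm v" and ?t1.0 = 1, OF T holhx sub r(1)])
    fix w :: "complex ^ 'n" and t :: real assume w: "norm w = r" and t: "t \<in> {0..1::real}"
    show "gradient hx w \<noteq> 0 + t *\<^sub>R v"
    proof
      assume *: "gradient hx w = 0 + t *\<^sub>R v"
      have wT: "w \<in> T" using sub w by auto
      have eq: "axis i0 (w $ i0) + drop_component i0 (p (L w)) = t *\<^sub>R v" using * ghx [OF wT] by simp
      from arg_cong [OF this, of "\<lambda>y. y $ i0"] have w0: "w $ i0 = 0"
        by (simp add: v_def axis_def)
      with eq have eq': "drop_component i0 (p (L w)) = t *\<^sub>R v" by simp
      have Lw: "L w = axis i0 x + w" using w0 by (simp add: L_def vec_eq_iff)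
      have "r \<le> norm (L w)"
        unfolding w [symmetric] Lw using w0 by (intro norm_le_componentwise) (auto simp: axis_def)
      moreover have "L w $ i0 = x" using w0 by (simp add: Lw axis_def)
      moreover have "norm (L w) \<le> 2 * r" using L_norm [of w] w x(3) by simp
      ultimately have "\<kappa> * norm x \<le> norm (t *\<^sub>R v)" using bound [of "L w" x] x(4) eq' by simp
      also have "\<dots> \<le> norm v" using t by (simp add: mult_left_le_one_le)
      finally show False using v_lt by simp
    qed
  next
    fix w :: "complex ^ 'n" and t :: real assume w: "norm w < r"
    have "2 * Re (cnj (legendre hx w) * cdot w v) \<le> 2 * norm (cnj (legendre hx w) * cdot w v)"
      by (rule mult_left_mono [OF complex_Re_le_cmod]) simp
    also have "\<dots> \<le> 2 * (norm (legendre hx w) * (norm w * norm v))"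
      using norm_cdot_le [of w v] by (simp add: norm_mult mult_left_mono)
    also have "\<dots> \<le> 2 * (norm (legendre hx w) * (r * norm v))"
      using w by (intro mult_left_mono mult_right_mono) auto
    also have "\<dots> = r * norm v * (2 * norm (legendre hx w) * 1)" by simp
    also have "\<dots> \<le> r * norm v * ((norm (legendre hx w))\<^sup>2 + 1\<^sup>2)"
      using r sum_squares_bound [of "norm (legendre hx w)" 1] by (intro mult_left_mono) auto
    finally show "2 * Re (cnj (legendre hx w) * cdot w v) \<le> r * norm v * ((norm (legendre hx w))\<^sup>2 + 1\<^sup>2)" .
  next
    have "0 \<in> T" using sub r by auto
    moreover have "L 0 = axis i0 x" by (simp add: L_def vec_eq_iff)
    ultimately show "gradient hx 0 = 0 + 1 *\<^sub>R v" using ghx [of 0] by (simp add: v_def)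
  next
    fix t :: real show "((\<lambda>t. r * norm v * t) has_real_derivative r * norm v) (at t)"
      by (auto intro!: derivative_eq_intros)
  qed (simp_all add: r(1))
  then obtain w where w: "norm w < r" "gradient hx w = 0" by auto
  have "w \<in> T" using sub w(1) by auto
  then have eq: "axis i0 (w $ i0) + drop_component i0 (p (L w)) = 0" using ghx w(2) by simp
  from arg_cong [OF this, of "\<lambda>y. y $ i0"] have w0: "w $ i0 = 0" by (simp add: axis_def)
  with eq have "drop_component i0 (p (L w)) = 0" by simp
  moreover have "norm (L w) < \<rho>" using L_norm [of w] w(1) x(3) r by simp
  ultimately have "L w $ i0 = 0" using polar [of "L w"] by (simp add: p_def)
  then show False using x(1) by (simp add: L_def axis_def)
qed

text \<open>Start at a polar point and let the gradient shrink along the ray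
  \<open>\<tau> *\<^sub>R axis i0 u\<close>. On the polar curve \<open>cdot w (axis i0 u)\<close> is
  the Legendre value divided by \<open>(1 - l) * t\<close>, so the rate is
  \<open>2 / ((1 - l) * t)\<close>, with primitive \<open>2 / (1 - l) * ln t\<close>.\<close>

lemma slow_gradient_points:
  shows "\<exists>C>0. \<forall>d>0. \<exists>z. 0 < norm z \<and> norm z < d \<and> norm (gradient h z) \<le> C * norm z powr ((1 - l) / l)"
proof -
  define p where "p = gradient h"
  have cp: "continuous_on S p" unfolding p_def by (rule continuous_on_gradient [OF S(1,2)])
  obtain R where R: "0 < R" "cball 0 R \<subseteq> S" using S open_contains_cball by blast
  have nz: "p z \<noteq> 0" if "norm z \<le> R" "z \<noteq> 0" for z
    using iso [of z] that R(2) by (auto simp: p_def)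
  have "\<exists>c>0. \<forall>z\<in>sphere 0 R. c \<le> norm (p z)"
  proof (rule compact_norm_bounded_below)
    show "continuous_on (sphere 0 R) p" by (rule continuous_on_subset [OF cp]) (use R(2) in auto)
    show "p z \<noteq> 0" if "z \<in> sphere 0 R" for z using nz [of z] that R(1) by auto
  qed simp
  then obtain c where c: "0 < c" "\<And>z. norm z = R \<Longrightarrow> c \<le> norm (p z)" by auto
  have "isCont p 0" using cp S by (simp add: continuous_on_eq_continuous_at)
  moreover have "p 0 = 0" using iso [of 0] S by (simp add: p_def)
  ultimately obtain d0 where d0: "0 < d0" "\<And>z. norm z < d0 \<Longrightarrow> norm (p z) < c"
    using c(1) unfolding continuous_at_eps_delta by (metis dist_0_norm dist_commute diff_zero dist_norm)
  define \<rho> where "\<rho> = min R d0"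
  have "cball 0 \<rho> \<subseteq> S" using R(2) by (force simp: \<rho>_def subset_iff)
  moreover have "0 < \<rho>" using R d0 by (simp add: \<rho>_def)
  ultimately obtain z1 where z1: "norm z1 < \<rho>" "drop_component i0 (p z1) = 0" "z1 $ i0 \<noteq> 0"
    using polar_point_exists [of \<rho>] unfolding p_def by blast
  define u where "u = p z1 $ i0"
  have pz1: "p z1 = axis i0 u" using axis_drop_component [of i0 "p z1"] z1(2) by (simp add: u_def)
  have "z1 \<noteq> 0" using z1(3) by auto
  then have u: "u \<noteq> 0" using nz [of z1] z1(1) pz1 by (auto simp: \<rho>_def)
  have u_lt: "norm u < c" using d0(2) [of z1] z1(1) pz1 by (simp add: \<rho>_def)
  have z1S: "z1 \<in> S" using z1(1) R(2) by (auto simp: \<rho>_def)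
  have polar_legendre: "legendre h z = of_real (1 - l) * z $ i0 * (of_real t * u)"
    if "z \<in> S" "gradient h z = t *\<^sub>R axis i0 u" for z t
  proof -
    have "drop_component i0 (gradient h z) = 0" unfolding that(2) by (simp add: vec_eq_iff axis_def)
    moreover have "gradient h z $ i0 = of_real t * u" unfolding that(2) vector_scaleR_component by (simp add: axis_def scaleR_conv_of_real [where 'a = complex])
    ultimately show ?thesis using legendre_euler [OF that(1)] by (simp add: cdot.zero_right)
  qed
  define k1 where "k1 = norm (legendre h z1)"
  have k1: "0 < k1"
    using polar_legendre [OF z1S, of 1] pz1 z1(3) u l by (simp add: k1_def p_def)
  define a where "a = k1 / (2 * (1 - l) * norm u)"
  have a: "0 < a" using k1 u l by (simp add: a_def)
  have transport: "\<exists>z. norm z < R \<and> p z = \<tau> *\<^sub>R axis i0 u \<and> a * \<tau> powr (l / (1 - l)) \<le> norm (z $ i0)"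
    if \<tau>: "0 < \<tau>" "\<tau> \<le> 1" for \<tau>
  proof -
    define E where "E = exp (2 / (1 - l) * ln \<tau> - 2 / (1 - l) * ln 1)"
    have E: "0 < E" "E = (\<tau> powr (1 / (1 - l)))\<^sup>2"
      using \<tau> l by (simp_all add: E_def powr_def exp_double [symmetric])
    \<comment> \<open>Small enough that subtracting \<open>s^2\<close> from the growth estimate
      still leaves a fixed fraction of \<open>k1^2 * E\<close>.\<close>
    define s where "s = k1 * sqrt (E / 2)"
    have s: "0 < s" "s\<^sup>2 = k1\<^sup>2 * E / 2" using k1 E(1) by (simp_all add: s_def power_mult_distrib)
    have "2 * ln \<tau> / (1 - l) \<le> 0" using \<tau> l by (intro divide_nonpos_pos) auto
    then have E1: "E \<le> 1" by (simp add: E_def)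
    have "\<exists>z. norm z < R \<and> gradient h z = 0 + \<tau> *\<^sub>R axis i0 u \<and>
       ((norm (legendre h z1))\<^sup>2 + s\<^sup>2) * exp (2 / (1 - l) * ln \<tau> - 2 / (1 - l) * ln 1) \<le> (norm (legendre h z))\<^sup>2 + s\<^sup>2"
    proof (rule legendre_growth [where b = "\<lambda>t. 2 / (1 - l) * ln t" and b' = "\<lambda>t. 2 / (1 - l) * (1 / t)" and ?t1.0 = 1, OF S(1,2) R(2,1) \<tau>(2) s(1)])
      fix w :: "complex ^ 'n" and t :: real assume w: "norm w = R" and t: "t \<in> {\<tau>..1}"
      have "norm (0 + t *\<^sub>R axis i0 u :: complex ^ 'n) \<le> norm u" using t \<tau> by (simp add: mult_left_le_one_le)
      then show "gradient h w \<noteq> 0 + t *\<^sub>R axis i0 u" using c(2) [OF w] u_lt by (auto simp: p_def)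
    next
      fix t :: real assume "t \<in> {\<tau>..1}"
      then have "0 < t" using \<tau> by auto
      then show "((\<lambda>t. 2 / (1 - l) * ln t) has_real_derivative 2 / (1 - l) * (1 / t)) (at t)"
        by (intro DERIV_cmult) (auto intro!: derivative_eq_intros simp: inverse_eq_divide)
    next
      show "continuous_on {\<tau>..1} (\<lambda>t. 2 / (1 - l) * (1 / t))"
        using \<tau> by (intro continuous_intros) auto
    next
      fix w :: "complex ^ 'n" and t :: real assume w: "norm w < R" and t: "t \<in> {\<tau>..1}" and g: "gradient h w = 0 + t *\<^sub>R axis i0 u"
      have t0: "0 < t" using t \<tau> by auto
      have wS: "w \<in> S" using w R(2) by auto
      have k: "legendre h w = of_real (1 - l) * w $ i0 * (of_real t * u)" using polar_legendre [OF wS] g by simp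
      have "cdot w (axis i0 u) = legendre h w / of_real ((1 - l) * t)"
        unfolding k using l t0 by simp
      then have "cnj (legendre h w) * cdot w (axis i0 u) = of_real ((norm (legendre h w))\<^sup>2 / ((1 - l) * t))"
        using complex_norm_square [of "legendre h w"] by (simp add: mult.commute)
      then have "2 * Re (cnj (legendre h w) * cdot w (axis i0 u)) = 2 / (1 - l) * (1 / t) * (norm (legendre h w))\<^sup>2"
        by (simp only: Re_complex_of_real) simp
      also have "\<dots> \<le> 2 / (1 - l) * (1 / t) * ((norm (legendre h w))\<^sup>2 + s\<^sup>2)"
        using l t0 by (intro mult_left_mono) auto
      finally show "2 * Re (cnj (legendre h w) * cdot w (axis i0 u)) \<le> 2 / (1 - l) * (1 / t) * ((norm (legendre h w))\<^sup>2 + s\<^sup>2)" .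
    next
      show "norm z1 < R" using z1(1) by (simp add: \<rho>_def)
      show "gradient h z1 = 0 + 1 *\<^sub>R axis i0 u" using pz1 by (simp add: p_def)
    qed
    then obtain z where z: "norm z < R" "gradient h z = \<tau> *\<^sub>R axis i0 u" "(k1\<^sup>2 + s\<^sup>2) * E \<le> (norm (legendre h z))\<^sup>2 + s\<^sup>2"
      by (auto simp: k1_def E_def)
    have zS: "z \<in> S" using z(1) R(2) by auto
    have "k1\<^sup>2 * E \<le> (k1\<^sup>2 + s\<^sup>2) * E" using E(1) by (intro mult_right_mono) auto
    then have "k1\<^sup>2 * E / 4 \<le> (norm (legendre h z))\<^sup>2"
      using z(3) s(2) zero_le_power2 [of "norm (legendre h z)"] by linarith
    then have "(k1 * \<tau> powr (1 / (1 - l)) / 2)\<^sup>2 \<le> (norm (legendre h z))\<^sup>2"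
      unfolding E(2) by (simp add: power_mult_distrib power_divide)
    then have "k1 * \<tau> powr (1 / (1 - l)) / 2 \<le> norm (legendre h z)"
      by (rule power2_le_imp_le) simp
    also have "norm (legendre h z) = (1 - l) * norm (z $ i0) * (\<tau> * norm u)"
      unfolding polar_legendre [OF zS z(2)] norm_mult norm_of_real using l \<tau> by simp
    finally have "k1 * (\<tau> powr (1 / (1 - l))) / 2 \<le> (1 - l) * norm (z $ i0) * (\<tau> * norm u)" .
    \<comment> \<open>Dividing the bound for the Legendre value by the size \<open>\<tau>\<close> of
      the gradient leaves the exponent \<open>l / (1 - l)\<close> for the coordinate.\<close>
    moreover have "\<tau> powr (1 / (1 - l)) = \<tau> powr (l / (1 - l)) * \<tau>"
    proof -
      have "1 / (1 - l) = l / (1 - l) + 1" using l by (simp add: field_simps)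
      then show ?thesis using \<tau> by (simp only: powr_add) simp
    qed
    ultimately have "(k1 * \<tau> powr (l / (1 - l))) * \<tau> \<le> (2 * (1 - l) * norm u * norm (z $ i0)) * \<tau>"
      by (simp add: algebra_simps)
    then have "k1 * \<tau> powr (l / (1 - l)) \<le> 2 * (1 - l) * norm u * norm (z $ i0)"
      using \<tau>(1) by (rule mult_right_le_imp_le)
    then have "a * \<tau> powr (l / (1 - l)) \<le> norm (z $ i0)"
      using l u by (simp add: a_def field_simps)
    with z show ?thesis by (auto simp: p_def)
  qed
  define C where "C = norm u * (1 / a) powr ((1 - l) / l)"
  have C: "0 < C" using u a by (simp add: C_def)
  show ?thesis
  proof (intro exI [of _ C] conjI allI impI C)
    fix d :: real assume d: "0 < d"
    \<comment> \<open>Away from the origin the gradient is bounded below, so a small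
      \<open>\<tau>\<close> forces the transported point into the ball of radius
      \<open>d\<close>.\<close>
    have "\<exists>e>0. \<forall>z\<in>cball 0 R - ball 0 d. e \<le> norm (p z)"
    proof (rule compact_norm_bounded_below)
      show "compact (cball 0 R - ball 0 d :: (complex ^ 'n) set)" by (intro compact_diff) auto
      show "continuous_on (cball 0 R - ball 0 d) p" using R by (intro continuous_on_subset [OF cp]) auto
      show "p z \<noteq> 0" if "z \<in> cball 0 R - ball 0 d" for z
      proof -
        have "norm z \<le> R" "d \<le> norm z" using that by auto
        then have "norm z \<le> R" "z \<noteq> 0" using d by auto
        then show ?thesis by (rule nz)
      qed
    qed
    then obtain e where e: "0 < e" "\<And>z. norm z \<le> R \<Longrightarrow> d \<le> norm z \<Longrightarrow> e \<le> norm (p z)" by auto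
    define \<tau> where "\<tau> = min 1 (e / (2 * norm u))"
    have \<tau>: "0 < \<tau>" "\<tau> \<le> 1" "\<tau> * norm u < e"
    proof -
      show "0 < \<tau>" "\<tau> \<le> 1" using e u by (auto simp: \<tau>_def)
      have "\<tau> * norm u \<le> e / (2 * norm u) * norm u" by (intro mult_right_mono) (auto simp: \<tau>_def)
      then show "\<tau> * norm u < e" using e u by simp
    qed
    obtain z where z: "norm z < R" "p z = \<tau> *\<^sub>R axis i0 u" "a * \<tau> powr (l / (1 - l)) \<le> norm (z $ i0)"
      using transport [OF \<tau>(1,2)] by blast
    have pz: "norm (p z) = \<tau> * norm u" using z(2) \<tau> by simp
    have "norm z < d"
    proof (rule ccontr)
      assume "\<not> norm z < d"
      then have "e \<le> norm (p z)" using e(2) [of z] z(1) by auto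
      then show False using pz \<tau>(3) by simp
    qed
    moreover have ze: "a * \<tau> powr (l / (1 - l)) \<le> norm z"
      using z(3) Finite_Cartesian_Product.norm_nth_le [of z i0] by linarith
    moreover have "0 < a * \<tau> powr (l / (1 - l))" using a \<tau>(1) by simp
    then have "0 < norm z" using ze by linarith
    moreover have "norm (gradient h z) \<le> C * norm z powr ((1 - l) / l)"
    proof -
      have "\<tau> powr (l / (1 - l)) \<le> (1 / a) * norm z" using ze a by (simp add: field_simps)
      then have "(\<tau> powr (l / (1 - l))) powr ((1 - l) / l) \<le> ((1 / a) * norm z) powr ((1 - l) / l)"
        using l by (intro powr_mono2) auto
      moreover have "(\<tau> powr (l / (1 - l))) powr ((1 - l) / l) = \<tau>"
        using l \<tau>(1) by (simp add: powr_powr)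
      moreover have "((1 / a) * norm z) powr ((1 - l) / l) = (1 / a) powr ((1 - l) / l) * norm z powr ((1 - l) / l)"
        by (rule powr_mult)
      ultimately have "\<tau> * norm u \<le> ((1 / a) powr ((1 - l) / l) * norm z powr ((1 - l) / l)) * norm u"
        by (intro mult_right_mono) auto
      then show ?thesis using pz by (simp add: C_def p_def mult_ac)
    qed
    ultimately show "\<exists>z. 0 < norm z \<and> norm z < d \<and> norm (gradient h z) \<le> C * norm z powr ((1 - l) / l)" by blast
  qed
qed

end

section \<open>Linear algebra\<close>

lemma minus_matrix_vector: "(- M) *v x = - (M *v (x :: complex ^ 'n))"
  by (simp add: vec_eq_iff matrix_vector_mult_def sum_negf)

lemma matrix_vector_axis: "(M *v axis j 1) $ i = M $ i $ j" for M :: "complex ^ 'n ^ 'm"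
  using cdot_axis [of "M $ i" j 1] by (simp add: matrix_vector_cdot)

lemma transpose_diff: "transpose (A - B) = transpose A - transpose B" for A B :: "complex ^ 'n ^ 'm"
  by (simp add: vec_eq_iff transpose_def)

lemma count_image_reflect: "count (image_mset (\<lambda>x. 1 - x) X) y = count X (1 - y)" for y :: "'a::ring_1"
  by (induction X) (auto simp: algebra_simps)

lemmas matrix_action_simps = minus_matrix_vector matrix_vector_mul_assoc [symmetric] matrix_vector_mult_add_rdistrib
  matrix_vector_mult_diff_rdistrib matrix_vector_right_distrib matrix_vector_mult_diff_distrib
  vector_scalar_commute

lemma poly_det_exists:
  fixes M0 M1 :: "complex ^ 'n ^ 'n"
  shows "\<exists>q. \<forall>x. poly q x = det (M0 + mat x ** M1)"
proof (intro exI allI)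
  fix x
  have "(mat x ** M1) $ i $ j = x * M1 $ i $ j" for i j
  proof -
    have "(if i = k then x else 0) * M1 $ k $ j = (if i = k then x * M1 $ k $ j else 0)" for k by simp
    then show ?thesis by (simp add: matrix_matrix_mult_def mat_def)
  qed
  then have "poly ((\<chi> i j. [:M0 $ i $ j, M1 $ i $ j:]) $ i $ j) x = (M0 + mat x ** M1) $ i $ j" for i j
    by simp
  then show "poly (det (\<chi> i j. [:M0 $ i $ j, M1 $ i $ j:])) x = det (M0 + mat x ** M1)"
    unfolding det_def by (simp add: poly_sum poly_prod)
qed

section \<open>Triangularisation with small off-diagonal entries\<close>

lemma kernel_exists: "det (A :: complex ^ 'n ^ 'n) = 0 \<Longrightarrow> \<exists>x. x \<noteq> 0 \<and> A *v x = 0"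
  using det_nonzero_iff_kernel [of A] by blast

text \<open>The range of \<open>P\<close> stands for the quotient by \<open>V\<close>, so that
  quotient maps can be handled as matrices of the same size.\<close>

lemma projection_with_kernel:
  fixes V :: "(complex ^ 'n) set"
  assumes V: "vec.subspace V"
  shows "\<exists>P :: complex ^ 'n ^ 'n. \<forall>x. (P *v x = 0 \<longleftrightarrow> x \<in> V) \<and> P *v (P *v x) = P *v x"
proof -
  obtain b where b: "b \<subseteq> V" "vec.independent b" "vec.span b = V"
    using vec.basis_subspace_exists [OF V] by metis
  define c where "c = vec.extend_basis b"
  have c: "b \<subseteq> c" "vec.independent c" "vec.span c = UNIV"
    using vec.extend_basis_superset [OF b(2)] vec.independent_extend_basis [OF b(2)]
      vec.span_extend_basis [OF b(2)] by (auto simp: c_def)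
  obtain g where g: "Vector_Spaces.linear (*s) (*s) g" "\<forall>x\<in>c. g x = (if x \<in> b then 0 else x)"
    using vec.linear_independent_extend [OF c(2), of "\<lambda>x. if x \<in> b then 0 else x"] by blast
  define P where "P = matrix g"
  have P: "P *v x = g x" for x
    using matrix_works [OF g(1)] by (simp add: P_def)
  have 0: "P *v x = 0" if "x \<in> V" for x
  proof -
    have "x \<in> vec.span b" using that b(3) by simp
    then show ?thesis
    proof (induction rule: vec.span_induct_alt)
      case (step d x y)
      have "P *v x = 0" using step(1) g(2) c(1) P by auto
      then show ?case using step by (simp add: matrix_action_simps)
    qed simp
  qed
  have 1: "P *v x - x \<in> V" for x
  proof -
    have "x \<in> vec.span c" using c(3) by simp
    then show ?thesis
    proof (induction rule: vec.span_induct_alt)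
      case base
      show ?case using vec.subspace_0 [OF V] by simp
    next
      case (step d x y)
      have "P *v x - x \<in> V"
        using step(1) g(2) b(1) P vec.subspace_0 [OF V] vec.subspace_neg [OF V, of x] by auto
      from vec.subspace_add [OF V vec.subspace_scale [OF V this, of d] step(2)]
      show ?case by (simp add: matrix_action_simps algebra_simps vec.scale_right_diff_distrib)
    qed
  qed
  have "P *v x = 0 \<longleftrightarrow> x \<in> V" for x
    using 0 [of x] 1 [of x] vec.subspace_neg [OF V, of "- x"] by auto
  moreover have "P *v (P *v x) = P *v x" for x
    using 0 [OF 1 [of x]] by (simp add: matrix_action_simps)
  ultimately show ?thesis by blast
qed

text \<open>The map induced on the quotient is \<open>P ** A ** P\<close> on the range of
  \<open>P\<close>, and \<open>det (M0 + mat x ** P)\<close> is its characteristic polynomial, the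
  kernel of \<open>P\<close> contributing a factor \<open>1\<close>. If it had no root, it would be
  constant, and substituting \<open>x = 1 / y\<close> and clearing denominators would give
  \<open>D y = poly q 0 * E y\<close> for \<open>y \<noteq> 0\<close>. As \<open>y\<close> tends to
  \<open>0\<close>, the left side tends to \<open>1\<close>, but \<open>E y\<close> to
  \<open>det (mat 1 - P) = 0\<close>.\<close>

lemma quotient_eigenvector:
  fixes A :: "complex ^ 'n ^ 'n"
  assumes V: "vec.subspace V" "V \<noteq> UNIV" and inv: "\<And>v. v \<in> V \<Longrightarrow> A *v v \<in> V"
  shows "\<exists>v \<alpha>. v \<notin> V \<and> A *v v - \<alpha> *s v \<in> V"
proof -
  obtain P :: "complex ^ 'n ^ 'n" where P: "\<And>x. P *v x = 0 \<longleftrightarrow> x \<in> V" "\<And>x. P *v (P *v x) = P *v x"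
    using projection_with_kernel [OF V(1)] by metis
  define M0 where "M0 = mat 1 - P - P ** A ** P"
  obtain q where q: "\<And>x. poly q x = det (M0 + mat x ** P)"
    using poly_det_exists [of M0 P] by blast
  have "\<exists>x. poly q x = 0"
  proof (rule ccontr)
    assume no: "\<nexists>x. poly q x = 0"
    then have "constant (poly q)" using Fundamental_Theorem_Algebra.fundamental_theorem_of_algebra [of q] by auto
    then have qc: "poly q x = poly q 0" for x by (auto simp: constant_def)
    define D where "D y = det (mat 1 - mat y ** (P ** A ** P))" for y
    define E where "E y = det (mat 1 - P + mat y ** P)" for y
    have DE: "D y = poly q 0 * E y" if "y \<noteq> 0" for y
    proof -
      have "(M0 + mat (1 / y) ** P) ** (mat 1 - P + mat y ** P) = mat 1 - mat y ** (P ** A ** P)"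
        unfolding matrix_eq M0_def using that by (simp add: matrix_action_simps P(2) algebra_simps vec.scale_right_diff_distrib)
      from arg_cong [OF this, of det] show ?thesis
        using q [of "1 / y"] qc [of "1 / y"] by (simp add: det_mul D_def E_def)
    qed
    have cont: "((\<lambda>y. det (M + mat y ** N)) \<longlongrightarrow> det M) (at 0)" for M N :: "complex ^ 'n ^ 'n"
    proof -
      obtain r where r: "\<And>y. poly r y = det (M + mat y ** N)" using poly_det_exists [of M N] by blast
      have "(poly r \<longlongrightarrow> poly r 0) (at 0)"
        using poly_isCont [where p = r and x = 0] by (simp add: isCont_def)
      moreover have "poly r 0 = det M"
      proof -
        have "M + mat 0 ** N = M" unfolding matrix_eq by (simp add: matrix_action_simps)
        then show ?thesis using r [of 0] by simp
      qed
      moreover have "poly r = (\<lambda>y. det (M + mat y ** N))" using r by auto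
      ultimately show ?thesis by simp
    qed
    have "(D \<longlongrightarrow> 1) (at 0)"
    proof -
      have "D = (\<lambda>y. det (mat 1 + mat y ** (- (P ** A ** P))))"
        unfolding D_def fun_eq_iff by (intro allI arg_cong [where f = det]) (simp add: matrix_eq matrix_action_simps)
      then show ?thesis using cont [of "mat 1" "- (P ** A ** P)"] by simp
    qed
    moreover have "\<forall>\<^sub>F y in at 0. poly q 0 * det (mat 1 - P + mat y ** P) = D y"
      using DE by (simp add: eventually_at_filter E_def)
    from Lim_transform_eventually [OF tendsto_mult [OF tendsto_const cont [of "mat 1 - P" P]] this]
    have "(D \<longlongrightarrow> poly q 0 * det (mat 1 - P)) (at 0)" .
    moreover have "det (mat 1 - P) = 0"
    proof -
      obtain x where "x \<notin> V" using V(2) by blast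
      then have "P *v x \<noteq> 0" using P(1) by simp
      moreover have "(mat 1 - P) *v (P *v x) = 0" by (simp add: matrix_action_simps P(2))
      ultimately show ?thesis using det_nonzero_iff_kernel [of "mat 1 - P"] by blast
    qed
    ultimately show False using LIM_unique [of D 1 0 "poly q 0 * det (mat 1 - P)"] by simp
  qed
  then obtain \<alpha> where "det (M0 + mat \<alpha> ** P) = 0" using q by auto
  then obtain v where v: "v \<noteq> 0" "(M0 + mat \<alpha> ** P) *v v = 0" using kernel_exists by blast
  have e: "v - P *v v - P *v (A *v (P *v v)) + \<alpha> *s (P *v v) = 0"
    using v(2) by (simp add: M0_def matrix_action_simps)
  \<comment> \<open>Applying \<open>P\<close> separates the blocks: the range part is an eigenvector
    equation, and what remains says that \<open>v\<close> lies in the range of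
    \<open>P\<close>.\<close>
  have "P *v (v - P *v v - P *v (A *v (P *v v)) + \<alpha> *s (P *v v)) = 0" unfolding e by simp
  then have e2: "\<alpha> *s (P *v v) = P *v (A *v (P *v v))" by (simp add: matrix_action_simps P(2))
  with e have vP: "P *v v = v" by simp
  then have "P *v (A *v v - \<alpha> *s v) = P *v (A *v v) - \<alpha> *s v" by (simp add: matrix_action_simps)
  also have "\<dots> = 0" using e2 vP by simp
  finally have "P *v (A *v v - \<alpha> *s v) = 0" .
  moreover have "v \<notin> V" using P(1) [of v] vP v(1) by auto
  ultimately show ?thesis using P(1) by blast
qed

text \<open>Otherwise \<open>A - mat \<alpha>\<close> is injective and, by dimension, maps
  \<open>V\<close> onto \<open>V\<close>; then the image of \<open>v\<close> is also the image of an
  element of \<open>V\<close>.\<close>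

lemma quotient_eigenvalue_is_eigenvalue:
  fixes A :: "complex ^ 'n ^ 'n"
  assumes V: "vec.subspace V" and inv: "\<And>v. v \<in> V \<Longrightarrow> A *v v \<in> V"
    and v: "v \<notin> V" "A *v v - \<alpha> *s v \<in> V"
  shows "\<exists>w. w \<noteq> 0 \<and> A *v w = \<alpha> *s w"
proof (rule ccontr)
  assume no: "\<not> ?thesis"
  define X where "X = A - mat \<alpha>"
  have X: "X *v w = A *v w - \<alpha> *s w" for w by (simp add: X_def matrix_action_simps)
  have inj: "X *v w = 0 \<Longrightarrow> w = 0" for w using no X by auto
  have linj: "inj ((*v) X)"
  proof (rule injI)
    fix x y assume "X *v x = X *v y"
    then have "X *v (x - y) = 0" by (simp add: matrix_action_simps)
    from inj [OF this] show "x = y" by simp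
  qed
  have XV: "(*v) X ` V \<subseteq> V"
    using inv X vec.subspace_diff [OF V] vec.subspace_scale [OF V] by auto
  have "(*v) X ` V = V"
  proof (rule vec.subspace_dim_equal)
    show "vec.subspace ((*v) X ` V)" by (rule vec.linear_subspace_image) (use V in auto)
    have "vec.dim ((*v) X ` V) = vec.dim V"
      by (rule vec.dim_image_eq) (use linj in \<open>auto intro: inj_on_subset\<close>)
    then show "vec.dim V \<le> vec.dim ((*v) X ` V)" by simp
  qed (use V XV in auto)
  then obtain v' where "v' \<in> V" "X *v v = X *v v'" using v(2) X by (metis (no_types, lifting) image_iff)
  then show False using v(1) linj by (auto simp: inj_def)
qed

text \<open>Triangularisation by induction: each new vector is an eigenvector modulo the span
  \<open>V\<close> of the previous ones. Multiplying it by a small number scales its remainder in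
  \<open>V\<close>, so the off-diagonal entries become arbitrarily small without Jordan normal form.
  The diagonal entries are recorded as eigenvalues of \<open>A\<close> itself.\<close>

lemma near_diagonal_family:
  fixes A :: "complex ^ 'n ^ 'n" and I :: "'n set" and \<epsilon> :: real
  assumes \<epsilon>: "0 < \<epsilon>" and "finite I"
  shows "\<exists>b \<alpha>. vec.independent (b ` I) \<and> inj_on b I \<and>
     (\<forall>i\<in>I. (\<exists>w. w \<noteq> 0 \<and> A *v w = \<alpha> i *s w) \<and>
        (\<exists>c. A *v b i = \<alpha> i *s b i + (\<Sum>j\<in>I. c j *s b j) \<and> (\<forall>j. norm (c j) \<le> \<epsilon>)))"
  using \<open>finite I\<close>
proof (induction I rule: finite_induct)
  case empty
  show ?case by (simp add: vec.independent_empty)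
next
  case (insert i I)
  then obtain b \<alpha> where b: "vec.independent (b ` I)" "inj_on b I"
    and ev: "\<And>i. i \<in> I \<Longrightarrow> \<exists>w. w \<noteq> 0 \<and> A *v w = \<alpha> i *s w"
    and c: "\<And>i. i \<in> I \<Longrightarrow> \<exists>c. A *v b i = \<alpha> i *s b i + (\<Sum>j\<in>I. c j *s b j) \<and> (\<forall>j. norm (c j) \<le> \<epsilon>)"
    by blast
  define V where "V = vec.span (b ` I)"
  have V: "vec.subspace V" by (simp add: V_def)
  have bV: "b j \<in> V" if "j \<in> I" for j using that by (auto simp: V_def intro: vec.span_base)
  have sumV: "(\<Sum>j\<in>I. c j *s b j) \<in> V" for c
    by (rule vec.subspace_sum [OF V]) (rule vec.subspace_scale [OF V bV])
  have inv: "A *v v \<in> V" if "v \<in> V" for v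
    using that unfolding V_def
  proof (induction rule: vec.span_induct_alt)
    case base
    show ?case using vec.subspace_0 [OF V] by (simp add: V_def)
  next
    case (step d x y)
    then obtain k where k: "k \<in> I" "x = b k" by blast
    obtain c where "A *v b k = \<alpha> k *s b k + (\<Sum>j\<in>I. c j *s b j)" using c [OF k(1)] by blast
    then have "A *v x \<in> V" using vec.subspace_add [OF V vec.subspace_scale [OF V bV [OF k(1)]] sumV] k(2) by simp
    from vec.subspace_add [OF V vec.subspace_scale [OF V this, of d]] step(2)
    show ?case by (simp add: matrix_action_simps V_def)
  qed
  have "V \<noteq> UNIV"
  proof
    assume "V = UNIV"
    then have "CARD('n) = vec.dim V" by (simp add: vec.dim_UNIV card_cart_basis)
    also have "\<dots> = card (b ` I)" unfolding V_def by (simp add: vec.dim_span vec.dim_eq_card_independent [OF b(1)])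
    also have "\<dots> = card I" by (rule card_image [OF b(2)])
    also have "\<dots> < CARD('n)" using insert(2) by (intro psubset_card_mono) auto
    finally show False by simp
  qed
  from quotient_eigenvector [OF V this inv]
  obtain v \<beta> where v: "v \<notin> V" "A *v v - \<beta> *s v \<in> V" by blast
  from v(2) obtain d where d: "A *v v - \<beta> *s v = (\<Sum>j\<in>I. d j *s b j)"
  proof -
    have "A *v v - \<beta> *s v \<in> range (\<lambda>u. \<Sum>v\<in>b ` I. u v *s v)"
      using v(2) vec.span_finite [of "b ` I"] insert(1) by (simp add: V_def)
    then obtain u where "A *v v - \<beta> *s v = (\<Sum>v\<in>b ` I. u v *s v)" by blast
    then have "A *v v - \<beta> *s v = (\<Sum>j\<in>I. u (b j) *s b j)" by (simp add: sum.reindex [OF b(2)])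
    then show ?thesis by (rule that)
  qed
  \<comment> \<open>The added \<open>1\<close> covers the case that all \<open>d j\<close>
    vanish.\<close>
  define \<delta> where "\<delta> = \<epsilon> / (1 + (\<Sum>j\<in>I. norm (d j)))"
  have sum0: "0 \<le> (\<Sum>j\<in>I. norm (d j))" by (simp add: sum_nonneg)
  have \<delta>: "0 < \<delta>" using \<epsilon> sum0 by (simp add: \<delta>_def)
  define w where "w = of_real \<delta> *s v"
  have wV: "w \<notin> V"
  proof
    assume "w \<in> V"
    from vec.subspace_scale [OF V this, of "1 / of_real \<delta>"] \<delta> have "v \<in> V" by (simp add: w_def)
    with v(1) show False by simp
  qed
  define b' where "b' = b(i := w)"
  define \<alpha>' where "\<alpha>' = \<alpha>(i := \<beta>)"
  have b'I: "b' j = b j" "\<alpha>' j = \<alpha> j" if "j \<in> I" for j using that insert(2) by (auto simp: b'_def \<alpha>'_def)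
  have b'i: "b' i = w" "\<alpha>' i = \<beta>" by (simp_all add: b'_def \<alpha>'_def)
  have img: "b' ` insert i I = insert w (b ` I)" using b'I b'i by auto
  have sum': "(\<Sum>j\<in>insert i I. (if j = i then 0 else c j) *s b' j) = (\<Sum>j\<in>I. c j *s b j)" for c :: "'n \<Rightarrow> complex"
    using insert(1,2) b'I by (auto intro!: sum.cong)
  show ?case
  proof (rule exI [of _ b'], rule exI [of _ \<alpha>'], intro conjI ballI)
    show "vec.independent (b' ` insert i I)"
      unfolding img by (rule vec.independent_insertI [OF _ b(1)]) (use wV in \<open>simp add: V_def\<close>)
    have "w \<noteq> b j" if "j \<in> I" for j using wV bV [OF that] by auto
    then have "w \<notin> b' ` I" using b'I by auto
    moreover have "inj_on b' I" using b(2) b'I by (simp add: inj_on_def)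
    ultimately show "inj_on b' (insert i I)" using b'i insert(2) by (simp add: inj_on_insert)
  next
    fix k assume k: "k \<in> insert i I"
    show "\<exists>w. w \<noteq> 0 \<and> A *v w = \<alpha>' k *s w"
    proof (cases "k = i")
      case True
      then show ?thesis using quotient_eigenvalue_is_eigenvalue [OF V inv v] b'i by simp
    next
      case False
      with k show ?thesis using ev [of k] b'I by simp
    qed
    show "\<exists>c. A *v b' k = \<alpha>' k *s b' k + (\<Sum>j\<in>insert i I. c j *s b' j) \<and> (\<forall>j. norm (c j) \<le> \<epsilon>)"
    proof (cases "k = i")
      case True
      have "A *v w = \<beta> *s w + of_real \<delta> *s (A *v v - \<beta> *s v)"
        by (simp add: w_def matrix_action_simps vec.scale_right_diff_distrib mult.commute)
      also have "\<dots> = \<beta> *s w + (\<Sum>j\<in>I. (of_real \<delta> * d j) *s b j)"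
        unfolding d by (simp add: vec.scale_sum_right)
      finally have 1: "A *v w = \<beta> *s w + (\<Sum>j\<in>I. (if j \<in> I then of_real \<delta> * d j else 0) *s b j)" by simp
      have 2: "norm (if j \<in> I then of_real \<delta> * d j else 0) \<le> \<epsilon>" for j
      proof (cases "j \<in> I")
        case True
        have "norm (d j) \<le> (\<Sum>j\<in>I. norm (d j))" by (rule member_le_sum [OF True]) (use insert(1) in auto)
        then have "\<delta> * norm (d j) \<le> \<delta> * (1 + (\<Sum>j\<in>I. norm (d j)))" using \<delta> by (intro mult_left_mono) auto
        also have "\<dots> = \<epsilon>" using sum0 by (simp add: \<delta>_def)
        finally show ?thesis using True \<delta> by (simp add: norm_mult)
      qed (use \<epsilon> in simp)
      show ?thesis
        unfolding True b'i
        by (rule exI [of _ "\<lambda>j. if j = i then 0 else if j \<in> I then of_real \<delta> * d j else 0"])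
          (use 1 2 \<epsilon> in \<open>simp add: sum'\<close>)
    next
      case False
      then have kI: "k \<in> I" using k by simp
      then obtain c where c: "A *v b k = \<alpha> k *s b k + (\<Sum>j\<in>I. c j *s b j)" "\<And>j. norm (c j) \<le> \<epsilon>"
        using c by blast
      show ?thesis
        unfolding b'I [OF kI]
        by (rule exI [of _ "\<lambda>j. if j = i then 0 else c j"]) (use c \<epsilon> in \<open>simp add: sum'\<close>)
    qed
  qed
qed

lemma near_diagonal_form:
  fixes A :: "complex ^ 'n ^ 'n" and \<epsilon> :: real
  assumes "0 < \<epsilon>"
  shows "\<exists>(T :: complex ^ 'n ^ 'n) T' \<alpha>. T ** T' = mat 1 \<and> T' ** T = mat 1 \<and> (\<forall>i. \<exists>w. w \<noteq> 0 \<and> A *v w = \<alpha> i *s w) \<and>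
     (\<forall>i j. norm ((T' ** A ** T) $ i $ j - (if i = j then \<alpha> i else 0)) \<le> \<epsilon>)"
proof -
  obtain b :: "'n \<Rightarrow> complex ^ 'n" and \<alpha> where b: "vec.independent (range b)" "inj b" and ev: "\<And>i. \<exists>w. w \<noteq> 0 \<and> A *v w = \<alpha> i *s w"
    and c: "\<And>i. \<exists>c. A *v b i = \<alpha> i *s b i + (\<Sum>j\<in>UNIV. c j *s b j) \<and> (\<forall>j. norm (c j) \<le> \<epsilon>)"
    using near_diagonal_family [OF assms, of "UNIV :: 'n set" A] by auto
  define T :: "complex ^ 'n ^ 'n" where "T = (\<chi> i j. b j $ i)"
  have T: "T *v x = (\<Sum>j\<in>UNIV. x $ j *s b j)" for x
    by (simp add: vec_eq_iff T_def matrix_vector_mult_def mult.commute)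
  have "det T \<noteq> 0"
    unfolding det_nonzero_iff_kernel
  proof (intro allI impI)
    fix x assume "T *v x = 0"
    then have "(\<Sum>v\<in>range b. x $ (inv b v) *s v) = 0" by (simp add: T sum.reindex [OF b(2)] b(2))
    then have "x $ (inv b (b j)) = 0" for j
      using vec.independentD [OF b(1) _ order_refl, of "\<lambda>v. x $ inv b v" "b j"] by simp
    then show "x = 0" using b(2) by (simp add: vec_eq_iff)
  qed
  then obtain T' where T': "T ** T' = mat 1" "T' ** T = mat 1"
    using invertible_det_nz [of T] by (auto simp: invertible_def)
  have Te: "T *v axis i 1 = b i" for i
    unfolding vec_eq_iff matrix_vector_axis by (simp add: T_def)
  have near: "norm ((T' ** A ** T) $ i $ j - (if i = j then \<alpha> i else 0)) \<le> \<epsilon>" for i j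
  proof -
    obtain c where c: "A *v b j = \<alpha> j *s b j + (\<Sum>k\<in>UNIV. c k *s b k)" "\<And>k. norm (c k) \<le> \<epsilon>"
      using c by blast
    have "A *v b j = T *v (\<alpha> j *s axis j 1 + (\<chi> k. c k))"
      unfolding matrix_vector_right_distrib vector_scalar_commute Te c(1) by (simp add: T)
    then have "(T' ** A ** T) *v axis j 1 = (T' ** T) *v (\<alpha> j *s axis j 1 + (\<chi> k. c k))"
      by (simp only: matrix_vector_mul_assoc [symmetric] Te)
    then have "(T' ** A ** T) *v axis j 1 = \<alpha> j *s axis j 1 + (\<chi> k. c k)"
      by (simp add: T')
    then have "((T' ** A ** T) *v axis j 1) $ i = (\<alpha> j *s axis j 1 + (\<chi> k. c k)) $ i" by (rule arg_cong)
    then have "(T' ** A ** T) $ i $ j = (if i = j then \<alpha> i else 0) + c i"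
      unfolding matrix_vector_axis by (simp add: axis_def)
    then show ?thesis using c(2) by simp
  qed
  show ?thesis
  proof (rule exI [of _ T], rule exI [of _ T'], rule exI [of _ \<alpha>], intro conjI allI)
    show "T ** T' = mat 1" "T' ** T = mat 1" using T' by simp_all
    show "\<exists>w. w \<noteq> 0 \<and> A *v w = \<alpha> i *s w" for i by (rule ev)
    show "norm ((T' ** A ** T) $ i $ j - (if i = j then \<alpha> i else 0)) \<le> \<epsilon>" for i j by (rule near)
  qed
qed

text \<open>The transpose of a generalised inverse \<open>C\<close> of a symmetric \<open>B\<close>
  is again one, and \<open>C ** B ** transpose C\<close> combines both into a symmetric one.\<close>

lemma symmetric_generalized_inverse:
  fixes B :: "complex ^ 'n ^ 'n"
  assumes "transpose B = B"
  shows "\<exists>C. transpose C = C \<and> (\<forall>x. B *v (C *v (B *v x)) = B *v x)"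
proof -
  have "\<exists>g. range g \<subseteq> UNIV \<and> Vector_Spaces.linear (*s) (*s) g \<and> (\<forall>v\<in>range ((*v) B). B *v g v = v)"
    by (rule vec.linear_exists_right_inverse_on) auto
  then obtain g where g: "Vector_Spaces.linear (*s) (*s) g" "\<And>x. B *v g (B *v x) = B *v x" by auto
  define C where "C = matrix g"
  have "C *v x = g x" for x using matrix_works [OF g(1)] by (simp add: C_def)
  then have BCB: "B ** C ** B = B" using g(2) by (simp add: matrix_eq matrix_action_simps)
  have "transpose (B ** C ** B) = B ** transpose C ** B"
    by (simp add: matrix_transpose_mul assms matrix_mul_assoc)
  then have BCtB: "B ** transpose C ** B = B" using BCB assms by simp
  show ?thesis
  proof (intro exI [of _ "C ** B ** transpose C"] conjI allI)
    show "transpose (C ** B ** transpose C) = C ** B ** transpose C"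
      by (simp add: matrix_transpose_mul assms matrix_mul_assoc transpose_transpose)
    have "B ** (C ** B ** transpose C) ** B = (B ** C ** B) ** transpose C ** B" by (simp add: matrix_mul_assoc)
    also have "\<dots> = B" using BCB BCtB by simp
    finally show "B *v ((C ** B ** transpose C) *v (B *v x)) = B *v x" for x
      by (simp add: matrix_vector_mul_assoc matrix_mul_assoc)
  qed
qed


text \<open>By hypothesis \<open>\<Omega> = B (A - 1/2)\<close> is antisymmetric, so it factors
  through \<open>B\<close> on both sides. For a symmetric generalised inverse \<open>C\<close> the
  matrix \<open>S = - C \<Omega> C\<close> is antisymmetric with \<open>B S B = - \<Omega>\<close>,
  which removes the deviation of \<open>B A\<close> from \<open>B / 2\<close>.\<close>

lemma euler_correction_exists:
  fixes A B :: "complex ^ 'n ^ 'n"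
  assumes B: "transpose B = B" and AB: "\<And>x. transpose A *v (B *v x) + B *v (A *v x) = B *v x"
  shows "\<exists>S. transpose S = - S \<and> (\<forall>x. B *v ((A + S ** B) *v x) = (1 / 2) *s (B *v x))"
proof -
  obtain C where C: "transpose C = C" "\<And>x. B *v (C *v (B *v x)) = B *v x"
    using symmetric_generalized_inverse [OF B] by blast
  define \<Omega> where "\<Omega> = B ** (A - mat (1 / 2))"
  have \<Omega>: "\<Omega> *v x = B *v (A *v x) - (1 / 2) *s (B *v x)" for x
    by (simp add: \<Omega>_def matrix_action_simps)
  have half: "(1 / 2) *s y + (1 / 2) *s y = y" for y :: "complex ^ 'n"
    by (simp add: vec.scale_left_distrib [symmetric])
  have "transpose \<Omega> = (transpose A - mat (1 / 2)) ** B"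
    by (simp add: \<Omega>_def matrix_transpose_mul B transpose_diff transpose_mat)
  also have "\<dots> = - \<Omega>"
  proof -
    have "((transpose A - mat (1 / 2)) ** B) *v x = (- \<Omega>) *v x" for x
    proof -
      have "transpose A *v (B *v x) = B *v x - B *v (A *v x)" using AB [of x] by (simp add: algebra_simps)
      then have "((transpose A - mat (1 / 2)) ** B) *v x = B *v x - B *v (A *v x) - (1 / 2) *s (B *v x)"
        by (simp add: matrix_action_simps del: transpose_matrix_vector)
      also have "\<dots> = - (\<Omega> *v x)" unfolding \<Omega> using half [of "B *v x"] by (simp add: algebra_simps)
      also have "\<dots> = (- \<Omega>) *v x" using matrix_vector_mult_diff_rdistrib [of 0 \<Omega> x] by simp
      finally show ?thesis .
    qed
    then show ?thesis by (simp add: matrix_eq)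
  qed
  finally have \<Omega>t: "transpose \<Omega> = - \<Omega>" .
  have C\<Omega>: "B *v (C *v (\<Omega> *v x)) = \<Omega> *v x" for x
    unfolding \<Omega> by (simp add: matrix_vector_mult_diff_distrib vector_scalar_commute C(2))
  have \<Omega>C: "\<Omega> *v (C *v (B *v x)) = \<Omega> *v x" for x
  proof -
    have "\<Omega> = - transpose \<Omega>" using \<Omega>t by simp
    also have "\<dots> = - ((transpose A - mat (1 / 2)) ** B)"
      by (simp add: \<Omega>_def matrix_transpose_mul B transpose_diff transpose_mat)
    finally have e: "\<Omega> *v y = - ((transpose A - mat (1 / 2)) *v (B *v y))" for y
      using matrix_vector_mult_diff_rdistrib [of 0 "(transpose A - mat (1 / 2)) ** B" y]
      by (simp add: matrix_vector_mul_assoc)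
    show ?thesis unfolding e C(2) ..
  qed
  define S where "S = - (C ** \<Omega> ** C)"
  have S: "S *v x = - (C *v (\<Omega> *v (C *v x)))" for x
    by (simp add: S_def minus_matrix_vector matrix_vector_mul_assoc matrix_mul_assoc)
  show ?thesis
  proof (intro exI [of _ S] conjI allI)
    have "transpose (C ** \<Omega> ** C) = C ** transpose \<Omega> ** C"
      by (simp add: matrix_transpose_mul C(1) matrix_mul_assoc)
    moreover have "C ** (- \<Omega>) ** C = - (C ** \<Omega> ** C)"
      by (simp add: vec_eq_iff matrix_matrix_mult_def sum_negf)
    moreover have "transpose (- M) = - transpose M" for M :: "complex ^ 'n ^ 'n"
      by (simp add: vec_eq_iff transpose_def)
    ultimately show "transpose S = - S" by (simp add: S_def \<Omega>t)
    fix x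
    have "B *v (S *v (B *v x)) = - (B *v (C *v (\<Omega> *v (C *v (B *v x)))))"
      unfolding S using matrix_vector_mult_diff_distrib [of B 0] by simp
    also have "\<dots> = - (\<Omega> *v x)" unfolding \<Omega>C C\<Omega> ..
    finally show "B *v ((A + S ** B) *v x) = (1 / 2) *s (B *v x)"
      by (simp add: matrix_vector_mult_add_rdistrib matrix_vector_right_distrib matrix_vector_mul_assoc [symmetric] \<Omega>)
  qed
qed

section \<open>The multiset of eigenvalues\<close>

text \<open>\<open>E = transpose N ** N\<close>, where \<open>N\<close> kills the kernel of
  \<open>\<pi>\<close> and sends a basis of its range to distinct unit vectors: a sum of squares in
  these coordinates. In \<open>eigenvalues_split\<close> it completes \<open>B\<close>, which
  vanishes on that range, to invertible forms.\<close>

lemma nondegenerate_on_projection: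
  fixes \<pi> :: "complex ^ 'n ^ 'n"
  assumes \<pi>: "\<And>x. \<pi> *v (\<pi> *v x) = \<pi> *v x"
  shows "\<exists>E. E ** \<pi> = E \<and> transpose \<pi> ** E = E \<and> (\<forall>x. E *v x = 0 \<longrightarrow> \<pi> *v x = 0)"
proof -
  define K where "K = range ((*v) \<pi>)"
  have "vec.subspace K" unfolding K_def by (rule vec.linear_subspace_image) auto
  then obtain b where b: "finite b" "b \<subseteq> K" "vec.independent b" "vec.span b = K" "card b = vec.dim K"
    using vec.basis_subspace_exists by metis
  have "card b \<le> CARD('n)" using b(5) vec.dim_subset_UNIV [of K] by (simp add: vec.dimension_def card_cart_basis)
  then obtain \<sigma> :: "complex ^ 'n \<Rightarrow> 'n" where \<sigma>: "inj_on \<sigma> b"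
    using card_le_inj [OF b(1), of "UNIV :: 'n set"] by auto
  obtain f where f: "Vector_Spaces.linear (*s) (*s) f" "\<forall>x\<in>b. f x = axis (\<sigma> x) 1"
    using vec.linear_independent_extend [OF b(3), of "\<lambda>x. axis (\<sigma> x) 1"] by blast
  define N where "N = matrix f ** \<pi>"
  have fN: "matrix f *v x = f x" for x using matrix_works [OF f(1)] by simp
  have N\<pi>: "N ** \<pi> = N" unfolding matrix_eq by (simp add: N_def matrix_action_simps \<pi>)
  have \<pi>b: "\<pi> *v x = x" if "x \<in> K" for x using that \<pi> by (auto simp: K_def)
  have Nb: "N *v x = axis (\<sigma> x) 1" if "x \<in> b" for x
    using that b(2) \<pi>b [of x] f(2) by (auto simp: N_def matrix_vector_mul_assoc [symmetric] fN)
  show ?thesis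
  proof (intro exI [of _ "transpose N ** N"] conjI allI impI)
    show "transpose N ** N ** \<pi> = transpose N ** N" by (simp add: matrix_mul_assoc [symmetric] N\<pi>)
    have "transpose \<pi> ** transpose N = transpose N" by (simp add: matrix_transpose_mul [symmetric] N\<pi>)
    then show "transpose \<pi> ** (transpose N ** N) = transpose N ** N" by (simp add: matrix_mul_assoc)
    fix x assume "(transpose N ** N) *v x = 0"
    then have 0: "transpose N *v (N *v x) = 0" by (simp add: matrix_vector_mul_assoc)
    have "\<pi> *v x \<in> vec.span b" using b(4) by (simp add: K_def)
    then obtain u where u: "\<pi> *v x = (\<Sum>v\<in>b. u v *s v)" using vec.span_finite [OF b(1)] by auto
    have "N *v x = N *v (\<pi> *v x)" by (simp add: matrix_vector_mul_assoc N\<pi>)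
    also have "\<dots> = (\<Sum>v\<in>b. u v *s (N *v v))" unfolding u by (simp add: vec.linear_sum vec.linear_scale vector_scalar_commute)
    also have "\<dots> = (\<Sum>v\<in>b. u v *s axis (\<sigma> v) 1)" by (rule sum.cong) (simp_all add: Nb)
    finally have Nx: "N *v x = (\<Sum>v\<in>b. u v *s axis (\<sigma> v) 1)" .
    have "u v = 0" if v: "v \<in> b" for v
    proof -
      have "0 = cdot (transpose N *v (N *v x)) v" using 0 by (simp add: cdot.zero_left)
      also have "\<dots> = cdot (N *v x) (N *v v)" by (rule cdot_transpose [symmetric])
      also have "\<dots> = (N *v x) $ \<sigma> v" by (simp add: Nb [OF v])
      also have "\<dots> = (\<Sum>w\<in>b. if w = v then u w else 0)"
        unfolding Nx sum_component using \<sigma> v by (intro sum.cong) (auto simp: axis_def inj_on_def)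
      also have "\<dots> = u v" using b(1) v by simp
      finally show ?thesis by simp
    qed
    then show "\<pi> *v x = 0" by (simp add: u)
  qed
qed

text \<open>The substitution \<open>x \<mapsto> 1 - x\<close> carries the linear factor at
  \<open>1 - a\<close> to the one at \<open>a\<close>, up to sign.\<close>

lemma order_reflect_le:
  fixes p q :: "complex poly"
  assumes "p \<noteq> 0" "q \<noteq> 0" "\<And>x. poly p x = c * poly q (1 - x)"
  shows "order a p \<ge> order (1 - a) q"
proof -
  define k where "k = order (1 - a) q"
  have "[:- (1 - a), 1:] ^ k dvd q" unfolding k_def by (rule order_1)
  then obtain r where r: "q = [:- (1 - a), 1:] ^ k * r" by (auto simp: dvd_def)
  have "poly p x = poly ([:- a, 1:] ^ k * (smult (c * (- 1) ^ k) (pcompose r [:1, - 1:]))) x" for x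
  proof -
    have "poly p x = c * ((1 - x - (1 - a)) ^ k * poly r (1 - x))"
      unfolding assms(3) r by (simp add: algebra_simps)
    also have "(1 - x - (1 - a)) ^ k = (- 1) ^ k * (x - a) ^ k"
      by (simp add: power_mult_distrib [symmetric])
    finally show ?thesis by (simp add: poly_pcompose algebra_simps)
  qed
  then have "p = [:- a, 1:] ^ k * (smult (c * (- 1) ^ k) (pcompose r [:1, - 1:]))"
    by (subst poly_eq_poly_eq_iff [symmetric]) (rule ext)
  then have "[:- a, 1:] ^ k dvd p" by (rule dvdI)
  then show ?thesis using assms(1) by (simp add: k_def order_divides)
qed

text \<open>The kernel of \<open>B\<close> is invariant under \<open>A\<close>, so the
  characteristic polynomial factors into that of the kernel block (\<open>dM\<close>, giving
  \<open>P\<close>) and that of the complementary block (\<open>dN\<close>, giving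
  \<open>Q\<close>). On the complement \<open>B\<close> is nondegenerate and conjugates the block of
  \<open>A\<close> to the transpose of that of \<open>1 - A\<close>, whence the symmetry of
  \<open>Q\<close>.\<close>

lemma eigenvalues_split:
  fixes A B :: "complex ^ 'n ^ 'n"
  assumes B: "transpose B = B" and AB: "\<And>x. transpose A *v (B *v x) + B *v (A *v x) = B *v x"
  shows "\<exists>P Q. eigenvalues A = P + Q \<and> image_mset (\<lambda>x. 1 - x) Q = Q \<and>
     (\<forall>\<alpha>. \<alpha> \<in># P \<longleftrightarrow> (\<exists>v. v \<noteq> 0 \<and> B *v v = 0 \<and> A *v v = \<alpha> *s v))"
proof -
  obtain C where C: "transpose C = C" "\<And>x. B *v (C *v (B *v x)) = B *v x"
    using symmetric_generalized_inverse [OF B] by blast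
  define \<pi> where "\<pi> = mat 1 - C ** B"
  have \<pi>: "\<pi> *v x = x - C *v (B *v x)" for x by (simp add: \<pi>_def matrix_action_simps)
  have B\<pi>: "B *v (\<pi> *v x) = 0" for x by (simp add: \<pi> matrix_vector_mult_diff_distrib C(2))
  have \<pi>K: "\<pi> *v x = x" if "B *v x = 0" for x using that by (simp add: \<pi>)
  have \<pi>\<pi>: "\<pi> *v (\<pi> *v x) = \<pi> *v x" for x by (rule \<pi>K [OF B\<pi>])
  have BA: "B *v (A *v x) = 0" if "B *v x = 0" for x using AB [of x] that by simp
  have \<pi>A: "\<pi> *v (A *v (\<pi> *v x)) = A *v (\<pi> *v x)" for x by (rule \<pi>K [OF BA [OF B\<pi>]])
  obtain E where E: "E ** \<pi> = E" "transpose \<pi> ** E = E" "\<And>x. E *v x = 0 \<Longrightarrow> \<pi> *v x = 0"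
    using nondegenerate_on_projection [OF \<pi>\<pi>] by blast
  have E\<pi>: "E *v (\<pi> *v x) = E *v x" for x by (simp add: matrix_vector_mul_assoc E(1))
  have \<pi>E: "transpose \<pi> *v (E *v x) = E *v x" for x unfolding matrix_vector_mul_assoc E(2) ..
  have tB\<pi>: "transpose \<pi> *v (B *v x) = 0" for x
  proof -
    have "transpose \<pi> ** B = transpose (B ** \<pi>)" by (simp add: matrix_transpose_mul B)
    also have "B ** \<pi> = 0" unfolding matrix_eq using B\<pi> by (simp add: matrix_vector_mul_assoc [symmetric])
    finally show ?thesis unfolding matrix_vector_mul_assoc by (simp add: transpose_def vec_eq_iff matrix_vector_mult_def)
  qed
  have detE: "det (E + B) \<noteq> 0" "det (E - B) \<noteq> 0"
  proof -
    have *: "x = 0" if "B *v x = c *s (E *v x)" "c \<noteq> 0" for x c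
    proof -
      have "transpose \<pi> *v (B *v x) = c *s (E *v x)" unfolding that(1) vector_scalar_commute \<pi>E ..
      then have "E *v x = 0" using that(2) tB\<pi> by simp
      moreover then have "B *v x = 0" using that(1) by simp
      ultimately show ?thesis using E(3) \<pi>K by metis
    qed
    show "det (E + B) \<noteq> 0"
      unfolding det_nonzero_iff_kernel
    proof (intro allI impI)
      fix x assume "(E + B) *v x = 0"
      then have "B *v x = (- 1) *s (E *v x)" by (simp add: matrix_vector_mult_add_rdistrib add_eq_0_iff)
      then show "x = 0" by (rule *) simp
    qed
    show "det (E - B) \<noteq> 0"
      unfolding det_nonzero_iff_kernel
    proof (intro allI impI)
      fix x assume "(E - B) *v x = 0"
      then have "B *v x = 1 *s (E *v x)" by (simp add: matrix_vector_mult_diff_rdistrib)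
      then show "x = 0" by (rule *) simp
    qed
  qed
  define \<Lambda> where "\<Lambda> = mat 1 - \<pi>"
  have \<Lambda>: "\<Lambda> *v x = x - \<pi> *v x" for x by (simp add: \<Lambda>_def matrix_action_simps)
  \<comment> \<open>In blocks for kernel and complement, \<open>A\<close> is upper triangular:
    \<open>M x\<close> carries the kernel block of \<open>mat x - A\<close>, \<open>N x\<close> the
    complementary one, and the unipotent \<open>U\<close> the off-diagonal block.\<close>
  define N where "N x = \<pi> + \<Lambda> ** (mat x - A) ** \<Lambda>" for x
  define M where "M x = (mat x - A) ** \<pi> + \<Lambda>" for x
  define U where "U = mat 1 - \<pi> ** A ** \<Lambda>"
  obtain dN where dN: "\<And>x. poly dN x = det (N x)"
  proof -
    obtain q where "\<And>x. poly q x = det ((\<pi> - \<Lambda> ** A ** \<Lambda>) + mat x ** \<Lambda>)" using poly_det_exists by blast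
    moreover have "(\<pi> - \<Lambda> ** A ** \<Lambda>) + mat x ** \<Lambda> = N x" for x
      unfolding matrix_eq N_def by (simp add: matrix_action_simps \<Lambda> \<pi>\<pi> vec.scale_right_diff_distrib)
    ultimately show ?thesis using that by metis
  qed
  obtain dM where dM: "\<And>x. poly dM x = det (M x)"
  proof -
    obtain q where "\<And>x. poly q x = det ((\<Lambda> - A ** \<pi>) + mat x ** \<pi>)" using poly_det_exists by blast
    moreover have "(\<Lambda> - A ** \<pi>) + mat x ** \<pi> = M x" for x
      unfolding matrix_eq M_def by (simp add: matrix_action_simps \<Lambda> vec.scale_right_diff_distrib)
    ultimately show ?thesis using that by metis
  qed
  have fact: "N x ** U ** M x = mat x - A" for x
    unfolding matrix_eq N_def M_def U_def
    by (simp add: matrix_action_simps \<Lambda> \<pi>\<pi> \<pi>A vec.scale_right_diff_distrib)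
  then have "poly (charpoly A) x = poly (smult (det U) (dN * dM)) x" for x
    unfolding poly_charpoly fact [symmetric] det_mul by (simp add: dN dM)
  then have cp: "charpoly A = smult (det U) (dN * dM)"
    by (subst poly_eq_poly_eq_iff [symmetric]) (rule ext)
  then have nz: "det U \<noteq> 0" "dN \<noteq> 0" "dM \<noteq> 0" using charpoly_nonzero [of A] by auto
  have ev: "eigenvalues A = proots dM + proots dN"
    unfolding eigenvalues_def cp using nz by (simp add: proots_mult)
  \<comment> \<open>The relation \<open>B (x - A) = - (1 - x - transpose A) B\<close> has a minus
    sign, which is why \<open>E + B\<close> turns into \<open>E - B\<close>.\<close>
  have sym: "det (E + B) * poly dN x = det (E - B) * poly dN (1 - x)" for x
  proof -
    have "(E + B) ** N x = transpose (N (1 - x)) ** (E - B)"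
      unfolding matrix_eq
    proof
      fix y
      have "((E + B) ** N x) *v y = E *v y + (x *s (B *v y) - B *v (A *v y))"
        using B\<pi> [of "A *v (y - \<pi> *v y)"] BA [OF B\<pi> [of y]]
        by (simp add: N_def matrix_action_simps \<Lambda> \<pi>\<pi> E\<pi> B\<pi> vec.scale_right_diff_distrib)
      moreover have "transpose (N (1 - x)) = transpose \<pi> + (mat 1 - transpose \<pi>) ** (mat (1 - x) - transpose A) ** (mat 1 - transpose \<pi>)"
      proof -
        have tadd: "transpose (X + Y) = transpose X + transpose Y" for X Y :: "complex ^ 'n ^ 'n"
          by (simp add: vec_eq_iff transpose_def)
        show ?thesis
          unfolding N_def \<Lambda>_def tadd matrix_transpose_mul transpose_diff transpose_mat by (simp only: matrix_mul_assoc)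
      qed
      moreover have "transpose \<pi> *v (transpose A *v (B *v y)) = 0"
      proof -
        have "transpose A *v (B *v y) = B *v (y - A *v y)"
          using AB [of y] by (simp add: matrix_vector_mult_diff_distrib algebra_simps del: transpose_matrix_vector)
        then show ?thesis using tB\<pi> by simp
      qed
      moreover have "transpose A *v (B *v y) = B *v y - B *v (A *v y)"
        using AB [of y] by (simp add: algebra_simps del: transpose_matrix_vector)
      ultimately show "((E + B) ** N x) *v y = (transpose (N (1 - x)) ** (E - B)) *v y"
        by (simp add: matrix_action_simps \<pi>E tB\<pi> vec.scale_right_diff_distrib vec.scale_left_diff_distrib
            del: transpose_matrix_vector)
    qed
    from arg_cong [OF this, of det] show ?thesis by (simp add: det_mul dN mult.commute)
  qed
  have ord: "order a dN = order (1 - a) dN" for a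
  proof (rule antisym)
    have *: "poly dN x = det (E - B) / det (E + B) * poly dN (1 - x)" for x
      using sym [of x] detE by (simp add: field_simps)
    show "order a dN \<ge> order (1 - a) dN" by (rule order_reflect_le [OF nz(2,2) *])
    show "order a dN \<le> order (1 - a) dN" using order_reflect_le [OF nz(2,2) *, of "1 - a"] by simp
  qed
  have "image_mset (\<lambda>x. 1 - x) (proots dN) = proots dN"
  proof (rule multiset_eqI)
    fix a
    show "count (image_mset (\<lambda>x. 1 - x) (proots dN)) a = count (proots dN) a"
      unfolding count_image_reflect using ord [of a] nz by simp
  qed
  moreover have "\<alpha> \<in># proots dM \<longleftrightarrow> (\<exists>v. v \<noteq> 0 \<and> B *v v = 0 \<and> A *v v = \<alpha> *s v)" for \<alpha>
  proof -
    have M: "M \<alpha> *v v = \<alpha> *s (\<pi> *v v) - A *v (\<pi> *v v) + (v - \<pi> *v v)" for v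
      by (simp add: M_def matrix_action_simps \<Lambda>)
    have "\<alpha> \<in># proots dM \<longleftrightarrow> det (M \<alpha>) = 0" using nz(3) dM by simp
    also have "\<dots> \<longleftrightarrow> (\<exists>v. v \<noteq> 0 \<and> M \<alpha> *v v = 0)" using det_nonzero_iff_kernel [of "M \<alpha>"] by blast
    also have "\<dots> \<longleftrightarrow> (\<exists>v. v \<noteq> 0 \<and> B *v v = 0 \<and> A *v v = \<alpha> *s v)"
    proof (intro ex_cong1 conj_cong refl)
      fix v
      show "M \<alpha> *v v = 0 \<longleftrightarrow> B *v v = 0 \<and> A *v v = \<alpha> *s v"
      proof
        assume 0: "M \<alpha> *v v = 0"
        have "B *v (M \<alpha> *v v) = B *v v"
          unfolding M by (simp add: matrix_vector_right_distrib matrix_vector_mult_diff_distrib vector_scalar_commute B\<pi> BA [OF B\<pi>])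
        with 0 have "B *v v = 0" by simp
        then show "B *v v = 0 \<and> A *v v = \<alpha> *s v" using 0 \<pi>K [of v] by (simp add: M)
      qed (simp add: M \<pi>K)
    qed
    finally show ?thesis .
  qed
  ultimately show ?thesis using ev by blast
qed

text \<open>Below \<open>1 / 2\<close> the multiset \<open>L - L_minus L\<close> agrees with
  \<open>P\<close>: a value \<open>x < 1 / 2\<close> is removed as often as \<open>1 - x\<close>
  occurs, which is only in \<open>Q\<close>, and there as often as \<open>x\<close> itself. Values
  from \<open>1 / 2\<close> on cannot lower the minimum, since \<open>1 / 2\<close> is in the
  set.\<close>

lemma Min_L_zero:
  fixes P Q :: "real multiset"
  assumes P: "\<And>x. x \<in># P \<Longrightarrow> 0 < x \<and> x \<le> 1 / 2" and Q: "image_mset (\<lambda>x. 1 - x) Q = Q"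
  shows "Min (L_zero (P + Q)) = Min (set_mset P \<union> {1 / 2})"
proof -
  define L where "L = P + Q"
  have Qc: "count Q (1 - x) = count Q x" for x using count_image_reflect [of Q x] Q by simp
  have cm: "count (L - L_minus L) x = count P x" if x: "x < 1 / 2" for x
  proof -
    have "count (L_minus L) x = count L (1 - x)" using x by (simp add: L_minus_def count_image_reflect)
    moreover have "count P (1 - x) = 0" 
    proof -
      have "1 - x \<notin># P" using P [of "1 - x"] x by auto
      then show ?thesis by (simp add: not_in_iff)
    qed
    ultimately show ?thesis by (simp add: L_def Qc)
  qed
  have fin: "finite (L_zero L)" "finite (set_mset P \<union> {1 / 2})" by (simp_all add: L_zero_def)
  have mem: "x \<in> L_zero L \<longleftrightarrow> x \<in> set_mset P \<union> {1 / 2}" if "x < 1 / 2" for x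
    using cm [OF that] that by (auto simp: L_zero_def count_greater_zero_iff [symmetric] simp del: count_greater_zero_iff)
  have le: "Min X \<le> Min Y" if "finite X" "finite Y" "1 / 2 \<in> X" "1 / 2 \<in> Y" "\<And>x. x < 1 / 2 \<Longrightarrow> x \<in> Y \<Longrightarrow> x \<in> X" for X Y :: "real set"
  proof (rule Min.boundedI)
    fix y assume "y \<in> Y"
    show "Min X \<le> y"
    proof (cases "y < 1 / 2")
      case True
      then show ?thesis using that \<open>y \<in> Y\<close> by (intro Min_le) auto
    next
      case False
      have "Min X \<le> 1 / 2" using that by (intro Min_le) auto
      with False show ?thesis by simp
    qed
  qed (use that in auto)
  have h: "1 / 2 \<in> L_zero L" "1 / 2 \<in> set_mset P \<union> {1 / 2}" by (simp_all add: L_zero_def)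
  show ?thesis
    unfolding L_def [symmetric] using le [OF fin h] le [OF fin(2,1) h(2,1)] mem by (intro antisym) auto
qed

section \<open>Cauchy estimates and limits in several variables\<close>

lemma eventually_nhds_0: "(\<forall>\<^sub>F z in nhds (0 :: 'a::real_normed_vector). P z) \<longleftrightarrow> (\<exists>r>0. \<forall>z. norm z < r \<longrightarrow> P z)"
  by (simp add: eventually_nhds_metric dist_norm)

lemma hol_line:
  assumes "hol S f" "z + t *s v \<in> S"
  shows "((\<lambda>s. f (z + s *s v)) has_field_derivative cdot (gradient f (z + t *s v)) v) (at t)"
proof -
  have "bounded_linear (\<lambda>s :: complex. s *s v)"
  proof (rule bounded_linear_intro [where K = "norm v"])
    show "norm (s *s v) \<le> norm s * norm v" for s by simp
    show "(r *\<^sub>R s) *s v = r *\<^sub>R (s *s v)" for r :: real and s :: complex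
      by (simp only: vec_eq_iff vector_smult_component vector_scaleR_component) simp
  qed (simp add: vec.scale_left_distrib)
  from has_derivative_add [OF has_derivative_const bounded_linear_imp_has_derivative [OF this]]
  have "((\<lambda>s. z + s *s v) has_derivative (\<lambda>s. s *s v)) (at t)" by simp
  from has_derivative_compose [OF this hol_has_derivative [OF assms]]
  show ?thesis
    unfolding has_field_derivative_def by (rule has_derivative_eq_rhs) (simp add: fun_eq_iff mult.commute)
qed

lemma cauchy_line:
  assumes f: "hol S f" "\<And>w. norm w \<le> R \<Longrightarrow> z + w \<in> S" and R: "0 < R"
    and B: "\<And>w. norm w \<le> R \<Longrightarrow> norm (f (z + w)) \<le> B" and v: "norm v = R"
    and t: "norm t + \<rho> \<le> 1" "0 < \<rho>"
  shows "norm ((deriv ^^ k) (\<lambda>s. f (z + s *s v)) t) \<le> fact k * B / \<rho> ^ k"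
proof (rule Cauchy_inequality)
  have sub: "z + s *s v \<in> S" if "dist t s \<le> \<rho>" for s
  proof -
    have "norm s \<le> norm t + norm (s - t)" using norm_triangle_ineq [of t "s - t"] by simp
    then have "norm s \<le> 1" using that t(1) by (simp add: dist_norm norm_minus_commute)
    then show ?thesis using R v by (intro f(2)) (simp add: mult_left_le_one_le)
  qed
  have d: "((\<lambda>s. f (z + s *s v)) has_field_derivative cdot (gradient f (z + s *s v)) v) (at s)"
    if "dist t s \<le> \<rho>" for s
    by (rule hol_line [OF f(1) sub [OF that]])
  show "(\<lambda>s. f (z + s *s v)) holomorphic_on ball t \<rho>"
    unfolding holomorphic_on_def field_differentiable_def
    using d by (meson has_field_derivative_at_within less_imp_le mem_ball)
  show "continuous_on (cball t \<rho>) (\<lambda>s. f (z + s *s v))"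
  proof (rule continuous_at_imp_continuous_on, rule ballI)
    show "isCont (\<lambda>s. f (z + s *s v)) s" if "s \<in> cball t \<rho>" for s
      using DERIV_isCont [OF d [of s]] that by simp
  qed
  show "norm (f (z + s *s v)) \<le> B" if "norm (t - s) = \<rho>" for s
  proof (rule B)
    have "norm s \<le> norm t + norm (t - s)" using norm_triangle_ineq4 [of t "t - s"] by simp
    then have "norm s \<le> 1" using that t(1) by simp
    then show "norm (s *s v) \<le> R" using R v by (simp add: mult_left_le_one_le)
  qed
qed (rule t)

lemma cauchy_gradient:
  assumes f: "hol S f" "\<And>w. norm w \<le> R \<Longrightarrow> z + w \<in> S" and R: "0 < R"
    and B: "\<And>w. norm w \<le> R \<Longrightarrow> norm (f (z + w)) \<le> B"
  shows "norm (cdot (gradient f z) v) \<le> B / R * norm v"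
proof (cases "v = 0")
  case False
  define w where "w = of_real (R / norm v) *s v"
  have w: "norm w = R" using False R by (simp add: w_def norm_divide)
  have "((\<lambda>s. f (z + s *s w)) has_field_derivative cdot (gradient f (z + 0 *s w)) w) (at 0)"
    by (rule hol_line [OF f(1)]) (use f(2) [of 0] R in simp)
  then have "deriv (\<lambda>s. f (z + s *s w)) 0 = cdot (gradient f z) w" by (simp add: DERIV_imp_deriv)
  with cauchy_line [OF f R B w, of 0 1 1] have "norm (cdot (gradient f z) w) \<le> B" by simp
  then have "R / norm v * norm (cdot (gradient f z) v) \<le> B"
    using R by (simp add: w_def norm_mult norm_divide)
  then show ?thesis using False R by (simp add: field_simps)
qed (simp add: cdot.zero_right)

lemma taylor_bound:
  assumes f: "hol S f" "\<And>w. norm w \<le> R \<Longrightarrow> z + w \<in> S" and R: "0 < R"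
    and B: "\<And>w. norm w \<le> R \<Longrightarrow> norm (f (z + w)) \<le> B" and y: "norm y \<le> R / 2"
  shows "norm (f (z + y) - f z - cdot (gradient f z) y) \<le> 8 * B / R\<^sup>2 * (norm y)\<^sup>2"
proof (cases "y = 0")
  case False
  define w where "w = of_real (R / norm y) *s y"
  define s0 :: complex where "s0 = of_real (norm y / R)"
  have w: "norm w = R" using False R by (simp add: w_def norm_divide)
  have yw: "y = s0 *s w" using False R by (simp add: w_def s0_def)
  have s0: "norm s0 \<le> 1 / 2" using y R by (simp add: s0_def norm_divide field_simps)
  define \<phi> where "\<phi> s = f (z + s *s w)" for s
  have sub: "z + s *s w \<in> S" if "norm s < 1" for s
    using that R w by (intro f(2)) (simp add: mult_left_le_one_le)
  have hol\<phi>: "\<phi> holomorphic_on ball 0 1"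
    unfolding holomorphic_on_def field_differentiable_def \<phi>_def
    using hol_line [OF f(1) sub] by (metis has_field_derivative_at_within mem_ball_0)
  \<comment> \<open>Discs of radius \<open>1 / 2\<close> around points of the disc of radius
    \<open>1 / 2\<close> stay in the unit disc, so the second derivative is at most
    \<open>2 * B / (1 / 2)^2\<close>: the origin of the constant \<open>8\<close>.\<close>
  have "norm ((deriv ^^ 0) \<phi> s0 - (\<Sum>i\<le>1. (deriv ^^ i) \<phi> 0 * (s0 - 0) ^ i / fact i))
      \<le> (2 * B / (1 / 2)\<^sup>2) * norm (s0 - 0) ^ Suc 1 / fact 1"
  proof (rule complex_Taylor [where S = "cball 0 (1 / 2)" and f = "\<lambda>i. (deriv ^^ i) \<phi>" and n = 1])
    fix i and s :: complex assume s: "s \<in> cball 0 (1 / 2)"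
    have "((deriv ^^ i) \<phi> has_field_derivative deriv ((deriv ^^ i) \<phi>) s) (at s)"
      using s by (intro holomorphic_derivI [OF holomorphic_higher_deriv [OF hol\<phi>]]) auto
    then show "((deriv ^^ i) \<phi> has_field_derivative (deriv ^^ Suc i) \<phi> s) (at s within cball 0 (1 / 2))"
      by (simp add: has_field_derivative_at_within)
  next
    fix s :: complex assume "s \<in> cball 0 (1 / 2)"
    then have "norm s + 1 / 2 \<le> 1" by simp
    from cauchy_line [OF f R B w this, of 2]
    show "norm ((deriv ^^ Suc 1) \<phi> s) \<le> 2 * B / (1 / 2)\<^sup>2"
      unfolding \<phi>_def [abs_def] by (simp add: numeral_2_eq_2)
  qed (use s0 in auto)
  moreover have "deriv \<phi> 0 = cdot (gradient f z) w"
  proof -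
    have "(\<phi> has_field_derivative cdot (gradient f (z + 0 *s w)) w) (at 0)"
      unfolding \<phi>_def by (rule hol_line [OF f(1)]) (use f(2) [of 0] R in simp)
    then show ?thesis by (simp add: DERIV_imp_deriv)
  qed
  moreover have "\<phi> s0 = f (z + y)" "\<phi> 0 = f z" by (simp_all add: \<phi>_def yw)
  moreover have "cdot (gradient f z) y = cdot (gradient f z) w * s0" by (simp add: yw mult.commute)
  ultimately have "norm (f (z + y) - f z - cdot (gradient f z) y) \<le> 2 * B / (1 / 2)\<^sup>2 * (norm s0)\<^sup>2"
    by (simp add: power2_eq_square algebra_simps)
  also have "\<dots> = 8 * B / R\<^sup>2 * (norm y)\<^sup>2"
    using R by (simp add: s0_def norm_divide power2_eq_square field_simps)
  finally show ?thesis .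
qed (simp add: cdot.zero_right)

text \<open>The normalised conjugate of \<open>x\<close>, or any unit vector if
  \<open>x = 0\<close>. Testing against such a \<open>u\<close> reduces estimates for vectors to
  scalar functions.\<close>

lemma dual_vector_exists: "\<exists>u. norm u = 1 \<and> cdot u x = of_real (norm x)"
proof (cases "x = 0")
  case True
  then show ?thesis by (intro exI [of _ "axis undefined 1"]) (simp add: cdot.zero_right)
next
  case False
  define c :: "complex ^ 'a" where "c = (\<chi> i. cnj (x $ i))"
  have n: "norm c = norm x" by (simp add: c_def norm_vec_def)
  have "cdot c x = of_real ((norm x)\<^sup>2)"
  proof -
    have "(norm x)\<^sup>2 = (\<Sum>i\<in>UNIV. (norm (x $ i))\<^sup>2)"
      by (simp add: norm_vec_def L2_set_def sum_nonneg)
    then have "of_real ((norm x)\<^sup>2) = (\<Sum>i\<in>UNIV. complex_of_real ((norm (x $ i))\<^sup>2))" by simp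
    then show ?thesis
      unfolding cdot_def c_def complex_norm_square by (simp add: mult.commute)
  qed
  then show ?thesis using False n
    by (intro exI [of _ "of_real (1 / norm x) *s c"]) (simp add: power2_eq_square norm_divide)
qed

lemma hol_cdot_const: "holv S F \<Longrightarrow> hol S (\<lambda>w. cdot u (F w))"
  and gradient_cdot_const: "holv S F \<Longrightarrow> z \<in> S \<Longrightarrow> gradient (\<lambda>w. cdot u (F w)) z = transpose (jac F z) *v u"
proof -
  have d: "((\<lambda>w. cdot u (F w)) has_derivative cdot (transpose (jac F z) *v u)) (at z)"
    if "holv S F" "z \<in> S" for z
    using has_derivative_compose [OF holv_has_derivative [OF that]
        bounded_linear_imp_has_derivative [OF cdot.bounded_linear_right]]
    unfolding cdot_transpose .
  show "holv S F \<Longrightarrow> hol S (\<lambda>w. cdot u (F w))" using d unfolding hol_def by blast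
  show "holv S F \<Longrightarrow> z \<in> S \<Longrightarrow> gradient (\<lambda>w. cdot u (F w)) z = transpose (jac F z) *v u"
    using d by (rule gradient_eqI)
qed

lemma cauchy_jacobian:
  assumes F: "holv S F" "\<And>w. norm w \<le> R \<Longrightarrow> z + w \<in> S" and R: "0 < R"
    and B: "\<And>w. norm w \<le> R \<Longrightarrow> norm (F (z + w)) \<le> B"
  shows "norm (jac F z *v v) \<le> B / R * norm v"
proof -
  obtain u where u: "norm u = 1" "cdot u (jac F z *v v) = of_real (norm (jac F z *v v))"
    using dual_vector_exists by blast
  have zS: "z \<in> S" using F(2) [of 0] R by simp
  have "norm (cdot (gradient (\<lambda>w. cdot u (F w)) z) v) \<le> B / R * norm v"
  proof (rule cauchy_gradient [OF hol_cdot_const [OF F(1)] F(2) R])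
    show "norm (cdot u (F (z + w))) \<le> B" if "norm w \<le> R" for w
      using norm_cdot_le [of u "F (z + w)"] B [OF that] u(1) by simp
  qed
  then show ?thesis
    unfolding gradient_cdot_const [OF F(1) zS] cdot_transpose [symmetric] u(2) by simp
qed

lemma taylor_bound_vec:
  assumes F: "holv S F" "\<And>w. norm w \<le> R \<Longrightarrow> z + w \<in> S" and R: "0 < R"
    and B: "\<And>w. norm w \<le> R \<Longrightarrow> norm (F (z + w)) \<le> B" and y: "norm y \<le> R / 2"
  shows "norm (F (z + y) - F z - jac F z *v y) \<le> 8 * B / R\<^sup>2 * (norm y)\<^sup>2"
proof -
  define e where "e = F (z + y) - F z - jac F z *v y"
  obtain u where u: "norm u = 1" "cdot u e = of_real (norm e)"
    using dual_vector_exists by blast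
  have zS: "z \<in> S" using F(2) [of 0] R by simp
  have "norm (cdot u (F (z + y)) - cdot u (F z) - cdot (gradient (\<lambda>w. cdot u (F w)) z) y) \<le> 8 * B / R\<^sup>2 * (norm y)\<^sup>2"
  proof (rule taylor_bound [OF hol_cdot_const [OF F(1)] F(2) R _ y])
    show "norm (cdot u (F (z + w))) \<le> B" if "norm w \<le> R" for w
      using norm_cdot_le [of u "F (z + w)"] B [OF that] u(1) by simp
  qed
  moreover have "cdot u (F (z + y)) - cdot u (F z) - cdot (gradient (\<lambda>w. cdot u (F w)) z) y = cdot u e"
    unfolding gradient_cdot_const [OF F(1) zS] cdot_transpose [symmetric] e_def by (simp add: cdot.diff_right)
  ultimately show ?thesis using u(2) by (simp add: e_def)
qed

lemma holv_local_bounds: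
  assumes "open S" "0 \<in> S" and F: "holv S F"
  shows "\<exists>r>0. \<exists>C\<ge>0. cball 0 (2 * r) \<subseteq> S \<and> (\<forall>z. norm z \<le> 2 * r \<longrightarrow> norm (F z) \<le> C) \<and>
    (\<forall>z y. norm z \<le> r \<longrightarrow> norm y \<le> r / 2 \<longrightarrow> norm (F (z + y) - F z - jac F z *v y) \<le> C * (norm y)\<^sup>2)"
proof -
  obtain e where e: "0 < e" "cball 0 e \<subseteq> S" using assms open_contains_cball by blast
  define r where "r = e / 2"
  have r: "0 < r" "cball 0 (2 * r) \<subseteq> S" using e by (simp_all add: r_def)
  have "bounded (F ` cball 0 (2 * r))"
    by (intro compact_imp_bounded compact_continuous_image continuous_on_subset [OF holv_continuous_on [OF F] r(2)]) simp
  then obtain B0 where "\<forall>y\<in>F ` cball 0 (2 * r). norm y \<le> B0" unfolding bounded_iff by blast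
  then have B0: "norm (F z) \<le> B0" if "norm z \<le> 2 * r" for z using that by simp
  have B0': "0 \<le> B0" using order_trans [OF norm_ge_zero B0 [of 0]] r(1) by simp
  have sum: "norm (z + w) \<le> 2 * r" if "norm z \<le> r" "norm w \<le> r" for z w :: "complex ^ 'a"
    using norm_triangle_ineq [of z w] that by linarith
  define C where "C = max B0 (8 * B0 / r\<^sup>2)"
  have "norm (F (z + y) - F z - jac F z *v y) \<le> C * (norm y)\<^sup>2" if z: "norm z \<le> r" and y: "norm y \<le> r / 2" for z y
  proof -
    have "norm (F (z + y) - F z - jac F z *v y) \<le> 8 * B0 / r\<^sup>2 * (norm y)\<^sup>2"
    proof (rule taylor_bound_vec [OF F _ r(1) _ y])
      show "z + w \<in> S" if "norm w \<le> r" for w using sum [OF z that] r(2) by auto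
      show "norm (F (z + w)) \<le> B0" if "norm w \<le> r" for w using B0 [OF sum [OF z that]] .
    qed
    also have "\<dots> \<le> C * (norm y)\<^sup>2" by (intro mult_right_mono) (auto simp: C_def)
    finally show ?thesis .
  qed
  moreover have "norm (F z) \<le> C" if "norm z \<le> 2 * r" for z using B0 [OF that] by (simp add: C_def)
  ultimately show ?thesis using r B0' by (intro exI [of _ r] exI [of _ C] conjI) (auto simp: C_def)
qed

section \<open>Uniform limits, power series and inverse functions\<close>

lemma hol_uniform_limit:
  assumes S: "open S" and f: "\<And>n. hol S (f n)" and lim: "uniform_limit S f g F" and F: "F \<noteq> bot"
  shows "hol S g"
proof (rule osgood(1) [OF S])
  show "continuous_on S g"
    by (rule uniform_limit_theorem [OF _ lim F]) (intro always_eventually allI hol_continuous_on f)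
next
  fix z j assume "z \<in> S"
  then obtain r where r: "0 < r" "cball z r \<subseteq> S" using S open_contains_cball by blast
  have sub: "z + axis j t \<in> S" if "t \<in> cball 0 r" for t
    using r(2) that by (auto simp: subset_iff dist_norm norm_minus_commute)
  have d: "((\<lambda>t. f n (z + axis j t)) has_field_derivative gradient (f n) (z + axis j t) $ j) (at t)" if "t \<in> cball 0 r" for n t
  proof -
    have ax: "axis j s = s *s axis j 1" for s :: complex by (simp add: vec_eq_iff axis_def)
    have "z + t *s axis j 1 \<in> S" using sub [OF that] ax [of t] by simp
    from hol_line [OF f this] show ?thesis unfolding ax [symmetric] by simp
  qed
  obtain "(\<lambda>t. g (z + axis j t)) holomorphic_on ball 0 r"
  proof (rule holomorphic_uniform_limit [where f = "\<lambda>n t. f n (z + axis j t)" and z = 0 and r = r and F = F])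
    show "uniform_limit (cball 0 r) (\<lambda>n t. f n (z + axis j t)) (\<lambda>t. g (z + axis j t)) F"
      by (rule uniform_limit_compose' [OF lim]) (use sub in auto)
    have "continuous_on (cball 0 r) (\<lambda>t. f n (z + axis j t))" for n
      by (intro continuous_at_imp_continuous_on ballI DERIV_isCont [OF d])
    moreover have "(\<lambda>t. f n (z + axis j t)) holomorphic_on ball 0 r" for n
      unfolding holomorphic_on_def field_differentiable_def
      using d by (meson ball_subset_cball has_field_derivative_at_within subsetD)
    ultimately show "\<forall>\<^sub>F n in F. continuous_on (cball 0 r) (\<lambda>t. f n (z + axis j t)) \<and> (\<lambda>t. f n (z + axis j t)) holomorphic_on ball 0 r"
      by simp
  qed (use F in auto)
  then show "(\<lambda>t. g (z + axis j t)) field_differentiable at 0"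
    using r(1) by (simp add: holomorphic_on_imp_differentiable_at)
qed

lemma hol_power: "hol S f \<Longrightarrow> hol S (\<lambda>z. f z ^ k)"
proof (induction k)
  case (Suc k)
  then show ?case using hol_mult [of S f "\<lambda>z. f z ^ k"] by simp
qed simp

lemma convergent_power_series_hol:
  fixes g :: "complex ^ 'n \<Rightarrow> complex"
  assumes "g \<in> convergent_power_series"
  shows "\<exists>r>0. hol (ball 0 r) g"
proof -
  obtain c where "\<forall>\<^sub>F z in nhds 0. ((\<lambda>k. c k * (\<Prod>i\<in>UNIV. (z $ i) ^ k i)) has_sum g z) UNIV"
    using assms by (auto simp: convergent_power_series_def)
  then obtain e where e: "0 < e" "\<And>z. norm z < e \<Longrightarrow> ((\<lambda>k. c k * (\<Prod>i\<in>UNIV. (z $ i) ^ k i)) has_sum g z) UNIV"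
    unfolding eventually_nhds_0 by blast
  \<comment> \<open>The point with all coordinates \<open>t\<close> lies in the domain of
    convergence. Unconditional summability there is absolute, and its terms dominate those on the
    polydisc of radius \<open>t\<close>, as the Weierstrass test requires.\<close>
  define t where "t = e / (real CARD('n) + 1)"
  have t: "0 < t" using e by (simp add: t_def)
  define z0 :: "complex ^ 'n" where "z0 = (\<chi> i. of_real t)"
  have "norm z0 \<le> (\<Sum>i\<in>(UNIV :: 'n set). norm (z0 $ i))" unfolding norm_vec_def by (rule L2_set_le_sum) simp
  also have "\<dots> = real CARD('n) * t" using t by (simp add: z0_def)
  also have "\<dots> < e" using e by (simp add: t_def field_simps)
  finally have "(\<lambda>k. c k * (\<Prod>i\<in>UNIV. (z0 $ i) ^ k i)) summable_on UNIV"
    using e(2) by (auto simp: summable_on_def)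
  then have sm: "(\<lambda>k. norm (c k * (\<Prod>i\<in>UNIV. (z0 $ i) ^ k i))) summable_on UNIV"
    by (simp only: summable_on_iff_abs_summable_on_complex)
  define r where "r = min t e"
  have r: "0 < r" using t e by (simp add: r_def)
  have "uniform_limit (ball 0 r) (\<lambda>K z. \<Sum>k\<in>K. c k * (\<Prod>i\<in>UNIV. (z $ i) ^ k i)) g (finite_subsets_at_top UNIV)"
  proof (rule Weierstrass_m_test_general' [OF _ _ sm])
    fix k and z :: "complex ^ 'n" assume "z \<in> ball 0 r"
    then have z: "norm (z $ i) \<le> t" for i
      using Finite_Cartesian_Product.norm_nth_le [of z i] by (simp add: r_def)
    have "(\<Prod>i\<in>UNIV. norm (z $ i) ^ k i) \<le> (\<Prod>i\<in>UNIV. t ^ k i)"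
      using z by (intro prod_mono) (simp add: power_mono)
    then show "norm (c k * (\<Prod>i\<in>UNIV. (z $ i) ^ k i)) \<le> norm (c k * (\<Prod>i\<in>UNIV. (z0 $ i) ^ k i))"
      using t by (simp add: norm_mult prod_norm [symmetric] norm_power z0_def mult_left_mono)
  qed (use e(2) in \<open>auto simp: r_def\<close>)
  then have "hol (ball 0 r) g"
  proof (rule hol_uniform_limit [rotated 2])
    show "hol (ball 0 r) (\<lambda>z. \<Sum>k\<in>K. c k * (\<Prod>i\<in>UNIV. (z $ i) ^ k i))" for K
      by (intro hol_sum hol_mult hol_const hol_prod hol_power hol_component)
  qed auto
  with r show ?thesis by blast
qed

lemma holomorphic_germ_hol:
  fixes f :: "complex ^ 'n \<Rightarrow> complex"
  assumes "holomorphic_germ f"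
  shows "\<exists>r>0. hol (ball 0 r) f"
proof -
  obtain r where r: "0 < r" "\<And>z. norm z < r \<Longrightarrow> \<exists>f'. (f has_derivative f') (at z) \<and> Vector_Spaces.linear (*s) (*) f'"
    using assms unfolding holomorphic_germ_def eventually_nhds_0 by blast
  have "\<exists>D. (f has_derivative cdot D) (at z)" if z: "norm z < r" for z
  proof -
    obtain f' where f': "(f has_derivative f') (at z)" "Vector_Spaces.linear (*s) (*) f'"
      using r(2) [OF z] by blast
    interpret L: Vector_Spaces.linear "(*s)" "(*)" f' by (rule f'(2))
    have "f' v = cdot (\<chi> j. f' (axis j 1)) v" for v
    proof -
      have "v = (\<Sum>i\<in>UNIV. v $ i *s axis i 1)" by (rule basis_expansion [symmetric])
      then have "f' v = f' (\<Sum>i\<in>UNIV. v $ i *s axis i 1)" by simp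
      also have "\<dots> = (\<Sum>i\<in>UNIV. v $ i * f' (axis i 1))" by (simp only: L.sum L.scale)
      finally show ?thesis by (simp add: cdot_def mult.commute)
    qed
    then have "f' = cdot (\<chi> j. f' (axis j 1))" by (rule ext)
    then show ?thesis using f'(1) by metis
  qed
  then have "hol (ball 0 r) f" by (simp add: hol_def)
  with r(1) show ?thesis by blast
qed

text \<open>The real inverse function theorem; the inverse of a complex linear derivative is given
  by the inverse matrix, so the local inverse is holomorphic.\<close>

lemma hol_inverse_function:
  fixes \<Theta> :: "complex ^ 'n \<Rightarrow> complex ^ 'n"
  assumes S: "open S" "0 \<in> S" and \<Theta>: "holv S \<Theta>" "\<Theta> 0 = 0" and nd: "det (jac \<Theta> 0) \<noteq> 0"
  shows "\<exists>W \<Phi>. open W \<and> 0 \<in> W \<and> holv W \<Phi> \<and> \<Phi> ` W \<subseteq> S \<and> \<Phi> 0 = 0 \<and>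
    (\<forall>w\<in>W. \<Theta> (\<Phi> w) = w \<and> jac \<Theta> (\<Phi> w) ** jac \<Phi> w = mat 1)"
proof -
  obtain N where N: "N ** jac \<Theta> 0 = mat 1"
    using nd invertible_det_nz [of "jac \<Theta> 0"] by (auto simp: invertible_def)
  define D where "D z = Blinfun (\<lambda>v. jac \<Theta> z *v v)" for z
  have D: "blinfun_apply (D z) = (\<lambda>v. jac \<Theta> z *v v)" for z
    unfolding D_def by (rule bounded_linear_Blinfun_apply [OF matrix_vector_mul_bounded_linear])
  define M where "M = Blinfun (\<lambda>v. N *v v)"
  have M: "blinfun_apply M = (\<lambda>v. N *v v)"
    unfolding M_def by (rule bounded_linear_Blinfun_apply [OF matrix_vector_mul_bounded_linear])
  have 1: "\<And>x. x \<in> S \<Longrightarrow> (\<Theta> has_derivative blinfun_apply (D x)) (at x)"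
    unfolding D by (rule holv_has_derivative [OF \<Theta>(1)])
  have 2: "continuous_on S D"
  proof (rule continuous_on_blinfun_componentwise)
    have cj: "continuous_on S (\<lambda>z. jac \<Theta> z $ i $ j)" for i j
      using continuous_on_component [OF continuous_on_component [OF continuous_on_jac [OF S(1) \<Theta>(1)]]] .
    show "continuous_on S (\<lambda>z. blinfun_apply (D z) v)" for v
      unfolding D matrix_vector_mult_def by (intro continuous_intros cj)
  qed
  have 3: "M o\<^sub>L D 0 = id_blinfun"
    by (rule blinfun_eqI) (simp add: M D matrix_vector_mul_assoc N)
  obtain U V \<Phi> g' where U: "open U" "U \<subseteq> S" "0 \<in> U" and V: "open V" "\<Theta> 0 \<in> V" and h: "homeomorphism U V \<Theta> \<Phi>"
    and d: "\<And>y. y \<in> V \<Longrightarrow> (\<Phi> has_derivative g' y) (at y)"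
    and g': "\<And>y. y \<in> V \<Longrightarrow> g' y = inv (blinfun_apply (D (\<Phi> y)))"
    and b: "\<And>y. y \<in> V \<Longrightarrow> bij (blinfun_apply (D (\<Phi> y)))"
    using inverse_function_theorem [OF S(1) 1 2 S(2) 3] by metis
  have eq: "\<exists>X. (\<Phi> has_derivative (\<lambda>v. X *v v)) (at y) \<and> jac \<Theta> (\<Phi> y) ** X = mat 1" if y: "y \<in> V" for y
  proof -
    let ?J = "jac \<Theta> (\<Phi> y)"
    have bij: "bij ((*v) ?J)" using b [OF y] by (simp add: D)
    have "\<forall>x. ?J *v x = 0 \<longrightarrow> x = 0" using bij by (metis bij_betw_def injD matrix_vector_mult_0_right)
    then have "det ?J \<noteq> 0" by (simp add: det_nonzero_iff_kernel)
    then obtain X where X: "?J ** X = mat 1" "X ** ?J = mat 1"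
      using invertible_det_nz [of ?J] by (auto simp: invertible_def)
    have "inv ((*v) ?J) = (\<lambda>v. X *v v)"
      by (rule inv_unique_comp) (auto simp: fun_eq_iff matrix_vector_mul_assoc X)
    then have "g' y = (\<lambda>v. X *v v)" using g' [OF y] by (simp add: D)
    then show ?thesis using d [OF y] X by auto
  qed
  have 0: "\<Phi> 0 = 0" using h U(3) \<Theta>(2) by (auto simp: homeomorphism_def)
  show ?thesis
  proof (intro exI [of _ V] exI [of _ \<Phi>] conjI ballI)
    show "holv V \<Phi>" by (rule holvI) (use eq in blast)
    show "\<Phi> ` V \<subseteq> S" using h U(2) by (auto simp: homeomorphism_def)
    show "0 \<in> V" using V(2) \<Theta>(2) by simp
    fix w assume w: "w \<in> V"
    show "\<Theta> (\<Phi> w) = w" using h w by (auto simp: homeomorphism_def)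
    obtain X where X: "(\<Phi> has_derivative (\<lambda>v. X *v v)) (at w)" "jac \<Theta> (\<Phi> w) ** X = mat 1" using eq [OF w] by blast
    from X show "jac \<Theta> (\<Phi> w) ** jac \<Phi> w = mat 1" unfolding jac_eqI [OF X(1)] by simp
  qed (rule V(1) 0)+
qed

section \<open>Euler pairs\<close>

declare transpose_matrix_vector [simp del]

text \<open>The relation and the isolatedness are imposed on the whole of one open set
  \<open>S\<close>, so that compactness arguments have a fixed domain. That \<open>G\<close>
  vanishes at \<open>0\<close> is a consequence, proved in \<open>euler_field_zero\<close>.\<close>

definition euler_pair :: "(complex ^ 'n) set \<Rightarrow> (complex ^ 'n \<Rightarrow> complex) \<Rightarrow> (complex ^ 'n \<Rightarrow> complex ^ 'n) \<Rightarrow> bool" where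
  "euler_pair S h G \<longleftrightarrow> open S \<and> 0 \<in> S \<and> hol S h \<and> holv S G \<and>
     (\<forall>z\<in>S. h z = cdot (G z) (gradient h z)) \<and> (\<forall>z\<in>S. gradient h z = 0 \<longleftrightarrow> z = 0)"

lemma euler_pairD:
  assumes "euler_pair S h G"
  shows "open S" "0 \<in> S" "hol S h" "holv S G" "\<And>z. z \<in> S \<Longrightarrow> h z = cdot (G z) (gradient h z)"
    "\<And>z. z \<in> S \<Longrightarrow> gradient h z = 0 \<longleftrightarrow> z = 0" "gradient h 0 = 0" "holv S (gradient h)"
  using assms holv_gradient [of S h] by (simp_all add: euler_pair_def)

lemma euler_derivative:
  assumes E: "euler_pair S h G" and z: "z \<in> S"
  shows "jac (gradient h) z *v G z = gradient h z - transpose (jac G z) *v gradient h z"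
proof -
  define p where "p = gradient h"
  note D = euler_pairD [OF E]
  have dG: "(G has_derivative (\<lambda>v. jac G z *v v)) (at z)" by (rule holv_has_derivative [OF D(4) z])
  have dp: "(p has_derivative (\<lambda>v. jac p z *v v)) (at z)"
    unfolding p_def by (rule holv_has_derivative [OF D(8) z])
  have eq: "(\<lambda>v. cdot (G z) (jac p z *v v) + cdot (jac G z *v v) (p z))
      = cdot (transpose (jac p z) *v G z + transpose (jac G z) *v p z)"
    by (simp add: fun_eq_iff cdot_transpose cdot.add_left cdot_commute [of "jac G z *v _"])
  have "((\<lambda>z. cdot (G z) (p z)) has_derivative cdot (transpose (jac p z) *v G z + transpose (jac G z) *v p z)) (at z)"
    using cdot.FDERIV [OF dG dp] unfolding eq .
  then have "(h has_derivative cdot (transpose (jac p z) *v G z + transpose (jac G z) *v p z)) (at z)"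
    by (rule has_derivative_transform_within_open [OF _ D(1) z]) (simp add: D(5) p_def)
  from gradient_eqI [OF this] have "p z = transpose (jac p z) *v G z + transpose (jac G z) *v p z"
    by (simp add: p_def)
  moreover have "transpose (jac p z) = jac p z" unfolding p_def by (rule hessian_symmetric [OF D(1,3) z])
  ultimately show ?thesis unfolding p_def [symmetric] by (simp add: algebra_simps)
qed

lemma norm_transpose_le:
  fixes M :: "complex ^ 'n ^ 'n"
  assumes "\<And>v. norm (M *v v) \<le> K * norm v"
  shows "norm (transpose M *v q) \<le> K * norm q"
proof -
  obtain u where u: "norm u = 1" "cdot u (transpose M *v q) = of_real (norm (transpose M *v q))"
    using dual_vector_exists by blast
  have "cdot u (transpose M *v q) = cdot q (M *v u)" 
    using cdot_transpose [of q M u] by (simp add: cdot_commute)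
  then have "norm (transpose M *v q) = norm (cdot q (M *v u))" using u(2) by (metis norm_of_real abs_norm_cancel)
  also have "\<dots> \<le> norm q * norm (M *v u)" by (rule norm_cdot_le)
  also have "\<dots> \<le> norm q * K" using assms [of u] u(1) by (intro mult_left_mono) auto
  finally show ?thesis by (simp add: mult.commute)
qed

text \<open>By \<open>euler_derivative\<close>, one explicit Euler step along \<open>G\<close>
  changes the gradient by a linear map applied to the gradient itself, up to an error that is
  quadratic in the step with a uniform constant.\<close>

lemma euler_pair_bounds:
  assumes E: "euler_pair S h G"
  shows "\<exists>r>0. \<exists>C\<ge>1. cball 0 (2 * r) \<subseteq> S \<and> (\<forall>z. norm z \<le> 2 * r \<longrightarrow> norm (G z) \<le> C) \<and>
    (\<forall>z c. norm z \<le> r \<longrightarrow> norm c * C \<le> r / 2 \<longrightarrow>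
       norm (gradient h (z + c *s G z) - (gradient h z + c *s (gradient h z - transpose (jac G z) *v gradient h z))) \<le> C * (norm c)\<^sup>2) \<and>
    (\<forall>z q. norm z \<le> r \<longrightarrow> norm (transpose (jac G z) *v q) \<le> C * norm q)"
proof -
  note D = euler_pairD [OF E]
  obtain r1 C1 where 1: "0 < r1" "0 \<le> C1" "cball 0 (2 * r1) \<subseteq> S" "\<And>z. norm z \<le> 2 * r1 \<Longrightarrow> norm (G z) \<le> C1"
    using holv_local_bounds [OF D(1,2,4)] by blast
  obtain r2 C2 where 2: "0 < r2" "0 \<le> C2" "cball 0 (2 * r2) \<subseteq> S"
    "\<And>z y. norm z \<le> r2 \<Longrightarrow> norm y \<le> r2 / 2 \<Longrightarrow> norm (gradient h (z + y) - gradient h z - jac (gradient h) z *v y) \<le> C2 * (norm y)\<^sup>2"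
    using holv_local_bounds [OF D(1,2,8)] by blast
  define r where "r = min r1 r2"
  define C where "C = 1 + C1 + C2 * C1\<^sup>2 + C1 / r"
  have r: "0 < r" "r \<le> r1" "r \<le> r2" using 1 2 by (auto simp: r_def)
  have C: "1 \<le> C" "C1 \<le> C" "C2 * C1\<^sup>2 \<le> C" "C1 / r \<le> C"
    using 1(2) 2(2) r(1) by (simp_all add: C_def)
  have G: "norm (G z) \<le> C1" if "norm z \<le> 2 * r" for z using 1(4) [of z] that r by simp
  have "norm (gradient h (z + c *s G z) - (gradient h z + c *s (gradient h z - transpose (jac G z) *v gradient h z))) \<le> C * (norm c)\<^sup>2"
    if z: "norm z \<le> r" and c: "norm c * C \<le> r / 2" for z c
  proof -
    have Gz: "norm (G z) \<le> C1" using G [of z] z r(1) by simp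
    have n: "norm (c *s G z) \<le> norm c * C1" using Gz by (simp add: mult_left_mono)
    also have "\<dots> \<le> norm c * C" using C(2) by (intro mult_left_mono) auto
    finally have "norm (c *s G z) \<le> r2 / 2" using c r(3) by simp
    with z r(3) have "norm (gradient h (z + c *s G z) - gradient h z - jac (gradient h) z *v (c *s G z)) \<le> C2 * (norm (c *s G z))\<^sup>2"
      by (intro 2(4)) auto
    also have "\<dots> \<le> C2 * (norm c * C1)\<^sup>2" using n 2(2) by (intro mult_left_mono power_mono) auto
    also have "\<dots> \<le> C * (norm c)\<^sup>2"
      using mult_right_mono [OF C(3), of "(norm c)\<^sup>2"] by (simp add: power_mult_distrib mult_ac)
    moreover have "z \<in> S" using z r 1(1,3) by auto
    then have "jac (gradient h) z *v (c *s G z) = c *s (gradient h z - transpose (jac G z) *v gradient h z)"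
      unfolding vector_scalar_commute using euler_derivative [OF E] by simp
    ultimately show ?thesis by (simp add: algebra_simps)
  qed
  moreover have "norm (transpose (jac G z) *v q) \<le> C * norm q" if z: "norm z \<le> r" for z q
  proof (rule norm_transpose_le)
    fix v
    have zw: "norm (z + w) \<le> 2 * r" if "norm w \<le> r" for w using norm_triangle_ineq [of z w] z that by linarith
    have "norm (jac G z *v v) \<le> C1 / r * norm v"
    proof (rule cauchy_jacobian [OF D(4) _ r(1)])
      show "z + w \<in> S" if "norm w \<le> r" for w using zw [OF that] r(2) 1(3) by auto
      show "norm (G (z + w)) \<le> C1" if "norm w \<le> r" for w by (rule G [OF zw [OF that]])
    qed
    also have "\<dots> \<le> C * norm v" using C(4) by (intro mult_right_mono) auto
    finally show "norm (jac G z *v v) \<le> C * norm v" .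
  qed
  moreover have "cball 0 (2 * r) \<subseteq> S"
  proof -
    have "cball (0 :: complex ^ 'a) (2 * r) \<subseteq> cball 0 (2 * r1)" using r by (intro subset_cball) simp
    then show ?thesis using 1(3) by blast
  qed
  moreover have "\<forall>z. norm z \<le> 2 * r \<longrightarrow> norm (G z) \<le> C" using G C(2) by (meson order_trans)
  ultimately show ?thesis using r(1) C(1) by blast
qed

lemma gradient_annulus_bound:
  assumes E: "euler_pair S h G" and R: "cball 0 R \<subseteq> S" and e: "0 < e"
  shows "\<exists>m>0. \<forall>z. e \<le> norm z \<longrightarrow> norm z \<le> R \<longrightarrow> m \<le> norm (gradient h z)"
proof -
  note D = euler_pairD [OF E]
  define K where "K = cball (0 :: complex ^ 'a) R - ball 0 e"
  have K: "compact K" unfolding K_def by (intro compact_diff) auto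
  have KS: "K \<subseteq> S" using R by (auto simp: K_def)
  have c: "continuous_on K (\<lambda>z. norm (gradient h z))"
    by (intro continuous_on_norm continuous_on_subset [OF continuous_on_gradient [OF D(1,3)] KS])
  show ?thesis
  proof (cases "K = {}")
    case True
    have "\<not> (e \<le> norm z \<and> norm z \<le> R)" for z :: "complex ^ 'a"
    proof
      assume "e \<le> norm z \<and> norm z \<le> R"
      then have "z \<in> K" by (simp add: K_def)
      with True show False by simp
    qed
    then show ?thesis by (intro exI [of _ 1]) auto
  next
    case False
    obtain x where x: "x \<in> K" "\<And>y. y \<in> K \<Longrightarrow> norm (gradient h x) \<le> norm (gradient h y)"
      using continuous_attains_inf [OF K False c] by blast
    have "e \<le> norm x" using x(1) by (simp add: K_def)
    then have "x \<noteq> 0" using e by auto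
    then have "gradient h x \<noteq> 0" using D(6) [of x] x(1) KS by auto
    then show ?thesis using x(2) by (intro exI [of _ "norm (gradient h x)"]) (auto simp: K_def)
  qed
qed

lemma one_plus_power_le_exp: "0 \<le> (x::real) \<Longrightarrow> (1 + x) ^ k \<le> exp (real k * x)"
  using power_mono [of "1 + x" "exp x" k] exp_ge_add_one_self [of x] by (simp add: exp_of_nat_mult)

text \<open>Along an integral curve \<open>u\<close> of \<open>G\<close> the gradient solves a linear equation; if \<open>G 0 \<noteq> 0\<close> it would
  vanish along the curve through \<open>0\<close>. The curve is replaced by Euler polygons.\<close>

lemma euler_field_zero:
  assumes E: "euler_pair S h G"
  shows "G 0 = 0"
proof (rule ccontr)
  assume G0: "G 0 \<noteq> 0"
  note D = euler_pairD [OF E]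
  define p where "p = gradient h"
  define c where "c = G 0"
  obtain r C where rC: "0 < r" "1 \<le> C" "cball 0 (2 * r) \<subseteq> S" "\<And>z. norm z \<le> 2 * r \<Longrightarrow> norm (G z) \<le> C"
    "\<And>z t. norm z \<le> r \<Longrightarrow> norm t * C \<le> r / 2 \<Longrightarrow>
       norm (p (z + t *s G z) - (p z + t *s (p z - transpose (jac G z) *v p z))) \<le> C * (norm t)\<^sup>2"
    "\<And>z q. norm z \<le> r \<Longrightarrow> norm (transpose (jac G z) *v q) \<le> C * norm q"
    using euler_pair_bounds [OF E] unfolding p_def by metis
  have "isCont G 0" using holv_continuous_on [OF D(4)] D(1,2) by (simp add: continuous_on_eq_continuous_at)
  then obtain r1 where r1: "0 < r1" "\<And>z. norm z < r1 \<Longrightarrow> norm (G z - c) < norm c / 2"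
    using G0 unfolding continuous_at_eps_delta c_def dist_norm
    by (metis diff_zero half_gt_zero_iff zero_less_norm_iff)
  \<comment> \<open>Up to time \<open>s\<close> the polygon stays where \<open>G\<close> differs
    from \<open>c\<close> by less than half of \<open>norm c\<close>, so at time \<open>s\<close> it
    is at distance at least \<open>e\<close> from \<open>0\<close>.\<close>
  define s where "s = min r r1 / (2 * C)"
  have s: "0 < s" "s * C < r1" "s * C \<le> r / 2" using rC(1,2) r1(1) by (auto simp: s_def field_simps min_def)
  define e where "e = s * norm c / 2"
  have e: "0 < e" using s(1) G0 by (simp add: e_def c_def)
  obtain m where m: "0 < m" "\<And>z. e \<le> norm z \<Longrightarrow> norm z \<le> r \<Longrightarrow> m \<le> norm (p z)"
  proof -
    have "cball 0 r \<subseteq> S" using subset_cball [of r "2 * r" "0 :: complex ^ 'a"] rC(1,3) by auto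
    from gradient_annulus_bound [OF E this e] show ?thesis using that unfolding p_def by blast
  qed
  define K where "K = 1 + C"
  define Q where "Q = C * s\<^sup>2 * exp (s * K)"
  obtain N :: nat where N: "Q / m < real N" using reals_Archimedean2 by blast
  have Q: "0 < Q" using s(1) rC(2) by (simp add: Q_def)
  have N0: "0 < real N" using N Q m(1) by (meson divide_pos_pos less_trans)
  define t where "t = s / real N"
  have t: "0 < t" "real N * t = s" using s(1) N0 by (simp_all add: t_def)
  have ts: "t \<le> s"
    unfolding t_def using s(1) N0 by (simp add: field_simps)
  define u where "u k = ((\<lambda>z. z + of_real t *s G z) ^^ k) 0" for k
  have u0: "u 0 = 0" and uS: "u (Suc k) = u k + of_real t *s G (u k)" for k by (simp_all add: u_def)
  \<comment> \<open>Position, deviation from the straight line with velocity \<open>c\<close>, and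
    gradient: the last starts at \<open>0\<close> and collects one error \<open>C * t^2\<close> per
    step, amplified by \<open>1 + t * K\<close>.\<close>
  have main: "norm (u k) \<le> real k * t * C \<and> norm (u k - of_real (real k * t) *s c) \<le> real k * t * (norm c / 2) \<and>
      norm (p (u k)) \<le> real k * (C * t\<^sup>2) * (1 + t * K) ^ k" if "k \<le> N" for k
    using that
  proof (induction k)
    case 0
    show ?case using D(7) by (simp add: u0 p_def)
  next
    case (Suc k)
    then have IH: "norm (u k) \<le> real k * t * C" "norm (u k - of_real (real k * t) *s c) \<le> real k * t * (norm c / 2)"
      "norm (p (u k)) \<le> real k * (C * t\<^sup>2) * (1 + t * K) ^ k" by auto
    have "real k * t \<le> s" unfolding t(2) [symmetric] using Suc(2) t(1) by (intro mult_right_mono) auto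
    then have "real k * t * C \<le> s * C" using rC(2) by (intro mult_right_mono) auto
    then have uk: "norm (u k) < r1" "norm (u k) \<le> r" using IH(1) s rC(1) by auto
    have G1: "norm (G (u k)) \<le> C" using rC(4) [of "u k"] uk(2) rC(1) by simp
    have 1: "norm (u (Suc k)) \<le> real (Suc k) * t * C"
    proof -
      have "norm (u (Suc k)) \<le> norm (u k) + norm (of_real t *s G (u k))" unfolding uS by (rule norm_triangle_ineq)
      also have "norm (of_real t *s G (u k)) \<le> t * C" using t(1) G1 by simp
      finally show ?thesis using IH(1) by (simp add: algebra_simps)
    qed
    have 2: "norm (u (Suc k) - of_real (real (Suc k) * t) *s c) \<le> real (Suc k) * t * (norm c / 2)"
    proof -
      have eq: "u (Suc k) - of_real (real (Suc k) * t) *s c = (u k - of_real (real k * t) *s c) + of_real t *s (G (u k) - c)"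
        unfolding uS by (simp add: vec_eq_iff algebra_simps)
      have "norm (u (Suc k) - of_real (real (Suc k) * t) *s c) \<le> norm (u k - of_real (real k * t) *s c) + norm (of_real t *s (G (u k) - c))"
        unfolding eq by (rule norm_triangle_ineq)
      also have "norm (of_real t *s (G (u k) - c)) \<le> t * (norm c / 2)"
        unfolding norm_smult_vec norm_of_real abs_of_pos [OF t(1)] using t(1) r1(2) [OF uk(1)] by (intro mult_left_mono) auto
      finally show ?thesis using IH(2) by (simp add: algebra_simps)
    qed
    have 3: "norm (p (u (Suc k))) \<le> real (Suc k) * (C * t\<^sup>2) * (1 + t * K) ^ Suc k"
    proof -
      have tC: "norm (of_real t :: complex) * C \<le> r / 2"
      proof -
        have "t * C \<le> s * C" using ts rC(2) by (intro mult_right_mono) auto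
        then show ?thesis using s(3) t(1) by simp
      qed
      have "norm (p (u k) + of_real t *s (p (u k) - transpose (jac G (u k)) *v p (u k)))
          \<le> norm (p (u k)) + t * (norm (p (u k)) + C * norm (p (u k)))"
      proof -
        have "norm (of_real t *s (p (u k) - transpose (jac G (u k)) *v p (u k))) \<le> t * (norm (p (u k)) + C * norm (p (u k)))"
          unfolding norm_smult_vec norm_of_real abs_of_pos [OF t(1)]
          using norm_triangle_ineq4 [of "p (u k)" "transpose (jac G (u k)) *v p (u k)"] rC(6) [OF uk(2), of "p (u k)"] t(1)
          by (intro mult_left_mono) auto
        then show ?thesis using norm_triangle_ineq [of "p (u k)"] by (meson add_left_mono order_trans)
      qed
      moreover have "norm (p (u (Suc k)) - (p (u k) + of_real t *s (p (u k) - transpose (jac G (u k)) *v p (u k)))) \<le> C * t\<^sup>2"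
        using rC(5) [OF uk(2) tC] t(1) by (simp add: uS)
      ultimately have "norm (p (u (Suc k))) \<le> norm (p (u k)) * (1 + t * K) + C * t\<^sup>2"
        using norm_triangle_sub [of "p (u (Suc k))" "p (u k) + of_real t *s (p (u k) - transpose (jac G (u k)) *v p (u k))"]
        by (simp add: K_def algebra_simps)
      also have "\<dots> \<le> real k * (C * t\<^sup>2) * (1 + t * K) ^ k * (1 + t * K) + C * t\<^sup>2"
        using IH(3) t(1) rC(2) by (intro add_right_mono mult_right_mono) (auto simp: K_def)
      also have "\<dots> \<le> real k * (C * t\<^sup>2) * (1 + t * K) ^ Suc k + C * t\<^sup>2 * (1 + t * K) ^ Suc k"
      proof -
        have "1 \<le> (1 + t * K) ^ Suc k" using t(1) rC(2) by (intro one_le_power) (simp add: K_def)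
        from mult_left_mono [OF this, of "C * t\<^sup>2"] show ?thesis using rC(2) by (simp add: mult_ac)
      qed
      also have "\<dots> = real (Suc k) * (C * t\<^sup>2) * (1 + t * K) ^ Suc k" by (simp add: algebra_simps)
      finally show ?thesis .
    qed
    show ?case using 1 2 3 by blast
  qed
  note mN = main [OF order_refl, unfolded t(2)]
  have u: "norm (u N) \<le> s * C" "norm (u N - of_real s *s c) \<le> s * (norm c / 2)"
    "norm (p (u N)) \<le> real N * (C * t\<^sup>2) * (1 + t * K) ^ N"
    using mN by blast+
  have "s * norm c \<le> norm (u N) + norm (u N - of_real s *s c)"
    using norm_triangle_sub [of "of_real s *s c" "u N"] s(1) by (simp add: norm_minus_commute)
  then have "e \<le> norm (u N)" using u(2) by (simp add: e_def)
  moreover have "norm (u N) \<le> r" using u(1) s(3) rC(1) by simp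
  \<comment> \<open>At the end point the gradient is at least \<open>m\<close>, while
    \<open>N\<close> errors of order \<open>1 / N^2\<close> add up to at most
    \<open>Q / N\<close>.\<close>
  ultimately have "m \<le> norm (p (u N))" by (rule m(2))
  also have "\<dots> \<le> real N * (C * t\<^sup>2) * (1 + t * K) ^ N" by (rule u(3))
  also have "\<dots> \<le> real N * (C * t\<^sup>2) * exp (real N * (t * K))"
    using t(1) rC(2) by (intro mult_left_mono one_plus_power_le_exp) (auto simp: K_def)
  also have "real N * (t * K) = s * K" unfolding t(2) [symmetric] by simp
  also have "real N * (C * t\<^sup>2) * exp (s * K) = Q / real N"
    using N0 by (simp add: Q_def t_def power2_eq_square)
  finally have "m * real N \<le> Q" using N0 by (simp add: field_simps)
  then show False using N m(1) by (simp add: field_simps)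
qed

text \<open>The identity of \<open>euler_derivative\<close> differentiated at \<open>0\<close>. The
  second derivatives of the gradient and of \<open>G\<close> come with the factors
  \<open>G 0\<close> and \<open>gradient h 0\<close>, which both vanish.\<close>

lemma euler_hessian:
  assumes E: "euler_pair S h G"
  shows "transpose (jac G 0) *v (jac (gradient h) 0 *v x) + jac (gradient h) 0 *v (jac G 0 *v x) = jac (gradient h) 0 *v x"
proof -
  note D = euler_pairD [OF E]
  define p where "p = gradient h"
  define B where "B = jac p 0"
  have G0: "G 0 = 0" by (rule euler_field_zero [OF E])
  have "(transpose (jac G 0) *v (B *v x) + B *v (jac G 0 *v x)) $ i = (B *v x) $ i" for i
  proof -
    have hp: "hol S (\<lambda>z. p z $ j)" for j unfolding p_def by (rule hol_gradient [OF D(1,3)])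
    have hG: "hol S (\<lambda>z. G z $ j)" for j using D(4) by (simp add: holv_def)
    have hjp: "hol S (\<lambda>z. jac p z $ i $ j)" for j unfolding p_def by (rule hol_jac [OF D(1,8)])
    have hjG: "hol S (\<lambda>z. jac G z $ j $ i)" for j by (rule hol_jac [OF D(1,4)])
    have prod: "((\<lambda>z. a z * b z) has_derivative cdot (a 0 *s gradient b 0)) (at 0)"
      if "hol S a" "hol S b" "b 0 = 0" for a b
      by (rule has_derivative_eq_rhs [OF has_derivative_mult [OF hol_has_derivative [OF that(1) D(2)] hol_has_derivative [OF that(2) D(2)]]])
        (simp add: fun_eq_iff that(3))
    have grow: "gradient (\<lambda>z. F z $ j) 0 = jac F 0 $ j" for F :: "complex ^ 'a \<Rightarrow> complex ^ 'a" and j by (simp add: jac_def)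
    have p0: "p 0 $ j = 0" and G0': "G 0 $ j = 0" for j using D(7) G0 by (simp_all add: p_def)
    have l: "((\<lambda>z. (\<Sum>j\<in>UNIV. jac p z $ i $ j * G z $ j) + (\<Sum>j\<in>UNIV. jac G z $ j $ i * p z $ j)) has_derivative
        (\<lambda>v. (\<Sum>j\<in>UNIV. cdot (jac p 0 $ i $ j *s jac G 0 $ j) v) + (\<Sum>j\<in>UNIV. cdot (jac G 0 $ j $ i *s jac p 0 $ j) v))) (at 0)"
      by (intro has_derivative_add has_derivative_sum prod [OF hjp hG G0', unfolded grow] prod [OF hjG hp p0, unfolded grow])
    have "(\<Sum>j\<in>UNIV. jac p z $ i $ j * G z $ j) + (\<Sum>j\<in>UNIV. jac G z $ j $ i * p z $ j) = p z $ i" if "z \<in> S" for z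
      using arg_cong [OF euler_derivative [OF E that], of "\<lambda>v. v $ i"]
      by (simp add: p_def [symmetric] matrix_vector_mult_def transpose_def)
    then have "((\<lambda>z. p z $ i) has_derivative
        (\<lambda>v. (\<Sum>j\<in>UNIV. cdot (jac p 0 $ i $ j *s jac G 0 $ j) v) + (\<Sum>j\<in>UNIV. cdot (jac G 0 $ j $ i *s jac p 0 $ j) v))) (at 0)"
      by (rule has_derivative_transform_within_open [OF l D(1,2)])
    from has_derivative_unique [OF this hol_has_derivative [OF hp D(2)]]
    have "(\<Sum>j\<in>UNIV. cdot (jac p 0 $ i $ j *s jac G 0 $ j) x) + (\<Sum>j\<in>UNIV. cdot (jac G 0 $ j $ i *s jac p 0 $ j) x) = cdot (jac p 0 $ i) x"
      unfolding grow by (rule fun_cong)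
    moreover have "(B *v (jac G 0 *v x)) $ i = (\<Sum>j\<in>UNIV. cdot (jac p 0 $ i $ j *s jac G 0 $ j) x)"
      unfolding B_def matrix_vector_mult_def [of "jac p 0"] by (simp add: matrix_vector_cdot)
    moreover have "(transpose (jac G 0) *v (B *v x)) $ i = (\<Sum>j\<in>UNIV. cdot (jac G 0 $ j $ i *s jac p 0 $ j) x)"
      unfolding B_def matrix_vector_mult_def [of "transpose (jac G 0)"] by (simp add: matrix_vector_cdot transpose_def)
    moreover have "(B *v x) $ i = cdot (jac p 0 $ i) x" by (simp add: B_def matrix_vector_cdot)
    ultimately show ?thesis by (simp add: add.commute)
  qed
  then show ?thesis unfolding B_def p_def by (simp add: vec_eq_iff)
qed

text \<open>Gradients transform as covectors, by the transposed Jacobian, and \<open>G\<close> as a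
  vector field, by the inverse \<open>N\<close> of the Jacobian, so their pairing is
  invariant.\<close>

lemma euler_pullback:
  assumes E: "euler_pair S h G" and W: "open W" "0 \<in> W" "holv W \<Phi>" "\<Phi> ` W \<subseteq> S"
    and \<Phi>0: "\<And>w. w \<in> W \<Longrightarrow> \<Phi> w = 0 \<longleftrightarrow> w = 0" and N: "\<And>w. w \<in> W \<Longrightarrow> jac \<Phi> w ** N w = mat 1"
  shows "hol W (\<lambda>w. h (\<Phi> w))"
    and "\<And>w. w \<in> W \<Longrightarrow> gradient (\<lambda>w. h (\<Phi> w)) w = transpose (jac \<Phi> w) *v gradient h (\<Phi> w)"
    and "\<And>w. w \<in> W \<Longrightarrow> h (\<Phi> w) = cdot (N w *v G (\<Phi> w)) (gradient (\<lambda>w. h (\<Phi> w)) w)"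
    and "\<And>w. w \<in> W \<Longrightarrow> gradient (\<lambda>w. h (\<Phi> w)) w = 0 \<longleftrightarrow> w = 0"
proof -
  note D = euler_pairD [OF E]
  show "hol W (\<lambda>w. h (\<Phi> w))" by (rule hol_compose [OF W(3) D(3) W(4)])
  fix w assume w: "w \<in> W"
  have wS: "\<Phi> w \<in> S" using W(4) w by auto
  show g: "gradient (\<lambda>w. h (\<Phi> w)) w = transpose (jac \<Phi> w) *v gradient h (\<Phi> w)"
    by (rule gradient_eqI [OF gradient_compose [OF holv_has_derivative [OF W(3) w] hol_has_derivative [OF D(3) wS]]])
  have "cdot (N w *v G (\<Phi> w)) (gradient (\<lambda>w. h (\<Phi> w)) w) = cdot (gradient h (\<Phi> w)) (jac \<Phi> w *v (N w *v G (\<Phi> w)))"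
    unfolding g using cdot_transpose [of "gradient h (\<Phi> w)" "jac \<Phi> w" "N w *v G (\<Phi> w)"] by (simp add: cdot_commute)
  also have "\<dots> = cdot (gradient h (\<Phi> w)) (G (\<Phi> w))" by (simp add: matrix_vector_mul_assoc N [OF w])
  finally show "h (\<Phi> w) = cdot (N w *v G (\<Phi> w)) (gradient (\<lambda>w. h (\<Phi> w)) w)"
    using D(5) [OF wS] by (simp add: cdot_commute)
  have "transpose (N w) ** transpose (jac \<Phi> w) = mat 1"
    by (simp add: matrix_transpose_mul [symmetric] N [OF w] transpose_mat)
  then have "transpose (jac \<Phi> w) *v q = 0 \<longleftrightarrow> q = 0" for q
    by (metis matrix_vector_mul_assoc matrix_vector_mul_lid matrix_vector_mult_0_right)
  then show "gradient (\<lambda>w. h (\<Phi> w)) w = 0 \<longleftrightarrow> w = 0"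
    unfolding g using D(6) [OF wS] \<Phi>0 [OF w] by simp
qed

section \<open>Coordinates in which the linear part is almost diagonal\<close>

definition diag_apply :: "('n \<Rightarrow> complex) \<Rightarrow> complex ^ 'n \<Rightarrow> complex ^ 'n" where
  "diag_apply \<alpha> q = (\<chi> i. \<alpha> i * q $ i)"

lemma diag_apply_nth [simp]: "diag_apply \<alpha> q $ i = \<alpha> i * q $ i"
  by (simp add: diag_apply_def)

lemma near_diagonal_error:
  fixes M :: "complex ^ 'n ^ 'n"
  assumes "\<And>i j. norm (M $ i $ j - (if i = j then \<alpha> i else 0)) \<le> \<epsilon>"
  shows "norm (M *v q - diag_apply \<alpha> q) \<le> (real CARD('n))\<^sup>2 * \<epsilon> * norm q"
proof -
  have c: "norm ((M *v q - diag_apply \<alpha> q) $ i) \<le> real CARD('n) * \<epsilon> * norm q" for i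
  proof -
    have "(\<Sum>j\<in>UNIV. (if i = j then \<alpha> i else 0) * q $ j) = (\<Sum>j\<in>UNIV. if i = j then \<alpha> i * q $ j else 0)"
      by (rule sum.cong) auto
    then have "(M *v q - diag_apply \<alpha> q) $ i = (\<Sum>j\<in>UNIV. (M $ i $ j - (if i = j then \<alpha> i else 0)) * q $ j)"
      by (simp add: matrix_vector_mult_def left_diff_distrib sum_subtractf)
    then have "norm ((M *v q - diag_apply \<alpha> q) $ i) \<le> (\<Sum>j\<in>UNIV. norm ((M $ i $ j - (if i = j then \<alpha> i else 0)) * q $ j))"
      by (simp only: norm_sum)
    also have "\<dots> \<le> (\<Sum>j\<in>(UNIV :: 'n set). \<epsilon> * norm q)"
    proof (rule sum_mono)
      fix j
      show "norm ((M $ i $ j - (if i = j then \<alpha> i else 0)) * q $ j) \<le> \<epsilon> * norm q"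
        unfolding norm_mult using assms [of i j] Finite_Cartesian_Product.norm_nth_le [of q j]
        by (intro mult_mono) (auto intro: order_trans [OF norm_ge_zero])
    qed
    finally show ?thesis by simp
  qed
  have "norm (M *v q - diag_apply \<alpha> q) \<le> (\<Sum>i\<in>UNIV. norm ((M *v q - diag_apply \<alpha> q) $ i))"
    unfolding norm_vec_def by (rule L2_set_le_sum) simp
  also have "\<dots> \<le> (\<Sum>i\<in>(UNIV :: 'n set). real CARD('n) * \<epsilon> * norm q)" by (rule sum_mono) (rule c)
  finally show ?thesis by (simp add: power2_eq_square mult_ac)
qed

text \<open>The estimate of \<open>G\<close> governs the motion of points, and the one with
  \<open>transpose\<close> the motion of the gradient, by \<open>euler_derivative\<close>. The
  errors are relative to the norm, which makes them errors in exponential rates.\<close>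

definition almost_diagonal :: "(complex ^ 'n \<Rightarrow> complex ^ 'n) \<Rightarrow> ('n \<Rightarrow> complex) \<Rightarrow> real \<Rightarrow> real \<Rightarrow> bool" where
  "almost_diagonal G \<alpha> \<delta> r \<longleftrightarrow> (\<forall>z. norm z \<le> r \<longrightarrow> norm (G z - diag_apply \<alpha> z) \<le> \<delta> * norm z \<and>
     (\<forall>q. norm (jac G z *v q - diag_apply \<alpha> q) \<le> \<delta> * norm q \<and>
          norm (transpose (jac G z) *v q - diag_apply \<alpha> q) \<le> \<delta> * norm q))"

lemma almost_diagonal_exists:
  fixes G :: "complex ^ 'n \<Rightarrow> complex ^ 'n"
  assumes S: "open S" "0 \<in> S" and G: "holv S G" "G 0 = 0" and \<delta>: "0 < \<delta>"
    and M: "\<And>i j. norm (jac G 0 $ i $ j - (if i = j then \<alpha> i else 0)) \<le> \<epsilon>" and \<epsilon>: "(real CARD('n))\<^sup>2 * (2 * \<epsilon>) \<le> \<delta> / 2" "0 < \<epsilon>"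
  shows "\<exists>r>0. cball 0 r \<subseteq> S \<and> almost_diagonal G \<alpha> \<delta> r"
proof -
  obtain r1 C where 1: "0 < r1" "0 \<le> C" "cball 0 (2 * r1) \<subseteq> S"
    "\<And>z y. norm z \<le> r1 \<Longrightarrow> norm y \<le> r1 / 2 \<Longrightarrow> norm (G (z + y) - G z - jac G z *v y) \<le> C * (norm y)\<^sup>2"
    using holv_local_bounds [OF S G(1)] by blast
  have "\<forall>\<^sub>F z in nhds 0. \<forall>i\<in>UNIV. \<forall>j\<in>UNIV. norm (jac G z $ i $ j - jac G 0 $ i $ j) < \<epsilon>"
  proof (intro eventually_ball_finite ballI finite)
    fix i j
    have "continuous_on S (\<lambda>z. jac G z $ i $ j)"
      using continuous_on_component [OF continuous_on_component [OF continuous_on_jac [OF S(1) G(1)]]] .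
    then have "isCont (\<lambda>z. jac G z $ i $ j) 0" using S by (simp add: continuous_on_eq_continuous_at)
    then show "\<forall>\<^sub>F z in nhds 0. norm (jac G z $ i $ j - jac G 0 $ i $ j) < \<epsilon>"
      using \<epsilon>(2) unfolding continuous_at_eps_delta eventually_nhds_0 dist_norm by auto
  qed
  then obtain r2 where 2: "0 < r2" "\<And>z i j. norm z < r2 \<Longrightarrow> norm (jac G z $ i $ j - jac G 0 $ i $ j) < \<epsilon>"
    unfolding eventually_nhds_0 by auto
  define r where "r = min (r1 / 2) (min (r2 / 2) (\<delta> / (2 * (C + 1))))"
  have r: "0 < r" "r \<le> r1 / 2" "r < r2" "C * r \<le> \<delta> / 2"
  proof -
    show "0 < r" using 1(1,2) 2(1) \<delta> by (simp add: r_def)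
    show "r \<le> r1 / 2" unfolding r_def by (rule min.cobounded1)
    show "r < r2" using 2(1) unfolding r_def by (simp add: min_less_iff_disj)
    have "C * r \<le> C * (\<delta> / (2 * (C + 1)))" using 1(2) by (intro mult_left_mono) (auto simp: r_def)
    also have "\<dots> \<le> \<delta> / 2" using 1(2) \<delta> by (simp add: field_simps)
    finally show "C * r \<le> \<delta> / 2" .
  qed
  have jz: "norm (jac G z $ i $ j - (if i = j then \<alpha> i else 0)) \<le> 2 * \<epsilon>" if "norm z \<le> r" for z i j
  proof -
    have "norm (jac G z $ i $ j - jac G 0 $ i $ j) < \<epsilon>" using 2(2) [of z i j] that r(3) by simp
    with M [of i j] norm_triangle_ineq [of "jac G z $ i $ j - jac G 0 $ i $ j" "jac G 0 $ i $ j - (if i = j then \<alpha> i else 0)"]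
    show ?thesis by simp
  qed
  have bd: "norm (jac G z *v q - diag_apply \<alpha> q) \<le> \<delta> / 2 * norm q" if "norm z \<le> r" for z q
    using near_diagonal_error [OF jz [OF that], of q] mult_right_mono [OF \<epsilon>(1), of "norm q"] by simp
  have jt: "norm (transpose (jac G z) $ i $ j - (if i = j then \<alpha> i else 0)) \<le> 2 * \<epsilon>" if "norm z \<le> r" for z i j
    using jz [OF that, of j i] by (cases "i = j") (simp_all add: transpose_def)
  have bt: "norm (transpose (jac G z) *v q - diag_apply \<alpha> q) \<le> \<delta> / 2 * norm q" if "norm z \<le> r" for z q
    using near_diagonal_error [OF jt [OF that], of q] mult_right_mono [OF \<epsilon>(1), of "norm q"] by simp
  have half: "\<delta> / 2 * norm q \<le> \<delta> * norm q" for q :: "complex ^ 'n" using \<delta> by (intro mult_right_mono) auto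
  have Gz: "norm (G z - diag_apply \<alpha> z) \<le> \<delta> * norm z" if z: "norm z \<le> r" for z
  proof -
    have "norm (G (0 + z) - G 0 - jac G 0 *v z) \<le> C * (norm z)\<^sup>2" using z r(1,2) 1(1) by (intro 1(4)) auto
    also have "\<dots> \<le> C * (r * norm z)" unfolding power2_eq_square using z 1(2) by (intro mult_left_mono mult_right_mono) auto
    also have "\<dots> \<le> \<delta> / 2 * norm z" using mult_right_mono [OF r(4), of "norm z"] by (simp add: mult_ac)
    finally have "norm (G z - jac G 0 *v z) \<le> \<delta> / 2 * norm z" using G(2) by simp
    moreover have "norm (jac G 0 *v z - diag_apply \<alpha> z) \<le> \<delta> / 2 * norm z" using bd [of 0 z] r(1) by simp
    ultimately show ?thesis
      using norm_triangle_ineq [of "G z - jac G 0 *v z" "jac G 0 *v z - diag_apply \<alpha> z"] by simp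
  qed
  have "cball 0 r \<subseteq> S"
    using subset_cball [of r "2 * r1" "0 :: complex ^ 'n"] r(2) 1(1,3) by auto
  moreover have "almost_diagonal G \<alpha> \<delta> r"
    unfolding almost_diagonal_def using Gz bd bt half by (meson order_trans)
  ultimately show ?thesis using r(1) by blast
qed

lemma euler_pair_diagonalize:
  fixes h :: "complex ^ 'n \<Rightarrow> complex"
  assumes E: "euler_pair S h G" and \<delta>: "0 < \<delta>"
  obtains T T' :: "complex ^ 'n ^ 'n" and r :: real and \<alpha> :: "'n \<Rightarrow> complex"
  where "T ** T' = mat 1" "T' ** T = mat 1" "0 < r"
    "\<And>i. \<exists>w. w \<noteq> 0 \<and> jac G 0 *v w = \<alpha> i *s w" "cball 0 r \<subseteq> {w. T *v w \<in> S}"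
    "euler_pair {w. T *v w \<in> S} (\<lambda>w. h (T *v w)) (\<lambda>w. T' *v G (T *v w))"
    "almost_diagonal (\<lambda>w. T' *v G (T *v w)) \<alpha> \<delta> r"
    "jac (\<lambda>w. T' *v G (T *v w)) 0 = T' ** jac G 0 ** T"
    "\<And>w. T *v w \<in> S \<Longrightarrow> gradient (\<lambda>w. h (T *v w)) w = transpose T *v gradient h (T *v w)"
proof -
  note D = euler_pairD [OF E]
  \<comment> \<open>A matrix with entries off by \<open>2 * \<epsilon>\<close> has error at most
    \<open>\<delta> / 2\<close>; the other half of \<open>\<delta>\<close> is left for the nonlinear
    part of \<open>G\<close>.\<close>
  define \<epsilon> where "\<epsilon> = \<delta> / (4 * (real CARD('n))\<^sup>2)"
  have n: "0 < (real CARD('n))\<^sup>2" by simp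
  have \<epsilon>: "0 < \<epsilon>" "(real CARD('n))\<^sup>2 * (2 * \<epsilon>) \<le> \<delta> / 2" using \<delta> n by (simp_all add: \<epsilon>_def field_simps)
  obtain T T' :: "complex ^ 'n ^ 'n" and \<alpha> where T: "T ** T' = mat 1" "T' ** T = mat 1"
    and ev: "\<forall>i. \<exists>w. w \<noteq> 0 \<and> jac G 0 *v w = \<alpha> i *s w"
    and near: "\<forall>i j. norm ((T' ** jac G 0 ** T) $ i $ j - (if i = j then \<alpha> i else 0)) \<le> \<epsilon>"
    using near_diagonal_form [OF \<epsilon>(1), of "jac G 0"] by blast
  define W where "W = {w. T *v w \<in> S}"
  have cT: "continuous_on UNIV (\<lambda>w. T *v w)" by (rule holv_continuous_on [OF holv_linear])
  have "open ((\<lambda>w. T *v w) -` S)" by (rule open_vimage [OF D(1) cT])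
  then have W: "open W" "0 \<in> W" using D(2) by (simp_all add: W_def vimage_def)
  have TW: "(\<lambda>w. T *v w) ` W \<subseteq> S" by (auto simp: W_def)
  have T0: "T *v w = 0 \<longleftrightarrow> w = 0" for w
    by (metis T(2) matrix_vector_mul_assoc matrix_vector_mul_lid matrix_vector_mult_0_right)
  have N: "jac (\<lambda>w. T *v w) w ** T' = mat 1" for w by (simp add: T)
  note P = euler_pullback [OF E W holv_linear TW T0 N]
  define G' where "G' w = T' *v G (T *v w)" for w
  have hG: "holv W G'"
    unfolding G'_def
  proof (rule holv_compose [OF _ holv_linear subset_UNIV])
    show "holv W (\<lambda>w. G (T *v w))" by (rule holv_compose [OF holv_linear D(4) TW])
  qed
  have "(G has_derivative (\<lambda>v. jac G 0 *v v)) (at (T *v 0))" using holv_has_derivative [OF D(4,2)] by simp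
  from has_derivative_compose [OF bounded_linear_imp_has_derivative [OF matrix_vector_mul_bounded_linear] this]
  have "((\<lambda>w. G (T *v w)) has_derivative (\<lambda>v. jac G 0 *v (T *v v))) (at 0)" .
  from has_derivative_compose [OF this bounded_linear_imp_has_derivative [OF matrix_vector_mul_bounded_linear]]
  have "((\<lambda>w. T' *v G (T *v w)) has_derivative (\<lambda>v. T' *v (jac G 0 *v (T *v v)))) (at 0)" .
  then have "(G' has_derivative (\<lambda>v. (T' ** jac G 0 ** T) *v v)) (at 0)"
    by (simp add: G'_def [abs_def] matrix_vector_mul_assoc matrix_mul_assoc)
  then have jG: "jac G' 0 = T' ** jac G 0 ** T" by (rule jac_eqI)
  have G'0: "G' 0 = 0" using euler_field_zero [OF E] by (simp add: G'_def)
  have near': "norm (jac G' 0 $ i $ j - (if i = j then \<alpha> i else 0)) \<le> \<epsilon>" for i j using near jG by simp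
  obtain r where r: "0 < r" "cball 0 r \<subseteq> W" "almost_diagonal G' \<alpha> \<delta> r"
    using almost_diagonal_exists [OF W hG G'0 \<delta> near' \<epsilon>(2,1)] by blast
  have EP: "euler_pair W (\<lambda>w. h (T *v w)) G'"
    unfolding euler_pair_def using W P(1,3,4) hG by (simp add: G'_def)
  have gr: "gradient (\<lambda>w. h (T *v w)) w = transpose T *v gradient h (T *v w)" if "T *v w \<in> S" for w
    using P(2) that by (simp add: W_def)
  show ?thesis
  proof (rule that [of T T' r \<alpha>])
    show "\<exists>w. w \<noteq> 0 \<and> jac G 0 *v w = \<alpha> i *s w" for i using ev by blast
  qed (use T r EP jG gr in \<open>simp_all add: W_def G'_def [abs_def]\<close>)
qed

section \<open>Growth of the gradient on cones\<close>

definition proj :: "'n set \<Rightarrow> complex ^ 'n \<Rightarrow> complex ^ 'n" where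
  "proj I z = (\<chi> i. if i \<in> I then z $ i else 0)"

lemma proj_nth [simp]: "proj I z $ i = (if i \<in> I then z $ i else 0)"
  by (simp add: proj_def)

lemma proj_UNIV [simp]: "proj UNIV z = z" and proj_empty [simp]: "proj {} z = 0"
  by (simp_all add: vec_eq_iff)

lemma proj_0 [simp]: "proj I 0 = 0"
  by (simp add: vec_eq_iff)

lemma norm_vec_sq: "(norm (z :: complex ^ 'n))\<^sup>2 = (\<Sum>i\<in>UNIV. (norm (z $ i))\<^sup>2)"
  by (simp add: norm_vec_def L2_set_def sum_nonneg)

lemma norm_proj_sq: "(norm (proj I z))\<^sup>2 + (norm (proj (- I) z))\<^sup>2 = (norm z)\<^sup>2"
  unfolding norm_vec_sq sum.distrib [symmetric] by (rule sum.cong) auto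

lemma norm_proj_le: "norm (proj I z) \<le> norm z"
  unfolding norm_vec_def by (rule L2_set_mono) auto

lemma bounded_linear_proj: "bounded_linear (proj I)"
  by (rule bounded_linear_intro [where K = 1]) (auto simp: vec_eq_iff norm_proj_le)

lemma inner_diag_apply_proj:
  "(c *s diag_apply \<alpha> z) \<bullet> proj I z = (\<Sum>i\<in>UNIV. if i \<in> I then Re (c * \<alpha> i) * (norm (z $ i))\<^sup>2 else 0)"
  unfolding inner_vec_def
proof (rule sum.cong)
  fix i
  have "(w * q) \<bullet> q = Re w * (norm q)\<^sup>2" for w q :: complex
    unfolding inner_complex_def cmod_power2 by (simp add: algebra_simps power2_eq_square)
  from this [of "c * \<alpha> i" "z $ i"]
  show "(c *s diag_apply \<alpha> z) $ i \<bullet> proj I z $ i = (if i \<in> I then Re (c * \<alpha> i) * (norm (z $ i))\<^sup>2 else 0)"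
    by (simp add: mult.assoc)
qed simp

lemma inner_diag_apply_proj_ge:
  assumes "\<And>i. i \<in> I \<Longrightarrow> a \<le> Re (c * \<alpha> i)"
  shows "a * (norm (proj I z))\<^sup>2 \<le> (c *s diag_apply \<alpha> z) \<bullet> proj I z"
  unfolding inner_diag_apply_proj norm_vec_sq sum_distrib_left
proof (rule sum_mono)
  fix i
  show "a * (norm (proj I z $ i))\<^sup>2 \<le> (if i \<in> I then Re (c * \<alpha> i) * (norm (z $ i))\<^sup>2 else 0)"
    by (cases "i \<in> I") (simp_all add: mult_right_mono [OF assms] del: times_complex.sel)
qed

lemma inner_diag_apply_proj_le:
  assumes "\<And>i. i \<in> I \<Longrightarrow> Re (c * \<alpha> i) \<le> a"
  shows "(c *s diag_apply \<alpha> z) \<bullet> proj I z \<le> a * (norm (proj I z))\<^sup>2"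
  unfolding inner_diag_apply_proj norm_vec_sq sum_distrib_left
proof (rule sum_mono)
  fix i
  show "(if i \<in> I then Re (c * \<alpha> i) * (norm (z $ i))\<^sup>2 else 0) \<le> a * (norm (proj I z $ i))\<^sup>2"
    by (cases "i \<in> I") (simp_all add: mult_right_mono [OF assms] del: times_complex.sel)
qed

lemma norm_sq_path_derivative:
  fixes u w :: "'a::real_inner"
  shows "((\<lambda>s. (norm (u + s *\<^sub>R w))\<^sup>2) has_real_derivative 2 * (w \<bullet> u)) (at 0)"
proof -
  have eq: "(\<lambda>s. (norm (u + s *\<^sub>R w))\<^sup>2) = (\<lambda>s. u \<bullet> u + s * (2 * (w \<bullet> u)) + s * s * (w \<bullet> w))"
    by (simp add: fun_eq_iff power2_norm_eq_inner inner_add_left inner_add_right inner_commute [of u w] algebra_simps)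
  show ?thesis unfolding eq by (auto intro!: derivative_eq_intros)
qed

lemma eventually_less_right:
  fixes f :: "real \<Rightarrow> real"
  shows "(f has_real_derivative d) (at 0) \<Longrightarrow> d < 0 \<Longrightarrow> \<forall>\<^sub>F s in at_right 0. f s < f 0"
    and "(f has_real_derivative d) (at 0) \<Longrightarrow> f 0 < c \<Longrightarrow> \<forall>\<^sub>F s in at_right 0. f s < c"
proof -
  assume d: "(f has_real_derivative d) (at 0)"
  show "\<forall>\<^sub>F s in at_right 0. f s < f 0" if "d < 0"
    using DERIV_neg_dec_right [OF d that] unfolding eventually_at_right_field by auto
  have "(f \<longlongrightarrow> f 0) (at_right 0)"
    using DERIV_isCont [OF d] by (simp add: isCont_def filterlim_at_split)
  then show "\<forall>\<^sub>F s in at_right 0. f s < c" if "f 0 < c" using that by (rule order_tendstoD)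
qed

text \<open>Moving along \<open>\<omega> *s G z\<close>, the coordinates in \<open>I\<close> grow at
  rate at least \<open>a - 2 * \<delta>\<close> and faster than the others, so the cone where they
  dominate is kept, while the gradient grows at rate at most \<open>b + \<delta>\<close>. Hence the
  logarithm \<open>F\<close> of the squared norm of the gradient, divided by that of
  \<open>proj I z\<close> to the power \<open>\<theta>\<close>, decreases. Its minimum over the
  compact part \<open>K r0\<close> of the cone is attained at the outer boundary, where the bound
  does not depend on \<open>r0\<close>.\<close>

lemma cone_lower_bound:
  fixes h :: "complex ^ 'n \<Rightarrow> complex"
  assumes E: "euler_pair S h G" and r: "0 < r" "cball 0 r \<subseteq> S" and AD: "almost_diagonal G \<alpha> \<delta> r"
    and \<omega>: "norm \<omega> = 1" and I: "\<And>i. i \<in> I \<Longrightarrow> a \<le> Re (\<omega> * \<alpha> i)" "\<And>i. i \<notin> I \<Longrightarrow> Re (\<omega> * \<alpha> i) \<le> a - \<gamma>"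
    and b: "\<And>i. Re (\<omega> * (1 - \<alpha> i)) \<le> b"
    and \<delta>: "0 < \<delta>" "4 * \<delta> < \<gamma>" "2 * \<delta> < a" and \<theta>: "0 < \<theta>" "b + \<delta> < \<theta> * (a - 2 * \<delta>)"
  shows "\<exists>c>0. \<exists>\<rho>>0. \<forall>z. norm z \<le> \<rho> \<longrightarrow> norm (proj (- I) z) \<le> norm (proj I z) \<longrightarrow>
     c * norm (proj I z) powr \<theta> \<le> norm (gradient h z)"
proof -
  note D = euler_pairD [OF E]
  define p where "p = gradient h"
  define r1 where "r1 = r / 4"
  have r1: "0 < r1" using r by (simp add: r1_def)
  define K where "K r0 = {z. r0 \<le> norm (proj I z) \<and> norm (proj I z) \<le> r1 \<and> norm (proj (- I) z) \<le> norm (proj I z)}" for r0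
  have z_le: "norm z \<le> 2 * norm (proj I z)" if "norm (proj (- I) z) \<le> norm (proj I z)" for z
  proof -
    have "z = proj I z + proj (- I) z" by (simp add: vec_eq_iff)
    then have "norm z \<le> norm (proj I z) + norm (proj (- I) z)" by (metis norm_triangle_ineq)
    with that show ?thesis by simp
  qed
  have Kr: "norm z \<le> r" if "z \<in> K r0" for z r0
    using z_le [of z] that r1 by (auto simp: K_def r1_def)
  have cproj: "continuous_on A (\<lambda>z. norm (proj J z))" for A and J :: "'n set"
    by (intro continuous_on_norm bounded_linear.continuous_on [OF bounded_linear_proj] continuous_on_id)
  have compK: "compact (K r0)" for r0
  proof -
    have "closed (K r0)" unfolding K_def
      by (intro closed_Collect_conj closed_Collect_le continuous_on_const cproj)
    moreover have "bounded (K r0)" using Kr unfolding bounded_iff by blast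
    ultimately show ?thesis by (simp add: compact_eq_bounded_closed)
  qed
  define F where "F z = ln ((norm (p z))\<^sup>2) - \<theta> * ln ((norm (proj I z))\<^sup>2)" for z
  have pos: "0 < (norm (p z))\<^sup>2" "0 < (norm (proj I z))\<^sup>2" "z \<in> S" "z \<noteq> 0" if "z \<in> K r0" "0 < r0" for z r0
  proof -
    have "0 < norm (proj I z)" using that by (auto simp: K_def)
    then show "0 < (norm (proj I z))\<^sup>2" by simp
    then show z0: "z \<noteq> 0" by auto
    show zS: "z \<in> S" using Kr [OF that(1)] r(2) by auto
    have "p z \<noteq> 0" using D(6) [OF zS] z0 by (simp add: p_def)
    then show "0 < (norm (p z))\<^sup>2" by simp
  qed
  have contF: "continuous_on (K r0) F" if "0 < r0" for r0
  proof -
    have "K r0 \<subseteq> S" using pos(3) that by blast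
    then have "continuous_on (K r0) p" unfolding p_def by (rule continuous_on_subset [OF continuous_on_gradient [OF D(1,3)]])
    moreover have "\<forall>z\<in>K r0. (norm (p z))\<^sup>2 \<noteq> 0" using pos(1) that by (metis less_irrefl)
    moreover have "\<forall>z\<in>K r0. (norm (proj I z))\<^sup>2 \<noteq> 0" using pos(2) that by (metis less_irrefl)
    ultimately show ?thesis
      unfolding F_def by (intro continuous_on_diff continuous_on_mult continuous_on_const continuous_on_ln continuous_on_power continuous_on_norm cproj) auto
  qed
  \<comment> \<open>A point below the outer boundary has a neighbour in \<open>K r0\<close> with
    smaller \<open>F\<close>. The sign of one-sided derivatives at \<open>s = 0\<close> decides
    this, so the motion may be a straight line.\<close>
  have descend: "\<exists>z'\<in>K r0. F z' < F z" if z: "z \<in> K r0" "0 < r0" "norm (proj I z) < r1" for z r0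
  proof -
    note ps = pos [OF z(1,2)]
    define y where "y = \<omega> *s G z"
    have zr: "norm z \<le> r" by (rule Kr [OF z(1)])
    have cone: "norm (proj (- I) z) \<le> norm (proj I z)" using z(1) by (simp add: K_def)
    define e where "e = y - \<omega> *s diag_apply \<alpha> z"
    have "norm (\<omega> *s (G z - diag_apply \<alpha> z)) \<le> \<delta> * norm z"
      unfolding norm_smult_vec \<omega> using AD zr by (simp add: almost_diagonal_def)
    then have "norm e \<le> \<delta> * norm z" unfolding e_def y_def by (simp only: vec.scale_right_diff_distrib)
    also have "\<dots> \<le> \<delta> * (2 * norm (proj I z))" using z_le [OF cone] \<delta>(1) by (intro mult_left_mono) auto
    finally have e: "norm e \<le> 2 * \<delta> * norm (proj I z)" by simp
    have eI: "\<bar>e \<bullet> proj J z\<bar> \<le> 2 * \<delta> * (norm (proj I z))\<^sup>2" if "norm (proj J z) \<le> norm (proj I z)" for J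
    proof -
      have "\<bar>e \<bullet> proj J z\<bar> \<le> norm e * norm (proj J z)" by (rule Cauchy_Schwarz_ineq2)
      also have "\<dots> \<le> (2 * \<delta> * norm (proj I z)) * norm (proj I z)" using e that \<delta>(1) by (intro mult_mono) auto
      finally show ?thesis by (simp add: power2_eq_square)
    qed
    have ye: "y = \<omega> *s diag_apply \<alpha> z + e" by (simp add: e_def)
    have yI: "(a - 2 * \<delta>) * (norm (proj I z))\<^sup>2 \<le> y \<bullet> proj I z"
    proof -
      have "a * (norm (proj I z))\<^sup>2 \<le> (\<omega> *s diag_apply \<alpha> z) \<bullet> proj I z"
        by (rule inner_diag_apply_proj_ge) (rule I(1))
      then show ?thesis using eI [OF order_refl] unfolding ye inner_add_left left_diff_distrib by linarith
    qed
    have yJ: "y \<bullet> proj (- I) z \<le> (a - \<gamma>) * (norm (proj (- I) z))\<^sup>2 + 2 * \<delta> * (norm (proj I z))\<^sup>2"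
    proof -
      have "(\<omega> *s diag_apply \<alpha> z) \<bullet> proj (- I) z \<le> (a - \<gamma>) * (norm (proj (- I) z))\<^sup>2"
        by (rule inner_diag_apply_proj_le) (use I(2) in auto)
      then show ?thesis using eI [OF cone] unfolding ye inner_add_left by linarith
    qed
    have pi: "proj J y \<bullet> proj J z = y \<bullet> proj J z" for J
      unfolding inner_vec_def by (rule sum.cong) auto
    have path: "proj J (z + s *\<^sub>R y) = proj J z + s *\<^sub>R proj J y" for J s
      by (simp add: vec_eq_iff)
    have dJ: "((\<lambda>s. (norm (proj J (z + s *\<^sub>R y)))\<^sup>2) has_real_derivative 2 * (y \<bullet> proj J z)) (at 0)" for J
      unfolding path using norm_sq_path_derivative [of "proj J z" "proj J y"] by (simp add: pi)
    have dp: "((\<lambda>s. (norm (p (z + s *\<^sub>R y)))\<^sup>2) has_real_derivative 2 * ((jac p z *v y) \<bullet> p z)) (at 0)"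
    proof -
      have "((\<lambda>s. z + s *\<^sub>R y) has_derivative (\<lambda>s. s *\<^sub>R y)) (at 0)"
        by (auto intro!: derivative_eq_intros)
      moreover have "(p has_derivative (\<lambda>v. jac p z *v v)) (at (z + 0 *\<^sub>R y))"
        using holv_has_derivative [OF D(8) ps(3)] by (simp add: p_def)
      ultimately have dd: "((\<lambda>s. p (z + s *\<^sub>R y)) has_derivative (\<lambda>s. jac p z *v (s *\<^sub>R y))) (at 0)"
        by (rule has_derivative_compose)
      have "jac p z *v (s *\<^sub>R y) = s *\<^sub>R (jac p z *v y)" for s
        by (rule linear_scale [OF bounded_linear.linear [OF matrix_vector_mul_bounded_linear]])
      then have "(\<lambda>s. p (z + 0 *\<^sub>R y) \<bullet> (jac p z *v (s *\<^sub>R y)) + (jac p z *v (s *\<^sub>R y)) \<bullet> p (z + 0 *\<^sub>R y)) = (*) (2 * ((jac p z *v y) \<bullet> p z))"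
        by (simp add: fun_eq_iff inner_commute [of "p z"])
      with has_derivative_inner [OF dd dd] show ?thesis
        unfolding power2_norm_eq_inner has_field_derivative_def by simp
    qed
    have Dp: "(jac p z *v y) \<bullet> p z \<le> (b + \<delta>) * (norm (p z))\<^sup>2"
    proof -
      have "jac p z *v y = \<omega> *s (p z - transpose (jac G z) *v p z)"
        unfolding y_def vector_scalar_commute p_def using euler_derivative [OF E ps(3)] by simp
      also have "\<dots> = \<omega> *s diag_apply (\<lambda>i. 1 - \<alpha> i) (p z) - \<omega> *s (transpose (jac G z) *v p z - diag_apply \<alpha> (p z))"
        by (simp add: vec_eq_iff algebra_simps)
      finally have eq: "jac p z *v y = \<omega> *s diag_apply (\<lambda>i. 1 - \<alpha> i) (p z) - \<omega> *s (transpose (jac G z) *v p z - diag_apply \<alpha> (p z))" .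
      have 1: "(\<omega> *s diag_apply (\<lambda>i. 1 - \<alpha> i) (p z)) \<bullet> p z \<le> b * (norm (p z))\<^sup>2"
        using inner_diag_apply_proj_le [of UNIV \<omega> "\<lambda>i. 1 - \<alpha> i" b "p z"] b by simp
      have "\<bar>(\<omega> *s (transpose (jac G z) *v p z - diag_apply \<alpha> (p z))) \<bullet> p z\<bar> \<le> norm (\<omega> *s (transpose (jac G z) *v p z - diag_apply \<alpha> (p z))) * norm (p z)"
        by (rule Cauchy_Schwarz_ineq2)
      also have "\<dots> \<le> (\<delta> * norm (p z)) * norm (p z)"
        unfolding norm_smult_vec \<omega> using AD zr by (intro mult_right_mono) (auto simp: almost_diagonal_def)
      finally have 2: "\<bar>(\<omega> *s (transpose (jac G z) *v p z - diag_apply \<alpha> (p z))) \<bullet> p z\<bar> \<le> \<delta> * (norm (p z))\<^sup>2"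
        by (simp add: power2_eq_square)
      show ?thesis unfolding eq inner_diff_left using 1 2 by (simp add: distrib_right)
    qed
    define P where "P s = (norm (p (z + s *\<^sub>R y)))\<^sup>2" for s
    define A where "A s = (norm (proj I (z + s *\<^sub>R y)))\<^sup>2" for s
    define B where "B s = (norm (proj (- I) (z + s *\<^sub>R y)))\<^sup>2" for s
    have dP: "(P has_real_derivative 2 * ((jac p z *v y) \<bullet> p z)) (at 0)" using dp by (simp add: P_def [abs_def])
    have dA: "(A has_real_derivative 2 * (y \<bullet> proj I z)) (at 0)" using dJ by (simp add: A_def [abs_def])
    have dB: "(B has_real_derivative 2 * (y \<bullet> proj (- I) z)) (at 0)" using dJ by (simp add: B_def [abs_def])
    have P0: "P 0 = (norm (p z))\<^sup>2" and A0: "A 0 = (norm (proj I z))\<^sup>2" and B0: "B 0 = (norm (proj (- I) z))\<^sup>2"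
      by (simp_all add: P_def A_def B_def)
    have A0p: "0 < A 0" and P0p: "0 < P 0" using ps by (simp_all add: A0 P0)
    have evF: "\<forall>\<^sub>F s in at_right 0. ln (P s) - \<theta> * ln (A s) < ln (P 0) - \<theta> * ln (A 0)"
    proof (rule eventually_less_right(1))
      show "((\<lambda>s. ln (P s) - \<theta> * ln (A s)) has_real_derivative
          (1 / P 0 * (2 * ((jac p z *v y) \<bullet> p z)) - \<theta> * (1 / A 0 * (2 * (y \<bullet> proj I z))))) (at 0)"
        by (intro DERIV_diff DERIV_cmult DERIV_chain2 [OF DERIV_ln_divide dP] DERIV_chain2 [OF DERIV_ln_divide dA] P0p A0p)
      have "1 / P 0 * (2 * ((jac p z *v y) \<bullet> p z)) \<le> 2 * (b + \<delta>)"
        using Dp P0p by (simp add: P0 field_simps)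
      also have "\<dots> < \<theta> * (2 * (a - 2 * \<delta>))" using \<theta>(2) by (simp add: algebra_simps)
      also have "2 * (a - 2 * \<delta>) \<le> 1 / A 0 * (2 * (y \<bullet> proj I z))"
        using yI A0p by (simp add: A0 field_simps)
      finally show "1 / P 0 * (2 * ((jac p z *v y) \<bullet> p z)) - \<theta> * (1 / A 0 * (2 * (y \<bullet> proj I z))) < 0"
        using \<theta>(1) by simp
    qed
    have evA: "\<forall>\<^sub>F s in at_right 0. - A s < - A 0"
    proof (rule eventually_less_right(1) [OF DERIV_minus [OF dA]])
      have "0 < (a - 2 * \<delta>) * (norm (proj I z))\<^sup>2" using \<delta> ps(2) by simp
      then show "- (2 * (y \<bullet> proj I z)) < 0" using yI by simp
    qed
    have evA2: "\<forall>\<^sub>F s in at_right 0. A s < r1\<^sup>2"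
      by (rule eventually_less_right(2) [OF dA]) (use z(3) in \<open>simp add: A0 power_strict_mono\<close>)
    have dBA: "((\<lambda>s. B s - A s) has_real_derivative (2 * (y \<bullet> proj (- I) z) - 2 * (y \<bullet> proj I z))) (at 0)"
      by (rule DERIV_diff [OF dB dA])
    have evB: "\<forall>\<^sub>F s in at_right 0. B s - A s < 0"
    proof (cases "B 0 < A 0")
      case True
      then show ?thesis by (intro eventually_less_right(2) [OF dBA]) simp
    next
      case False
      then have eq: "norm (proj (- I) z) = norm (proj I z)" using cone unfolding A0 B0 by (simp add: power2_less_eq_zero_iff abs_le_square_iff [symmetric] not_less)
      \<comment> \<open>On the boundary of the cone both parts have equal norm; the gap
        \<open>\<gamma>\<close> between the rates beats the error \<open>4 * \<delta>\<close> and
        pushes the point inside.\<close>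
      have "2 * (y \<bullet> proj (- I) z) - 2 * (y \<bullet> proj I z) \<le> 2 * ((4 * \<delta> - \<gamma>) * (norm (proj I z))\<^sup>2)"
        using yI yJ unfolding eq by (simp add: algebra_simps)
      also have "\<dots> < 0" using \<delta>(2) ps(2) by (simp add: mult_neg_pos)
      finally have "\<forall>\<^sub>F s in at_right 0. B s - A s < B 0 - A 0" by (rule eventually_less_right(1) [OF dBA])
      then show ?thesis using eq by (simp add: A0 B0)
    qed
    have "\<forall>\<^sub>F s in at_right (0::real). z + s *\<^sub>R y \<in> K r0 \<and> F (z + s *\<^sub>R y) < F z"
      using evF evA evA2 evB
    proof eventually_elim
      case (elim s)
      have "r0\<^sup>2 \<le> (norm (proj I z))\<^sup>2" using z(1,2) by (intro power_mono) (auto simp: K_def)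
      then have "r0\<^sup>2 \<le> (norm (proj I (z + s *\<^sub>R y)))\<^sup>2" using elim(2) by (simp add: A_def)
      then have "r0 \<le> norm (proj I (z + s *\<^sub>R y))" by (rule power2_le_imp_le) simp
      moreover have "norm (proj I (z + s *\<^sub>R y)) < r1"
        by (rule power2_less_imp_less) (use elim(3) r1 in \<open>simp_all add: A_def\<close>)
      moreover have "norm (proj (- I) (z + s *\<^sub>R y)) < norm (proj I (z + s *\<^sub>R y))"
        by (rule power2_less_imp_less) (use elim(4) in \<open>simp_all add: A_def B_def\<close>)
      ultimately have "z + s *\<^sub>R y \<in> K r0" by (simp add: K_def)
      moreover have "F (z + s *\<^sub>R y) < F z" using elim(1) by (simp add: F_def P_def A_def)
      ultimately show ?case by blast
    qed
    then show ?thesis using eventually_happens' [OF trivial_limit_at_right_real] by blast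
  qed
  have "bounded (F ` K r1)" by (intro compact_imp_bounded compact_continuous_image contF compK r1)
  then obtain M where "\<forall>y\<in>F ` K r1. norm y \<le> M" unfolding bounded_iff by blast
  then have M: "- M \<le> F z" if "z \<in> K r1" for z using that by (auto simp: abs_le_iff)
  have lower: "- M \<le> F z" if z: "z \<in> K r0" "0 < r0" for z r0
  proof -
    have ne: "K r0 \<noteq> {}" using z by auto
    obtain z' where z': "z' \<in> K r0" "\<And>w. w \<in> K r0 \<Longrightarrow> F z' \<le> F w"
      using continuous_attains_inf [OF compK ne contF [OF z(2)]] by blast
    have "\<not> norm (proj I z') < r1" using descend [OF z'(1) z(2)] z'(2) by (meson not_less)
    then have "z' \<in> K r1" using z'(1) by (simp add: K_def)
    then show ?thesis using M z'(2) [OF z(1)] by force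
  qed
  show ?thesis
  proof (intro exI conjI allI impI)
    show "0 < exp (- M / 2)" by simp
    show "0 < r1" by (rule r1)
    fix z assume z: "norm z \<le> r1" "norm (proj (- I) z) \<le> norm (proj I z)"
    show "exp (- M / 2) * norm (proj I z) powr \<theta> \<le> norm (gradient h z)"
    proof (cases "proj I z = 0")
      case True
      then show ?thesis by simp
    next
      case False
      then have n: "0 < norm (proj I z)" by simp
      have zK: "z \<in> K (norm (proj I z))" using z norm_proj_le [of I z] by (simp add: K_def)
      note ps = pos [OF zK n]
      have pz: "0 < norm (p z)" using ps(1) by simp
      have "- M \<le> 2 * ln (norm (p z)) - \<theta> * (2 * ln (norm (proj I z)))"
        using lower [OF zK n] n pz by (simp add: F_def ln_realpow)
      then have "- M / 2 + \<theta> * ln (norm (proj I z)) \<le> ln (norm (p z))" by simp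
      then have "exp (- M / 2 + \<theta> * ln (norm (proj I z))) \<le> exp (ln (norm (p z)))" by (rule iffD2 [OF exp_le_cancel_iff])
      then have "exp (- M / 2) * exp (\<theta> * ln (norm (proj I z))) \<le> norm (p z)" by (simp only: exp_add exp_ln [OF pz])
      then show ?thesis using n by (simp add: powr_def p_def)
    qed
  qed
qed

lemma powr_comparison_absurd:
  fixes c C d \<theta> q :: real
  assumes c: "0 < c" and d: "0 < d" and \<theta>: "\<theta> < q" and le: "\<And>s. 0 < s \<Longrightarrow> s < d \<Longrightarrow> c * s powr \<theta> \<le> C * s powr q"
  shows False
proof -
  define C' where "C' = \<bar>C\<bar> + 1"
  have C': "0 < C'" "C \<le> C'" by (simp_all add: C'_def)
  define s where "s = min (d / 2) ((c / (2 * C')) powr (1 / (q - \<theta>)))"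
  have s: "0 < s" "s < d" using c d C' by (auto simp: s_def)
  have "s powr (q - \<theta>) \<le> ((c / (2 * C')) powr (1 / (q - \<theta>))) powr (q - \<theta>)"
    using s \<theta> by (intro powr_mono2) (auto simp: s_def)
  also have "\<dots> = c / (2 * C')" using c C' \<theta> by (simp add: powr_powr)
  finally have 1: "C' * s powr (q - \<theta>) \<le> c / 2" using C' by (simp add: field_simps)
  have "s powr q = s powr (q - \<theta>) * s powr \<theta>" by (simp add: powr_add [symmetric])
  then have "c * s powr \<theta> \<le> (C * s powr (q - \<theta>)) * s powr \<theta>" using le [OF s] by simp
  also have "\<dots> \<le> (C' * s powr (q - \<theta>)) * s powr \<theta>" using C'(2) by (intro mult_right_mono) auto
  also have "\<dots> \<le> c / 2 * s powr \<theta>" using 1 by (intro mult_right_mono) auto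
  finally show False using c s(1) by simp
qed

lemma finite_eigenvalues: "finite {\<eta>. \<exists>w. w \<noteq> 0 \<and> A *v w = \<eta> *s (w :: complex ^ 'n)}"
proof (rule finite_subset [OF _ poly_roots_finite [OF charpoly_nonzero [of A]]], rule subsetI)
  fix \<eta> assume "\<eta> \<in> {\<eta>. \<exists>w. w \<noteq> 0 \<and> A *v w = \<eta> *s w}"
  then obtain w where "w \<noteq> 0" "(mat \<eta> - A) *v w = 0" by (auto simp: matrix_action_simps)
  then show "\<eta> \<in> {x. poly (charpoly A) x = 0}" using det_nonzero_iff_kernel [of "mat \<eta> - A"] by (auto simp: poly_charpoly)
qed

lemma finite_gap:
  fixes f :: "'a \<Rightarrow> real"
  assumes "finite X"
  shows "\<exists>\<gamma>>0. \<forall>x\<in>X. f x < a \<longrightarrow> f x \<le> a - \<gamma>"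
  using assms
proof (induction X)
  case (insert x X)
  then obtain \<gamma> where \<gamma>: "0 < \<gamma>" "\<And>y. y \<in> X \<Longrightarrow> f y < a \<Longrightarrow> f y \<le> a - \<gamma>" by blast
  show ?case
  proof (intro exI [of _ "if f x < a then min \<gamma> (a - f x) else \<gamma>"] conjI ballI impI)
    fix y assume "y \<in> insert x X" "f y < a"
    then show "f y \<le> a - (if f x < a then min \<gamma> (a - f x) else \<gamma>)" using \<gamma>(2) [of y] by (auto simp: min_def)
  qed (use \<gamma>(1) in auto)
qed (auto intro: exI [of _ 1])

text \<open>Suppose \<open>b < 2 * Re (\<omega> * \<beta>)\<close>. In almost diagonal coordinates
  the eigenvector \<open>v\<close> lies in the cone of the coordinates with rate at least
  \<open>a\<close>, so \<open>cone_lower_bound\<close> bounds the gradient along \<open>v\<close>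
  below by a power less than \<open>2\<close> of the distance; but as \<open>v\<close> is in the
  kernel of the Hessian, the gradient along \<open>v\<close> is at most quadratic.\<close>

lemma kernel_eigenvalue_bound:
  fixes h :: "complex ^ 'n \<Rightarrow> complex"
  assumes E: "euler_pair S h G" and v: "v \<noteq> 0" "jac (gradient h) 0 *v v = 0" "jac G 0 *v v = \<beta> *s v"
    and \<omega>: "norm \<omega> = 1" "0 < Re (\<omega> * \<beta>)"
    and b: "\<And>\<eta> w. w \<noteq> 0 \<Longrightarrow> jac G 0 *v w = \<eta> *s w \<Longrightarrow> Re (\<omega> * (1 - \<eta>)) \<le> b"
  shows "2 * Re (\<omega> * \<beta>) \<le> b"
proof (rule ccontr)
  define a where "a = Re (\<omega> * \<beta>)"
  assume "\<not> ?thesis"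
  then have ba: "b < 2 * a" by (simp add: a_def)
  have a: "0 < a" using \<omega>(2) by (simp add: a_def)
  \<comment> \<open>The midpoint of \<open>b / a\<close> and \<open>2\<close>; the maximum with
    \<open>1\<close> keeps it positive when \<open>b\<close> is negative.\<close>
  define \<theta> where "\<theta> = max 1 (1 + b / (2 * a))"
  have \<theta>: "0 < \<theta>" "\<theta> < 2" "b < \<theta> * a"
  proof -
    show "0 < \<theta>" "\<theta> < 2" using ba a by (auto simp: \<theta>_def field_simps)
    have "b < (1 + b / (2 * a)) * a" using ba a by (simp add: field_simps)
    also have "\<dots> \<le> \<theta> * a" using a by (intro mult_right_mono) (auto simp: \<theta>_def)
    finally show "b < \<theta> * a" .
  qed
  obtain \<gamma> where \<gamma>: "0 < \<gamma>" "\<And>\<eta> w. w \<noteq> 0 \<Longrightarrow> jac G 0 *v w = \<eta> *s w \<Longrightarrow> Re (\<omega> * \<eta>) < a \<Longrightarrow> Re (\<omega> * \<eta>) \<le> a - \<gamma>"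
    using finite_gap [OF finite_eigenvalues [of "jac G 0"], of "\<lambda>\<eta>. Re (\<omega> * \<eta>)" a] by blast
  define \<delta> where "\<delta> = min (\<gamma> / 8) (min (a / 4) ((\<theta> * a - b) / (2 * (1 + 2 * \<theta>))))"
  have \<delta>: "0 < \<delta>" "4 * \<delta> < \<gamma>" "2 * \<delta> < a" "b + \<delta> < \<theta> * (a - 2 * \<delta>)"
  proof -
    show "0 < \<delta>" using \<gamma>(1) a \<theta> by (simp add: \<delta>_def)
    have "\<delta> \<le> \<gamma> / 8" unfolding \<delta>_def by (rule min.cobounded1)
    moreover have "\<delta> \<le> a / 4" unfolding \<delta>_def by (intro min.coboundedI2 min.cobounded1)
    ultimately show "4 * \<delta> < \<gamma>" "2 * \<delta> < a" using \<gamma>(1) a by linarith+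
    have "\<delta> \<le> (\<theta> * a - b) / (2 * (1 + 2 * \<theta>))" by (simp add: \<delta>_def)
    then have "\<delta> * (2 * (1 + 2 * \<theta>)) \<le> \<theta> * a - b" using \<theta>(1) by (subst (asm) pos_le_divide_eq) auto
    moreover have "0 < \<delta> * (1 + 2 * \<theta>)" using \<open>0 < \<delta>\<close> \<theta>(1) by simp
    ultimately show "b + \<delta> < \<theta> * (a - 2 * \<delta>)" by (simp add: algebra_simps)
  qed
  obtain T T' :: "complex ^ 'n ^ 'n" and \<alpha> :: "'n \<Rightarrow> complex" and r :: real where T: "T ** T' = mat 1" "T' ** T = mat 1" and r: "0 < r"
    and ev: "\<And>i. \<exists>w. w \<noteq> 0 \<and> jac G 0 *v w = \<alpha> i *s w" and rW: "cball 0 r \<subseteq> {w. T *v w \<in> S}"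
    and EP: "euler_pair {w. T *v w \<in> S} (\<lambda>w. h (T *v w)) (\<lambda>w. T' *v G (T *v w))"
    and AD: "almost_diagonal (\<lambda>w. T' *v G (T *v w)) \<alpha> \<delta> r"
    and jG: "jac (\<lambda>w. T' *v G (T *v w)) 0 = T' ** jac G 0 ** T"
    and gr: "\<And>w. T *v w \<in> S \<Longrightarrow> gradient (\<lambda>w. h (T *v w)) w = transpose T *v gradient h (T *v w)"
  proof (rule euler_pair_diagonalize [OF E \<delta>(1)], goal_cases)
    case (1 T T' r \<alpha>)
    show ?case by (rule 1(1) [OF 1(2-10)])
  qed
  define h' where "h' = (\<lambda>w. h (T *v w))"
  define G' where "G' = (\<lambda>w. T' *v G (T *v w))"
  define W where "W = {w. T *v w \<in> S}"
  note D = euler_pairD [OF EP, folded W_def h'_def G'_def]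
  define I where "I = {i. a \<le> Re (\<omega> * \<alpha> i)}"
  have I: "\<And>i. i \<in> I \<Longrightarrow> a \<le> Re (\<omega> * \<alpha> i)" "\<And>i. i \<notin> I \<Longrightarrow> Re (\<omega> * \<alpha> i) \<le> a - \<gamma>"
    unfolding I_def using ev \<gamma>(2) by (simp, metis mem_Collect_eq not_le)
  have b': "Re (\<omega> * (1 - \<alpha> i)) \<le> b" for i using ev b by blast
  obtain c \<rho> where c: "0 < c" "0 < \<rho>" "\<And>z. norm z \<le> \<rho> \<Longrightarrow> norm (proj (- I) z) \<le> norm (proj I z) \<Longrightarrow>
      c * norm (proj I z) powr \<theta> \<le> norm (gradient h' z)"
    using cone_lower_bound [OF EP r rW AD \<omega>(1) I b' \<delta>(1-3) \<theta>(1) \<delta>(4)] unfolding h'_def by blast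
  define v' where "v' = T' *v v"
  have Tv': "T *v v' = v" by (simp add: v'_def matrix_vector_mul_assoc T)
  have v'0: "v' \<noteq> 0" using Tv' v(1) by auto
  have "jac G' 0 *v v' = \<beta> *s v'"
  proof -
    have "jac G' 0 *v v' = T' *v (jac G 0 *v (T *v v'))"
      unfolding G'_def jG by (simp add: matrix_vector_mul_assoc matrix_mul_assoc)
    then show ?thesis unfolding Tv' v(3) vector_scalar_commute by (simp add: v'_def)
  qed
  then have err: "norm (\<beta> *s v' - diag_apply \<alpha> v') \<le> \<delta> * norm v'"
    using AD r unfolding almost_diagonal_def G'_def by (metis less_imp_le norm_zero)
  \<comment> \<open>A coordinate outside \<open>I\<close> has \<open>\<alpha> i\<close> at distance
    at least \<open>\<gamma>\<close> from \<open>\<beta>\<close>, so the eigenvector equation makes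
    it small.\<close>
  have "\<gamma> * norm (proj (- I) v') \<le> norm (\<beta> *s v' - diag_apply \<alpha> v')"
  proof -
    have "norm (of_real \<gamma> *s proj (- I) v') \<le> norm (\<beta> *s v' - diag_apply \<alpha> v')"
      unfolding norm_vec_def
    proof (rule L2_set_mono)
      fix i
      show "norm ((of_real \<gamma> *s proj (- I) v') $ i) \<le> norm ((\<beta> *s v' - diag_apply \<alpha> v') $ i)"
      proof (cases "i \<in> I")
        case False
        have "\<gamma> \<le> Re (\<omega> * (\<beta> - \<alpha> i))" using I(2) [OF False] by (simp add: a_def algebra_simps)
        also have "\<dots> \<le> norm (\<omega> * (\<beta> - \<alpha> i))" by (rule complex_Re_le_cmod)
        finally have "\<gamma> \<le> norm (\<beta> - \<alpha> i)" using \<omega>(1) by (simp add: norm_mult)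
        then have "\<gamma> * norm (v' $ i) \<le> norm ((\<beta> - \<alpha> i) * v' $ i)" by (simp add: norm_mult mult_right_mono)
        then show ?thesis using False \<gamma>(1) by (simp add: norm_mult left_diff_distrib)
      qed simp
    qed simp
    then show ?thesis using \<gamma>(1) by simp
  qed
  with err have "\<gamma> * norm (proj (- I) v') \<le> \<delta> * norm v'" by linarith
  also have "\<dots> \<le> \<delta> * (norm (proj I v') + norm (proj (- I) v'))"
  proof -
    have "v' = proj I v' + proj (- I) v'" by (simp add: vec_eq_iff)
    then have "norm v' \<le> norm (proj I v') + norm (proj (- I) v')" by (metis norm_triangle_ineq)
    then show ?thesis using \<delta>(1) by (intro mult_left_mono) auto
  qed
  finally have le: "(\<gamma> - \<delta>) * norm (proj (- I) v') \<le> \<delta> * norm (proj I v')" by (simp add: algebra_simps)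
  have cone: "norm (proj (- I) v') \<le> norm (proj I v')"
  proof -
    have "\<delta> * norm (proj (- I) v') \<le> (\<gamma> - \<delta>) * norm (proj (- I) v')" using \<delta> by (intro mult_right_mono) auto
    then have "\<delta> * norm (proj (- I) v') \<le> \<delta> * norm (proj I v')" using le by linarith
    then show ?thesis using \<delta>(1) by simp
  qed
  have vI: "0 < norm (proj I v')"
  proof (rule ccontr)
    assume "\<not> ?thesis"
    then have "(norm v')\<^sup>2 = 0" using cone norm_proj_sq [of I v'] by simp
    then show False using v'0 by simp
  qed
  have "jac (gradient h') 0 *v v' = 0"
  proof -
    have dT: "((\<lambda>w. T *v w) has_derivative (\<lambda>w. T *v w)) (at 0)"
      by (rule bounded_linear_imp_has_derivative [OF matrix_vector_mul_bounded_linear])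
    have "(gradient h has_derivative (\<lambda>w. jac (gradient h) 0 *v w)) (at (T *v 0))"
      using holv_has_derivative [OF euler_pairD(8) [OF E] euler_pairD(2) [OF E]] by simp
    from has_derivative_compose [OF dT this]
    have "((\<lambda>w. gradient h (T *v w)) has_derivative (\<lambda>w. jac (gradient h) 0 *v (T *v w))) (at 0)" .
    from has_derivative_compose [OF this bounded_linear_imp_has_derivative [OF matrix_vector_mul_bounded_linear]]
    have "((\<lambda>w. transpose T *v gradient h (T *v w)) has_derivative (\<lambda>w. transpose T *v (jac (gradient h) 0 *v (T *v w)))) (at 0)" .
    then have "(gradient h' has_derivative (\<lambda>w. transpose T *v (jac (gradient h) 0 *v (T *v w)))) (at 0)"
      by (rule has_derivative_transform_within_open [OF _ D(1,2)]) (simp add: gr h'_def W_def)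
    then have "(gradient h' has_derivative (\<lambda>w. (transpose T ** jac (gradient h) 0 ** T) *v w)) (at 0)"
      by (simp add: matrix_vector_mul_assoc matrix_mul_assoc)
    from jac_eqI [OF this] show ?thesis by (simp add: matrix_vector_mul_assoc [symmetric] Tv' v(2))
  qed
  moreover obtain r2 C where r2: "0 < r2" "0 \<le> C" "\<And>z y. norm z \<le> r2 \<Longrightarrow> norm y \<le> r2 / 2 \<Longrightarrow>
      norm (gradient h' (z + y) - gradient h' z - jac (gradient h') z *v y) \<le> C * (norm y)\<^sup>2"
    using holv_local_bounds [OF D(1,2,8)] by blast
  ultimately have flat: "norm (gradient h' (of_real s *s v')) \<le> C * (s * norm v')\<^sup>2" if "0 < s" "s * norm v' \<le> r2 / 2" for s :: real
    using r2(3) [of 0 "of_real s *s v'"] that r2(1) D(7) by (simp add: vector_scalar_commute)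
  define d where "d = min (\<rho> / norm v') (r2 / 2 / norm v')"
  show False
  proof (rule powr_comparison_absurd)
    show "0 < c * norm (proj I v') powr \<theta>" using c(1) vI by simp
    show "0 < d" using c(2) r2(1) v'0 by (simp add: d_def)
    show "\<theta> < 2" by (rule \<theta>(2))
    fix s :: real assume s: "0 < s" "s < d"
    have s1: "s * norm v' \<le> \<rho>" "s * norm v' \<le> r2 / 2"
      using s v'0 by (simp_all add: d_def field_simps)
    have pj: "proj J (of_real s *s v') = of_real s *s proj J v'" for J by (simp add: vec_eq_iff)
    have "c * norm (proj I (of_real s *s v')) powr \<theta> \<le> norm (gradient h' (of_real s *s v'))"
      by (rule c(3)) (use s(1) s1(1) cone in \<open>simp_all add: pj mult_left_mono\<close>)
    also have "\<dots> \<le> C * (s * norm v')\<^sup>2" by (rule flat [OF s(1) s1(2)])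
    also have "norm (proj I (of_real s *s v')) = s * norm (proj I v')" using s(1) by (simp add: pj)
    finally show "c * norm (proj I v') powr \<theta> * s powr \<theta> \<le> (C * (norm v')\<^sup>2) * s powr 2"
      using s(1) by (simp add: powr_mult powr_numeral power_mult_distrib mult_ac)
  qed
qed

text \<open>With \<open>I = UNIV\<close> and \<open>\<omega> = 1\<close> the cone is the whole
  space, and the rates \<open>l\<close> of points and \<open>1 - l\<close> of the gradient admit
  every exponent above \<open>(1 - l) / l\<close>. The rest carries the bound back through the
  linear change of coordinates.\<close>

lemma gradient_lower_bound:
  fixes h :: "complex ^ 'n \<Rightarrow> complex"
  assumes E: "euler_pair S h G" and l: "0 < l" "\<And>\<eta> w. w \<noteq> 0 \<Longrightarrow> jac G 0 *v w = \<eta> *s w \<Longrightarrow> l \<le> Re \<eta>"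
    and \<theta>: "0 < \<theta>" "1 - l < \<theta> * l"
  shows "\<exists>c>0. \<exists>\<rho>>0. \<forall>z. norm z \<le> \<rho> \<longrightarrow> c * norm z powr \<theta> \<le> norm (gradient h z)"
proof -
  define \<delta> where "\<delta> = min (l / 4) ((\<theta> * l - (1 - l)) / (2 * (1 + 2 * \<theta>)))"
  have \<delta>: "0 < \<delta>" "2 * \<delta> < l" "(1 - l) + \<delta> < \<theta> * (l - 2 * \<delta>)"
  proof -
    show "0 < \<delta>" using l(1) \<theta> by (simp add: \<delta>_def)
    have "\<delta> \<le> l / 4" unfolding \<delta>_def by (rule min.cobounded1)
    then show "2 * \<delta> < l" using l(1) by linarith
    have "\<delta> \<le> (\<theta> * l - (1 - l)) / (2 * (1 + 2 * \<theta>))" by (simp add: \<delta>_def)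
    then have "\<delta> * (2 * (1 + 2 * \<theta>)) \<le> \<theta> * l - (1 - l)" using \<theta>(1) by (subst (asm) pos_le_divide_eq) auto
    moreover have "0 < \<delta> * (1 + 2 * \<theta>)" using \<open>0 < \<delta>\<close> \<theta>(1) by simp
    ultimately show "(1 - l) + \<delta> < \<theta> * (l - 2 * \<delta>)" by (simp add: algebra_simps)
  qed
  obtain T T' :: "complex ^ 'n ^ 'n" and \<alpha> :: "'n \<Rightarrow> complex" and r :: real where T: "T ** T' = mat 1" "T' ** T = mat 1" and r: "0 < r"
    and ev: "\<And>i. \<exists>w. w \<noteq> 0 \<and> jac G 0 *v w = \<alpha> i *s w" and rW: "cball 0 r \<subseteq> {w. T *v w \<in> S}"
    and EP: "euler_pair {w. T *v w \<in> S} (\<lambda>w. h (T *v w)) (\<lambda>w. T' *v G (T *v w))"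
    and AD: "almost_diagonal (\<lambda>w. T' *v G (T *v w)) \<alpha> \<delta> r"
    and "jac (\<lambda>w. T' *v G (T *v w)) 0 = T' ** jac G 0 ** T"
    and gr: "\<And>w. T *v w \<in> S \<Longrightarrow> gradient (\<lambda>w. h (T *v w)) w = transpose T *v gradient h (T *v w)"
  proof (rule euler_pair_diagonalize [OF E \<delta>(1)], goal_cases)
    case (1 T T' r \<alpha>)
    show ?case by (rule 1(1) [OF 1(2-10)])
  qed
  have \<alpha>: "l \<le> Re (\<alpha> i)" for i using ev l(2) by blast
  \<comment> \<open>No coordinate is outside \<open>I\<close>, so \<open>\<gamma>\<close> has only
    to exceed \<open>4 * \<delta>\<close>.\<close>
  have "\<exists>c>0. \<exists>\<rho>>0. \<forall>z. norm z \<le> \<rho> \<longrightarrow> norm (proj (- UNIV) z) \<le> norm (proj UNIV z) \<longrightarrow>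
     c * norm (proj UNIV z) powr \<theta> \<le> norm (gradient (\<lambda>w. h (T *v w)) z)"
    by (rule cone_lower_bound [OF EP r rW AD, where \<omega> = 1 and a = l and \<gamma> = "5 * \<delta>" and b = "1 - l"])
      (use \<alpha> \<delta> \<theta>(1) in auto)
  then obtain c \<rho> where c: "0 < c" "0 < \<rho>" "\<And>z. norm z \<le> \<rho> \<Longrightarrow> c * norm z powr \<theta> \<le> norm (gradient (\<lambda>w. h (T *v w)) z)"
    by auto
  obtain K1 where K1: "0 \<le> K1" "\<And>v. norm (transpose T *v v) \<le> K1 * norm v"
    using matrix_vector_norm_bound [of "transpose T"] by blast
  obtain K2 where K2: "0 \<le> K2" "\<And>v. norm (T *v v) \<le> K2 * norm v"
    using matrix_vector_norm_bound [of T] by blast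
  obtain K3 where K3: "0 \<le> K3" "\<And>v. norm (T' *v v) \<le> K3 * norm v"
    using matrix_vector_norm_bound [of T'] by blast
  define c' where "c' = c / ((K1 + 1) * (K2 + 1) powr \<theta>)"
  define \<rho>' where "\<rho>' = min \<rho> r / (K3 + 1)"
  show ?thesis
  proof (rule exI [of _ c'], intro conjI exI [of _ \<rho>'] allI impI)
    show "0 < c'" using c(1) K1(1) K2(1) by (simp add: c'_def add_nonneg_pos)
    show "0 < \<rho>'" using c(2) r K3(1) by (simp add: \<rho>'_def add_nonneg_pos)
    fix z :: "complex ^ 'n" assume z: "norm z \<le> \<rho>'"
    define w where "w = T' *v z"
    have Tw: "T *v w = z" by (simp add: w_def matrix_vector_mul_assoc T)
    have "norm w \<le> K3 * norm z" unfolding w_def by (rule K3(2))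
    also have "\<dots> \<le> (K3 + 1) * \<rho>'" using z K3(1) by (intro mult_mono) auto
    also have "\<dots> = min \<rho> r" using K3(1) by (simp add: \<rho>'_def)
    finally have w: "norm w \<le> \<rho>" "norm w \<le> r" by auto
    then have "T *v w \<in> S" using rW by auto
    then have "norm (gradient (\<lambda>w. h (T *v w)) w) \<le> K1 * norm (gradient h z)"
      using gr [of w] K1(2) [of "gradient h z"] by (simp add: Tw)
    also have "\<dots> \<le> (K1 + 1) * norm (gradient h z)" by (intro mult_right_mono) auto
    finally have 1: "c * norm w powr \<theta> \<le> (K1 + 1) * norm (gradient h z)" using c(3) [OF w(1)] by linarith
    have "norm z \<le> (K2 + 1) * norm w"
      using K2(2) [of w] unfolding Tw by (simp add: distrib_right add_increasing2)
    then have "norm z powr \<theta> \<le> ((K2 + 1) * norm w) powr \<theta>" using \<theta>(1) by (intro powr_mono2) auto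
    also have "\<dots> = (K2 + 1) powr \<theta> * norm w powr \<theta>" by (rule powr_mult)
    finally have "c * norm z powr \<theta> \<le> (K2 + 1) powr \<theta> * (c * norm w powr \<theta>)" using c(1) by (simp add: mult.left_commute)
    also have "\<dots> \<le> (K2 + 1) powr \<theta> * ((K1 + 1) * norm (gradient h z))" using 1 by (intro mult_left_mono) auto
    finally have "c * norm z powr \<theta> \<le> (K2 + 1) powr \<theta> * ((K1 + 1) * norm (gradient h z))" .
    moreover have "0 < (K1 + 1) * (K2 + 1) powr \<theta>" using K1(1) K2(1) by (simp add: add_nonneg_pos)
    ultimately show "c' * norm z powr \<theta> \<le> norm (gradient h z)"
      unfolding c'_def by (simp add: pos_divide_le_eq mult_ac)
  qed
qed

section \<open>Iteration of Euler steps\<close>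

lemma norm_diff_scale_sq:
  fixes x u :: "'a::real_inner"
  shows "(norm (x - t *\<^sub>R u))\<^sup>2 = (norm x)\<^sup>2 - 2 * t * (u \<bullet> x) + t\<^sup>2 * (norm u)\<^sup>2"
  unfolding power2_norm_eq_inner
  by (simp add: inner_diff_left inner_diff_right inner_commute [of x u] power2_eq_square [of t] algebra_simps)

lemma left_eigenvector_exists:
  fixes A :: "complex ^ 'n ^ 'n"
  assumes "w \<noteq> 0" "A *v w = \<beta> *s w"
  shows "\<exists>\<zeta>. \<zeta> \<noteq> 0 \<and> transpose A *v \<zeta> = \<beta> *s \<zeta>"
proof -
  have "(A - mat \<beta>) *v w = 0" using assms(2) by (simp add: matrix_action_simps)
  then have "det (A - mat \<beta>) = 0" using det_nonzero_iff_kernel [of "A - mat \<beta>"] assms(1) by blast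
  then have "det (transpose (A - mat \<beta>)) = 0" by (simp add: det_transpose)
  then obtain \<zeta> where \<zeta>: "\<zeta> \<noteq> 0" "transpose (A - mat \<beta>) *v \<zeta> = 0" using kernel_exists by blast
  then have "transpose A *v \<zeta> - \<beta> *s \<zeta> = 0" by (simp add: transpose_diff transpose_mat matrix_action_simps)
  with \<zeta>(1) show ?thesis by auto
qed

lemma holv_euler_step: "holv S G \<Longrightarrow> holv S (\<lambda>z. z - c *s G z)"
  unfolding holv_def by (simp add: hol_diff hol_mult)

lemma holv_id: "holv S (\<lambda>z :: complex ^ 'n. z)"
  by (simp add: holv_def)

text \<open>A left eigenvector \<open>\<zeta>\<close> of the Jacobian turns the linear part of the
  iterates into powers of the single number \<open>1 - c * \<beta>\<close>.\<close>

lemma funpow_euler_step_derivative: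
  assumes G: "open S" "0 \<in> S" "holv S G" "G 0 = 0" and \<zeta>: "transpose (jac G 0) *v \<zeta> = \<beta> *s \<zeta>"
  shows "((\<lambda>z. cdot \<zeta> (((\<lambda>z. z - c *s G z) ^^ k) z)) has_derivative cdot ((1 - c * \<beta>) ^ k *s \<zeta>)) (at 0)"
proof (induction k)
  case 0
  show ?case using bounded_linear_imp_has_derivative [OF cdot.bounded_linear_right [of \<zeta>], of "at 0"] by simp
next
  case (Suc k)
  define M where "M = mat 1 - mat c ** jac G 0"
  have "(G has_derivative (\<lambda>v. jac G 0 *v v)) (at 0)" by (rule holv_has_derivative [OF G(3,2)])
  from has_derivative_compose [OF this bounded_linear_imp_has_derivative [OF matrix_vector_mul_bounded_linear [of "mat c"]]]
  have "((\<lambda>z. c *s G z) has_derivative (\<lambda>v. c *s (jac G 0 *v v))) (at 0)" by simp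
  from has_derivative_diff [OF has_derivative_ident this]
  have "((\<lambda>z. z - c *s G z) has_derivative (\<lambda>v. M *v v)) (at 0)"
    by (simp add: M_def matrix_action_simps)
  moreover have "((\<lambda>z. cdot \<zeta> (((\<lambda>z. z - c *s G z) ^^ k) z)) has_derivative cdot ((1 - c * \<beta>) ^ k *s \<zeta>)) (at (0 - c *s G 0))"
  proof -
    have z0: "0 - c *s G 0 = 0" using G(4) by simp
    show ?thesis unfolding z0 by (rule Suc)
  qed
  ultimately have "((\<lambda>z. cdot \<zeta> (((\<lambda>z. z - c *s G z) ^^ k) (z - c *s G z))) has_derivative
      cdot (transpose M *v ((1 - c * \<beta>) ^ k *s \<zeta>))) (at 0)"
    by (rule gradient_compose)
  moreover have "transpose M *v ((1 - c * \<beta>) ^ k *s \<zeta>) = (1 - c * \<beta>) ^ Suc k *s \<zeta>"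
  proof -
    have "transpose M *v \<zeta> = \<zeta> - transpose (jac G 0) *v (c *s \<zeta>)"
      by (simp add: M_def transpose_diff transpose_mat matrix_transpose_mul matrix_vector_mult_diff_rdistrib matrix_vector_mul_assoc [symmetric])
    also have "\<dots> = (1 - c * \<beta>) *s \<zeta>" unfolding vector_scalar_commute \<zeta> by (simp add: vec_eq_iff algebra_simps)
    finally have e: "transpose M *v \<zeta> = (1 - c * \<beta>) *s \<zeta>" .
    show ?thesis unfolding vector_scalar_commute e vec.scale_scale power_Suc by (simp only: mult.commute)
  qed
  ultimately show ?case by (simp only: funpow_Suc_right o_def)
qed

lemma holv_funpow:
  assumes F: "holv S F" and maps: "\<And>k. (F ^^ k) ` U \<subseteq> S"
  shows "holv U (F ^^ k)"
proof (induction k)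
  case 0
  show ?case using holv_id by (simp add: id_def)
next
  case (Suc k)
  from holv_compose [OF Suc F maps] show ?case by (simp add: comp_def)
qed

text \<open>The Euler steps along \<open>- G\<close> contract the gradient, up to an error that is quadratic in the step,
  hence contract a neighbourhood of \<open>0\<close>; their linear part is then contracting as well.\<close>

lemma eigenvalue_positive:
  fixes h :: "complex ^ 'n \<Rightarrow> complex"
  assumes E: "euler_pair S h G" and \<kappa>: "0 < \<kappa>" "\<And>\<eta> w. w \<noteq> 0 \<Longrightarrow> jac G 0 *v w = \<eta> *s w \<Longrightarrow> Re \<eta> \<le> 1 - \<kappa>"
    and \<beta>: "w \<noteq> 0" "jac G 0 *v w = \<beta> *s w"
  shows "0 < Re \<beta>"
proof (rule ccontr)
  assume "\<not> 0 < Re \<beta>"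
  then have R\<beta>: "Re \<beta> \<le> 0" by simp
  define \<delta> where "\<delta> = \<kappa> / 2"
  have \<delta>: "0 < \<delta>" using \<kappa>(1) by (simp add: \<delta>_def)
  obtain T T' :: "complex ^ 'n ^ 'n" and \<alpha> :: "'n \<Rightarrow> complex" and r :: real where T: "T ** T' = mat 1" "T' ** T = mat 1" and r: "0 < r"
    and ev: "\<And>i. \<exists>w. w \<noteq> 0 \<and> jac G 0 *v w = \<alpha> i *s w" and rW: "cball 0 r \<subseteq> {w. T *v w \<in> S}"
    and EP: "euler_pair {w. T *v w \<in> S} (\<lambda>w. h (T *v w)) (\<lambda>w. T' *v G (T *v w))"
    and AD: "almost_diagonal (\<lambda>w. T' *v G (T *v w)) \<alpha> \<delta> r"
    and jG: "jac (\<lambda>w. T' *v G (T *v w)) 0 = T' ** jac G 0 ** T"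
    and gr: "\<And>w. T *v w \<in> S \<Longrightarrow> gradient (\<lambda>w. h (T *v w)) w = transpose T *v gradient h (T *v w)"
  proof (rule euler_pair_diagonalize [OF E \<delta>], goal_cases)
    case (1 T T' r \<alpha>)
    show ?case by (rule 1(1) [OF 1(2-10)])
  qed
  define h' where "h' = (\<lambda>w. h (T *v w))"
  define G' where "G' = (\<lambda>w. T' *v G (T *v w))"
  define W where "W = {w. T *v w \<in> S}"
  define p where "p = gradient h'"
  have E': "euler_pair W h' G'" using EP by (simp add: W_def h'_def G'_def)
  note D = euler_pairD [OF E']
  have G'0: "G' 0 = 0" by (rule euler_field_zero [OF E'])
  have AD': "almost_diagonal G' \<alpha> \<delta> r" using AD by (simp add: G'_def)
  obtain \<zeta> where \<zeta>: "\<zeta> \<noteq> 0" "transpose (jac G' 0) *v \<zeta> = \<beta> *s \<zeta>"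
  proof -
    have "T *v (T' *v w) = w" by (simp add: matrix_vector_mul_assoc T)
    then have "jac G' 0 *v (T' *v w) = \<beta> *s (T' *v w)"
      unfolding G'_def jG by (simp add: matrix_vector_mul_assoc [symmetric] \<beta>(2) vector_scalar_commute)
    moreover have "T' *v w \<noteq> 0" using \<open>T *v (T' *v w) = w\<close> \<beta>(1) by auto
    ultimately show ?thesis using left_eigenvector_exists that by blast
  qed
  obtain r0 C where C: "0 < r0" "1 \<le> C" "cball 0 (2 * r0) \<subseteq> W" "\<And>z. norm z \<le> 2 * r0 \<Longrightarrow> norm (G' z) \<le> C"
    "\<And>z t. norm z \<le> r0 \<Longrightarrow> norm t * C \<le> r0 / 2 \<Longrightarrow>
       norm (p (z + t *s G' z) - (p z + t *s (p z - transpose (jac G' z) *v p z))) \<le> C * (norm t)\<^sup>2"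
    "\<And>z q. norm z \<le> r0 \<Longrightarrow> norm (transpose (jac G' z) *v q) \<le> C * norm q"
    using euler_pair_bounds [OF E'] unfolding p_def by metis
  define \<rho> where "\<rho> = min r r0"
  have \<rho>: "0 < \<rho>" "\<rho> \<le> r" "\<rho> \<le> r0" using r C(1) by (simp_all add: \<rho>_def)
  have \<rho>W: "cball 0 \<rho> \<subseteq> W" using subset_cball [of \<rho> "2 * r0" "0 :: complex ^ 'n"] \<rho>(3) C(1,3) by auto
  obtain m where m: "0 < m" "\<And>z. \<rho> / 2 \<le> norm z \<Longrightarrow> norm z \<le> \<rho> \<Longrightarrow> m \<le> norm (p z)"
    using gradient_annulus_bound [OF E' \<rho>W, of "\<rho> / 2"] \<rho>(1) unfolding p_def by auto
  have "isCont p 0" using holv_continuous_on [OF D(8)] D(1,2) by (simp add: p_def continuous_on_eq_continuous_at)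
  then obtain \<sigma>0 where \<sigma>0: "0 < \<sigma>0" "\<And>z. norm z < \<sigma>0 \<Longrightarrow> norm (p z) < m / 2"
    using m(1) D(7) unfolding continuous_at_eps_delta p_def dist_norm by (metis diff_zero half_gt_zero_iff)
  define \<sigma> where "\<sigma> = min \<sigma>0 (\<rho> / 2)"
  have \<sigma>: "0 < \<sigma>" "\<sigma> \<le> \<rho> / 2" "\<And>z. norm z < \<sigma> \<Longrightarrow> norm (p z) < m / 2" using \<sigma>0 \<rho>(1) by (auto simp: \<sigma>_def)
  obtain m' where m': "0 < m'" "\<And>z. \<sigma> / 4 \<le> norm z \<Longrightarrow> norm z \<le> \<rho> \<Longrightarrow> m' \<le> norm (p z)"
    using gradient_annulus_bound [OF E' \<rho>W, of "\<sigma> / 4"] \<sigma>(1) unfolding p_def by auto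
  define K where "K = 1 + C"
  have K: "0 < K" using C(2) by (simp add: K_def)
  \<comment> \<open>The four bounds keep, in this order, the quadratic term within half of the
    contraction, a step within \<open>\<rho> / 2\<close>, \<open>q\<close> within \<open>1\<close>,
    and the accumulated error \<open>B\<close> within a quarter of \<open>m\<close> and
    \<open>m'\<close>.\<close>
  define t where "t = min (\<kappa> / (2 * K\<^sup>2)) (min (\<rho> / (2 * C)) (min (4 / \<kappa>) (\<kappa> * min m m' / (16 * C))))"
  have C0: "0 < C" using C(2) by simp
  have t: "0 < t" "t \<le> \<kappa> / (2 * K\<^sup>2)" "t \<le> \<rho> / (2 * C)" "t \<le> 4 / \<kappa>" "t \<le> \<kappa> * min m m' / (16 * C)"
  proof -
    have "0 < min m m'" using m(1) m'(1) by simp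
    then show "0 < t" using \<kappa>(1) K \<rho>(1) C0 by (simp add: t_def del: min_less_iff_conj add: min_def)
    show "t \<le> \<kappa> / (2 * K\<^sup>2)" unfolding t_def by (rule min.cobounded1)
    show "t \<le> \<rho> / (2 * C)" unfolding t_def by (intro min.coboundedI2 min.cobounded1)
    show "t \<le> 4 / \<kappa>" unfolding t_def by (rule min.coboundedI2, rule min.coboundedI2, rule min.cobounded1)
    show "t \<le> \<kappa> * min m m' / (16 * C)" unfolding t_def by (rule min.coboundedI2, rule min.coboundedI2, rule min.cobounded2)
  qed
  define q where "q = t * \<kappa> / 4"
  have q: "0 < q" "q \<le> 1" using t(1,4) \<kappa>(1) by (simp_all add: q_def field_simps)
  \<comment> \<open>The fixed point of \<open>x \<mapsto> (1 - q) * x + C * t^2\<close>, a bound for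
    the total of all step errors.\<close>
  define B where "B = 4 * C * t / \<kappa>"
  have B: "0 \<le> B" "B \<le> min m m' / 4" "q * B = C * t\<^sup>2"
  proof -
    show "0 \<le> B" using C0 t(1) \<kappa>(1) by (simp add: B_def)
    have "B \<le> 4 * C * (\<kappa> * min m m' / (16 * C)) / \<kappa>"
      unfolding B_def using t(5) C0 \<kappa>(1) by (intro divide_right_mono mult_left_mono) auto
    also have "\<dots> = min m m' / 4" using C0 \<kappa>(1) by simp
    finally show "B \<le> min m m' / 4" .
    show "q * B = C * t\<^sup>2" using \<kappa>(1) by (simp add: q_def B_def power2_eq_square)
  qed
  have tC: "t * C \<le> \<rho> / 2" using t(3) C0 by (simp add: field_simps)
  define F where "F z = z - of_real t *s G' z" for z
  have contr: "norm (p (F z)) \<le> (1 - q) * norm (p z) + C * t\<^sup>2" if z: "norm z \<le> \<rho>" for z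
  proof -
    define u where "u = p z - transpose (jac G' z) *v p z"
    have zr: "norm z \<le> r" "norm z \<le> r0" using z \<rho> by auto
    have "norm u \<le> norm (p z) + norm (transpose (jac G' z) *v p z)" unfolding u_def by (rule norm_triangle_ineq4)
    then have nu: "norm u \<le> K * norm (p z)" using C(6) [OF zr(2), of "p z"] by (simp add: K_def distrib_right)
    have ueq: "u = 1 *s diag_apply (\<lambda>i. 1 - \<alpha> i) (p z) - (transpose (jac G' z) *v p z - diag_apply \<alpha> (p z))"
      unfolding u_def by (simp add: vec_eq_iff algebra_simps)
    have "\<kappa> * (norm (p z))\<^sup>2 \<le> (1 *s diag_apply (\<lambda>i. 1 - \<alpha> i) (p z)) \<bullet> p z"
    proof -
      have "\<kappa> \<le> Re (1 * (1 - \<alpha> i))" for i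
      proof -
        have "Re (\<alpha> i) \<le> 1 - \<kappa>" using ev [of i] \<kappa>(2) by blast
        then show ?thesis by simp
      qed
      then show ?thesis using inner_diag_apply_proj_ge [of UNIV \<kappa> 1 "\<lambda>i. 1 - \<alpha> i" "p z"] by simp
    qed
    moreover have "\<bar>(transpose (jac G' z) *v p z - diag_apply \<alpha> (p z)) \<bullet> p z\<bar> \<le> \<delta> * (norm (p z))\<^sup>2"
    proof -
      have "\<bar>(transpose (jac G' z) *v p z - diag_apply \<alpha> (p z)) \<bullet> p z\<bar> \<le> norm (transpose (jac G' z) *v p z - diag_apply \<alpha> (p z)) * norm (p z)"
        by (rule Cauchy_Schwarz_ineq2)
      also have "\<dots> \<le> (\<delta> * norm (p z)) * norm (p z)"
        using AD' zr(1) by (intro mult_right_mono) (auto simp: almost_diagonal_def)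
      finally show ?thesis by (simp add: power2_eq_square)
    qed
    ultimately have up: "\<kappa> / 2 * (norm (p z))\<^sup>2 \<le> u \<bullet> p z"
    proof -
      assume 1: "\<kappa> * (norm (p z))\<^sup>2 \<le> (1 *s diag_apply (\<lambda>i. 1 - \<alpha> i) (p z)) \<bullet> p z"
        and 2: "\<bar>(transpose (jac G' z) *v p z - diag_apply \<alpha> (p z)) \<bullet> p z\<bar> \<le> \<delta> * (norm (p z))\<^sup>2"
      have "u \<bullet> p z = (1 *s diag_apply (\<lambda>i. 1 - \<alpha> i) (p z)) \<bullet> p z - (transpose (jac G' z) *v p z - diag_apply \<alpha> (p z)) \<bullet> p z"
        by (subst ueq) (rule inner_diff_left)
      moreover have "\<delta> * (norm (p z))\<^sup>2 = \<kappa> / 2 * (norm (p z))\<^sup>2" by (simp add: \<delta>_def)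
      moreover have "\<kappa> * (norm (p z))\<^sup>2 = \<kappa> / 2 * (norm (p z))\<^sup>2 + \<kappa> / 2 * (norm (p z))\<^sup>2" by simp
      ultimately show ?thesis using 1 2 by linarith
    qed
    have "(norm (p z - t *\<^sub>R u))\<^sup>2 = (norm (p z))\<^sup>2 - 2 * t * (u \<bullet> p z) + t\<^sup>2 * (norm u)\<^sup>2"
      by (rule norm_diff_scale_sq)
    also have "\<dots> \<le> (norm (p z))\<^sup>2 - 2 * t * (\<kappa> / 2 * (norm (p z))\<^sup>2) + t\<^sup>2 * (K * norm (p z))\<^sup>2"
      using up nu t(1) by (intro add_mono diff_mono mult_left_mono power_mono) auto
    also have "\<dots> = (1 - t * \<kappa> + t * (t * K\<^sup>2)) * (norm (p z))\<^sup>2" by (simp add: power2_eq_square algebra_simps)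
    also have "\<dots> \<le> (1 - q)\<^sup>2 * (norm (p z))\<^sup>2"
    proof (rule mult_right_mono)
      have "t * K\<^sup>2 \<le> \<kappa> / 2" using t(2) K by (simp add: field_simps)
      then have "t * (t * K\<^sup>2) \<le> t * (\<kappa> / 2)" using t(1) by (intro mult_left_mono) auto
      then have "1 - t * \<kappa> + t * (t * K\<^sup>2) \<le> 1 - 2 * q" unfolding q_def by linarith
      also have "\<dots> \<le> (1 - q)\<^sup>2" using zero_le_power2 [of q] by (simp add: power2_diff)
      finally show "1 - t * \<kappa> + t * (t * K\<^sup>2) \<le> (1 - q)\<^sup>2" .
    qed simp
    finally have "(norm (p z - t *\<^sub>R u))\<^sup>2 \<le> ((1 - q) * norm (p z))\<^sup>2" by (simp only: power_mult_distrib)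
    then have 1: "norm (p z - t *\<^sub>R u) \<le> (1 - q) * norm (p z)" by (rule power2_le_imp_le) (use q in simp)
    have "norm (- of_real t :: complex) * C \<le> r0 / 2" using tC t(1) \<rho>(3) by simp
    note C5 = C(5) [OF zr(2) this]
    have Feq: "F z = z + (- of_real t) *s G' z" by (simp add: F_def vec_eq_iff)
    have ueq2: "p z - of_real t *s u = p z + (- of_real t) *s (p z - transpose (jac G' z) *v p z)"
      by (simp add: u_def vec_eq_iff algebra_simps)
    have "norm (p (F z) - (p z - of_real t *s u)) \<le> C * t\<^sup>2"
      unfolding Feq ueq2 using C5 by (simp only: norm_minus_cancel norm_of_real power2_abs)
    moreover have "of_real t *s u = t *\<^sub>R u"
      by (simp only: vec_eq_iff vector_smult_component vector_scaleR_component scaleR_conv_of_real [where 'a = complex]) simp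
    ultimately show ?thesis using 1 norm_triangle_sub [of "p (F z)" "p z - t *\<^sub>R u"] by simp
  qed
  \<comment> \<open>The gradient stays below \<open>m\<close>, its lower bound on the annulus from
    \<open>\<rho> / 2\<close> to \<open>\<rho>\<close>; a single step is too short to jump over the
    annulus, so the iterates remain inside.\<close>
  have iter: "norm ((F ^^ k) z) < \<rho> / 2 \<and> norm (p ((F ^^ k) z)) \<le> (1 - q) ^ k * norm (p z) + B" if z: "norm z < \<sigma>" for k z
  proof (induction k)
    case 0
    show ?case using z \<sigma>(2) B(1) by simp
  next
    case (Suc k)
    define y where "y = (F ^^ k) z"
    have y: "norm y < \<rho> / 2" "norm (p y) \<le> (1 - q) ^ k * norm (p z) + B" using Suc by (auto simp: y_def)
    have "norm (p (F y)) \<le> (1 - q) * norm (p y) + C * t\<^sup>2" by (rule contr) (use y(1) \<rho>(1) in simp)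
    also have "\<dots> \<le> (1 - q) * ((1 - q) ^ k * norm (p z) + B) + C * t\<^sup>2"
      using y(2) q by (intro add_right_mono mult_left_mono) auto
    also have "\<dots> = (1 - q) ^ Suc k * norm (p z) + B" using B(3) by (simp add: algebra_simps)
    finally have 1: "norm (p (F y)) \<le> (1 - q) ^ Suc k * norm (p z) + B" .
    have "(1 - q) ^ Suc k * norm (p z) \<le> 1 * norm (p z)"
      using q by (intro mult_right_mono power_le_one) auto
    then have "norm (p (F y)) < m" using 1 \<sigma>(3) [OF z] B(2) m(1) by linarith
    moreover have "norm (F y) \<le> \<rho>"
    proof -
      have "norm (F y) \<le> norm y + norm (of_real t *s G' y)" unfolding F_def by (rule norm_triangle_ineq4)
      also have "norm (of_real t *s G' y) \<le> t * C"
        using C(4) [of y] y(1) \<rho>(1,3) t(1) by (simp add: mult_left_mono)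
      finally show ?thesis using y(1) tC by simp
    qed
    ultimately have "norm (F y) < \<rho> / 2" using m(2) [of "F y"] by (meson not_less)
    then show ?case using 1 by (simp add: y_def)
  qed
  obtain n where n: "(1 - q) ^ n < m' / m" using real_arch_pow_inv [of "m' / m" "1 - q"] m(1) m'(1) q(1) by auto
  have small: "norm ((F ^^ n) z) \<le> \<sigma> / 4" if z: "norm z < \<sigma>" for z
  proof (rule ccontr)
    assume "\<not> ?thesis"
    then have "m' \<le> norm (p ((F ^^ n) z))" using iter [OF z, of n] \<rho>(1) by (intro m'(2)) auto
    also have "\<dots> \<le> (1 - q) ^ n * norm (p z) + B" using iter [OF z] by blast
    also have "\<dots> \<le> m' / m * (m / 2) + min m m' / 4"
      using n \<sigma>(3) [OF z] B(2) m(1) m'(1) q by (intro add_mono mult_mono) auto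
    also have "\<dots> < m'" using m(1) m'(1) by (simp add: min_def)
    finally show False by simp
  qed
  have maps: "(F ^^ k) ` ball 0 \<sigma> \<subseteq> W" for k
  proof
    fix y assume "y \<in> (F ^^ k) ` ball 0 \<sigma>"
    then obtain z where "norm z < \<sigma>" "y = (F ^^ k) z" by auto
    then have "norm y \<le> \<rho>" using iter [of z k] \<rho>(1) by simp
    then show "y \<in> W" using \<rho>W by auto
  qed
  have "holv W F" unfolding F_def [abs_def] by (rule holv_euler_step [OF D(4)])
  then have "holv (ball 0 \<sigma>) (F ^^ n)" using maps by (rule holv_funpow)
  then have hf: "hol (ball 0 \<sigma>) (\<lambda>z. cdot \<zeta> ((F ^^ n) z))" by (rule hol_cdot_const)
  have gf: "gradient (\<lambda>z. cdot \<zeta> ((F ^^ n) z)) 0 = (1 - of_real t * \<beta>) ^ n *s \<zeta>"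
    unfolding F_def [abs_def] by (rule gradient_eqI [OF funpow_euler_step_derivative [OF D(1,2,4) G'0 \<zeta>(2)]])
  obtain v where v: "norm v = 1" "cdot v \<zeta> = of_real (norm \<zeta>)" using dual_vector_exists by blast
  \<comment> \<open>The \<open>n\<close>-th iterate maps the ball of radius \<open>\<sigma>\<close>
    into that of radius \<open>\<sigma> / 4\<close>, so Cauchy's estimate on radius
    \<open>\<sigma> / 2\<close> shows that its linear part at least halves \<open>\<zeta>\<close>;
    with \<open>Re \<beta> \<le> 0\<close> it cannot shrink \<open>\<zeta>\<close>.\<close>
  have "norm (cdot (gradient (\<lambda>z. cdot \<zeta> ((F ^^ n) z)) 0) v) \<le> (norm \<zeta> * (\<sigma> / 4)) / (\<sigma> / 2) * norm v"
  proof (rule cauchy_gradient [OF hf])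
    show "norm (cdot \<zeta> ((F ^^ n) (0 + z))) \<le> norm \<zeta> * (\<sigma> / 4)" if "norm z \<le> \<sigma> / 2" for z
    proof -
      have "norm z < \<sigma>" using that \<sigma>(1) by simp
      then show ?thesis using norm_cdot_le [of \<zeta> "(F ^^ n) z"] small [of z] by (smt (verit) add_0 mult_left_mono norm_ge_zero)
    qed
  qed (use \<sigma>(1) in auto)
  moreover have "cdot (gradient (\<lambda>z. cdot \<zeta> ((F ^^ n) z)) 0) v = (1 - of_real t * \<beta>) ^ n * of_real (norm \<zeta>)"
    unfolding gf cdot_scale_left cdot_commute [of \<zeta> v] v(2) ..
  moreover have "(norm \<zeta> * (\<sigma> / 4)) / (\<sigma> / 2) * norm v = norm \<zeta> / 2" using \<sigma>(1) v(1) by simp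
  ultimately have "norm (1 - of_real t * \<beta>) ^ n * norm \<zeta> \<le> norm \<zeta> / 2"
    by (simp only: norm_mult norm_power norm_of_real abs_norm_cancel)
  moreover have "1 \<le> norm (1 - of_real t * \<beta>)"
  proof -
    have "t * Re \<beta> \<le> 0" using t(1) R\<beta> by (simp add: mult_nonneg_nonpos)
    then have "1 \<le> Re (1 - of_real t * \<beta>)" by simp
    then show ?thesis using complex_Re_le_cmod order_trans by blast
  qed
  then have "1 * norm \<zeta> \<le> norm (1 - of_real t * \<beta>) ^ n * norm \<zeta>" by (intro mult_right_mono one_le_power) auto
  ultimately show False using \<zeta>(1) by simp
qed

section \<open>Linearisation in one coordinate\<close>

lemma eq_0_if_le_multiple:
  fixes x K :: real
  assumes "0 \<le> x" "0 < a" "\<And>e. 0 < e \<Longrightarrow> e < a \<Longrightarrow> x \<le> K * e"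
  shows "x = 0"
proof (rule ccontr)
  assume "x \<noteq> 0"
  with assms(1) have x: "0 < x" by simp
  define e where "e = min (a / 2) (x / (2 * (\<bar>K\<bar> + 1)))"
  have e: "0 < e" "e < a" using assms(2) x by (auto simp: e_def min_less_iff_disj)
  have "x \<le> K * e" by (rule assms(3) [OF e])
  also have "\<dots> \<le> (\<bar>K\<bar> + 1) * e" using e(1) by (intro mult_right_mono) auto
  also have "\<dots> \<le> (\<bar>K\<bar> + 1) * (x / (2 * (\<bar>K\<bar> + 1)))" by (intro mult_left_mono) (auto simp: e_def)
  also have "\<dots> = x / 2"
  proof -
    have "\<bar>K\<bar> + 1 \<noteq> 0" by linarith
    then show ?thesis by (simp add: field_simps)
  qed
  finally show False using x by simp
qed

text \<open>Koenigs' construction for the Euler step \<open>F z = z - t G z\<close>: the quotients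
  of \<open>cdot \<zeta> (F^k z)\<close> by \<open>(1 - t l)^k\<close> converge, since
  \<open>cdot \<zeta>\<close> satisfies the functional equation up to order two and twice the
  contraction rate of \<open>F\<close> beats \<open>l\<close>. Resonances are impossible because
  \<open>l\<close> is a lower bound for the real parts. Stopping at a large \<open>k\<close> leaves
  an error \<open>t^2\<close>, and the bounds do not depend on \<open>t\<close>.\<close>

lemma approximate_linearization:
  fixes G :: "complex ^ 'n \<Rightarrow> complex ^ 'n" and l :: real
  assumes W: "open W" "0 \<in> W" "holv W G" "G 0 = 0" and r: "0 < r" "cball 0 r \<subseteq> W"
    and l: "0 < l" and AD: "almost_diagonal G \<alpha> (l / 8) r" and \<alpha>: "\<And>i. l \<le> Re (\<alpha> i)"
    and \<zeta>: "transpose (jac G 0) *v \<zeta> = of_real l *s \<zeta>"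
  shows "\<exists>R>0. \<exists>M\<ge>0. \<exists>t0>0. R \<le> r \<and> (\<forall>t. 0 < t \<longrightarrow> t \<le> t0 \<longrightarrow> (\<exists>F. hol (ball 0 R) F \<and>
     (\<forall>z. norm z < R \<longrightarrow> norm (F z - cdot \<zeta> z) \<le> M * (norm z)\<^sup>2 \<and>
        norm (F (z - of_real t *s G z) - of_real (1 - t * l) * F z) \<le> t\<^sup>2)))"
proof -
  obtain r1 C where 1: "0 < r1" "0 \<le> C" "cball 0 (2 * r1) \<subseteq> W"
    "\<And>z y. norm z \<le> r1 \<Longrightarrow> norm y \<le> r1 / 2 \<Longrightarrow> norm (G (z + y) - G z - jac G z *v y) \<le> C * (norm y)\<^sup>2"
    using holv_local_bounds [OF W(1,2,3)] by blast
  define R where "R = min r (r1 / 2)"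
  have R: "0 < R" "R \<le> r" "R \<le> r1 / 2" using r(1) 1(1) by (simp_all add: R_def)
  obtain K0 where K0: "0 \<le> K0" "\<And>v. norm (jac G 0 *v v) \<le> K0 * norm v"
    using matrix_vector_norm_bound [of "jac G 0"] by blast
  define K where "K = K0 + l / 4"
  have K: "0 < K" using K0(1) l by (simp add: K_def)
  have GK: "norm (G z) \<le> K * norm z" if "norm z \<le> R" for z
  proof -
    have "norm (G z - diag_apply \<alpha> z) \<le> l / 8 * norm z" "norm (jac G 0 *v z - diag_apply \<alpha> z) \<le> l / 8 * norm z"
      using AD that R(2) r(1) by (auto simp: almost_diagonal_def)
    then show ?thesis
      using K0(2) [of z] norm_triangle_sub [of "G z" "diag_apply \<alpha> z"] norm_triangle_sub [of "diag_apply \<alpha> z" "jac G 0 *v z"]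
      unfolding K_def distrib_right by (simp add: norm_minus_commute)
  qed
  have Gi: "7 / 8 * l * (norm z)\<^sup>2 \<le> G z \<bullet> z" if "norm z \<le> R" for z
  proof -
    have "l * (norm z)\<^sup>2 \<le> diag_apply \<alpha> z \<bullet> z"
      using inner_diag_apply_proj_ge [of UNIV l 1 \<alpha> z] \<alpha> by simp
    moreover have "\<bar>(G z - diag_apply \<alpha> z) \<bullet> z\<bar> \<le> l / 8 * norm z * norm z"
      using AD that R(2) by (intro order_trans [OF Cauchy_Schwarz_ineq2] mult_right_mono) (auto simp: almost_diagonal_def)
    ultimately show ?thesis unfolding inner_diff_left power2_eq_square by linarith
  qed
  have quad: "norm (cdot \<zeta> (G y) - of_real l * cdot \<zeta> y) \<le> norm \<zeta> * C * (norm y)\<^sup>2" if "norm y \<le> R" for y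
  proof -
    have "cdot \<zeta> (jac G 0 *v y) = of_real l * cdot \<zeta> y" unfolding cdot_transpose \<zeta> by simp
    then have "cdot \<zeta> (G y) - of_real l * cdot \<zeta> y = cdot \<zeta> (G (0 + y) - G 0 - jac G 0 *v y)"
      by (simp add: cdot.diff_right W(4))
    then have "norm (cdot \<zeta> (G y) - of_real l * cdot \<zeta> y) \<le> norm \<zeta> * norm (G (0 + y) - G 0 - jac G 0 *v y)"
      by (simp only: norm_cdot_le)
    also have "\<dots> \<le> norm \<zeta> * (C * (norm y)\<^sup>2)" using that R(3) 1(1) by (intro mult_left_mono 1(4)) auto
    finally show ?thesis by simp
  qed
  define t0 where "t0 = min (l / (4 * K\<^sup>2)) (1 / (2 * l))"
  have t0: "0 < t0" using l K by (simp add: t0_def)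
  define M where "M = 8 * norm \<zeta> * C / l"
  have M: "0 \<le> M" using 1(2) l by (simp add: M_def)
  have main: "\<exists>F. hol (ball 0 R) F \<and> (\<forall>z. norm z < R \<longrightarrow> norm (F z - cdot \<zeta> z) \<le> M * (norm z)\<^sup>2 \<and>
        norm (F (z - of_real t *s G z) - of_real (1 - t * l) * F z) \<le> t\<^sup>2)" if t: "0 < t" "t \<le> t0" for t
  proof -
    have tK: "t * K\<^sup>2 \<le> l / 4"
    proof -
      have "t \<le> l / (4 * K\<^sup>2)" using t(2) by (simp add: t0_def)
      then show ?thesis using K by (simp add: field_simps)
    qed
    have tl: "t * l \<le> 1 / 2" using t(2) l by (simp add: t0_def field_simps)
    have tl0: "0 < t * l" using t(1) l by simp
    \<comment> \<open>\<open>\<mu>\<close> is the multiplier of \<open>\<zeta>\<close> under the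
      Euler step, \<open>\<nu>\<close> a contraction factor of the step, where \<open>3 / 4\<close>
      leaves room for the errors, and \<open>\<theta>\<close> the ratio of the geometric series, by
      \<open>\<nu>^2 \<le> \<theta> * \<mu>\<close>.\<close>
    define \<mu> where "\<mu> = 1 - t * l"
    define \<nu> where "\<nu> = 1 - 3 / 4 * (t * l)"
    define \<theta> where "\<theta> = 1 - t * l / 4"
    have \<mu>: "1 / 2 \<le> \<mu>" using tl by (simp add: \<mu>_def)
    have \<nu>: "0 \<le> \<nu>" "\<nu> \<le> 1" using tl tl0 by (simp_all add: \<nu>_def)
    have \<theta>: "0 \<le> \<theta>" "\<theta> < 1" using tl tl0 by (simp_all add: \<theta>_def)
    have \<nu>\<mu>: "\<nu>\<^sup>2 \<le> \<theta> * \<mu>"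
    proof -
      have "(t * l) * (t * l) \<le> (t * l) * (1 / 2)" using tl tl0 by (intro mult_left_mono) auto
      moreover have "\<theta> * \<mu> - \<nu>\<^sup>2 = (t * l) / 4 - 5 / 16 * ((t * l) * (t * l))"
        unfolding \<nu>_def \<theta>_def \<mu>_def by (simp add: power2_eq_square field_simps)
      ultimately show ?thesis using tl0 by linarith
    qed
    define F where "F z = z - of_real t *s G z" for z
    have FR: "norm (F z) \<le> \<nu> * norm z" if z: "norm z \<le> R" for z
    proof -
      have sc: "of_real t *s G z = t *\<^sub>R G z"
        by (simp only: vec_eq_iff vector_smult_component vector_scaleR_component scaleR_conv_of_real [where 'a = complex]) simp
      have "(norm (F z))\<^sup>2 = (norm z)\<^sup>2 - 2 * t * (G z \<bullet> z) + t\<^sup>2 * (norm (G z))\<^sup>2"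
        unfolding F_def sc by (rule norm_diff_scale_sq)
      also have "\<dots> \<le> (norm z)\<^sup>2 - 2 * t * (7 / 8 * l * (norm z)\<^sup>2) + t\<^sup>2 * (K * norm z)\<^sup>2"
        using Gi [OF z] GK [OF z] t(1) by (intro add_mono diff_mono mult_left_mono power_mono) auto
      also have "\<dots> = (1 - 7 / 4 * (t * l) + t * (t * K\<^sup>2)) * (norm z)\<^sup>2" by (simp add: power2_eq_square algebra_simps)
      also have "\<dots> \<le> \<nu>\<^sup>2 * (norm z)\<^sup>2"
      proof (rule mult_right_mono)
        have "t * (t * K\<^sup>2) \<le> t * (l / 4)" using tK t(1) by (intro mult_left_mono) auto
        moreover have "\<nu>\<^sup>2 = 1 - 3 / 2 * (t * l) + (3 / 4 * (t * l))\<^sup>2" by (simp add: \<nu>_def power2_eq_square algebra_simps)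
        moreover have "0 \<le> (3 / 4 * (t * l))\<^sup>2" by (rule zero_le_power2)
        moreover have "t * (l / 4) = (t * l) / 4" by simp
        ultimately show "1 - 7 / 4 * (t * l) + t * (t * K\<^sup>2) \<le> \<nu>\<^sup>2" by linarith
      qed simp
      finally have "(norm (F z))\<^sup>2 \<le> (\<nu> * norm z)\<^sup>2" by (simp only: power_mult_distrib)
      then show ?thesis by (rule power2_le_imp_le) (use \<nu>(1) in simp)
    qed
    have iter: "norm ((F ^^ k) z) \<le> \<nu> ^ k * norm z" "norm ((F ^^ k) z) \<le> norm z" if z: "norm z \<le> R" for k z
    proof -
      have "norm ((F ^^ k) z) \<le> \<nu> ^ k * norm z \<and> norm ((F ^^ k) z) \<le> norm z"
      proof (induction k)
        case (Suc k)
        then have "norm (F ((F ^^ k) z)) \<le> \<nu> * norm ((F ^^ k) z)" using z by (intro FR) simp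
        moreover have "\<nu> * norm ((F ^^ k) z) \<le> \<nu> * (\<nu> ^ k * norm z)" using Suc \<nu>(1) by (intro mult_left_mono) auto
        moreover have "\<nu> * norm ((F ^^ k) z) \<le> 1 * norm z" using Suc \<nu> by (intro mult_mono) auto
        ultimately show ?case by simp
      qed simp
      then show "norm ((F ^^ k) z) \<le> \<nu> ^ k * norm z" "norm ((F ^^ k) z) \<le> norm z" by auto
    qed
    define X where "X k z = cdot \<zeta> ((F ^^ k) z) / of_real (\<mu> ^ k)" for k z
    have step: "norm (X (Suc k) z - X k z) \<le> 2 * t * norm \<zeta> * C * \<theta> ^ k * (norm z)\<^sup>2" if z: "norm z \<le> R" for k z
    proof -
      define y where "y = (F ^^ k) z"
      have y: "norm y \<le> \<nu> ^ k * norm z" "norm y \<le> R" using iter [OF z, of k] z by (auto simp: y_def)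
      have "X (Suc k) z - X k z = (cdot \<zeta> (F y) - of_real \<mu> * cdot \<zeta> y) / of_real (\<mu> ^ Suc k)"
        using \<mu> by (simp add: X_def y_def diff_divide_distrib)
      also have "cdot \<zeta> (F y) - of_real \<mu> * cdot \<zeta> y = - of_real t * (cdot \<zeta> (G y) - of_real l * cdot \<zeta> y)"
        by (simp add: F_def \<mu>_def cdot.diff_right algebra_simps)
      finally have "norm (X (Suc k) z - X k z) = t * norm (cdot \<zeta> (G y) - of_real l * cdot \<zeta> y) / \<mu> ^ Suc k"
        using \<mu> t(1) by (simp add: norm_divide norm_mult norm_power)
      also have "\<dots> \<le> t * (norm \<zeta> * C * (\<nu> ^ k * norm z)\<^sup>2) / \<mu> ^ Suc k"
      proof (intro divide_right_mono mult_left_mono)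
        have "norm \<zeta> * C * (norm y)\<^sup>2 \<le> norm \<zeta> * C * (\<nu> ^ k * norm z)\<^sup>2"
          using y(1) 1(2) by (intro mult_left_mono power_mono) auto
        then show "norm (cdot \<zeta> (G y) - of_real l * cdot \<zeta> y) \<le> norm \<zeta> * C * (\<nu> ^ k * norm z)\<^sup>2"
          using quad [OF y(2)] by linarith
      qed (use t(1) \<mu> in auto)
      also have "\<dots> = t * norm \<zeta> * C * (norm z)\<^sup>2 * ((\<nu>\<^sup>2) ^ k / \<mu> ^ Suc k)"
        by (simp add: power_mult_distrib power_mult [symmetric] mult.commute [of k])
      also have "\<dots> \<le> t * norm \<zeta> * C * (norm z)\<^sup>2 * (2 * \<theta> ^ k)"
      proof (rule mult_left_mono)
        have "(\<nu>\<^sup>2) ^ k \<le> (\<theta> * \<mu>) ^ k" using \<nu>\<mu> by (intro power_mono) auto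
        then have "(\<nu>\<^sup>2) ^ k / \<mu> ^ Suc k \<le> (\<theta> * \<mu>) ^ k / \<mu> ^ Suc k" using \<mu> by (intro divide_right_mono) auto
        also have "\<dots> = \<theta> ^ k / \<mu>" using \<mu> by (simp add: power_mult_distrib)
        also have "\<dots> \<le> \<theta> ^ k / (1 / 2)" using \<mu> \<theta>(1) by (intro divide_left_mono) auto
        finally show "(\<nu>\<^sup>2) ^ k / \<mu> ^ Suc k \<le> 2 * \<theta> ^ k" by simp
      qed (use t(1) 1(2) in simp)
      finally show ?thesis by (simp add: mult_ac)
    qed
    have close: "norm (X k z - cdot \<zeta> z) \<le> M * (norm z)\<^sup>2" if z: "norm z \<le> R" for k z
    proof -
      have "norm (X k z - cdot \<zeta> z) \<le> (\<Sum>j<k. 2 * t * norm \<zeta> * C * \<theta> ^ j * (norm z)\<^sup>2)"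
      proof (induction k)
        case 0
        show ?case by (simp add: X_def)
      next
        case (Suc k)
        then show ?case using step [OF z, of k] norm_triangle_ineq [of "X (Suc k) z - X k z" "X k z - cdot \<zeta> z"] by simp
      qed
      also have "\<dots> = 2 * t * norm \<zeta> * C * (norm z)\<^sup>2 * (\<Sum>j<k. \<theta> ^ j)"
        unfolding sum_distrib_left by (rule sum.cong) simp_all
      \<comment> \<open>The sum of the geometric series is of order \<open>1 / t\<close> and cancels
        the factor \<open>t\<close> of the single steps: hence \<open>M\<close> is independent of
        \<open>t\<close>.\<close>
      also have "\<dots> \<le> 2 * t * norm \<zeta> * C * (norm z)\<^sup>2 * (1 / (t * l / 4))"
      proof (rule mult_left_mono)
        have "(\<Sum>j<k. \<theta> ^ j) = (1 - \<theta> ^ k) / (1 - \<theta>)" using \<theta>(2) by (simp add: sum_gp_strict)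
        also have "\<dots> \<le> 1 / (1 - \<theta>)" using \<theta> by (intro divide_right_mono) auto
        finally show "(\<Sum>j<k. \<theta> ^ j) \<le> 1 / (t * l / 4)" by (simp add: \<theta>_def)
      qed (use t(1) 1(2) in simp)
      also have "\<dots> = M * (norm z)\<^sup>2" using t(1) l by (simp add: M_def)
      finally show ?thesis .
    qed
    define c where "c = 2 * t * norm \<zeta> * C * R\<^sup>2 + 1"
    have c: "0 < c" using t(1) 1(2) by (simp add: c_def add_nonneg_pos)
    obtain k where k: "\<theta> ^ k < t\<^sup>2 / c" using real_arch_pow_inv [of "t\<^sup>2 / c" \<theta>] \<theta>(2) t(1) c by auto
    \<comment> \<open>The defect of the functional equation is \<open>\<mu>\<close> times one
      increment of \<open>X\<close>, which decays geometrically in \<open>k\<close>.\<close>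
    have last: "norm (X k (F z) - of_real \<mu> * X k z) \<le> t\<^sup>2" if z: "norm z < R" for z
    proof -
      have "X k (F z) = of_real \<mu> * X (Suc k) z" using \<mu> by (simp add: X_def funpow_swap1)
      then have "norm (X k (F z) - of_real \<mu> * X k z) = \<mu> * norm (X (Suc k) z - X k z)"
        using \<mu> by (simp add: right_diff_distrib [symmetric] norm_mult)
      also have "\<dots> \<le> 1 * norm (X (Suc k) z - X k z)" using tl0 by (intro mult_right_mono) (auto simp: \<mu>_def)
      also have "\<dots> \<le> 2 * t * norm \<zeta> * C * \<theta> ^ k * (norm z)\<^sup>2" using step [of z k] z by simp
      also have "\<dots> \<le> 2 * t * norm \<zeta> * C * \<theta> ^ k * R\<^sup>2"
        using z t(1) 1(2) \<theta>(1) by (intro mult_left_mono power_mono) auto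
      also have "\<dots> \<le> c * \<theta> ^ k" using \<theta>(1) by (simp add: c_def algebra_simps)
      also have "\<dots> \<le> t\<^sup>2" using k c by (simp add: field_simps)
      finally show ?thesis .
    qed
    have "holv W F" unfolding F_def [abs_def] by (rule holv_euler_step [OF W(3)])
    moreover have "(F ^^ k) ` ball 0 R \<subseteq> W" for k
    proof
      fix y assume "y \<in> (F ^^ k) ` ball 0 R"
      then obtain z where "norm z < R" "y = (F ^^ k) z" by auto
      then have "norm y \<le> r" using iter(2) [of z k] R(2) by simp
      then show "y \<in> W" using r(2) by auto
    qed
    ultimately have "holv (ball 0 R) (F ^^ k)" by (rule holv_funpow)
    then have "hol (ball 0 R) (\<lambda>z. (1 / of_real (\<mu> ^ k)) * cdot \<zeta> ((F ^^ k) z))"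
      by (intro hol_mult hol_const hol_cdot_const)
    then have "hol (ball 0 R) (X k)" by (simp add: X_def [abs_def])
    then show ?thesis using close last by (intro exI [of _ "X k"]) (auto simp: F_def \<mu>_def)
  qed
  show ?thesis using R M t0 main by blast
qed

text \<open>Let the step tend to \<open>0\<close>. The approximations are uniformly bounded, hence
  equicontinuous by Cauchy's estimate, and a subsequence converges uniformly. Expanding
  \<open>F (z - t G z)\<close> to first order and dividing by \<open>t\<close> turns the functional
  equation into the differential equation for the limit.\<close>

lemma linearization_exists:
  fixes G :: "complex ^ 'n \<Rightarrow> complex ^ 'n" and l :: real
  assumes W: "open W" "0 \<in> W" "holv W G" "G 0 = 0" and r: "0 < r" "cball 0 r \<subseteq> W"
    and l: "0 < l" and AD: "almost_diagonal G \<alpha> (l / 8) r" and \<alpha>: "\<And>i. l \<le> Re (\<alpha> i)"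
    and \<zeta>: "transpose (jac G 0) *v \<zeta> = of_real l *s \<zeta>"
  shows "\<exists>s>0. \<exists>\<xi>. ball 0 s \<subseteq> W \<and> hol (ball 0 s) \<xi> \<and> \<xi> 0 = 0 \<and> gradient \<xi> 0 = \<zeta> \<and>
     (\<forall>z\<in>ball 0 s. cdot (gradient \<xi> z) (G z) = of_real l * \<xi> z)"
proof -
  obtain R M t0 where R: "0 < R" "0 \<le> M" "0 < t0" "R \<le> r"
    and ex: "\<And>t. 0 < t \<Longrightarrow> t \<le> t0 \<Longrightarrow> \<exists>F. hol (ball 0 R) F \<and>
     (\<forall>z. norm z < R \<longrightarrow> norm (F z - cdot \<zeta> z) \<le> M * (norm z)\<^sup>2 \<and>
        norm (F (z - of_real t *s G z) - of_real (1 - t * l) * F z) \<le> t\<^sup>2)"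
    using approximate_linearization [OF assms] by blast
  define \<tau> where "\<tau> n = t0 / real (Suc n)" for n
  have \<tau>: "0 < \<tau> n" "\<tau> n \<le> t0" for n using R(3) by (simp_all add: \<tau>_def field_simps)
  have "\<forall>n. \<exists>F. hol (ball 0 R) F \<and> (\<forall>z. norm z < R \<longrightarrow> norm (F z - cdot \<zeta> z) \<le> M * (norm z)\<^sup>2 \<and>
        norm (F (z - of_real (\<tau> n) *s G z) - of_real (1 - \<tau> n * l) * F z) \<le> (\<tau> n)\<^sup>2)"
    using ex \<tau> by blast
  from choice [OF this] obtain F where F: "\<And>n. hol (ball 0 R) (F n)"
    "\<And>n z. norm z < R \<Longrightarrow> norm (F n z - cdot \<zeta> z) \<le> M * (norm z)\<^sup>2"
    "\<And>n z. norm z < R \<Longrightarrow> norm (F n (z - of_real (\<tau> n) *s G z) - of_real (1 - \<tau> n * l) * F n z) \<le> (\<tau> n)\<^sup>2"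
    by blast
  define B where "B = norm \<zeta> * R + M * R\<^sup>2"
  have B0: "0 \<le> B" using R by (simp add: B_def)
  have B: "norm (F n z) \<le> B" if "norm z < R" for n z
  proof -
    have "norm (F n z) \<le> norm (cdot \<zeta> z) + norm (F n z - cdot \<zeta> z)" by (rule norm_triangle_sub)
    moreover have "norm (cdot \<zeta> z) \<le> norm \<zeta> * R" using norm_cdot_le [of \<zeta> z] that by (meson less_imp_le mult_left_mono norm_ge_zero order_trans)
    moreover have "M * (norm z)\<^sup>2 \<le> M * R\<^sup>2" using that R by (intro mult_left_mono power_mono) auto
    ultimately show ?thesis using F(2) [OF that, of n] by (simp add: B_def)
  qed
  define R4 where "R4 = R / 4"
  have R4: "0 < R4" using R by (simp add: R4_def)
  have near: "norm (z + w) < R" if "norm z \<le> R / 2" "norm w \<le> R4" for z w :: "complex ^ 'n"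
    using norm_triangle_ineq [of z w] that R(1) by (simp add: R4_def)
  have taylor: "norm (F n (z + y) - F n z - cdot (gradient (F n) z) y) \<le> 8 * B / R4\<^sup>2 * (norm y)\<^sup>2"
    if "norm z \<le> R / 2" "norm y \<le> R4 / 2" for n z y
    by (rule taylor_bound [OF F(1) _ R4 _ that(2)]) (use near [OF that(1)] B in auto)
  have grad: "norm (cdot (gradient (F n) z) v) \<le> B / R4 * norm v" if "norm z \<le> R / 2" for n z v
    by (rule cauchy_gradient [OF F(1) _ R4]) (use near [OF that] B in auto)
  define L where "L = B / R4 + 4 * B / R4"
  have lip: "norm (F n (z + y) - F n z) \<le> L * norm y" if zy: "norm z \<le> R / 2" "norm y \<le> R4 / 2" for n z y
  proof -
    have "8 * B / R4\<^sup>2 * (norm y)\<^sup>2 \<le> 8 * B / R4\<^sup>2 * (R4 / 2 * norm y)"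
      unfolding power2_eq_square [of "norm y"] using zy(2) B0 by (intro mult_left_mono mult_right_mono) auto
    also have "\<dots> = 4 * B / R4 * norm y" using R4 by (simp add: power2_eq_square)
    finally have "8 * B / R4\<^sup>2 * (norm y)\<^sup>2 \<le> 4 * B / R4 * norm y" .
    then show ?thesis
      using taylor [OF zy, of n] grad [OF zy(1), of n y] norm_triangle_sub [of "F n (z + y) - F n z" "cdot (gradient (F n) z) y"]
      unfolding L_def distrib_right by linarith
  qed
  have L0: "0 \<le> L" using B0 R4 by (simp add: L_def)
  obtain g \<kappa> where g: "continuous_on (cball 0 (R / 2)) g" "strict_mono (\<kappa> :: nat \<Rightarrow> nat)"
    "\<And>e. 0 < e \<Longrightarrow> \<exists>N. \<forall>n x. n \<ge> N \<and> x \<in> cball 0 (R / 2) \<longrightarrow> norm (F (\<kappa> n) x - g x) < e"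
  proof (rule Arzela_Ascoli [of "cball 0 (R / 2)" F B])
    show "norm (F n x) \<le> B" if "x \<in> cball 0 (R / 2)" for n x using that R(1) by (intro B) simp
    show "\<exists>d>0. \<forall>n y. y \<in> cball 0 (R / 2) \<and> norm (x - y) < d \<longrightarrow> norm (F n x - F n y) < e"
      if x: "x \<in> cball 0 (R / 2)" and e: "0 < e" for x e
    proof (intro exI [of _ "min (R4 / 2) (e / (L + 1))"] conjI allI impI)
      show "0 < min (R4 / 2) (e / (L + 1))" using R4 e L0 by simp
      fix n y assume y: "y \<in> cball 0 (R / 2) \<and> norm (x - y) < min (R4 / 2) (e / (L + 1))"
      then have "norm (F n (x + (y - x)) - F n x) \<le> L * norm (y - x)"
        using x by (intro lip) (auto simp: norm_minus_commute)
      also have "\<dots> \<le> (L + 1) * norm (y - x)" by (intro mult_right_mono) auto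
      also have "\<dots> < e" using y L0 by (simp add: norm_minus_commute field_simps)
      finally show "norm (F n x - F n y) < e" by (simp add: norm_minus_commute)
    qed
  qed (use that in auto)
  have ul: "uniform_limit (ball 0 (R / 2)) (\<lambda>n. F (\<kappa> n)) g sequentially"
    unfolding uniform_limit_iff eventually_sequentially dist_norm
  proof (intro allI impI)
    fix e :: real assume "0 < e"
    then obtain N where "\<forall>n x. n \<ge> N \<and> x \<in> cball 0 (R / 2) \<longrightarrow> norm (F (\<kappa> n) x - g x) < e" using g(3) by blast
    then show "\<exists>N. \<forall>n\<ge>N. \<forall>x\<in>ball 0 (R / 2). norm (F (\<kappa> n) x - g x) < e" by (intro exI [of _ N]) auto
  qed
  have holF: "hol (ball 0 (R / 2)) (F n)" for n by (rule hol_subset [OF F(1)]) (use R(1) in auto)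
  have holg: "hol (ball 0 (R / 2)) g"
    by (rule hol_uniform_limit [OF open_ball holF ul]) simp
  have pick: "\<exists>n. \<tau> (\<kappa> n) < e \<and> (\<forall>x. norm x \<le> R / 2 \<longrightarrow> norm (F (\<kappa> n) x - g x) < e)" if e: "0 < e" for e
  proof -
    obtain N where N: "\<And>n x. n \<ge> N \<Longrightarrow> x \<in> cball 0 (R / 2) \<Longrightarrow> norm (F (\<kappa> n) x - g x) < e" using g(3) [OF e] by blast
    obtain N2 :: nat where N2: "t0 / e < real N2" using reals_Archimedean2 by blast
    define n where "n = max N N2"
    have "N2 \<le> \<kappa> n" using seq_suble [OF g(2), of n] by (simp add: n_def)
    then have "t0 / e < real (Suc (\<kappa> n))" using N2 by linarith
    then have "\<tau> (\<kappa> n) < e" using e by (simp add: \<tau>_def field_simps)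
    then show ?thesis using N [of n] by (intro exI [of _ n]) (auto simp: n_def)
  qed
  have gl: "norm (g z - cdot \<zeta> z) \<le> M * (norm z)\<^sup>2" if "norm z \<le> R / 2" for z
  proof (rule field_le_epsilon)
    fix e :: real assume "0 < e"
    from pick [OF this] obtain n where "norm (F (\<kappa> n) z - g z) < e" using \<open>norm z \<le> R / 2\<close> by blast
    then show "norm (g z - cdot \<zeta> z) \<le> M * (norm z)\<^sup>2 + e"
      using F(2) [of z "\<kappa> n"] that R(1) norm_triangle_ineq4 [of "F (\<kappa> n) z - cdot \<zeta> z" "F (\<kappa> n) z - g z"] by simp
  qed
  have g0: "g 0 = 0" using gl [of 0] R(1) by (simp add: cdot.zero_right)
  have diff_gradient: "gradient (\<lambda>z. a z - b z) z = gradient a z - gradient b z"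
    if "hol (ball 0 (R / 2)) a" "hol (ball 0 (R / 2)) b" "norm z < R / 2" for a b :: "complex ^ 'n \<Rightarrow> complex" and z
  proof (rule gradient_eqI)
    have z: "z \<in> ball 0 (R / 2)" using that(3) by simp
    have "((\<lambda>z. a z - b z) has_derivative (\<lambda>v. cdot (gradient a z) v - cdot (gradient b z) v)) (at z)"
      by (rule has_derivative_diff [OF hol_has_derivative [OF that(1) z] hol_has_derivative [OF that(2) z]])
    then show "((\<lambda>z. a z - b z) has_derivative cdot (gradient a z - gradient b z)) (at z)"
      by (simp add: cdot.diff_left [abs_def])
  qed
  have g1: "gradient g 0 = \<zeta>"
  proof -
    have ld: "gradient (cdot \<zeta>) 0 = \<zeta>"
      by (rule gradient_eqI [OF bounded_linear_imp_has_derivative [OF cdot.bounded_linear_right]])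
    have lh: "hol (ball 0 (R / 2)) (cdot \<zeta>)" using hol_cdot_right [of "ball 0 (R / 2)" \<zeta>] by simp
    define d where "d = gradient g 0 - \<zeta>"
    have dg: "gradient (\<lambda>z. g z - cdot \<zeta> z) 0 = d" using diff_gradient [OF holg lh, of 0] R(1) by (simp add: ld d_def)
    obtain v where v: "norm v = 1" "cdot v d = of_real (norm d)" using dual_vector_exists by blast
    \<comment> \<open>\<open>g\<close> differs from \<open>cdot \<zeta>\<close> by a quadratic term;
      Cauchy's estimate on radius \<open>e\<close> bounds the difference of the gradients at
      \<open>0\<close> by \<open>M * e\<close>.\<close>
    have "norm d = 0"
    proof (rule eq_0_if_le_multiple)
      fix e :: real assume e: "0 < e" "e < R / 2"
      have "norm (cdot (gradient (\<lambda>z. g z - cdot \<zeta> z) 0) v) \<le> (M * e\<^sup>2) / e * norm v"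
      proof (rule cauchy_gradient [OF hol_diff [OF holg lh] _ e(1)])
        fix w :: "complex ^ 'n" assume w: "norm w \<le> e"
        show "0 + w \<in> ball 0 (R / 2)" using w e(2) by simp
        have "M * (norm w)\<^sup>2 \<le> M * e\<^sup>2" using w R(2) by (intro mult_left_mono power_mono) auto
        then show "norm (g (0 + w) - cdot \<zeta> (0 + w)) \<le> M * e\<^sup>2" using gl [of w] w e(2) by simp
      qed
      moreover have "cdot d v = of_real (norm d)" using v(2) by (simp add: cdot_commute)
      ultimately show "norm d \<le> M * e" using e(1) v(1) by (simp add: dg power2_eq_square)
    qed (use R(1) in auto)
    then show ?thesis by (simp add: d_def)
  qed
  have pde: "cdot (gradient g z) (G z) = of_real l * g z" if z: "norm z < R4" for z
  proof -
    define D where "D = cdot (gradient g z) (G z) - of_real l * g z"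
    have zR: "norm z \<le> R / 2" "norm z < R / 2" using z R(1) by (auto simp: R4_def)
    define C' where "C' = 1 + 8 * B / R4\<^sup>2 * (norm (G z))\<^sup>2"
    have "norm D = 0"
    proof (rule eq_0_if_le_multiple)
      show "0 < R4 / 2 / (norm (G z) + 1)" using R4 by (simp add: add_nonneg_pos)
      fix e :: real assume e: "0 < e" "e < R4 / 2 / (norm (G z) + 1)"
      obtain n where n: "\<tau> (\<kappa> n) < e" "\<And>x. norm x \<le> R / 2 \<Longrightarrow> norm (F (\<kappa> n) x - g x) < e"
        using pick [OF e(1)] by blast
      define f where "f = F (\<kappa> n)"
      define t where "t = \<tau> (\<kappa> n)"
      have t: "0 < t" "t < e" using \<tau> n(1) by (simp_all add: t_def)
      have hf: "hol (ball 0 (R / 2)) f" using holF by (simp add: f_def)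
      have tG: "norm (- of_real t *s G z) \<le> R4 / 2"
      proof -
        have "t * norm (G z) \<le> e * (norm (G z) + 1)" using t by (intro mult_mono) auto
        also have "\<dots> \<le> R4 / 2" 
        proof -
          have "0 < norm (G z) + 1" by (simp add: add_nonneg_pos)
          from iffD1 [OF pos_less_divide_eq [OF this] e(2)] show ?thesis by simp
        qed
        finally show ?thesis using t(1) by simp
      qed
      have 1: "norm (f (z - of_real t *s G z) - f z + of_real t * cdot (gradient f z) (G z)) \<le> 8 * B / R4\<^sup>2 * (t * norm (G z))\<^sup>2"
        using taylor [OF zR(1) tG, of "\<kappa> n"] t(1) unfolding f_def by (simp add: cdot.minus_right vec.scale_minus_left)
      have 2: "norm (f (z - of_real t *s G z) - of_real (1 - t * l) * f z) \<le> t\<^sup>2"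
        using F(3) [of z "\<kappa> n"] zR R(1) by (simp add: f_def t_def)
      have "of_real t * (cdot (gradient f z) (G z) - of_real l * f z) =
          (f (z - of_real t *s G z) - f z + of_real t * cdot (gradient f z) (G z)) - (f (z - of_real t *s G z) - of_real (1 - t * l) * f z)"
        by (simp add: algebra_simps)
      then have "norm (of_real t * (cdot (gradient f z) (G z) - of_real l * f z)) \<le> 8 * B / R4\<^sup>2 * (t * norm (G z))\<^sup>2 + t\<^sup>2"
        using 1 2 norm_triangle_ineq4 by (smt (verit))
      also have "\<dots> = t * (t * C')" by (simp add: C'_def power2_eq_square algebra_simps)
      finally have "t * norm (cdot (gradient f z) (G z) - of_real l * f z) \<le> t * (t * C')" using t(1) by (simp only: norm_mult norm_of_real abs_of_pos)
      then have "norm (cdot (gradient f z) (G z) - of_real l * f z) \<le> t * C'" using t(1) by simp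
      also have "\<dots> \<le> e * C'" using t(2) B0 by (intro mult_right_mono) (auto simp: C'_def)
      finally have 3: "norm (cdot (gradient f z) (G z) - of_real l * f z) \<le> e * C'" .
      have 4: "norm (cdot (gradient (\<lambda>z. f z - g z) z) (G z)) \<le> e / R4 * norm (G z)"
      proof (rule cauchy_gradient [OF hol_diff [OF hf holg] _ R4])
        fix w :: "complex ^ 'n" assume w: "norm w \<le> R4"
        have nw: "norm (z + w) < R / 2" using norm_triangle_ineq [of z w] w z by (simp add: R4_def)
        then show "z + w \<in> ball 0 (R / 2)" by simp
        show "norm (f (z + w) - g (z + w)) \<le> e" using n(2) [of "z + w"] nw by (simp add: f_def)
      qed
      have 5: "norm (of_real l * (f z - g z)) \<le> l * e" using n(2) [OF zR(1)] l by (simp add: f_def norm_mult)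
      \<comment> \<open>Three errors: that of \<open>f\<close> in the differential equation, the
        gradient of \<open>f - g\<close>, and the value of \<open>f - g\<close>.\<close>
      have "D = (cdot (gradient f z) (G z) - of_real l * f z) - cdot (gradient (\<lambda>z. f z - g z) z) (G z) + of_real l * (f z - g z)"
        unfolding diff_gradient [OF hf holg zR(2)] D_def by (simp add: cdot.diff_left algebra_simps)
      then have "norm D \<le> e * C' + e / R4 * norm (G z) + l * e"
        using 3 4 5 norm_triangle_ineq norm_triangle_ineq4 by (smt (verit))
      then show "norm D \<le> (C' + norm (G z) / R4 + l) * e" by (simp add: algebra_simps)
    qed simp
    then show ?thesis by (simp add: D_def)
  qed
  have "ball 0 R4 \<subseteq> W" using r(2) R(1,4) by (auto simp: R4_def subset_iff)
  moreover have "hol (ball 0 R4) g" by (rule hol_subset [OF holg]) (use R(1) in \<open>auto simp: R4_def\<close>)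
  ultimately show ?thesis using R4 g0 g1 pde by (intro exI [of _ R4] conjI exI [of _ g]) auto
qed


section \<open>The exponent of an Euler pair\<close>

text \<open>The linearisation is done in almost diagonal coordinates with error \<open>l / 8\<close>
  and carried back; \<open>\<zeta>\<close> and the gradient of \<open>\<xi>\<close> transform as
  covectors.\<close>

lemma linear_coordinate_exists:
  fixes h :: "complex ^ 'n \<Rightarrow> complex" and l :: real
  assumes E: "euler_pair S h G" and l: "0 < l" "\<And>\<eta> w. w \<noteq> 0 \<Longrightarrow> jac G 0 *v w = \<eta> *s w \<Longrightarrow> l \<le> Re \<eta>"
    and \<zeta>: "transpose (jac G 0) *v \<zeta> = of_real l *s \<zeta>"
  shows "\<exists>U \<xi>. open U \<and> 0 \<in> U \<and> U \<subseteq> S \<and> hol U \<xi> \<and> \<xi> 0 = 0 \<and> gradient \<xi> 0 = \<zeta> \<and>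
     (\<forall>z\<in>U. cdot (gradient \<xi> z) (G z) = of_real l * \<xi> z)"
proof -
  have l8: "0 < l / 8" using l(1) by simp
  obtain T T' :: "complex ^ 'n ^ 'n" and \<alpha> :: "'n \<Rightarrow> complex" and r :: real where T: "T ** T' = mat 1" "T' ** T = mat 1" and r: "0 < r"
    and ev: "\<And>i. \<exists>w. w \<noteq> 0 \<and> jac G 0 *v w = \<alpha> i *s w" and rW: "cball 0 r \<subseteq> {w. T *v w \<in> S}"
    and EP: "euler_pair {w. T *v w \<in> S} (\<lambda>w. h (T *v w)) (\<lambda>w. T' *v G (T *v w))"
    and AD: "almost_diagonal (\<lambda>w. T' *v G (T *v w)) \<alpha> (l / 8) r"
    and jG: "jac (\<lambda>w. T' *v G (T *v w)) 0 = T' ** jac G 0 ** T"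
    and gr: "\<And>w. T *v w \<in> S \<Longrightarrow> gradient (\<lambda>w. h (T *v w)) w = transpose T *v gradient h (T *v w)"
  proof (rule euler_pair_diagonalize [OF E l8], goal_cases)
    case (1 T T' r \<alpha>)
    show ?case by (rule 1(1) [OF 1(2-10)])
  qed
  define G1 where "G1 = (\<lambda>w. T' *v G (T *v w))"
  define W where "W = {w. T *v w \<in> S}"
  note D = euler_pairD [OF EP, folded W_def G1_def]
  have AD1: "almost_diagonal G1 \<alpha> (l / 8) r" and rW1: "cball 0 r \<subseteq> W" using AD rW by (simp_all add: G1_def W_def)
  have \<alpha>: "l \<le> Re (\<alpha> i)" for i using ev [of i] l(2) by blast
  have G10: "G1 0 = 0" using euler_field_zero [OF E] by (simp add: G1_def)
  have TT: "T *v (T' *v x) = x" "T' *v (T *v x) = x" for x by (simp_all add: matrix_vector_mul_assoc T)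
  have tTT: "transpose T' *v (transpose T *v x) = x" for x
    by (simp add: matrix_vector_mul_assoc matrix_transpose_mul [symmetric] T transpose_mat)
  have tTT2: "transpose T *v (transpose T' *v x) = x" "transpose T' *v (transpose T *v x) = x" for x
    by (simp_all add: matrix_vector_mul_assoc matrix_transpose_mul [symmetric] T transpose_mat)
  have "transpose (jac G1 0) *v (transpose T *v \<zeta>) = transpose T *v (transpose (jac G 0) *v (transpose T' *v (transpose T *v \<zeta>)))"
    unfolding G1_def jG by (simp add: matrix_transpose_mul matrix_vector_mul_assoc [symmetric])
  then have \<zeta>1: "transpose (jac G1 0) *v (transpose T *v \<zeta>) = of_real l *s (transpose T *v \<zeta>)"
    unfolding tTT \<zeta> vector_scalar_commute .
  obtain s \<xi>1 where s: "0 < s" "ball 0 s \<subseteq> W" "hol (ball 0 s) \<xi>1" "\<xi>1 0 = 0" "gradient \<xi>1 0 = transpose T *v \<zeta>"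
    "\<And>z. z \<in> ball 0 s \<Longrightarrow> cdot (gradient \<xi>1 z) (G1 z) = of_real l * \<xi>1 z"
    using linearization_exists [OF D(1,2,4) G10 r rW1 l(1) AD1 \<alpha> \<zeta>1] by blast
  define U where "U = {z. T' *v z \<in> ball 0 s}"
  define \<xi> where "\<xi> z = \<xi>1 (T' *v z)" for z
  have "open ((\<lambda>z. T' *v z) -` ball 0 s)"
    by (rule open_vimage [OF open_ball holv_continuous_on [OF holv_linear]])
  then have U: "open U" by (simp add: U_def vimage_def)
  have "0 \<in> U" using s(1) by (simp add: U_def)
  moreover have "U \<subseteq> S"
  proof
    fix z assume "z \<in> U"
    then have "T' *v z \<in> W" using s(2) by (auto simp: U_def)
    then show "z \<in> S" by (simp add: W_def TT)
  qed
  moreover have "hol U \<xi>" unfolding \<xi>_def [abs_def] by (rule hol_compose [OF holv_linear s(3)]) (auto simp: U_def)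
  moreover have gx: "gradient \<xi> z = transpose T' *v gradient \<xi>1 (T' *v z)" if "z \<in> U" for z
    unfolding \<xi>_def [abs_def]
  proof (rule gradient_eqI, rule gradient_compose)
    show "((\<lambda>z. T' *v z) has_derivative (\<lambda>v. T' *v v)) (at z)"
      by (rule bounded_linear_imp_has_derivative [OF matrix_vector_mul_bounded_linear])
    show "(\<xi>1 has_derivative cdot (gradient \<xi>1 (T' *v z))) (at (T' *v z))"
      by (rule hol_has_derivative [OF s(3)]) (use that in \<open>simp add: U_def\<close>)
  qed
  moreover have "gradient \<xi> 0 = \<zeta>" using gx [OF \<open>0 \<in> U\<close>] by (simp add: s(5) tTT2)
  moreover have "cdot (gradient \<xi> z) (G z) = of_real l * \<xi> z" if z: "z \<in> U" for z
  proof -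
    have "cdot (gradient \<xi> z) (G z) = cdot (gradient \<xi>1 (T' *v z)) (T' *v G z)"
      unfolding gx [OF z] by (rule cdot_transpose [symmetric])
    also have "T' *v G z = G1 (T' *v z)" by (simp add: G1_def TT)
    also have "cdot (gradient \<xi>1 (T' *v z)) (G1 (T' *v z)) = of_real l * \<xi>1 (T' *v z)" using z by (intro s(6)) (simp add: U_def)
    finally have *: "cdot (gradient \<xi> z) (G z) = of_real l * \<xi>1 (T' *v z)" .
    have xz: "\<xi> z = \<xi>1 (T' *v z)" by (simp add: \<xi>_def)
    show ?thesis unfolding xz by (rule *)
  qed
  ultimately show ?thesis using U s(4) by (intro exI [of _ U] exI [of _ \<xi>]) (auto simp: \<xi>_def)
qed

lemma holv_zero_bounds:
  fixes F :: "complex ^ 'n \<Rightarrow> complex ^ 'n"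
  assumes S: "open S" "0 \<in> S" and F: "holv S F" "F 0 = 0"
  shows "\<exists>r>0. \<exists>K>0. cball 0 r \<subseteq> S \<and> (\<forall>z. norm z \<le> r \<longrightarrow> norm (F z) \<le> K * norm z \<and>
     norm (F z - jac F 0 *v z) \<le> K * (norm z)\<^sup>2 \<and> (\<forall>q. norm (transpose (jac F z) *v q) \<le> K * norm q))"
proof -
  obtain r C where r: "0 < r" "0 \<le> C" "cball 0 (2 * r) \<subseteq> S" "\<And>z. norm z \<le> 2 * r \<Longrightarrow> norm (F z) \<le> C"
    "\<And>z y. norm z \<le> r \<Longrightarrow> norm y \<le> r / 2 \<Longrightarrow> norm (F (z + y) - F z - jac F z *v y) \<le> C * (norm y)\<^sup>2"
    using holv_local_bounds [OF S F(1)] by metis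
  obtain K0 where K0: "0 \<le> K0" "\<And>v. norm (jac F 0 *v v) \<le> K0 * norm v"
    using matrix_vector_norm_bound [of "jac F 0"] by blast
  define K where "K = 1 + K0 + C * r + C + C / r"
  have K: "0 < K" "K0 + C * r \<le> K" "C \<le> K" "C / r \<le> K" using K0(1) r(1,2) by (simp_all add: K_def add_pos_nonneg)
  have 1: "norm (F z - jac F 0 *v z) \<le> C * (norm z)\<^sup>2" if "norm z \<le> r / 2" for z
    using r(5) [of 0 z] that r(1) F(2) by simp
  show ?thesis
  proof (rule exI [of _ "r / 2"], intro conjI exI [of _ K] allI impI K(1))
    show "0 < r / 2" using r(1) by simp
    show "cball 0 (r / 2) \<subseteq> S" using subset_cball [of "r / 2" "2 * r" "0 :: complex ^ 'n"] r(1,3) by auto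
    fix z :: "complex ^ 'n" assume z: "norm z \<le> r / 2"
    have "C * (norm z)\<^sup>2 \<le> K * (norm z)\<^sup>2" using K(3) by (intro mult_right_mono) auto
    then show "norm (F z - jac F 0 *v z) \<le> K * (norm z)\<^sup>2" using 1 [OF z] by linarith
    have "C * (norm z)\<^sup>2 \<le> C * (r * norm z)" unfolding power2_eq_square using z r by (intro mult_left_mono mult_right_mono) auto
    then have "norm (F z) \<le> (K0 + C * r) * norm z"
      using norm_triangle_sub [of "F z" "jac F 0 *v z"] 1 [OF z] K0(2) [of z] by (simp add: algebra_simps)
    also have "\<dots> \<le> K * norm z" using K(2) by (intro mult_right_mono) auto
    finally show "norm (F z) \<le> K * norm z" .
    fix q
    show "norm (transpose (jac F z) *v q) \<le> K * norm q"
    proof (rule norm_transpose_le)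
      fix v
      have zw: "norm (z + w) \<le> 2 * r" if "norm w \<le> r" for w using norm_triangle_ineq [of z w] z that r(1) by linarith
      have "norm (jac F z *v v) \<le> C / r * norm v"
      proof (rule cauchy_jacobian [OF F(1) _ r(1)])
        show "z + w \<in> S" if "norm w \<le> r" for w using zw [OF that] r(3) by auto
        show "norm (F (z + w)) \<le> C" if "norm w \<le> r" for w by (rule r(4) [OF zw [OF that]])
      qed
      also have "\<dots> \<le> K * norm v" using K(4) by (intro mult_right_mono) auto
      finally show "norm (jac F z *v v) \<le> K * norm v" .
    qed
  qed
qed

text \<open>The gradient vanishes at \<open>0\<close> and is Lipschitz there. This settles the case
  \<open>l = 1 / 2\<close>, in which the kernel of the Hessian may be trivial.\<close>

lemma slow_points_linear:
  fixes h :: "complex ^ 'n \<Rightarrow> complex"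
  assumes E: "euler_pair S h G"
  shows "\<exists>C>0. \<forall>d>0. \<exists>z. 0 < norm z \<and> norm z < d \<and> norm (gradient h z) \<le> C * norm z powr 1"
proof -
  note D = euler_pairD [OF E]
  obtain r K where r: "0 < r" "0 < K" "\<And>z. norm z \<le> r \<Longrightarrow> norm (gradient h z) \<le> K * norm z"
    using holv_zero_bounds [OF D(1,2,8,7)] by blast
  show ?thesis
  proof (intro exI [of _ K] conjI allI impI r(2))
    fix d :: real assume d: "0 < d"
    define z :: "complex ^ 'n" where "z = axis undefined (of_real (min r (d / 2)))"
    have z: "norm z = min r (d / 2)" using r(1) d by (simp add: z_def)
    then have "0 < norm z" "norm z < d" "norm z \<le> r" using r(1) d by auto
    then show "\<exists>z. 0 < norm z \<and> norm z < d \<and> norm (gradient h z) \<le> K * norm z powr 1"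
      using r(3) [of z] by (intro exI [of _ z]) simp
  qed
qed

text \<open>The coordinate \<open>\<xi>\<close> linearising \<open>G\<close> is completed to a
  coordinate system \<open>\<Theta>\<close> whose derivative sends the kernel vector
  \<open>v\<close> to the axis \<open>i0\<close>. Then the setting of the polar curve is reached:
  component \<open>i0\<close> of the new field is \<open>l\<close> times the coordinate, and the
  gradient along the axis is of second order.\<close>

lemma slow_points:
  fixes h :: "complex ^ 'n \<Rightarrow> complex" and l :: real
  assumes E: "euler_pair S h G" and l: "0 < l" "l < 1" "\<And>\<eta> w. w \<noteq> 0 \<Longrightarrow> jac G 0 *v w = \<eta> *s w \<Longrightarrow> l \<le> Re \<eta>"
    and \<zeta>: "transpose (jac G 0) *v \<zeta> = of_real l *s \<zeta>"
    and v: "jac (gradient h) 0 *v v = 0" "cdot \<zeta> v = 1"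
  shows "\<exists>C>0. \<forall>d>0. \<exists>z. 0 < norm z \<and> norm z < d \<and> norm (gradient h z) \<le> C * norm z powr ((1 - l) / l)"
proof -
  note D = euler_pairD [OF E]
  define p where "p = gradient h"
  have "\<exists>U \<xi>. open U \<and> 0 \<in> U \<and> U \<subseteq> S \<and> hol U \<xi> \<and> \<xi> 0 = 0 \<and> gradient \<xi> 0 = \<zeta> \<and>
     (\<forall>z\<in>U. cdot (gradient \<xi> z) (G z) = of_real l * \<xi> z)"
    by (rule linear_coordinate_exists [OF E l(1,3) \<zeta>])
  then obtain U \<xi> where U: "open U" "0 \<in> U" "U \<subseteq> S" and \<xi>: "hol U \<xi>" "\<xi> 0 = 0" "gradient \<xi> 0 = \<zeta>"
    "\<And>z. z \<in> U \<Longrightarrow> cdot (gradient \<xi> z) (G z) = of_real l * \<xi> z"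
    by blast
  have "\<zeta> \<noteq> 0" using v(2) by (auto simp: cdot.zero_left)
  \<comment> \<open>Replacing a coordinate with \<open>\<zeta> $ i0 \<noteq> 0\<close> by
    \<open>\<xi>\<close> keeps the Jacobian invertible; subtracting \<open>v $ j * \<xi>\<close>
    from the others makes them vanish to first order along \<open>v\<close>.\<close>
  then obtain i0 where i0: "\<zeta> $ i0 \<noteq> 0" by (auto simp: vec_eq_iff)
  define \<Theta> :: "complex ^ 'n \<Rightarrow> complex ^ 'n" where "\<Theta> z = (\<chi> j. if j = i0 then \<xi> z else z $ j - v $ j * \<xi> z)" for z
  have \<Theta>i: "(\<lambda>z. \<Theta> z $ j) = (if j = i0 then \<xi> else (\<lambda>z. z $ j - v $ j * \<xi> z))" for j
    by (simp add: \<Theta>_def fun_eq_iff)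
  have hol\<Theta>: "holv U \<Theta>"
    unfolding holv_def \<Theta>i using \<xi>(1) by (auto intro!: hol_diff hol_mult hol_const hol_component)
  have \<Theta>0: "\<Theta> 0 = 0" by (simp add: \<Theta>_def vec_eq_iff \<xi>(2))
  have jrow: "jac \<Theta> z $ i0 = gradient \<xi> z" for z by (simp add: jac_def \<Theta>i)
  have j\<Theta>: "(jac \<Theta> 0 *v x) $ j = (if j = i0 then cdot \<zeta> x else x $ j - v $ j * cdot \<zeta> x)" for x j
  proof (cases "j = i0")
    case True
    then show ?thesis using jrow [of 0] \<xi>(3) by (simp add: matrix_vector_cdot)
  next
    case False
    have "((\<lambda>z. z $ j - v $ j * \<xi> z) has_derivative (\<lambda>x. x $ j - v $ j * cdot \<zeta> x)) (at 0)"
      using has_derivative_diff [OF bounded_linear_imp_has_derivative [OF bounded_linear_vec_nth]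
          has_derivative_mult_right [OF hol_has_derivative [OF \<xi>(1) U(2)]]] by (simp add: \<xi>(3))
    moreover have "(\<lambda>x. x $ j - v $ j * cdot \<zeta> x) = cdot (axis j 1 - v $ j *s \<zeta>)"
      by (simp add: fun_eq_iff cdot.diff_left cdot_commute [of "axis _ _"])
    ultimately have "gradient (\<lambda>z. z $ j - v $ j * \<xi> z) 0 = axis j 1 - v $ j *s \<zeta>" by (intro gradient_eqI) simp
    then have "jac \<Theta> 0 $ j = axis j 1 - v $ j *s \<zeta>" using False by (simp add: jac_def \<Theta>i)
    then show ?thesis using False by (simp add: matrix_vector_cdot cdot.diff_left cdot_commute [of "axis _ _"])
  qed
  have nd: "det (jac \<Theta> 0) \<noteq> 0"
    unfolding det_nonzero_iff_kernel
  proof (intro allI impI)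
    fix x assume 0: "jac \<Theta> 0 *v x = 0"
    then have "(jac \<Theta> 0 *v x) $ i0 = 0" by simp
    then have z0: "cdot \<zeta> x = 0" unfolding j\<Theta> by simp
    have xj: "x $ j = 0" if "j \<noteq> i0" for j
    proof -
      have "(jac \<Theta> 0 *v x) $ j = 0" using 0 by simp
      then show ?thesis unfolding j\<Theta> using that z0 by simp
    qed
    have "x = axis i0 (x $ i0)" using xj by (simp add: vec_eq_iff axis_def)
    then have "cdot \<zeta> x = \<zeta> $ i0 * x $ i0" by (metis cdot_axis)
    then have "x $ i0 = 0" using z0 i0 by simp
    with xj show "x = 0" by (metis vec_eq_iff zero_index)
  qed
  obtain W \<Phi> where W: "open W" "0 \<in> W" and \<Phi>: "holv W \<Phi>" "\<Phi> ` W \<subseteq> U" "\<Phi> 0 = 0"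
    and inv: "\<And>w. w \<in> W \<Longrightarrow> \<Theta> (\<Phi> w) = w" "\<And>w. w \<in> W \<Longrightarrow> jac \<Theta> (\<Phi> w) ** jac \<Phi> w = mat 1"
    using hol_inverse_function [OF U(1,2) hol\<Theta> \<Theta>0 nd] by blast
  have inv': "jac \<Phi> w ** jac \<Theta> (\<Phi> w) = mat 1" if "w \<in> W" for w
    using inv(2) [OF that] by (simp add: matrix_left_right_inverse)
  have \<Phi>S: "\<Phi> ` W \<subseteq> S" using \<Phi>(2) U(3) by blast
  have \<Phi>z: "\<Phi> w = 0 \<longleftrightarrow> w = 0" if "w \<in> W" for w using inv(1) [OF that] \<Theta>0 \<Phi>(3) by auto
  have P1: "hol W (\<lambda>w. h (\<Phi> w))" by (rule euler_pullback(1) [OF E W \<Phi>(1) \<Phi>S \<Phi>z inv'])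
  have P2: "gradient (\<lambda>w. h (\<Phi> w)) w = transpose (jac \<Phi> w) *v gradient h (\<Phi> w)" if "w \<in> W" for w
    by (rule euler_pullback(2) [OF E W \<Phi>(1) \<Phi>S \<Phi>z inv' that])
  have P3: "h (\<Phi> w) = cdot (jac \<Theta> (\<Phi> w) *v G (\<Phi> w)) (gradient (\<lambda>w. h (\<Phi> w)) w)" if "w \<in> W" for w
    by (rule euler_pullback(3) [OF E W \<Phi>(1) \<Phi>S \<Phi>z inv' that])
  have P4: "gradient (\<lambda>w. h (\<Phi> w)) w = 0 \<longleftrightarrow> w = 0" if "w \<in> W" for w
    by (rule euler_pullback(4) [OF E W \<Phi>(1) \<Phi>S \<Phi>z inv' that])
  define h2 where "h2 w = h (\<Phi> w)" for w
  define G2 where "G2 w = jac \<Theta> (\<Phi> w) *v G (\<Phi> w)" for w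
  have gr: "gradient h2 w = transpose (jac \<Phi> w) *v p (\<Phi> w)" if "w \<in> W" for w
    using P2 [OF that] by (simp add: h2_def [abs_def] p_def)
  have contG: "continuous_on W G2"
  proof -
    have "holv U (\<lambda>z. jac \<Theta> z *v G z)"
      unfolding holv_def
    proof
      fix i
      have "hol U (\<lambda>z. \<Sum>j\<in>UNIV. jac \<Theta> z $ i $ j * G z $ j)"
      proof (intro hol_sum hol_mult hol_jac [OF U(1) hol\<Theta>])
        show "hol U (\<lambda>z. G z $ j)" for j using holv_subset [OF D(4) U(3)] by (simp add: holv_def)
      qed
      then show "hol U (\<lambda>z. (jac \<Theta> z *v G z) $ i)" by (simp add: matrix_vector_mult_def)
    qed
    from holv_continuous_on [OF holv_compose [OF \<Phi>(1) this \<Phi>(2)]] show ?thesis by (simp add: G2_def [abs_def])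
  qed
  obtain rp Kp where rp: "0 < rp" "0 < Kp" "\<And>z. norm z \<le> rp \<Longrightarrow> norm (p z - jac p 0 *v z) \<le> Kp * (norm z)\<^sup>2"
    using holv_zero_bounds [OF D(1,2,8,7)] unfolding p_def by blast
  obtain r\<Phi> K\<Phi> where r\<Phi>: "0 < r\<Phi>" "0 < K\<Phi>" "cball 0 r\<Phi> \<subseteq> W" "\<And>w. norm w \<le> r\<Phi> \<Longrightarrow> norm (\<Phi> w) \<le> K\<Phi> * norm w"
    "\<And>w. norm w \<le> r\<Phi> \<Longrightarrow> norm (\<Phi> w - jac \<Phi> 0 *v w) \<le> K\<Phi> * (norm w)\<^sup>2"
    "\<And>w q. norm w \<le> r\<Phi> \<Longrightarrow> norm (transpose (jac \<Phi> w) *v q) \<le> K\<Phi> * norm q"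
    using holv_zero_bounds [OF W \<Phi>(1,3)] by blast
  obtain r\<Theta> K\<Theta> where r\<Theta>: "0 < r\<Theta>" "0 < K\<Theta>" "\<And>w. norm w \<le> r\<Theta> \<Longrightarrow> norm (\<Theta> w) \<le> K\<Theta> * norm w"
    "\<And>w q. norm w \<le> r\<Theta> \<Longrightarrow> norm (transpose (jac \<Theta> w) *v q) \<le> K\<Theta> * norm q"
    using holv_zero_bounds [OF U(1,2) hol\<Theta> \<Theta>0] by blast
  obtain KB where KB: "0 \<le> KB" "\<And>x. norm (jac p 0 *v x) \<le> KB * norm x" using matrix_vector_norm_bound [of "jac p 0"] by blast
  have "jac \<Theta> 0 *v v = axis i0 1"
    unfolding vec_eq_iff j\<Theta> using v(2) by (simp add: axis_def)
  then have "jac \<Phi> 0 *v axis i0 1 = jac \<Phi> 0 *v (jac \<Theta> (\<Phi> 0) *v v)" using \<Phi>(3) by simp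
  also have "\<dots> = v" by (simp add: matrix_vector_mul_assoc inv' [OF W(2)])
  finally have j\<Phi>v: "jac \<Phi> 0 *v axis i0 1 = v" .
  \<comment> \<open>To first order \<open>\<Phi>\<close> maps the axis to the line of
    \<open>v\<close>, on which the linear part of the gradient vanishes; only quadratic terms are
    left.\<close>
  have flat: "\<exists>d>0. \<forall>x. norm x < d \<longrightarrow> norm (gradient h2 (axis i0 x)) \<le> e * norm x" if e: "0 < e" for e
  proof -
    define M where "M = K\<Phi> * (KB * K\<Phi> + Kp * K\<Phi>\<^sup>2)"
    have M: "0 \<le> M" using KB(1) rp(2) r\<Phi>(2) by (simp add: M_def)
    define d where "d = min r\<Phi> (min (rp / K\<Phi>) (e / (M + 1)))"
    have d: "0 < d" using r\<Phi>(1,2) rp(1) e M by (simp add: d_def)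
    show ?thesis
    proof (intro exI [of _ d] conjI allI impI d)
      fix x :: complex assume x: "norm x < d"
      have x1: "norm x \<le> r\<Phi>" "norm x < rp / K\<Phi>" "norm x < e / (M + 1)" using x by (simp_all add: d_def)
      define w :: "complex ^ 'n" where "w = axis i0 x"
      have w: "norm w = norm x" by (simp add: w_def)
      have wW: "w \<in> W" using x1(1) w r\<Phi>(3) by auto
      have "w = x *s axis i0 1" by (simp add: w_def vec_eq_iff axis_def)
      then have "jac \<Phi> 0 *v w = x *s v" by (simp add: vector_scalar_commute j\<Phi>v)
      then have "jac p 0 *v (jac \<Phi> 0 *v w) = 0" using v(1) by (simp add: vector_scalar_commute p_def)
      then have "jac p 0 *v \<Phi> w = jac p 0 *v (\<Phi> w - jac \<Phi> 0 *v w)" by (simp add: matrix_vector_mult_diff_distrib)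
      then have "norm (jac p 0 *v \<Phi> w) \<le> KB * norm (\<Phi> w - jac \<Phi> 0 *v w)" using KB(2) by simp
      also have "\<dots> \<le> KB * (K\<Phi> * (norm x)\<^sup>2)" using r\<Phi>(5) [of w] x1(1) w KB(1) by (intro mult_left_mono) auto
      finally have 1: "norm (jac p 0 *v \<Phi> w) \<le> KB * (K\<Phi> * (norm x)\<^sup>2)" .
      have n\<Phi>: "norm (\<Phi> w) \<le> K\<Phi> * norm x" using r\<Phi>(4) [of w] x1(1) w by simp
      also have "\<dots> \<le> rp" using x1(2) r\<Phi>(2) by (simp add: field_simps)
      finally have "norm (p (\<Phi> w) - jac p 0 *v \<Phi> w) \<le> Kp * (norm (\<Phi> w))\<^sup>2" by (rule rp(3))
      also have "\<dots> \<le> Kp * (K\<Phi> * norm x)\<^sup>2" using n\<Phi> rp(2) by (intro mult_left_mono power_mono) auto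
      finally have "norm (p (\<Phi> w)) \<le> (KB * K\<Phi> + Kp * K\<Phi>\<^sup>2) * (norm x)\<^sup>2"
        using 1 norm_triangle_sub [of "p (\<Phi> w)" "jac p 0 *v \<Phi> w"] by (simp add: power_mult_distrib algebra_simps)
      then have "K\<Phi> * norm (p (\<Phi> w)) \<le> M * (norm x)\<^sup>2"
        using r\<Phi>(2) by (simp add: M_def mult.assoc)
      then have "norm (gradient h2 w) \<le> M * (norm x)\<^sup>2"
        unfolding gr [OF wW] using r\<Phi>(6) [of w "p (\<Phi> w)"] x1(1) w by simp
      also have "\<dots> = (M * norm x) * norm x" by (simp add: power2_eq_square)
      also have "\<dots> \<le> e * norm x"
      proof (rule mult_right_mono)
        have "M * norm x \<le> (M + 1) * norm x" by (intro mult_right_mono) auto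
        also have "\<dots> \<le> e" using x1(3) M by (simp add: field_simps)
        finally show "M * norm x \<le> e" .
      qed simp
      finally show "norm (gradient h2 (axis i0 x)) \<le> e * norm x" by (simp add: w_def)
    qed
  qed
  have "\<exists>C>0. \<forall>d>0. \<exists>z. 0 < norm z \<and> norm z < d \<and> norm (gradient h2 z) \<le> C * norm z powr ((1 - l) / l)"
  proof (rule slow_gradient_points [where S = W and G = G2 and ?i0.0 = i0])
    show "open W" "0 \<in> W" using W by simp_all
    show "hol W h2" using P1 by (simp add: h2_def [abs_def])
    show "continuous_on W G2" by (rule contG)
    show "h2 z = cdot (G2 z) (gradient h2 z)" if "z \<in> W" for z
      using P3 [OF that] by (simp add: h2_def [abs_def] G2_def)
    show "G2 z $ i0 = of_real l * z $ i0" if z: "z \<in> W" for z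
    proof -
      have "\<Phi> z \<in> U" using \<Phi>(2) z by auto
      then have "G2 z $ i0 = of_real l * \<xi> (\<Phi> z)" by (simp add: G2_def matrix_vector_cdot jrow \<xi>(4))
      also have "\<xi> (\<Phi> z) = \<Theta> (\<Phi> z) $ i0" by (simp add: \<Theta>_def)
      finally show ?thesis using inv(1) [OF z] by simp
    qed
    show "gradient h2 z = 0 \<longleftrightarrow> z = 0" if "z \<in> W" for z using P4 [OF that] by (simp add: h2_def [abs_def])
  qed (use l flat in auto)
  then obtain C where C: "0 < C" "\<And>d. 0 < d \<Longrightarrow> \<exists>z. 0 < norm z \<and> norm z < d \<and> norm (gradient h2 z) \<le> C * norm z powr ((1 - l) / l)"
    by blast
  define Q where "Q = (1 - l) / l"
  have Q: "0 \<le> Q" using l(1,2) by (simp add: Q_def)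
  show ?thesis
    unfolding Q_def [symmetric]
  proof (rule exI [of _ "K\<Theta> * C * K\<Theta> powr Q"], intro conjI allI impI)
    show "0 < K\<Theta> * C * K\<Theta> powr Q" using C(1) r\<Theta>(2) by simp
    fix d :: real assume d: "0 < d"
    define d' where "d' = min r\<Phi> (min d r\<Theta> / K\<Phi>)"
    have "0 < d'" using d r\<Phi>(1,2) r\<Theta>(1) by (simp add: d'_def)
    then obtain w where w: "0 < norm w" "norm w < d'" "norm (gradient h2 w) \<le> C * norm w powr Q" using C(2) unfolding Q_def by blast
    have w1: "norm w \<le> r\<Phi>" "norm w < min d r\<Theta> / K\<Phi>" using w(2) by (simp_all add: d'_def)
    have wW: "w \<in> W" using w1(1) r\<Phi>(3) by auto
    have n: "norm (\<Phi> w) < min d r\<Theta>"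
    proof -
      have "norm (\<Phi> w) \<le> K\<Phi> * norm w" by (rule r\<Phi>(4) [OF w1(1)])
      also have "\<dots> < min d r\<Theta>" using iffD1 [OF pos_less_divide_eq [OF r\<Phi>(2)] w1(2)] by (simp only: mult.commute)
      finally show ?thesis .
    qed
    have pos: "0 < norm (\<Phi> w)" using \<Phi>z [OF wW] w(1) by auto
    have "transpose (jac \<Theta> (\<Phi> w)) *v gradient h2 w = p (\<Phi> w)"
      unfolding gr [OF wW] by (simp add: matrix_vector_mul_assoc matrix_transpose_mul [symmetric] inv' [OF wW] transpose_mat)
    then have "norm (p (\<Phi> w)) \<le> K\<Theta> * norm (gradient h2 w)" using r\<Theta>(4) [of "\<Phi> w" "gradient h2 w"] n by simp
    also have "\<dots> \<le> K\<Theta> * (C * norm w powr Q)" using w(3) r\<Theta>(2) by (intro mult_left_mono) auto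
    also have "\<dots> \<le> K\<Theta> * (C * (K\<Theta> * norm (\<Phi> w)) powr Q)"
    proof (intro mult_left_mono powr_mono2 Q)
      show "norm w \<le> K\<Theta> * norm (\<Phi> w)" using r\<Theta>(3) [of "\<Phi> w"] n inv(1) [OF wW] by simp
    qed (use r\<Theta>(2) C(1) in auto)
    also have "\<dots> = K\<Theta> * C * K\<Theta> powr Q * norm (\<Phi> w) powr Q" unfolding powr_mult by simp
    finally show "\<exists>z. 0 < norm z \<and> norm z < d \<and> norm (gradient h z) \<le> K\<Theta> * C * K\<Theta> powr Q * norm z powr Q"
      using pos n by (intro exI [of _ "\<Phi> w"]) (simp add: p_def)
  qed
qed

text \<open>For the upper bound it is enough that every exponent above \<open>Q\<close> is
  admissible, since rational numbers accumulate at \<open>Q\<close>; an infimum need not be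
  attained. Conversely, the points in \<open>slow\<close> tend to \<open>0\<close> and refute every
  exponent below \<open>Q\<close>.\<close>

lemma map_lojasiewicz_exponent_eqI:
  fixes F :: "complex ^ 'n \<Rightarrow> complex ^ 'n" and Q :: real
  assumes Q: "0 < Q"
    and lower: "\<And>\<theta>. Q < \<theta> \<Longrightarrow> \<exists>c>0. \<exists>\<rho>>0. \<forall>z. norm z \<le> \<rho> \<longrightarrow> c * norm z powr \<theta> \<le> norm (F z)"
    and slow: "\<exists>C>0. \<forall>d>0. \<exists>z. 0 < norm z \<and> norm z < d \<and> norm (F z) \<le> C * norm z powr Q"
  shows "map_lojasiewicz_exponent F = ereal Q"
proof (rule antisym)
  define X where "X = {ereal (of_rat q) | q :: rat. q > 0 \<and> (\<exists>C>0. \<forall>\<^sub>F z in nhds 0. C * norm z powr of_rat q \<le> norm (F z))}"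
  have M: "map_lojasiewicz_exponent F = Inf X" by (simp add: map_lojasiewicz_exponent_def X_def)
  show "map_lojasiewicz_exponent F \<le> ereal Q"
  proof (rule ccontr)
    assume "\<not> ?thesis"
    then have "ereal Q < Inf X" unfolding M by simp
    then obtain y where y: "ereal Q < ereal y" "ereal y < Inf X" using ereal_dense2 by blast
    then obtain q where q: "Q < of_rat q" "of_rat q < y" using of_rat_dense [of Q y] by auto
    have "0 < q" using Q q(1) by (metis less_trans zero_less_of_rat_iff)
    moreover obtain c \<rho> where c: "0 < c" "0 < \<rho>" "\<And>z. norm z \<le> \<rho> \<Longrightarrow> c * norm z powr of_rat q \<le> norm (F z)"
      using lower [OF q(1)] by blast
    have "\<forall>\<^sub>F z in nhds 0. c * norm z powr of_rat q \<le> norm (F z)"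
      unfolding eventually_nhds_0 using c(2,3) by (intro exI [of _ \<rho>]) auto
    ultimately have "ereal (of_rat q) \<in> X" unfolding X_def using c(1) by blast
    then have "Inf X \<le> ereal (of_rat q)" by (rule Inf_lower)
    also have "\<dots> < ereal y" using q(2) by simp
    finally show False using y(2) by simp
  qed
  show "ereal Q \<le> map_lojasiewicz_exponent F"
    unfolding M
  proof (rule Inf_greatest)
    fix x assume "x \<in> X"
    then obtain q c where x: "x = ereal (of_rat q)" and c: "0 < c" "\<forall>\<^sub>F z in nhds 0. c * norm z powr of_rat q \<le> norm (F z)"
      unfolding X_def by blast
    obtain \<rho> where \<rho>: "0 < \<rho>" "\<And>z. norm z < \<rho> \<Longrightarrow> c * norm z powr of_rat q \<le> norm (F z)"
      using c(2) unfolding eventually_nhds_0 by blast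
    obtain C where C: "0 < C" "\<And>d. 0 < d \<Longrightarrow> \<exists>z. 0 < norm z \<and> norm z < d \<and> norm (F z) \<le> C * norm z powr Q"
      using slow by blast
    have "Q \<le> of_rat q"
    proof (rule ccontr)
      assume "\<not> ?thesis"
      then have lt: "of_rat q < Q" by simp
      define e where "e = Q - of_rat q"
      have e: "0 < e" using lt by (simp add: e_def)
      define d where "d = min \<rho> ((c / (2 * C)) powr (1 / e))"
      have "0 < d" using \<rho>(1) c(1) C(1) by (simp add: d_def)
      then obtain z where z: "0 < norm z" "norm z < d" "norm (F z) \<le> C * norm z powr Q" using C(2) by blast
      have "norm z powr e \<le> ((c / (2 * C)) powr (1 / e)) powr e" using z e by (intro powr_mono2) (auto simp: d_def)
      also have "\<dots> = c / (2 * C)" using e c(1) C(1) by (simp add: powr_powr)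
      finally have 1: "C * norm z powr e \<le> c / 2" using C(1) by (simp add: field_simps)
      have "norm z powr Q = norm z powr e * norm z powr of_rat q" by (simp add: powr_add [symmetric] e_def)
      then have "c * norm z powr of_rat q \<le> C * norm z powr e * norm z powr of_rat q"
        using \<rho>(2) [of z] z(2,3) by (simp add: d_def)
      also have "\<dots> \<le> c / 2 * norm z powr of_rat q" using 1 by (intro mult_right_mono) auto
      finally show False using c(1) z(1) by simp
    qed
    then show "ereal Q \<le> x" by (simp add: x)
  qed
qed

text \<open>By \<open>half\<close> all eigenvectors outside the kernel of \<open>B\<close> belong to
  \<open>1 / 2\<close>, so \<open>kernel_eigenvalue_bound\<close> becomes a condition on the finite
  set \<open>X\<close> and on \<open>1 / 2\<close>. Extremal elements of \<open>X\<close> and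
  suitable directions \<open>\<omega>\<close> leave only the closed interval; the endpoint
  \<open>0\<close>, which the comparison of rates does not reach, is excluded by
  \<open>eigenvalue_positive\<close>.\<close>

lemma kernel_spectrum:
  fixes h :: "complex ^ 'n \<Rightarrow> complex"
  defines "B \<equiv> jac (gradient h) 0"
  assumes E: "euler_pair S h G" and half: "\<And>x. B *v (jac G 0 *v x) = (1 / 2) *s (B *v x)"
    and v: "v \<noteq> 0" "B *v v = 0" "jac G 0 *v v = \<alpha> *s v"
  shows "Im \<alpha> = 0 \<and> 0 < Re \<alpha> \<and> Re \<alpha> \<le> 1 / 2"
proof -
  define X where "X = {\<alpha>. \<exists>v. v \<noteq> 0 \<and> B *v v = 0 \<and> jac G 0 *v v = \<alpha> *s v}"
  have fin: "finite X" by (rule finite_subset [OF _ finite_eigenvalues [of "jac G 0"]]) (auto simp: X_def)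
  have \<alpha>X: "\<alpha> \<in> X" using v by (auto simp: X_def)
  have eig: "\<eta> = 1 / 2 \<or> \<eta> \<in> X" if w: "w \<noteq> 0" "jac G 0 *v w = \<eta> *s w" for \<eta> w
  proof -
    have "\<eta> *s (B *v w) = (1 / 2) *s (B *v w)" using half [of w] unfolding w(2) vector_scalar_commute .
    then have "(\<eta> - 1 / 2) *s (B *v w) = 0" by (simp add: vec.scale_left_diff_distrib)
    then show ?thesis using w by (auto simp: X_def)
  qed
  have bound: "2 * Re (\<omega> * \<beta>) \<le> b"
    if bX: "\<beta> \<in> X" and \<omega>: "norm \<omega> = 1" "0 < Re (\<omega> * \<beta>)" and Xb: "\<And>\<eta>. \<eta> \<in> X \<Longrightarrow> Re (\<omega> * (1 - \<eta>)) \<le> b" and b: "Re \<omega> / 2 \<le> b" for \<omega> \<beta> b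
  proof -
    obtain u where u: "u \<noteq> 0" "B *v u = 0" "jac G 0 *v u = \<beta> *s u" using bX unfolding X_def by blast
    have le: "Re (\<omega> * (1 - \<eta>)) \<le> b" if "w \<noteq> 0" "jac G 0 *v w = \<eta> *s w" for \<eta> w
    proof (cases "\<eta> = 1 / 2")
      case True
      show ?thesis unfolding True using b by simp
    next
      case False
      with eig [OF that] Xb show ?thesis by blast
    qed
    show ?thesis by (rule kernel_eigenvalue_bound [OF E u(1) u(2) [unfolded B_def] u(3) \<omega> le])
  qed
  have ne: "X \<noteq> {}" using \<alpha>X by blast
  have arg_max: "\<exists>\<beta>\<in>X. \<forall>\<eta>\<in>X. f \<eta> \<le> f \<beta>" for f :: "complex \<Rightarrow> real"
  proof -
    have "Max (f ` X) \<in> f ` X" using fin ne by (intro Max_in) auto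
    then obtain \<beta> where "\<beta> \<in> X" "Max (f ` X) = f \<beta>" by blast
    then show ?thesis using fin by (intro bexI [of _ \<beta>] ballI) (metis Max_ge finite_imageI imageI, assumption)
  qed
  \<comment> \<open>For an element with maximal absolute imaginary part, one of the directions
    \<open>\<plusminus> \<i>\<close> would give
    \<open>2 |Im \<beta>| \<le> |Im \<beta>|\<close>.\<close>
  have im: "Im \<eta> = 0" if "\<eta> \<in> X" for \<eta>
  proof -
    obtain \<beta> where \<beta>: "\<beta> \<in> X" "\<And>\<eta>. \<eta> \<in> X \<Longrightarrow> \<bar>Im \<eta>\<bar> \<le> \<bar>Im \<beta>\<bar>" using arg_max [of "\<lambda>\<eta>. \<bar>Im \<eta>\<bar>"] by blast
    have "Im \<beta> = 0"
    proof (rule ccontr)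
      assume "Im \<beta> \<noteq> 0"
      then consider "0 < Im \<beta>" | "Im \<beta> < 0" by linarith
      then show False
      proof cases
        case 1
        have "Re (- \<i> * (1 - \<eta>)) \<le> Im \<beta>" if "\<eta> \<in> X" for \<eta> using \<beta>(2) [OF that] 1 by simp
        then have "2 * Re (- \<i> * \<beta>) \<le> Im \<beta>" using 1 by (intro bound [OF \<beta>(1)]) simp_all
        with 1 show False by simp
      next
        case 2
        have "Re (\<i> * (1 - \<eta>)) \<le> - Im \<beta>" if "\<eta> \<in> X" for \<eta> using \<beta>(2) [OF that] 2 by simp
        then have "2 * Re (\<i> * \<beta>) \<le> - Im \<beta>" using 2 by (intro bound [OF \<beta>(1)]) simp_all
        with 2 show False by simp
      qed
    qed
    with \<beta>(2) [OF that] show ?thesis by simp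
  qed
  \<comment> \<open>For a least real part \<open>x < 0\<close> and a greatest one \<open>y\<close>,
    direction \<open>-1\<close> gives \<open>- 2 x \<le> y - 1\<close> and direction
    \<open>1\<close> gives \<open>2 y \<le> 1 - x\<close>, which contradict each other.\<close>
  have nonneg: "0 \<le> Re \<eta>" if "\<eta> \<in> X" for \<eta>
  proof -
    obtain \<beta> where \<beta>: "\<beta> \<in> X" "\<And>\<eta>. \<eta> \<in> X \<Longrightarrow> Re \<beta> \<le> Re \<eta>" using arg_max [of "\<lambda>\<eta>. - Re \<eta>"] by auto
    obtain \<gamma> where \<gamma>: "\<gamma> \<in> X" "\<And>\<eta>. \<eta> \<in> X \<Longrightarrow> Re \<eta> \<le> Re \<gamma>" using arg_max [of Re] by blast
    have "0 \<le> Re \<beta>"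
    proof (rule ccontr)
      assume "\<not> 0 \<le> Re \<beta>"
      then have x: "Re \<beta> < 0" by simp
      have "Re ((- 1) * (1 - \<eta>)) \<le> max (Re \<gamma> - 1) (- 1 / 2)" if "\<eta> \<in> X" for \<eta> using \<gamma>(2) [OF that] by simp
      then have "2 * Re ((- 1) * \<beta>) \<le> max (Re \<gamma> - 1) (- 1 / 2)"
        using x by (intro bound [OF \<beta>(1)]) simp_all
      then have 1: "- 2 * Re \<beta> \<le> Re \<gamma> - 1" using x by (simp add: max_def split: if_splits)
      have "Re (1 * (1 - \<eta>)) \<le> 1 - Re \<beta>" if "\<eta> \<in> X" for \<eta> using \<beta>(2) [OF that] by simp
      then have "2 * Re (1 * \<gamma>) \<le> 1 - Re \<beta>" using x 1 by (intro bound [OF \<gamma>(1)]) simp_all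
      then have "2 * Re \<gamma> \<le> 1 - Re \<beta>" by simp
      with 1 x show False by linarith
    qed
    with \<beta>(2) [OF that] show ?thesis by simp
  qed
  \<comment> \<open>Now that the real parts are nonnegative, \<open>b = 1\<close> is admissible for
    direction \<open>1\<close>.\<close>
  have le: "Re \<eta> \<le> 1 / 2" if "\<eta> \<in> X" for \<eta>
  proof (cases "0 < Re \<eta>")
    case True
    have "Re (1 * (1 - \<eta>)) \<le> 1" if "\<eta> \<in> X" for \<eta> using nonneg [OF that] by simp
    then have "2 * Re (1 * \<eta>) \<le> 1" using True by (intro bound [OF that]) simp_all
    then show ?thesis by simp
  qed simp
  have "0 < Re \<alpha>"
  proof (rule eigenvalue_positive [OF E _ _ v(1,3)])
    show "(0 :: real) < 1 / 2" by simp
    show "Re \<eta> \<le> 1 - 1 / 2" if "w \<noteq> 0" "jac G 0 *v w = \<eta> *s w" for \<eta> w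
      using eig [OF that]
    proof
      assume "\<eta> = 1 / 2"
      show ?thesis unfolding \<open>\<eta> = 1 / 2\<close> by simp
    next
      assume "\<eta> \<in> X"
      from le [OF this] show ?thesis by simp
    qed
  qed
  with im [OF \<alpha>X] le [OF \<alpha>X] show ?thesis by simp
qed

text \<open>A functional that vanishes on the kernel of the symmetric \<open>B\<close> lies in the
  range of \<open>B\<close>, where \<open>transpose A\<close> acts as \<open>1 / 2\<close>.\<close>

lemma left_eigenvector_nonzero_on_kernel:
  fixes A B :: "complex ^ 'n ^ 'n"
  assumes B: "transpose B = B" and AB: "\<And>x. transpose A *v (B *v x) = (1 / 2) *s (B *v x)"
    and \<zeta>: "\<zeta> \<noteq> 0" "transpose A *v \<zeta> = \<beta> *s \<zeta>" "\<beta> \<noteq> 1 / 2"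
  shows "\<exists>v. B *v v = 0 \<and> cdot \<zeta> v = 1"
proof -
  have "\<exists>v. B *v v = 0 \<and> cdot \<zeta> v \<noteq> 0"
  proof (rule ccontr)
    assume "\<not> ?thesis"
    then have 0: "cdot \<zeta> v = 0" if "B *v v = 0" for v using that by blast
    obtain C where C: "transpose C = C" "\<And>x. B *v (C *v (B *v x)) = B *v x"
      using symmetric_generalized_inverse [OF B] by blast
    have "cdot \<zeta> x = cdot (B *v (C *v \<zeta>)) x" for x
    proof -
      have "B *v (x - C *v (B *v x)) = 0" by (simp add: matrix_vector_mult_diff_distrib C(2))
      from 0 [OF this] have "cdot \<zeta> x = cdot \<zeta> (C *v (B *v x))" by (simp add: cdot.diff_right)
      also have "\<dots> = cdot (transpose B *v (transpose C *v \<zeta>)) x" by (simp only: cdot_transpose)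
      finally show ?thesis by (simp only: B C(1))
    qed
    then have "\<zeta> $ i = (B *v (C *v \<zeta>)) $ i" for i by (metis cdot_axis mult.right_neutral)
    then have e: "\<zeta> = B *v (C *v \<zeta>)" by (simp add: vec_eq_iff)
    have "\<beta> *s \<zeta> = (1 / 2) *s \<zeta>" using AB [of "C *v \<zeta>"] \<zeta>(2) unfolding e [symmetric] by simp
    then have "(\<beta> - 1 / 2) *s \<zeta> = 0" by (simp add: vec.scale_left_diff_distrib)
    then show False using \<zeta>(1,3) by simp
  qed
  then obtain v where v: "B *v v = 0" "cdot \<zeta> v \<noteq> 0" by blast
  then show ?thesis by (intro exI [of _ "(1 / cdot \<zeta> v) *s v"]) (simp add: vector_scalar_commute)
qed

text \<open>Antisymmetry makes the added term orthogonal to the gradient in the pairing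
  \<open>cdot\<close>, so the Euler relation is kept.\<close>

lemma euler_pair_corrected:
  fixes h :: "complex ^ 'n \<Rightarrow> complex"
  assumes E: "euler_pair S h G" and M: "transpose M = - M"
  shows "euler_pair S h (\<lambda>z. G z + M *v gradient h z)"
    and "jac (\<lambda>z. G z + M *v gradient h z) 0 = jac G 0 + M ** jac (gradient h) 0"
proof -
  note D = euler_pairD [OF E]
  have 0: "cdot (M *v q) q = 0" for q
  proof -
    have "cdot (M *v q) q = cdot q (M *v q)" by (rule cdot_commute)
    also have "\<dots> = - cdot (M *v q) q" unfolding cdot_transpose M minus_matrix_vector by (rule cdot.minus_left)
    finally show ?thesis by simp
  qed
  have d: "((\<lambda>z. G z + M *v gradient h z) has_derivative (\<lambda>v. (jac G z + M ** jac (gradient h) z) *v v)) (at z)" if "z \<in> S" for z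
  proof -
    have "((\<lambda>z. M *v gradient h z) has_derivative (\<lambda>v. M *v (jac (gradient h) z *v v))) (at z)"
      by (rule has_derivative_compose [OF holv_has_derivative [OF D(8) that] bounded_linear_imp_has_derivative [OF matrix_vector_mul_bounded_linear]])
    from has_derivative_add [OF holv_has_derivative [OF D(4) that] this]
    show ?thesis by (simp add: matrix_action_simps)
  qed
  have "holv S (\<lambda>z. G z + M *v gradient h z)" by (rule holvI) (use d in blast)
  then show "euler_pair S h (\<lambda>z. G z + M *v gradient h z)"
    unfolding euler_pair_def using D(1-3,5,6) 0 by (simp add: cdot.add_left)
  show "jac (\<lambda>z. G z + M *v gradient h z) 0 = jac G 0 + M ** jac (gradient h) 0"
    by (rule jac_eqI [OF d [OF D(2)]])
qed

text \<open>The number \<open>l\<close> depends only on the eigenvalues on the kernel of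
  \<open>B\<close>, which the correction does not change as \<open>M ** B\<close> vanishes there; so
  both bounds may be proved for the corrected field.\<close>

lemma euler_pair_exponent:
  fixes h :: "complex ^ 'n \<Rightarrow> complex"
  assumes E: "euler_pair S h G"
    and l: "l = Min (L_zero (image_mset Re (eigenvalues (jac G 0))))"
  shows "map_lojasiewicz_exponent (gradient h) = ereal (1 / l - 1)"
proof -
  note D = euler_pairD [OF E]
  define A where "A = jac G 0"
  define B where "B = jac (gradient h) 0"
  have B: "transpose B = B" unfolding B_def by (rule hessian_symmetric [OF D(1,3,2)])
  have AB: "transpose A *v (B *v x) + B *v (A *v x) = B *v x" for x
    unfolding A_def B_def by (rule euler_hessian [OF E])
  obtain M where M: "transpose M = - M" "\<And>x. B *v ((A + M ** B) *v x) = (1 / 2) *s (B *v x)"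
    using euler_correction_exists [OF B AB] by blast
  define G' where "G' z = G z + M *v gradient h z" for z
  have E': "euler_pair S h G'" and jG': "jac G' 0 = A + M ** B"
    using euler_pair_corrected [OF E M(1)] by (simp_all add: G'_def [abs_def] A_def B_def)
  have half: "B *v (jac G' 0 *v x) = (1 / 2) *s (B *v x)" for x using M(2) by (simp add: jG')
  have onK: "jac G' 0 *v v = A *v v" if "B *v v = 0" for v using that by (simp add: jG' matrix_action_simps)
  have spec: "Im \<alpha> = 0 \<and> 0 < Re \<alpha> \<and> Re \<alpha> \<le> 1 / 2" if "v \<noteq> 0" "B *v v = 0" "A *v v = \<alpha> *s v" for v \<alpha>
    using kernel_spectrum [OF E' half [unfolded B_def] that(1) that(2) [unfolded B_def]] onK [OF that(2)] that(3) by simp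
  obtain P Q where PQ: "eigenvalues A = P + Q" "image_mset (\<lambda>x. 1 - x) Q = Q"
    "\<And>\<alpha>. \<alpha> \<in># P \<longleftrightarrow> (\<exists>v. v \<noteq> 0 \<and> B *v v = 0 \<and> A *v v = \<alpha> *s v)"
    using eigenvalues_split [OF B AB] by blast
  have Pr: "0 < x \<and> x \<le> 1 / 2" if x: "x \<in># image_mset Re P" for x
  proof -
    obtain \<alpha> where "\<alpha> \<in># P" "x = Re \<alpha>" using x by auto
    then show ?thesis using PQ(3) spec by blast
  qed
  have Qr: "image_mset (\<lambda>x. 1 - x) (image_mset Re Q) = image_mset Re Q"
  proof -
    have "image_mset (\<lambda>x. 1 - x) (image_mset Re Q) = image_mset Re (image_mset (\<lambda>x. 1 - x) Q)" by (simp add: multiset.map_comp comp_def)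
    then show ?thesis by (simp add: PQ(2))
  qed
  have "Min (L_zero (image_mset Re P + image_mset Re Q)) = Min (set_mset (image_mset Re P) \<union> {1 / 2})"
    by (rule Min_L_zero [OF Pr Qr])
  then have lM: "l = Min (set_mset (image_mset Re P) \<union> {1 / 2})"
    unfolding l A_def [symmetric] PQ(1) image_mset_union .
  have fin: "finite (set_mset (image_mset Re P) \<union> {1 / 2})" by simp
  have l_in: "l \<in> set_mset (image_mset Re P) \<union> {1 / 2}" unfolding lM by (rule Min_in [OF fin]) simp
  have l_le: "l \<le> 1 / 2" unfolding lM by (rule Min_le [OF fin]) simp
  have l_pos: "0 < l" using l_in Pr by auto
  have l_spec: "l \<le> Re \<alpha>" if "v \<noteq> 0" "B *v v = 0" "A *v v = \<alpha> *s v" for v \<alpha>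
  proof -
    have "\<alpha> \<in># P" using PQ(3) that by blast
    then show ?thesis unfolding lM by (intro Min_le [OF fin]) auto
  qed
  \<comment> \<open>Outside the kernel the corrected Jacobian has only the eigenvalue
    \<open>1 / 2\<close>, which is at least \<open>l\<close>: the purpose of the correction.\<close>
  have l_eig: "l \<le> Re \<eta>" if w: "w \<noteq> 0" "jac G' 0 *v w = \<eta> *s w" for \<eta> w
  proof -
    have "\<eta> *s (B *v w) = (1 / 2) *s (B *v w)" using half [of w] unfolding w(2) vector_scalar_commute .
    then have "(\<eta> - 1 / 2) *s (B *v w) = 0" by (simp add: vec.scale_left_diff_distrib)
    then consider "\<eta> = 1 / 2" | "B *v w = 0" by auto
    then show ?thesis
    proof cases
      case 1
      show ?thesis unfolding 1 using l_le by simp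
    next
      case 2
      then show ?thesis using l_spec [OF w(1) 2] onK [OF 2] w(2) by simp
    qed
  qed
  have Q: "1 / l - 1 = (1 - l) / l" "0 < 1 / l - 1" using l_pos l_le by (simp_all add: field_simps)
  show ?thesis
  proof (rule map_lojasiewicz_exponent_eqI [OF Q(2)])
    fix \<theta> assume \<theta>: "1 / l - 1 < \<theta>"
    then have "1 - l < \<theta> * l" using l_pos by (simp add: field_simps)
    moreover have "0 < \<theta>" using \<theta> Q(2) by simp
    ultimately show "\<exists>c>0. \<exists>\<rho>>0. \<forall>z. norm z \<le> \<rho> \<longrightarrow> c * norm z powr \<theta> \<le> norm (gradient h z)"
      by (intro gradient_lower_bound [OF E' l_pos l_eig])
  next
    show "\<exists>C>0. \<forall>d>0. \<exists>z. 0 < norm z \<and> norm z < d \<and> norm (gradient h z) \<le> C * norm z powr (1 / l - 1)"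
    \<comment> \<open>For \<open>l < 1 / 2\<close> the value \<open>l\<close> is an eigenvalue on
      the kernel, and a left eigenvector yields the coordinate to be linearised; for
      \<open>l = 1 / 2\<close> the exponent is \<open>1\<close>.\<close>
    proof (cases "l = 1 / 2")
      case True
      have one: "1 / l - 1 = 1" unfolding True by simp
      show ?thesis unfolding one by (rule slow_points_linear [OF E])
    next
      case False
      then obtain \<alpha> where "\<alpha> \<in># P" "l = Re \<alpha>" using l_in by auto
      then obtain w where w: "w \<noteq> 0" "B *v w = 0" "A *v w = \<alpha> *s w" using PQ(3) by blast
      then have "\<alpha> = of_real l" using spec [OF w] \<open>l = Re \<alpha>\<close> by (simp add: complex_eq_iff)
      then have "jac G' 0 *v w = of_real l *s w" using onK [OF w(2)] w(3) by simp
      then obtain \<zeta> where \<zeta>: "\<zeta> \<noteq> 0" "transpose (jac G' 0) *v \<zeta> = of_real l *s \<zeta>"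
        using left_eigenvector_exists [OF w(1)] by blast
      \<comment> \<open>As \<open>B A = B / 2\<close>, the identity for the Hessian leaves the other
        half to the transpose.\<close>
      have tAB: "transpose (jac G' 0) *v (B *v x) = (1 / 2) *s (B *v x)" for x
      proof -
        have "transpose (jac G' 0) *v (B *v x) + (1 / 2) *s (B *v x) = B *v x"
          using euler_hessian [OF E', of x] unfolding B_def [symmetric] half .
        moreover have "B *v x = (1 / 2) *s (B *v x) + (1 / 2) *s (B *v x)" by (simp add: vec.scale_left_distrib [symmetric])
        ultimately show ?thesis by (metis add_right_cancel)
      qed
      have "complex_of_real l \<noteq> 1 / 2"
      proof
        assume "complex_of_real l = 1 / 2"
        then have "Re (complex_of_real l) = Re (1 / 2)" by (rule arg_cong)
        then show False using False by simp
      qed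
      then obtain v where v: "B *v v = 0" "cdot \<zeta> v = 1"
        using left_eigenvector_nonzero_on_kernel [OF B tAB \<zeta>] by blast
      have "l < 1" using l_le by simp
      show ?thesis unfolding Q(1)
        by (rule slow_points [OF E' l_pos \<open>l < 1\<close> l_eig \<zeta>(2) v(1) [unfolded B_def] v(2)])
    qed
  qed
qed

theorem theorem5:
  fixes f :: "complex ^ 'n \<Rightarrow> complex"
    and g :: "'n \<Rightarrow> complex ^ 'n \<Rightarrow> complex"
    and L :: "real multiset"
    and l_min :: real
  assumes "isolated_singularity f"
    and "\<And>i. g i \<in> convergent_power_series"
    and "\<forall>\<^sub>F z in nhds 0. f z = (\<Sum>i\<in>UNIV. g i z * partial_deriv i f z)"
    and "L = image_mset Re (eigenvalues (complex_jacobian g 0))"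
    and "l_min = Min (L_zero L)"
  shows "lojasiewicz_exponent f = ereal (1 / l_min - 1)"
proof -
  have f: "holomorphic_germ f" "gradient f 0 = 0" "\<forall>\<^sub>F z in at 0. gradient f z \<noteq> 0"
    using assms(1) by (auto simp: isolated_singularity_def)
  obtain r1 where r1: "0 < r1" "hol (ball 0 r1) f" using holomorphic_germ_hol [OF f(1)] by blast
  have "\<forall>i. \<exists>r>0. hol (ball 0 r) (g i)" using convergent_power_series_hol [OF assms(2)] by blast
  from choice [OF this] obtain rg where rg: "\<And>i. 0 < rg i" "\<And>i. hol (ball 0 (rg i)) (g i)" by blast
  define r2 where "r2 = Min (range rg)"
  have r2: "0 < r2" "\<And>i. r2 \<le> rg i" using rg(1) by (auto simp: r2_def)
  obtain r3 where r3: "0 < r3" "\<And>z. norm z < r3 \<Longrightarrow> f z = (\<Sum>i\<in>UNIV. g i z * partial_deriv i f z)"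
    using assms(3) unfolding eventually_nhds_0 by blast
  have "\<forall>\<^sub>F z in nhds 0. z \<noteq> 0 \<longrightarrow> gradient f z \<noteq> 0" using f(3) by (simp add: eventually_at_filter)
  then obtain r4 where r4: "0 < r4" "\<And>z. norm z < r4 \<Longrightarrow> z \<noteq> 0 \<Longrightarrow> gradient f z \<noteq> 0"
    unfolding eventually_nhds_0 by blast
  \<comment> \<open>A common radius for the holomorphy of \<open>f\<close> and of all
    \<open>g i\<close>, for the relation and for the isolatedness.\<close>
  define r where "r = min (min r1 r2) (min r3 r4)"
  have r: "0 < r" "r \<le> r1" "r \<le> r2" "r \<le> r3" "r \<le> r4" using r1(1) r2(1) r3(1) r4(1) by (auto simp: r_def)
  define G where "G z = (\<chi> i. g i z)" for z
  have "hol (ball 0 r) f" by (rule hol_subset [OF r1(2)]) (use r(2) in auto)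
  moreover have "holv (ball 0 r) G"
    unfolding holv_def G_def
  proof
    fix i
    have "r \<le> rg i" using r(3) r2(2) [of i] by simp
    then show "hol (ball 0 r) (\<lambda>z. (\<chi> i. g i z) $ i)" using hol_subset [OF rg(2) [of i]] by (simp add: subset_ball)
  qed
  moreover have "f z = cdot (G z) (gradient f z)" if "z \<in> ball 0 r" for z
    using r3(2) [of z] that r(4) by (simp add: cdot_def G_def gradient_def)
  moreover have "gradient f z = 0 \<longleftrightarrow> z = 0" if "z \<in> ball 0 r" for z
    using r4(2) [of z] that r(5) f(2) by auto
  ultimately have "euler_pair (ball 0 r) f G" using r(1) by (simp add: euler_pair_def)
  moreover have "jac G 0 = complex_jacobian g 0"
    by (simp add: jac_def complex_jacobian_def G_def gradient_def)
  ultimately show ?thesis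
    unfolding lojasiewicz_exponent_def using euler_pair_exponent [of "ball 0 r" f G l_min] assms(4,5) by simp
qed

end
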